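(* The dimensions of the rational homology groups of $B_3[4]$ and $B_4[4]$ are as follows. For $n=3$: $\dim H_0(B_3[4];\mathbb{Q})=1$, $\dim H_1(B_3[4];\mathbb{Q})=6$, $\dim H_2(B_3[4];\mathbb{Q})=5$, and $\dim H_k(B_3[4];\mathbb{Q})=0$ for $k\ge 3$. For $n=4$: $\dim H_0(B_4[4];\mathbb{Q})=1$, $\dim H_1(B_4[4];\mathbb{Q})=21$, $\dim H_2(B_4[4];\mathbb{Q})=103$, $\dim H_3(B_4[4];\mathbb{Q})=83$, and $\dim H_k(B_4[4];\mathbb{Q})=0$ for $k\ge 4$.
   Context: $B_n$ is the braid group on $n$ strands. The level $4$ braid group $B_n[4]$ is the kernel of the composition $B_n\to GL_n(\mathbb{Z}[t,t^{-1}])\to GL_n(\mathbb{Z})\to GL_n(\mathbb{Z}/4)$, where the first map is the unreduced Burau representation, the second is evaluation at $t=-1$, and the third is reduction mod $4$. It is known that $B_n[4]$ equals the subgroup of the pure braid group $PB_n$ generated by all squares of elements of $PB_n$. *)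

theory Defs
  imports
    "Jordan_Normal_Form.VS_Connect"
    "HOL-Algebra.QuotRing"
    "HOL-Library.Poly_Mapping"
    "HOL-Library.Numeral_Type"
begin

hide_const (open) Poly_Mapping.degree Poly_Mapping.range

section \<open>Braid groups\<close>

text \<open>
  \<open>B\<^sub>n\<close> is given by Artin's presentation.  A letter \<open>(i, True)\<close> stands for the generator
  \<open>\<sigma>\<^sub>i\<close> and \<open>(i, False)\<close> for its inverse, where \<open>1 \<le> i < n\<close>.
\<close>

type_synonym braid_word = "(nat \<times> bool) list"

definition braid_words :: "nat \<Rightarrow> braid_word set" where
  "braid_words n = lists ({1..<n} \<times> UNIV)"

inductive braid_equiv :: "nat \<Rightarrow> braid_word \<Rightarrow> braid_word \<Rightarrow> bool" for n where
  refl: "w \<in> braid_words n \<Longrightarrow> braid_equiv n w w"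
| sym: "braid_equiv n u v \<Longrightarrow> braid_equiv n v u"
| trans: "braid_equiv n u v \<Longrightarrow> braid_equiv n v w \<Longrightarrow> braid_equiv n u w"
| app: "braid_equiv n u u' \<Longrightarrow> braid_equiv n v v' \<Longrightarrow> braid_equiv n (u @ v) (u' @ v')"
| cancel: "1 \<le> i \<Longrightarrow> i < n \<Longrightarrow> braid_equiv n [(i, b), (i, \<not> b)] []"
| far: "1 \<le> i \<Longrightarrow> i + 2 \<le> j \<Longrightarrow> j < n \<Longrightarrow>
    braid_equiv n [(i, True), (j, True)] [(j, True), (i, True)]"
| braid: "1 \<le> i \<Longrightarrow> Suc i < n \<Longrightarrow>
    braid_equiv n [(i, True), (Suc i, True), (i, True)] [(Suc i, True), (i, True), (Suc i, True)]"

definition braid_rel :: "nat \<Rightarrow> (braid_word \<times> braid_word) set" where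
  "braid_rel n = {(u, v). braid_equiv n u v}"

definition braid_group :: "nat \<Rightarrow> braid_word set monoid" where
  "braid_group n =
    \<lparr> carrier = braid_words n // braid_rel n,
      mult = (\<lambda>X Y. \<Union>u\<in>X. \<Union>v\<in>Y. braid_rel n `` {u @ v}),
      one = braid_rel n `` {[]} \<rparr>"

lemma braid_equiv_words: "braid_equiv n u v \<Longrightarrow> u \<in> braid_words n \<and> v \<in> braid_words n"
  by (induction rule: braid_equiv.induct) (auto simp: braid_words_def)

lemma equiv_braid_rel: "equiv (braid_words n) (braid_rel n)"
  by (rule equivI)
    (auto simp: braid_rel_def refl_on_def sym_def trans_def
      dest: braid_equiv_words intro: braid_equiv.refl braid_equiv.sym braid_equiv.trans)

lemma braid_group_mult:
  assumes "u \<in> braid_words n" "v \<in> braid_words n"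
  shows "(braid_rel n `` {u}) \<otimes>\<^bsub>braid_group n\<^esub> (braid_rel n `` {v}) = braid_rel n `` {u @ v}"
proof -
  have "(\<Union>a\<in>braid_rel n `` {u}. \<Union>b\<in>braid_rel n `` {v}. braid_rel n `` {a @ b})
      = braid_rel n `` {u @ v}"
    by (rule UN_equiv_class2[OF equiv_braid_rel equiv_braid_rel _ assms])
      (auto simp: congruent2_def braid_rel_def
        intro: braid_equiv.app braid_equiv.trans braid_equiv.sym)
  then show ?thesis
    by (simp add: braid_group_def)
qed

lemma braid_group_carrierE:
  assumes "X \<in> carrier (braid_group n)"
  obtains u where "u \<in> braid_words n" "X = braid_rel n `` {u}"
  using assms by (auto simp: braid_group_def elim: quotientE)

lemma braid_group_carrierI: "u \<in> braid_words n \<Longrightarrow> braid_rel n `` {u} \<in> carrier (braid_group n)"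
  by (simp add: braid_group_def quotientI)

lemma braid_words_app: "u \<in> braid_words n \<Longrightarrow> v \<in> braid_words n \<Longrightarrow> u @ v \<in> braid_words n"
  by (auto simp: braid_words_def)

lemma braid_equiv_inverse:
  assumes "u \<in> braid_words n"
  shows "\<exists>v\<in>braid_words n. braid_equiv n (v @ u) []"
  using assms
proof (induction u)
  case Nil
  then show ?case by (auto intro!: bexI[of _ "[]"] braid_equiv.refl)
next
  case (Cons l u)
  obtain i b where l: "l = (i, b)" by fastforce
  with Cons have i: "1 \<le> i" "i < n" and u: "u \<in> braid_words n"
    by (auto simp: braid_words_def)
  with Cons obtain v where v: "v \<in> braid_words n" "braid_equiv n (v @ u) []" by blast
  have "braid_equiv n [(i, \<not> b), (i, \<not> \<not> b)] []" by (rule braid_equiv.cancel) (use i in auto)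
  then have "braid_equiv n [(i, \<not> b), l] []" by (simp add: l)
  then have "braid_equiv n ([(i, \<not> b), l] @ u) ([] @ u)"
    using u by (rule braid_equiv.app[OF _ braid_equiv.refl])
  then have "braid_equiv n (v @ ([(i, \<not> b), l] @ u)) (v @ ([] @ u))"
    by (rule braid_equiv.app[OF braid_equiv.refl[OF v(1)]])
  then have "braid_equiv n ((v @ [(i, \<not> b)]) @ l # u) []"
    using braid_equiv.trans[OF _ v(2)] by simp
  moreover have "v @ [(i, \<not> b)] \<in> braid_words n"
    using v i by (auto simp: braid_words_def)
  ultimately show ?case by blast
qed

lemma group_braid_group: "group (braid_group n)"
proof (rule groupI)
  have nil: "[] \<in> braid_words n" by (simp add: braid_words_def)
  have one: "\<one>\<^bsub>braid_group n\<^esub> = braid_rel n `` {[]}" by (simp add: braid_group_def)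
  show "\<one>\<^bsub>braid_group n\<^esub> \<in> carrier (braid_group n)"
    by (simp add: one nil braid_group_carrierI)
  fix x y assume "x \<in> carrier (braid_group n)" "y \<in> carrier (braid_group n)"
  then obtain u v where u: "u \<in> braid_words n" "x = braid_rel n `` {u}"
    and v: "v \<in> braid_words n" "y = braid_rel n `` {v}"
    by (metis braid_group_carrierE)
  show "x \<otimes>\<^bsub>braid_group n\<^esub> y \<in> carrier (braid_group n)"
    using u v by (simp add: braid_group_mult braid_group_carrierI braid_words_app)
  show "\<one>\<^bsub>braid_group n\<^esub> \<otimes>\<^bsub>braid_group n\<^esub> x = x"
    using u nil by (simp add: one braid_group_mult)
  obtain w where w: "w \<in> braid_words n" "braid_equiv n (w @ u) []"
    using braid_equiv_inverse[OF u(1)] by blast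
  have "(braid_rel n `` {w}) \<otimes>\<^bsub>braid_group n\<^esub> x = \<one>\<^bsub>braid_group n\<^esub>"
    using u w by (simp add: one braid_group_mult)
      (rule equiv_class_eq[OF equiv_braid_rel], simp add: braid_rel_def)
  then show "\<exists>y\<in>carrier (braid_group n). y \<otimes>\<^bsub>braid_group n\<^esub> x = \<one>\<^bsub>braid_group n\<^esub>"
    using w braid_group_carrierI by blast
  fix z assume "z \<in> carrier (braid_group n)"
  then obtain w where w: "w \<in> braid_words n" "z = braid_rel n `` {w}"
    by (metis braid_group_carrierE)
  show "x \<otimes>\<^bsub>braid_group n\<^esub> y \<otimes>\<^bsub>braid_group n\<^esub> z
      = x \<otimes>\<^bsub>braid_group n\<^esub> (y \<otimes>\<^bsub>braid_group n\<^esub> z)"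
    using u v w by (simp add: braid_group_mult braid_words_app)
qed


section \<open>The unreduced Burau representation\<close>

text \<open>
  The ring \<open>\<int>[t, t\<^sup>-\<^sup>1]\<close> is the group ring of the additive group \<open>\<int>\<close>: the element
  \<open>Poly_Mapping.single k c\<close> is \<open>c t\<^sup>k\<close>, and multiplication is the convolution product.
\<close>

type_synonym laurent = "int \<Rightarrow>\<^sub>0 int"

abbreviation laurent_t :: laurent where "laurent_t \<equiv> Poly_Mapping.single 1 1"
abbreviation laurent_t_inv :: laurent where "laurent_t_inv \<equiv> Poly_Mapping.single (-1) 1"

definition GL :: "'a::comm_ring_1 itself \<Rightarrow> nat \<Rightarrow> 'a mat monoid" where
  "GL ty n = units_of (ring_mat ty n ())"

text \<open>
  The matrix with the block \<open>(a b; c d)\<close> in rows and columns \<open>i, i + 1\<close> (counted from 1, whereas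
  matrix indices start at 0) and the identity elsewhere.
\<close>

definition block_mat :: "nat \<Rightarrow> nat \<Rightarrow> 'a::comm_ring_1 \<Rightarrow> 'a \<Rightarrow> 'a \<Rightarrow> 'a \<Rightarrow> 'a mat" where
  "block_mat n i a b c d = mat n n (\<lambda>(r, s).
     if r = i - 1 \<and> s = i - 1 then a
     else if r = i - 1 \<and> s = i then b
     else if r = i \<and> s = i - 1 then c
     else if r = i \<and> s = i then d
     else if r = s then 1 else 0)"

fun burau_letter :: "nat \<Rightarrow> nat \<times> bool \<Rightarrow> laurent mat" where
  "burau_letter n (i, True) = block_mat n i (1 - laurent_t) laurent_t 1 0"
| "burau_letter n (i, False) = block_mat n i 0 1 laurent_t_inv (1 - laurent_t_inv)"

definition burau_word :: "nat \<Rightarrow> braid_word \<Rightarrow> laurent mat" where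
  "burau_word n w = foldr (\<lambda>l A. burau_letter n l * A) w (1\<^sub>m n)"

text \<open>\<open>burau_word\<close> is constant on each class of words, see \<open>burau_class\<close> below.\<close>

definition burau :: "nat \<Rightarrow> braid_word set \<Rightarrow> laurent mat" where
  "burau n X = the_elem (burau_word n ` X)"

text \<open>Evaluation at \<open>t = -1\<close>; note \<open>(-1)\<^sup>k = (-1)\<^bsup>\<bar>k\<bar>\<^esup>\<close> for negative \<open>k\<close>.\<close>

definition eval_minus_one :: "laurent \<Rightarrow> int" where
  "eval_minus_one p = (\<Sum>k\<in>Poly_Mapping.keys p. Poly_Mapping.lookup p k * (-1) ^ nat \<bar>k\<bar>)"

text \<open>The type \<open>4\<close> is the ring \<open>\<int>/4\<close>, and \<open>of_int\<close> into it is reduction mod 4.\<close>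

definition burau_mod4 :: "nat \<Rightarrow> braid_word set \<Rightarrow> 4 mat" where
  "burau_mod4 n X = map_mat of_int (map_mat eval_minus_one (burau n X))"

definition level4_braid_group :: "nat \<Rightarrow> braid_word set monoid" where
  "level4_braid_group n =
    (braid_group n)\<lparr>carrier := kernel (braid_group n) (GL TYPE(4) n) (burau_mod4 n)\<rparr>"

lemma block_mat_carrier [simp]: "block_mat n i a b c d \<in> carrier_mat n n"
  by (simp add: block_mat_def)

lemma dim_block_mat [simp]:
  "dim_row (block_mat n i a b c d) = n" "dim_col (block_mat n i a b c d) = n"
  by (simp_all add: block_mat_def)

lemma index_block_mat_mult:
  assumes i: "1 \<le> i" "i < n" and X: "X \<in> carrier_mat n m" and r: "r < n" and s: "s < m"
  shows "(block_mat n i a b c d * X) $$ (r, s) =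
    (if r = i - 1 then a * X $$ (i - 1, s) + b * X $$ (i, s)
     else if r = i then c * X $$ (i - 1, s) + d * X $$ (i, s)
     else X $$ (r, s))"
proof -
  obtain p where p: "i = Suc p" using i by (cases i) auto
  let ?f = "\<lambda>k. block_mat n i a b c d $$ (r, k) * X $$ (k, s)"
  have *: "(block_mat n i a b c d * X) $$ (r, s) = (\<Sum>k\<in>{0..<n}. ?f k)"
    using X r s by (simp add: scalar_prod_def)
  show ?thesis
  proof (cases "r = p \<or> r = Suc p")
    case True
    then have "(\<Sum>k\<in>{0..<n}. ?f k) = (\<Sum>k\<in>{p, Suc p}. ?f k)"
      using i r p by (intro sum.mono_neutral_right) (auto simp: block_mat_def)
    also have "\<dots> = ?f p + ?f (Suc p)" by simp
    finally show ?thesis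
      using True i r p unfolding * by (elim disjE) (simp_all add: block_mat_def)
  next
    case False
    have "?f k = 0" if "k < n" "k \<noteq> r" for k
      using False that r p by (simp add: block_mat_def)
    then have "(\<Sum>k\<in>{0..<n}. ?f k) = (\<Sum>k\<in>{r}. ?f k)"
      using r by (intro sum.mono_neutral_right) auto
    also have "\<dots> = X $$ (r, s)"
      using False r p by (simp add: block_mat_def)
    finally show ?thesis
      using False p unfolding * by simp
  qed
qed

lemma burau_letter_carrier [simp]: "burau_letter n l \<in> carrier_mat n n"
  by (cases l rule: burau_letter.cases[of "(n, l)" for n l, simplified]) auto

lemma burau_word_carrier [simp]: "burau_word n w \<in> carrier_mat n n"
  by (induction w) (auto simp: burau_word_def intro: mult_carrier_mat[OF burau_letter_carrier])

lemma burau_word_Nil [simp]: "burau_word n [] = 1\<^sub>m n"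
  by (simp add: burau_word_def)

lemma burau_word_Cons: "burau_word n (l # w) = burau_letter n l * burau_word n w"
  by (simp add: burau_word_def)

lemma burau_word_app: "burau_word n (u @ v) = burau_word n u * burau_word n v"
proof (induction u)
  case Nil
  then show ?case using left_mult_one_mat[OF burau_word_carrier[of n v]] by simp
next
  case (Cons l u)
  then show ?case
    by (simp add: burau_word_Cons
        assoc_mult_mat[OF burau_letter_carrier burau_word_carrier burau_word_carrier])
qed

lemma laurent_t_mult_inv: "laurent_t * laurent_t_inv = 1" "laurent_t_inv * laurent_t = 1"
  by (simp_all add: mult_single)

lemma block_mat_cancel:
  fixes t u :: "'a::comm_ring_1"
  assumes i: "1 \<le> i" "i < n" and tu: "t * u = 1" and X: "X \<in> carrier_mat n n"
  shows "block_mat n i (1 - t) t 1 0 * (block_mat n i 0 1 u (1 - u) * X) = X"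
    and "block_mat n i 0 1 u (1 - u) * (block_mat n i (1 - t) t 1 0 * X) = X"
proof -
  note c2 = mult_carrier_mat[OF block_mat_carrier X]
  have tu': "t * (u * x) = x" "u * (t * x) = x" for x
    using tu by (metis mult.assoc mult.commute mult_1)+
  note simps = index_block_mat_mult[OF i c2] index_block_mat_mult[OF i X]
  show "block_mat n i (1 - t) t 1 0 * (block_mat n i 0 1 u (1 - u) * X) = X"
    by (rule eq_matI) (use i X in \<open>auto simp: simps tu' algebra_simps simp del: index_mult_mat(1)\<close>)
  show "block_mat n i 0 1 u (1 - u) * (block_mat n i (1 - t) t 1 0 * X) = X"
    by (rule eq_matI) (use i X in \<open>auto simp: simps tu' algebra_simps simp del: index_mult_mat(1)\<close>)
qed

lemma block_mat_far:
  fixes X :: "'a::comm_ring_1 mat"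
  assumes i: "1 \<le> i" "i + 2 \<le> j" "j < n" and X: "X \<in> carrier_mat n n"
  shows "block_mat n i a b c d * (block_mat n j a' b' c' d' * X)
    = block_mat n j a' b' c' d' * (block_mat n i a b c d * X)"
proof -
  have ij: "1 \<le> i" "i < n" "1 \<le> j" "j < n" using i by auto
  note c2 = mult_carrier_mat[OF block_mat_carrier X]
  note simps = index_block_mat_mult[OF ij(1,2) c2] index_block_mat_mult[OF ij(1,2) X]
    index_block_mat_mult[OF ij(3,4) c2] index_block_mat_mult[OF ij(3,4) X]
  show ?thesis
  proof (rule eq_matI, goal_cases)
    case (1 r s)
    then have rs: "r < n" "s < n" using X by auto
    obtain p q where pq: "i = Suc p" "j = Suc q" using ij by (cases i; cases j) auto
    have ne: "p \<noteq> q" "Suc p \<noteq> q" "p \<noteq> Suc q" "p < n" "q < n" "Suc p < n" "Suc q < n"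
      using i pq by auto
    consider "r = p" | "r = Suc p" | "r = q" | "r = Suc q"
      | "r \<noteq> p \<and> r \<noteq> Suc p \<and> r \<noteq> q \<and> r \<noteq> Suc q" by blast
    then show ?case
      by cases (use rs ne ne(1-3)[symmetric] in \<open>simp_all add: simps[unfolded pq] pq del: index_mult_mat(1)\<close>)
  qed (use X in auto)
qed

lemma block_mat_braid:
  fixes t :: "'a::comm_ring_1" and X :: "'a mat"
  assumes i: "1 \<le> i" "Suc i < n" and X: "X \<in> carrier_mat n n"
  shows "block_mat n i (1 - t) t 1 0 * (block_mat n (Suc i) (1 - t) t 1 0 *
        (block_mat n i (1 - t) t 1 0 * X))
    = block_mat n (Suc i) (1 - t) t 1 0 * (block_mat n i (1 - t) t 1 0 *
        (block_mat n (Suc i) (1 - t) t 1 0 * X))"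
proof -
  have ij: "1 \<le> i" "i < n" "1 \<le> Suc i" "Suc i < n" using i by auto
  note c2 = mult_carrier_mat[OF block_mat_carrier X]
  note c3 = mult_carrier_mat[OF block_mat_carrier c2]
  note simps = index_block_mat_mult[OF ij(1,2) c3] index_block_mat_mult[OF ij(1,2) c2]
    index_block_mat_mult[OF ij(1,2) X] index_block_mat_mult[OF ij(3,4) c3]
    index_block_mat_mult[OF ij(3,4) c2] index_block_mat_mult[OF ij(3,4) X]
  show ?thesis
    by (rule eq_matI) (use i X in \<open>auto simp: simps algebra_simps simp del: index_mult_mat(1)\<close>)
qed

lemma burau_word_equiv: "braid_equiv n u v \<Longrightarrow> burau_word n u = burau_word n v"
proof (induction rule: braid_equiv.induct)
  case (cancel i b)
  then show ?case
    by (cases b) (simp_all only: burau_word_Cons burau_word_Nil burau_letter.simps not_True_eq_False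
        not_False_eq_True block_mat_cancel[OF cancel laurent_t_mult_inv(1) one_carrier_mat])
next
  case (far i j)
  then show ?case
    by (simp only: burau_word_Cons burau_word_Nil burau_letter.simps
        block_mat_far[OF far one_carrier_mat])
next
  case (braid i)
  then show ?case
    by (simp only: burau_word_Cons burau_word_Nil burau_letter.simps
        block_mat_braid[OF braid one_carrier_mat])
qed (simp_all add: burau_word_app)

lemma burau_class:
  assumes "w \<in> braid_words n"
  shows "burau n (braid_rel n `` {w}) = burau_word n w"
proof -
  have "burau_word n ` (braid_rel n `` {w}) = {burau_word n w}"
    using braid_equiv.refl[OF assms] by (auto simp: braid_rel_def dest: burau_word_equiv)
  then show ?thesis by (simp add: burau_def)
qed

lemma GL_simps:
  "\<one>\<^bsub>GL TYPE('a::comm_ring_1) n\<^esub> = 1\<^sub>m n" "A \<otimes>\<^bsub>GL TYPE('a) n\<^esub> B = A * B"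
  by (simp_all add: GL_def units_of_def ring_mat_simps)

lemma GL_I:
  assumes "A \<in> carrier_mat n n" "B \<in> carrier_mat n n" "A * B = 1\<^sub>m n" "B * A = 1\<^sub>m n"
  shows "A \<in> carrier (GL TYPE('a::comm_ring_1) n)"
  using assms by (auto simp: GL_def units_of_def Units_def ring_mat_simps)

lemma group_GL: "group (GL TYPE('a::comm_ring_1) n)"
proof -
  interpret ring "ring_mat TYPE('a) n ()" by (rule ring_mat)
  show ?thesis unfolding GL_def by (rule units_group)
qed

lemma burau_word_GL:
  assumes "w \<in> braid_words n"
  shows "burau_word n w \<in> carrier (GL TYPE(laurent) n)"
proof -
  obtain v where v: "v \<in> braid_words n" "braid_equiv n (v @ w) []"
    using braid_equiv_inverse[OF assms] by blast
  obtain u where u: "u \<in> braid_words n" "braid_equiv n (u @ v) []"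
    using braid_equiv_inverse[OF v(1)] by blast
  have 1: "burau_word n v * burau_word n w = 1\<^sub>m n"
    using burau_word_equiv[OF v(2)] by (simp add: burau_word_app)
  have 2: "burau_word n u * burau_word n v = 1\<^sub>m n"
    using burau_word_equiv[OF u(2)] by (simp add: burau_word_app)
  have "burau_word n u = burau_word n u * (burau_word n v * burau_word n w)"
    using right_mult_one_mat[OF burau_word_carrier] by (simp add: 1)
  also have "\<dots> = burau_word n u * burau_word n v * burau_word n w"
    by (rule assoc_mult_mat[symmetric]) (rule burau_word_carrier)+
  also have "\<dots> = burau_word n w"
    using left_mult_one_mat[OF burau_word_carrier] by (simp add: 2)
  finally have "burau_word n w * burau_word n v = 1\<^sub>m n" using 2 by simp
  with 1 show ?thesis by (intro GL_I[of _ _ "burau_word n v"]) auto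
qed

lemma burau_hom: "burau n \<in> hom (braid_group n) (GL TYPE(laurent) n)"
proof (rule homI)
  fix x assume "x \<in> carrier (braid_group n)"
  then show "burau n x \<in> carrier (GL TYPE(laurent) n)"
    by (auto elim!: braid_group_carrierE simp: burau_class burau_word_GL)
next
  fix x y assume "x \<in> carrier (braid_group n)" "y \<in> carrier (braid_group n)"
  then show "burau n (x \<otimes>\<^bsub>braid_group n\<^esub> y) = burau n x \<otimes>\<^bsub>GL TYPE(laurent) n\<^esub> burau n y"
    by (auto elim!: braid_group_carrierE
        simp: braid_group_mult burau_class braid_words_app burau_word_app GL_simps)
qed

lemma eval_minus_one_superset:
  assumes "finite S" "Poly_Mapping.keys p \<subseteq> S"
  shows "eval_minus_one p = (\<Sum>k\<in>S. Poly_Mapping.lookup p k * (-1) ^ nat \<bar>k\<bar>)"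
  unfolding eval_minus_one_def using assms
  by (intro sum.mono_neutral_left) (auto simp: in_keys_iff)

lemma eval_minus_one_single: "eval_minus_one (Poly_Mapping.single k c) = c * (-1) ^ nat \<bar>k\<bar>"
  by (subst eval_minus_one_superset[of "{k}"]) (auto simp: lookup_single)

lemma eval_minus_one_add: "eval_minus_one (p + q) = eval_minus_one p + eval_minus_one q"
proof -
  let ?S = "Poly_Mapping.keys p \<union> Poly_Mapping.keys q"
  have "finite ?S" "Poly_Mapping.keys (p + q) \<subseteq> ?S" by (simp_all add: keys_add)
  then show ?thesis
    by (simp add: eval_minus_one_superset[of ?S] lookup_add algebra_simps sum.distrib)
qed

lemma eval_minus_one_0: "eval_minus_one 0 = 0"
  by (simp add: eval_minus_one_def)

lemma eval_minus_one_1: "eval_minus_one 1 = 1"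
  using eval_minus_one_single[of 0 1] by simp

lemma eval_minus_one_sum: "eval_minus_one (sum f A) = (\<Sum>x\<in>A. eval_minus_one (f x))"
  by (induction A rule: infinite_finite_induct) (auto simp: eval_minus_one_add eval_minus_one_0)

lemma poly_mapping_eq_sum_single:
  "p = (\<Sum>k\<in>Poly_Mapping.keys p. Poly_Mapping.single k (Poly_Mapping.lookup p k))"
proof (rule poly_mapping_eqI)
  fix x
  have "Poly_Mapping.lookup (\<Sum>k\<in>Poly_Mapping.keys p. Poly_Mapping.single k (Poly_Mapping.lookup p k)) x
      = (\<Sum>k\<in>Poly_Mapping.keys p. if k = x then Poly_Mapping.lookup p k else 0)"
    by (simp add: lookup_sum lookup_single when_def)
  also have "\<dots> = Poly_Mapping.lookup p x"
    by (subst sum.delta) (auto simp: in_keys_iff)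
  finally show "Poly_Mapping.lookup p x = Poly_Mapping.lookup (\<Sum>k\<in>Poly_Mapping.keys p.
      Poly_Mapping.single k (Poly_Mapping.lookup p k)) x" ..
qed

lemma minus_one_power_abs_add:
  "(-1 :: int) ^ nat \<bar>k + l\<bar> = (-1) ^ nat \<bar>k\<bar> * (-1) ^ nat \<bar>l\<bar>"
  by (auto simp: minus_one_power_iff even_nat_iff)

lemma eval_minus_one_mult: "eval_minus_one (p * q) = eval_minus_one p * eval_minus_one q"
proof -
  let ?P = "Poly_Mapping.keys p" and ?Q = "Poly_Mapping.keys q"
  have "p * q = (\<Sum>k\<in>?P. Poly_Mapping.single k (Poly_Mapping.lookup p k)) *
      (\<Sum>l\<in>?Q. Poly_Mapping.single l (Poly_Mapping.lookup q l))"
    using poly_mapping_eq_sum_single[of p] poly_mapping_eq_sum_single[of q] by simp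
  also have "\<dots> = (\<Sum>k\<in>?P. \<Sum>l\<in>?Q.
      Poly_Mapping.single (k + l) (Poly_Mapping.lookup p k * Poly_Mapping.lookup q l))"
    by (simp add: sum_product mult_single)
  finally have "eval_minus_one (p * q) = (\<Sum>k\<in>?P. \<Sum>l\<in>?Q.
      (Poly_Mapping.lookup p k * (-1) ^ nat \<bar>k\<bar>) * (Poly_Mapping.lookup q l * (-1) ^ nat \<bar>l\<bar>))"
    by (simp add: eval_minus_one_sum eval_minus_one_single minus_one_power_abs_add mult_ac)
  then show ?thesis
    by (simp add: eval_minus_one_def sum_product)
qed

lemma eval_minus_one_hom: "comm_ring_hom eval_minus_one"
  by unfold_locales
    (simp_all add: eval_minus_one_add eval_minus_one_mult eval_minus_one_0 eval_minus_one_1)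

lemma map_mat_hom_GL:
  assumes "comm_ring_hom (f :: 'a::comm_ring_1 \<Rightarrow> 'b::comm_ring_1)"
  shows "map_mat f \<in> hom (GL TYPE('a) n) (GL TYPE('b) n)"
proof (rule homI)
  interpret comm_ring_hom f by fact
  fix A assume "A \<in> carrier (GL TYPE('a) n)"
  then obtain B where A: "A \<in> carrier_mat n n" and B: "B \<in> carrier_mat n n"
    and AB: "A * B = 1\<^sub>m n" "B * A = 1\<^sub>m n"
    by (auto simp: GL_def units_of_def Units_def ring_mat_simps)
  have "map_mat f A * map_mat f B = 1\<^sub>m n" "map_mat f B * map_mat f A = 1\<^sub>m n"
    using mat_hom_mult[OF A B] mat_hom_mult[OF B A] AB mat_hom_one by simp_all
  then show "map_mat f A \<in> carrier (GL TYPE('b) n)"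
    using A B by (intro GL_I[of _ _ "map_mat f B"]) auto
  fix A' assume "A' \<in> carrier (GL TYPE('a) n)"
  then have "A' \<in> carrier_mat n n" by (auto simp: GL_def units_of_def Units_def ring_mat_simps)
  then show "map_mat f (A \<otimes>\<^bsub>GL TYPE('a) n\<^esub> A') = map_mat f A \<otimes>\<^bsub>GL TYPE('b) n\<^esub> map_mat f A'"
    using mat_hom_mult[OF A] by (simp add: GL_simps)
qed

lemma of_int_mod4_hom: "comm_ring_hom (of_int :: int \<Rightarrow> 4)"
  by unfold_locales auto

lemma burau_mod4_hom: "burau_mod4 n \<in> hom (braid_group n) (GL TYPE(4) n)"
proof -
  have "(map_mat (of_int :: int \<Rightarrow> 4) \<circ> (map_mat eval_minus_one \<circ> burau n))
      \<in> hom (braid_group n) (GL TYPE(4) n)"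
    by (rule hom_compose[OF hom_compose[OF burau_hom map_mat_hom_GL[OF eval_minus_one_hom]]
          map_mat_hom_GL[OF of_int_mod4_hom]])
  then show ?thesis by (simp add: o_def burau_mod4_def[abs_def])
qed

lemma group_level4_braid_group: "group (level4_braid_group n)"
proof -
  interpret group_hom "braid_group n" "GL TYPE(4) n" "burau_mod4 n"
    by (intro group_hom.intro group_hom_axioms.intro group_braid_group group_GL burau_mod4_hom)
  show ?thesis
    unfolding level4_braid_group_def
    by (rule subgroup.subgroup_is_group[OF subgroup_kernel group_braid_group])
qed


section \<open>Rational group homology\<close>

definition quotient_module :: "('a, 'm) module \<Rightarrow> 'm set \<Rightarrow> ('a, 'm set) module" where
  "quotient_module M N =
    \<lparr> carrier = a_rcosets\<^bsub>M\<^esub> N, mult = undefined, one = undefined, zero = N, add = set_add M,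
      smult = (\<lambda>a X. \<Union>x\<in>X. N +>\<^bsub>M\<^esub> (a \<odot>\<^bsub>M\<^esub> x)) \<rparr>"

definition chain_scale :: "rat \<Rightarrow> ('b \<Rightarrow>\<^sub>0 rat) \<Rightarrow> ('b \<Rightarrow>\<^sub>0 rat)" where
  "chain_scale a c = Poly_Mapping.map ((*) a) c"

definition chain_module :: "('b \<Rightarrow>\<^sub>0 rat) set \<Rightarrow> (rat, 'b \<Rightarrow>\<^sub>0 rat) module" where
  "chain_module C =
    \<lparr> carrier = C, mult = undefined, one = undefined, zero = 0, add = (+), smult = chain_scale \<rparr>"

text \<open>
  \<open>H\<^sub>*(G; \<rat>)\<close> is the homology of the (unnormalised, inhomogeneous) bar complex with trivial
  coefficients: degree \<open>k\<close> is the rational vector space with basis \<open>G\<^sup>k\<close>, and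
  \<open>\<partial>[g\<^sub>1|\<dots>|g\<^sub>k] = [g\<^sub>2|\<dots>|g\<^sub>k] + \<Sum>\<^sub>i (-1)\<^sup>i [g\<^sub>1|\<dots>|g\<^sub>ig\<^sub>i\<^sub>+\<^sub>1|\<dots>|g\<^sub>k] + (-1)\<^sup>k [g\<^sub>1|\<dots>|g\<^sub>k\<^sub>-\<^sub>1]\<close>.
\<close>

definition bar_chains :: "'g monoid \<Rightarrow> nat \<Rightarrow> ('g list \<Rightarrow>\<^sub>0 rat) set" where
  "bar_chains G k = {c. Poly_Mapping.keys c \<subseteq> {gs. length gs = k \<and> set gs \<subseteq> carrier G}}"

definition bar_face :: "'g monoid \<Rightarrow> nat \<Rightarrow> 'g list \<Rightarrow> 'g list" where
  "bar_face G i gs =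
    (if i = 0 then tl gs
     else if i = length gs then butlast gs
     else take (i - 1) gs @ [gs ! (i - 1) \<otimes>\<^bsub>G\<^esub> gs ! i] @ drop (i + 1) gs)"

definition bar_boundary_basis :: "'g monoid \<Rightarrow> 'g list \<Rightarrow> ('g list \<Rightarrow>\<^sub>0 rat)" where
  "bar_boundary_basis G gs =
    (if gs = [] then 0 else \<Sum>i\<le>length gs. Poly_Mapping.single (bar_face G i gs) ((-1) ^ i))"

definition bar_boundary :: "'g monoid \<Rightarrow> ('g list \<Rightarrow>\<^sub>0 rat) \<Rightarrow> ('g list \<Rightarrow>\<^sub>0 rat)" where
  "bar_boundary G c =
    (\<Sum>gs\<in>Poly_Mapping.keys c. chain_scale (Poly_Mapping.lookup c gs) (bar_boundary_basis G gs))"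

definition bar_cycles :: "'g monoid \<Rightarrow> nat \<Rightarrow> ('g list \<Rightarrow>\<^sub>0 rat) set" where
  "bar_cycles G k = {c \<in> bar_chains G k. bar_boundary G c = 0}"

definition bar_boundaries :: "'g monoid \<Rightarrow> nat \<Rightarrow> ('g list \<Rightarrow>\<^sub>0 rat) set" where
  "bar_boundaries G k = bar_boundary G ` bar_chains G (Suc k)"

definition group_homology :: "'g monoid \<Rightarrow> nat \<Rightarrow> (rat, ('g list \<Rightarrow>\<^sub>0 rat) set) module" where
  "group_homology G k = quotient_module (chain_module (bar_cycles G k)) (bar_boundaries G k)"

text \<open>\<open>vectorspace.dim\<close> alone does not express finite-dimensionality.\<close>

definition has_dimension :: "('a::field, 'm) module \<Rightarrow> nat \<Rightarrow> bool" where
  "has_dimension V d \<longleftrightarrow>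
    vectorspace.fin_dim class_ring V \<and> vectorspace.dim class_ring V = d"

text \<open>The homology groups are indeed vector spaces; in particular \<open>\<partial> \<circ> \<partial> = 0\<close>.\<close>

lemma mem_a_r_coset: "y \<in> N +>\<^bsub>M\<^esub> x \<longleftrightarrow> (\<exists>h\<in>N. y = h \<oplus>\<^bsub>M\<^esub> x)"
  by (simp add: a_r_coset_def r_coset_def)

lemma module_quotient_module:
  assumes "submodule R N M"
  shows "Module.module R (quotient_module M N)"
proof -
  interpret N: submodule R N M by fact
  interpret Module.module R M by (rule N.module)
  have "subgroup N (add_monoid M)"
  proof (rule group.subgroupI)
    show "group (add_monoid M)" by (rule M.a_group)
    show "N \<noteq> {}" using N.zero_closed by blast
    fix a assume a: "a \<in> N"
    then have "a \<in> carrier M" using N.subset by blast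
    then have "\<ominus>\<^bsub>M\<^esub> a = (\<ominus>\<^bsub>R\<^esub> \<one>\<^bsub>R\<^esub>) \<odot>\<^bsub>M\<^esub> a"
      by (simp add: smult_l_minus)
    then show "inv\<^bsub>add_monoid M\<^esub> a \<in> N"
      using a by (simp add: a_inv_def)
  qed (use N.subset in auto)
  then have sub: "abelian_subgroup N M"
    by (intro abelian_subgroupI3 additive_subgroupI M.abelian_group_axioms)
  interpret abelian_subgroup N M by (rule sub)
  let ?Q = "quotient_module M N"
  have sm: "a \<odot>\<^bsub>?Q\<^esub> (N +>\<^bsub>M\<^esub> x) = N +>\<^bsub>M\<^esub> (a \<odot>\<^bsub>M\<^esub> x)"
    if a: "a \<in> carrier R" and x: "x \<in> carrier M" for a x
  proof -
    have "N +>\<^bsub>M\<^esub> (a \<odot>\<^bsub>M\<^esub> y) = N +>\<^bsub>M\<^esub> (a \<odot>\<^bsub>M\<^esub> x)" if y: "y \<in> N +>\<^bsub>M\<^esub> x" for y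
    proof -
      obtain h where h: "h \<in> N" "y = h \<oplus>\<^bsub>M\<^esub> x"
        using y unfolding mem_a_r_coset by blast
      then have "a \<odot>\<^bsub>M\<^esub> y = a \<odot>\<^bsub>M\<^esub> h \<oplus>\<^bsub>M\<^esub> a \<odot>\<^bsub>M\<^esub> x"
        using a x N.subset by (auto intro: smult_r_distr)
      then have "a \<odot>\<^bsub>M\<^esub> y \<in> N +>\<^bsub>M\<^esub> (a \<odot>\<^bsub>M\<^esub> x)"
        using a h unfolding mem_a_r_coset by blast
      then show ?thesis using a_repr_independence'[of _ "a \<odot>\<^bsub>M\<^esub> x"] a x by simp
    qed
    moreover have "N +>\<^bsub>M\<^esub> x \<noteq> {}" using a_rcos_self[OF x] by blast
    ultimately have "(\<Union>y\<in>N +>\<^bsub>M\<^esub> x. N +>\<^bsub>M\<^esub> (a \<odot>\<^bsub>M\<^esub> y)) = N +>\<^bsub>M\<^esub> (a \<odot>\<^bsub>M\<^esub> x)" by auto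
    then show ?thesis by (simp add: quotient_module_def)
  qed
  have car: "carrier ?Q = (\<lambda>x. N +>\<^bsub>M\<^esub> x) ` carrier M"
    by (auto simp: quotient_module_def A_RCOSETS_def')
  have ad: "(N +>\<^bsub>M\<^esub> x) \<oplus>\<^bsub>?Q\<^esub> (N +>\<^bsub>M\<^esub> y) = N +>\<^bsub>M\<^esub> (x \<oplus>\<^bsub>M\<^esub> y)"
    if "x \<in> carrier M" "y \<in> carrier M" for x y
    using a_rcos_sum[OF that] by (simp add: quotient_module_def)
  have ze: "\<zero>\<^bsub>?Q\<^esub> = N +>\<^bsub>M\<^esub> \<zero>\<^bsub>M\<^esub>"
    using M.a_coset_join2[OF M.zero_closed a_subgroup N.zero_closed]
    by (simp add: quotient_module_def)
  have "abelian_group ?Q"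
  proof (rule abelian_groupI)
    fix X assume "X \<in> carrier ?Q"
    then obtain x where x: "x \<in> carrier M" "X = N +>\<^bsub>M\<^esub> x" by (auto simp: car)
    then show "\<exists>Y\<in>carrier ?Q. Y \<oplus>\<^bsub>?Q\<^esub> X = \<zero>\<^bsub>?Q\<^esub>"
      by (intro bexI[of _ "N +>\<^bsub>M\<^esub> (\<ominus>\<^bsub>M\<^esub> x)"]) (simp_all add: ad ze car M.l_neg)
  qed (auto simp: car ad ze M.a_ac)
  then show ?thesis
    by (intro moduleI R.is_cring) (auto simp: car sm ad smult_l_distr smult_r_distr smult_assoc1)
qed

lemma lookup_chain_scale [simp]:
  "Poly_Mapping.lookup (chain_scale a c) x = a * Poly_Mapping.lookup c x"
  by (simp add: chain_scale_def map.rep_eq when_def)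

lemma module_chain_module:
  assumes "0 \<in> C" "\<And>x y. x \<in> C \<Longrightarrow> y \<in> C \<Longrightarrow> x + y \<in> C"
    and "\<And>a x. x \<in> C \<Longrightarrow> chain_scale a x \<in> C"
  shows "Module.module (class_ring :: rat ring) (chain_module C)"
proof (rule moduleI)
  show "cring (class_ring :: rat ring)" by (rule class_cring.cring_axioms)
  show "abelian_group (chain_module C)"
  proof (rule abelian_groupI)
    fix x assume "x \<in> carrier (chain_module C)"
    then have "chain_scale (-1) x \<in> C" using assms by (simp add: chain_module_def)
    moreover have "chain_scale (-1) x + x = 0"
      by (rule poly_mapping_eqI) (simp add: lookup_add)
    ultimately show "\<exists>y\<in>carrier (chain_module C). y \<oplus>\<^bsub>chain_module C\<^esub> x = \<zero>\<^bsub>chain_module C\<^esub>"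
      by (auto simp: chain_module_def)
  qed (use assms in \<open>auto simp: chain_module_def algebra_simps\<close>)
qed (use assms in \<open>auto simp: chain_module_def algebra_simps lookup_add intro!: poly_mapping_eqI\<close>)

lemma bar_boundary_superset:
  assumes "finite S" "Poly_Mapping.keys c \<subseteq> S"
  shows "bar_boundary G c = (\<Sum>gs\<in>S. chain_scale (Poly_Mapping.lookup c gs) (bar_boundary_basis G gs))"
  unfolding bar_boundary_def using assms
  by (intro sum.mono_neutral_left) (auto simp: in_keys_iff intro!: poly_mapping_eqI)

lemma chain_scale_add_left: "chain_scale (a + b) c = chain_scale a c + chain_scale b c"
  by (rule poly_mapping_eqI) (simp add: lookup_add algebra_simps)

lemma chain_scale_sum: "chain_scale a (sum f A) = (\<Sum>x\<in>A. chain_scale a (f x))"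
  by (rule poly_mapping_eqI) (simp add: lookup_sum sum_distrib_left)

lemma chain_scale_scale: "chain_scale a (chain_scale b c) = chain_scale (a * b) c"
  by (rule poly_mapping_eqI) (simp add: mult.assoc)

lemma chain_scale_zero: "chain_scale a 0 = 0"
  by (rule poly_mapping_eqI) simp

lemma chain_scale_single:
  "chain_scale a (Poly_Mapping.single x b) = Poly_Mapping.single x (a * b)"
  by (rule poly_mapping_eqI) (simp add: lookup_single when_def)

lemma keys_chain_scale: "Poly_Mapping.keys (chain_scale a c) \<subseteq> Poly_Mapping.keys c"
  by (auto simp: in_keys_iff)

lemma bar_boundary_add: "bar_boundary G (c + d) = bar_boundary G c + bar_boundary G d"
proof -
  let ?S = "Poly_Mapping.keys c \<union> Poly_Mapping.keys d"
  have "finite ?S" "Poly_Mapping.keys (c + d) \<subseteq> ?S" by (simp_all add: keys_add)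
  then show ?thesis
    by (simp add: bar_boundary_superset[of ?S] lookup_add chain_scale_add_left sum.distrib)
qed

lemma bar_boundary_zero: "bar_boundary G 0 = 0"
  by (simp add: bar_boundary_def)

lemma bar_boundary_scale: "bar_boundary G (chain_scale a c) = chain_scale a (bar_boundary G c)"
  using bar_boundary_superset[OF finite_keys keys_chain_scale, of G a c]
  by (simp add: bar_boundary_def[of G c] chain_scale_sum chain_scale_scale)

lemma bar_boundary_sum: "bar_boundary G (sum f A) = (\<Sum>x\<in>A. bar_boundary G (f x))"
  by (induction A rule: infinite_finite_induct) (auto simp: bar_boundary_add bar_boundary_zero)

lemma bar_boundary_single:
  "bar_boundary G (Poly_Mapping.single gs a) = chain_scale a (bar_boundary_basis G gs)"
  by (subst bar_boundary_superset[of "{gs}"]) (auto simp: lookup_single)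

lemma bar_chains_zero: "0 \<in> bar_chains G k"
  by (simp add: bar_chains_def)

lemma bar_chains_add: "c \<in> bar_chains G k \<Longrightarrow> d \<in> bar_chains G k \<Longrightarrow> c + d \<in> bar_chains G k"
  using keys_add[of c d] unfolding bar_chains_def by blast

lemma bar_chains_scale: "c \<in> bar_chains G k \<Longrightarrow> chain_scale a c \<in> bar_chains G k"
  using keys_chain_scale[of a c] unfolding bar_chains_def by blast

lemma bar_chains_sum: "(\<And>x. x \<in> A \<Longrightarrow> f x \<in> bar_chains G k) \<Longrightarrow> sum f A \<in> bar_chains G k"
  by (induction A rule: infinite_finite_induct) (auto simp: bar_chains_zero bar_chains_add)

lemma length_bar_face: "gs \<noteq> [] \<Longrightarrow> i \<le> length gs \<Longrightarrow> length (bar_face G i gs) = length gs - 1"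
  by (auto simp: bar_face_def)

lemma nth_bar_face:
  assumes "i \<le> length gs" "m < length gs - 1"
  shows "bar_face G i gs ! m =
    (if m + 1 < i then gs ! m else if m + 1 = i then gs ! m \<otimes>\<^bsub>G\<^esub> gs ! (m + 1) else gs ! (m + 1))"
proof -
  consider "i = 0" | "i = length gs" | p where "i = Suc p" "Suc p < length gs"
    using assms by (cases i) fastforce+
  then show ?thesis
  proof cases
    case (3 p)
    consider "m < p" | "m = p" | q where "m = Suc (p + q)"
      by (metis less_iff_Suc_add linorder_neqE_nat)
    then show ?thesis
      using 3 assms by cases (auto simp: bar_face_def nth_append nth_tl)
  qed (use assms in \<open>auto simp: bar_face_def nth_tl nth_butlast\<close>)
qed

lemma bar_face_closed:
  assumes "group G" "set gs \<subseteq> carrier G" "i \<le> length gs"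
  shows "set (bar_face G i gs) \<subseteq> carrier G"
proof (cases "gs = []")
  case True
  then show ?thesis using assms by (simp add: bar_face_def)
next
  case False
  interpret group G by fact
  have nth: "gs ! m \<in> carrier G" if "m < length gs" for m
    using assms(2) that by (auto simp: set_conv_nth)
  show ?thesis
    using False assms(3)
    by (auto simp: set_conv_nth length_bar_face nth_bar_face intro!: nth m_closed)
qed

lemma bar_face_face:
  assumes "group G" "set gs \<subseteq> carrier G" "j < i" "i \<le> length gs"
  shows "bar_face G j (bar_face G i gs) = bar_face G (i - 1) (bar_face G j gs)"
proof -
  interpret group G by fact
  have ne: "gs \<noteq> []" using assms by auto
  have nth: "gs ! m \<in> carrier G" if "m < length gs" for m
    using assms(2) that by (auto simp: set_conv_nth)
  have li: "length (bar_face G i gs) = length gs - 1" and lj: "length (bar_face G j gs) = length gs - 1"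
    using assms by (simp_all add: length_bar_face[OF ne])
  show ?thesis
  proof (cases "length gs = 1")
    case True
    then have "bar_face G i gs = []" "bar_face G j gs = []" using li lj by auto
    then show ?thesis using True assms by (simp add: bar_face_def)
  next
    case False
    then have "0 < length gs - 1" using ne by (cases gs) auto
    then have ne': "bar_face G i gs \<noteq> []" "bar_face G j gs \<noteq> []"
      using li lj by (metis length_greater_0_conv)+
    have jl: "j \<le> length (bar_face G i gs)" and il: "i - 1 \<le> length (bar_face G j gs)"
      using assms li lj by auto
    show ?thesis
    proof (rule nth_equalityI)
      show "length (bar_face G j (bar_face G i gs)) = length (bar_face G (i - 1) (bar_face G j gs))"
        using length_bar_face[OF ne'(1) jl] length_bar_face[OF ne'(2) il] li lj by simp
      fix m assume "m < length (bar_face G j (bar_face G i gs))"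
      then have m: "m < length gs - 2"
        using length_bar_face[OF ne'(1) jl] li by simp
      obtain p where p: "i = Suc p" using assms by (cases i) auto
      have m1: "m < length (bar_face G i gs) - 1" "m < length (bar_face G j gs) - 1"
        and m2: "m < length gs - 1" "m + 1 < length gs - 1" "j \<le> length gs"
        using m li lj assms by auto
      show "bar_face G j (bar_face G i gs) ! m = bar_face G (i - 1) (bar_face G j gs) ! m"
        unfolding nth_bar_face[OF jl m1(1)] nth_bar_face[OF il m1(2)]
          nth_bar_face[OF assms(4) m2(1)] nth_bar_face[OF assms(4) m2(2)]
          nth_bar_face[OF m2(3,1)] nth_bar_face[OF m2(3,2)]
        using assms(3) p m2 by (auto simp: m_assoc nth)
    qed
  qed
qed

lemma alternating_sum_cancel:
  fixes f :: "nat \<Rightarrow> nat \<Rightarrow> 'a::ab_group_add"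
  assumes "\<And>i j. j < i \<Longrightarrow> i \<le> Suc m \<Longrightarrow> f i j = - f j (i - 1)"
  shows "(\<Sum>i\<le>Suc m. \<Sum>j\<le>m. f i j) = 0"
proof -
  let ?S = "{..Suc m} \<times> {..m}"
  let ?A = "{(i, j) \<in> ?S. j < i}" and ?B = "{(i, j) \<in> ?S. i \<le> j}"
  have fin: "finite ?A" "finite ?B" by (auto intro: finite_subset[of _ ?S])
  have "(\<Sum>i\<le>Suc m. \<Sum>j\<le>m. f i j) = (\<Sum>(i, j)\<in>?S. f i j)"
    by (rule sum.cartesian_product)
  also have "?S = ?A \<union> ?B" by auto
  also have "(\<Sum>(i, j)\<in>?A \<union> ?B. f i j) = (\<Sum>(i, j)\<in>?A. f i j) + (\<Sum>(i, j)\<in>?B. f i j)"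
    by (rule sum.union_disjoint[OF fin]) auto
  also have "(\<Sum>(i, j)\<in>?A. f i j) = (\<Sum>(i, j)\<in>?B. - f i j)"
    by (rule sum.reindex_bij_witness[where i = "\<lambda>(i, j). (Suc j, i)" and j = "\<lambda>(i, j). (j, i - 1)"])
      (use assms in auto)
  also have "\<dots> = - (\<Sum>(i, j)\<in>?B. f i j)"
    by (simp add: sum_negf case_prod_beta)
  finally show ?thesis by simp
qed

lemma bar_boundary_basis_closed:
  assumes "group G" "length gs = Suc k" "set gs \<subseteq> carrier G"
  shows "bar_boundary_basis G gs \<in> bar_chains G k"
proof -
  have "Poly_Mapping.single (bar_face G i gs) ((-1) ^ i) \<in> bar_chains G k" if "i \<le> length gs" for i
  proof -
    have "length (bar_face G i gs) = k"
      using assms(2) length_bar_face[OF _ that, of G] by (cases gs) auto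
    then show ?thesis
      using bar_face_closed[OF assms(1,3) that] by (auto simp: bar_chains_def)
  qed
  then show ?thesis
    unfolding bar_boundary_basis_def by (auto intro: bar_chains_zero bar_chains_sum simp del: sum.atMost_Suc)
qed

lemma bar_boundary_closed:
  assumes "group G" "c \<in> bar_chains G (Suc k)"
  shows "bar_boundary G c \<in> bar_chains G k"
  unfolding bar_boundary_def using assms(2)
  by (intro bar_chains_sum bar_chains_scale bar_boundary_basis_closed[OF assms(1)])
    (auto simp: bar_chains_def)

lemma bar_boundary_boundary_basis:
  assumes G: "group G" and gs: "set gs \<subseteq> carrier G"
  shows "bar_boundary G (bar_boundary_basis G gs) = 0"
proof (cases "length gs \<le> 1")
  case True
  then have "gs = [] \<or> length gs = 1" by (cases gs) auto
  moreover have "bar_face G i gs = []" if "length gs = 1" "i \<le> 1" for i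
    using that length_bar_face[of gs i] by (cases "gs = []") auto
  ultimately show ?thesis
    by (auto simp: bar_boundary_basis_def bar_boundary_zero bar_boundary_sum bar_boundary_single
        chain_scale_zero)
next
  case False
  then obtain m where m: "length gs = Suc m" "m \<noteq> 0" by (cases "length gs") auto
  have ne: "gs \<noteq> []" using m by auto
  let ?f = "\<lambda>i j. Poly_Mapping.single (bar_face G j (bar_face G i gs)) ((-1) ^ i * (-1) ^ j :: rat)"
  have "bar_boundary_basis G (bar_face G i gs)
      = (\<Sum>j\<le>m. Poly_Mapping.single (bar_face G j (bar_face G i gs)) ((-1) ^ j))"
    if "i \<le> Suc m" for i
  proof -
    have l: "length (bar_face G i gs) = m" using m length_bar_face[OF ne] that by simp
    then have "bar_face G i gs \<noteq> []" using m by auto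
    with l show ?thesis by (simp add: bar_boundary_basis_def)
  qed
  then have "bar_boundary G (bar_boundary_basis G gs) = (\<Sum>i\<le>Suc m. \<Sum>j\<le>m. ?f i j)"
    using m ne by (simp add: bar_boundary_basis_def[of G gs] bar_boundary_sum bar_boundary_single
        chain_scale_sum chain_scale_single del: sum.atMost_Suc)
  also have "\<dots> = 0"
  proof (rule alternating_sum_cancel)
    fix i j assume ij: "j < i" "i \<le> Suc m"
    then obtain p where p: "i = Suc p" by (cases i) auto
    show "?f i j = - ?f j (i - 1)"
      using bar_face_face[OF G gs ij(1)] ij m p by (simp add: single_uminus[symmetric] mult.commute)
  qed
  finally show ?thesis .
qed

lemma bar_boundary_boundary:
  assumes "group G" "c \<in> bar_chains G k"
  shows "bar_boundary G (bar_boundary G c) = 0"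
proof -
  have "bar_boundary G (bar_boundary G c) = (\<Sum>gs\<in>Poly_Mapping.keys c.
      chain_scale (Poly_Mapping.lookup c gs) (bar_boundary G (bar_boundary_basis G gs)))"
    unfolding bar_boundary_def[of G c] by (simp add: bar_boundary_sum bar_boundary_scale)
  also have "\<dots> = 0"
    using assms by (intro sum.neutral)
      (auto simp: bar_chains_def bar_boundary_boundary_basis chain_scale_zero)
  finally show ?thesis .
qed

lemma vectorspace_group_homology:
  assumes "group G"
  shows "vectorspace class_ring (group_homology G k)"
proof -
  have "submodule class_ring (bar_boundaries G k) (chain_module (bar_cycles G k))"
  proof (rule submodule.intro)
    show "Module.module class_ring (chain_module (bar_cycles G k))"
      by (rule module_chain_module)
        (auto simp: bar_cycles_def bar_chains_zero bar_chains_add bar_chains_scale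
          bar_boundary_zero bar_boundary_add bar_boundary_scale chain_scale_zero)
    show "bar_boundaries G k \<subseteq> carrier (chain_module (bar_cycles G k))"
      using assms by (auto simp: bar_boundaries_def bar_cycles_def chain_module_def
          bar_boundary_closed bar_boundary_boundary)
    show "\<zero>\<^bsub>chain_module (bar_cycles G k)\<^esub> \<in> bar_boundaries G k"
      unfolding bar_boundaries_def chain_module_def
      by (auto intro!: image_eqI[where x = 0] simp: bar_boundary_zero bar_chains_zero)
  next
    fix v w assume "v \<in> bar_boundaries G k" "w \<in> bar_boundaries G k"
    then show "v \<oplus>\<^bsub>chain_module (bar_cycles G k)\<^esub> w \<in> bar_boundaries G k"
      by (auto simp: bar_boundaries_def chain_module_def bar_chains_add simp flip: bar_boundary_add)
  next
    fix a v assume "v \<in> bar_boundaries G k"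
    then show "a \<odot>\<^bsub>chain_module (bar_cycles G k)\<^esub> v \<in> bar_boundaries G k"
      by (auto simp: bar_boundaries_def chain_module_def bar_chains_scale simp flip: bar_boundary_scale)
  qed
  then show ?thesis
    unfolding group_homology_def
    by (intro vectorspace.intro module_quotient_module class_field)
qed

end

theory Submission
  imports Defs "HOL-Library.Product_Plus"
begin

text \<open>Artin combing and the Burau matrices modulo 4 identify \<open>B\<^sub>3[4]\<close> with \<open>\<int> \<times> E\<^sub>2\<close> and \<open>B\<^sub>4[4]\<close> with
  \<open>\<int> \<times> (E\<^sub>3 \<rtimes> E\<^sub>2)\<close>, where \<open>\<int>\<close> is generated by the square of the full twist and \<open>E\<^sub>n\<close> consists of the
  elements of the free group \<open>F\<^sub>n\<close> all of whose exponent sums are even. The groups \<open>\<int> \<times> F\<^sub>2\<close> and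
  \<open>\<int> \<times> (F\<^sub>3 \<rtimes> F\<^sub>2)\<close> act freely on contractible complexes that are iterated cones over Cayley trees, so the
  homology is that of the quotients of these complexes by the level 4 groups. The rational
  chains of a quotient form a complex of free modules over the group ring of \<open>(\<int>/2)\<^sup>2\<close> or \<open>(\<int>/2)\<^sup>5\<close>;
  they decompose along the characters of this group into small integer matrix complexes, whose
  homology is read off from explicit splittings.\<close>

section \<open>Rational homological algebra: comparing complexes and reading off dimensions\<close>

section \<open>Chains\<close>

text \<open>Modulo 4 at t = -1 every generator A_{j,n+1} acts as a transvection that adds twice a
  vector. As 2 * 2 = 0, these maps commute and depend only on exponent sums modulo 2; this is why
  level 4 amounts to even exponent sums. Combing alone yields iterated semidirect products in which
  the cyclic factor acts as well; dividing by a power of the full twist, which acts by inner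
  automorphisms, splits this factor off, and evenness survives because every letter has exponent one
  in the image of the full twist. An automorphism of F_3 does not permute the edges of the Cayley
  tree, so the cone is built from an action by chain maps only: an edge is sent to a geodesic, and
  Fox derivatives appear as its coefficients. Each character complex is replaced by the span of a
  few critical cells with zero differential, so that dimensions become counts of cells: 1 and 5 on
  three strands, and 1, 20, 83 on four, before the central factor multiplies these Poincare
  polynomials by 1 + t.\<close>

definition chains_on :: "'x set \<Rightarrow> ('x \<Rightarrow>\<^sub>0 rat) set" where
  "chains_on X = {c. Poly_Mapping.keys c \<subseteq> X}"

abbreviation cell :: "'x \<Rightarrow> 'x \<Rightarrow>\<^sub>0 rat" where
  "cell x \<equiv> Poly_Mapping.single x 1"

definition lin_map :: "(('x \<Rightarrow>\<^sub>0 rat) \<Rightarrow> ('y \<Rightarrow>\<^sub>0 rat)) \<Rightarrow> bool" where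
  "lin_map f \<longleftrightarrow> (\<forall>a b. f (a + b) = f a + f b) \<and> (\<forall>r a. f (chain_scale r a) = chain_scale r (f a))"

definition lin :: "('x \<Rightarrow> ('y \<Rightarrow>\<^sub>0 rat)) \<Rightarrow> ('x \<Rightarrow>\<^sub>0 rat) \<Rightarrow> ('y \<Rightarrow>\<^sub>0 rat)" where
  "lin F c = (\<Sum>x\<in>Poly_Mapping.keys c. chain_scale (Poly_Mapping.lookup c x) (F x))"

definition push :: "('x \<Rightarrow> 'y) \<Rightarrow> ('x \<Rightarrow>\<^sub>0 rat) \<Rightarrow> ('y \<Rightarrow>\<^sub>0 rat)" where
  "push \<phi> = lin (\<lambda>x. cell (\<phi> x))"

lemma chain_scale_one [simp]: "chain_scale 1 c = c"
  by (rule poly_mapping_eqI) simp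

lemma chain_scale_zero_left [simp]: "chain_scale 0 c = 0"
  by (rule poly_mapping_eqI) simp

lemma chain_scale_zero_right [simp]: "chain_scale a 0 = 0"
  by (rule chain_scale_zero)

lemma chain_scale_add_right: "chain_scale a (c + d) = chain_scale a c + chain_scale a d"
  by (rule poly_mapping_eqI) (simp add: lookup_add algebra_simps)

lemma chain_scale_diff_right: "chain_scale a (c - d) = chain_scale a c - chain_scale a d"
  by (rule poly_mapping_eqI) (simp add: lookup_minus algebra_simps)

lemma chain_scale_minus_one: "chain_scale (-1) c = - c"
  by (rule poly_mapping_eqI) simp

lemma chain_scale_minus_right: "chain_scale a (- c) = - chain_scale a c"
  by (rule poly_mapping_eqI) simp

lemma single_scale: "Poly_Mapping.single x a = chain_scale a (cell x)"
  by (simp add: chain_scale_single)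

lemma lin_map_add: "lin_map f \<Longrightarrow> f (a + b) = f a + f b"
  and lin_map_scale: "lin_map f \<Longrightarrow> f (chain_scale r a) = chain_scale r (f a)"
  by (simp_all add: lin_map_def)

lemma lin_map_0: "lin_map f \<Longrightarrow> f 0 = 0"
  using lin_map_scale[of f 0 0] by simp

lemma lin_map_uminus: "lin_map f \<Longrightarrow> f (- a) = - f a"
  using lin_map_scale[of f "-1" a] by (simp add: chain_scale_minus_one)

lemma lin_map_diff: "lin_map f \<Longrightarrow> f (a - b) = f a - f b"
  using lin_map_add[of f a "- b"] lin_map_uminus[of f b] by simp

lemma lin_map_sum: "lin_map f \<Longrightarrow> f (sum g A) = (\<Sum>x\<in>A. f (g x))"
  by (induction A rule: infinite_finite_induct) (auto simp: lin_map_0 lin_map_add)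

lemma lin_map_single: "lin_map f \<Longrightarrow> f (Poly_Mapping.single x a) = chain_scale a (f (cell x))"
  by (metis single_scale lin_map_scale)

lemma lin_superset:
  assumes "finite S" "Poly_Mapping.keys c \<subseteq> S"
  shows "lin F c = (\<Sum>x\<in>S. chain_scale (Poly_Mapping.lookup c x) (F x))"
  unfolding lin_def using assms
  by (intro sum.mono_neutral_left) (auto simp: in_keys_iff intro!: poly_mapping_eqI)

lemma lin_map_lin [simp, intro]: "lin_map (lin F)"
  unfolding lin_map_def
proof (intro conjI allI)
  fix a b :: "'a \<Rightarrow>\<^sub>0 rat" and r
  let ?S = "Poly_Mapping.keys a \<union> Poly_Mapping.keys b"
  have "finite ?S" "Poly_Mapping.keys (a + b) \<subseteq> ?S" by (simp_all add: keys_add)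
  then show "lin F (a + b) = lin F a + lin F b"
    by (simp add: lin_superset[of ?S] lookup_add chain_scale_add_left sum.distrib)
  show "lin F (chain_scale r a) = chain_scale r (lin F a)"
    using lin_superset[OF finite_keys keys_chain_scale, of F r a]
    by (simp add: lin_def[of F a] chain_scale_sum chain_scale_scale)
qed

lemma lin_cell [simp]: "lin F (cell x) = F x"
  by (subst lin_superset[of "{x}"]) auto

lemma lin_single: "lin F (Poly_Mapping.single x a) = chain_scale a (F x)"
  by (simp add: lin_map_single)

lemma lin_map_push [simp, intro]: "lin_map (push \<phi>)"
  by (simp add: push_def)

lemma push_cell [simp]: "push \<phi> (cell x) = cell (\<phi> x)"
  by (simp add: push_def)

lemma push_single: "push \<phi> (Poly_Mapping.single x a) = Poly_Mapping.single (\<phi> x) a"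
  by (simp add: push_def lin_single chain_scale_single)

lemmas lins = lin_map_lin[THEN lin_map_add] lin_map_lin[THEN lin_map_diff] lin_map_lin[THEN lin_map_0]
  lin_map_lin[THEN lin_map_uminus] lin_map_lin[THEN lin_map_scale] lin_map_lin[THEN lin_map_sum]
lemmas pushs = lin_map_push[THEN lin_map_add] lin_map_push[THEN lin_map_diff] lin_map_push[THEN lin_map_0]
  lin_map_push[THEN lin_map_uminus] lin_map_push[THEN lin_map_scale] lin_map_push[THEN lin_map_sum]

lemma chain_expand: "c = (\<Sum>x\<in>Poly_Mapping.keys c. chain_scale (Poly_Mapping.lookup c x) (cell x))"
proof (rule poly_mapping_eqI)
  fix y
  show "Poly_Mapping.lookup c y = Poly_Mapping.lookup
    (\<Sum>x\<in>Poly_Mapping.keys c. chain_scale (Poly_Mapping.lookup c x) (cell x)) y"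
    by (simp add: lookup_sum lookup_single when_def sum.delta in_keys_iff if_distrib cong: if_cong)
qed

text \<open>Chain identities are reduced to single cells through this rule. Agreement is asked only
  on the cells in \<open>X\<close>, because most identities are stated in one degree at a
  time.\<close>

lemma lin_map_eqI:
  assumes "lin_map f" "lin_map g" "\<And>x. x \<in> X \<Longrightarrow> f (cell x) = g (cell x)" "c \<in> chains_on X"
  shows "f c = g c"
proof -
  have "f c = (\<Sum>x\<in>Poly_Mapping.keys c. chain_scale (Poly_Mapping.lookup c x) (f (cell x)))"
    by (subst chain_expand[of c]) (simp add: lin_map_sum lin_map_scale assms)
  also have "\<dots> = (\<Sum>x\<in>Poly_Mapping.keys c. chain_scale (Poly_Mapping.lookup c x) (g (cell x)))"
    using assms(3,4) by (intro sum.cong) (auto simp: chains_on_def)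
  also have "\<dots> = g c"
    by (subst (3) chain_expand[of c]) (simp add: lin_map_sum lin_map_scale assms)
  finally show ?thesis .
qed

lemma lin_map_id [intro!]: "lin_map (\<lambda>c. c)"
  and lin_map_zero [intro!]: "lin_map (\<lambda>c. 0)"
  by (simp_all add: lin_map_def)

lemma lin_map_comp: "lin_map f \<Longrightarrow> lin_map g \<Longrightarrow> lin_map (\<lambda>c. f (g c))"
  by (simp add: lin_map_def)

lemma lin_map_plus: "lin_map f \<Longrightarrow> lin_map g \<Longrightarrow> lin_map (\<lambda>c. f c + g c)"
  by (simp add: lin_map_def chain_scale_add_right)

lemma lin_map_minus: "lin_map f \<Longrightarrow> lin_map g \<Longrightarrow> lin_map (\<lambda>c. f c - g c)"
  by (simp add: lin_map_def chain_scale_diff_right)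

lemmas lin_simps = lin_map_def lins pushs chain_scale_add_right chain_scale_diff_right

lemma chains_0 [simp]: "0 \<in> chains_on X"
  and chains_cell [simp]: "cell x \<in> chains_on X \<longleftrightarrow> x \<in> X"
  and chains_single: "x \<in> X \<Longrightarrow> Poly_Mapping.single x a \<in> chains_on X"
  by (auto simp: chains_on_def)

lemma chains_add: "a \<in> chains_on X \<Longrightarrow> b \<in> chains_on X \<Longrightarrow> a + b \<in> chains_on X"
  using keys_add[of a b] by (auto simp: chains_on_def)

lemma chains_uminus: "a \<in> chains_on X \<Longrightarrow> - a \<in> chains_on X"
  by (auto simp: chains_on_def in_keys_iff)

lemma chains_diff: "a \<in> chains_on X \<Longrightarrow> b \<in> chains_on X \<Longrightarrow> a - b \<in> chains_on X"
  using chains_add[of a X "- b"] chains_uminus[of b] by simp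

lemma chains_scale: "a \<in> chains_on X \<Longrightarrow> chain_scale r a \<in> chains_on X"
  using keys_chain_scale[of r a] by (auto simp: chains_on_def)

lemma chains_sum: "(\<And>i. i \<in> I \<Longrightarrow> F i \<in> chains_on X) \<Longrightarrow> sum F I \<in> chains_on X"
  by (induction I rule: infinite_finite_induct) (auto intro: chains_add)

lemma chains_mono: "X \<subseteq> Y \<Longrightarrow> c \<in> chains_on X \<Longrightarrow> c \<in> chains_on Y"
  by (auto simp: chains_on_def)

lemmas chains_intros = chains_0 chains_add chains_diff chains_uminus chains_scale chains_sum chains_single

lemma lin_map_mem:
  assumes "lin_map f" "\<And>x. x \<in> X \<Longrightarrow> f (cell x) \<in> chains_on Y" "c \<in> chains_on X"
  shows "f c \<in> chains_on Y"
proof -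
  have "f c = (\<Sum>x\<in>Poly_Mapping.keys c. chain_scale (Poly_Mapping.lookup c x) (f (cell x)))"
    by (subst chain_expand[of c]) (simp add: lin_map_sum lin_map_scale assms)
  also have "\<dots> \<in> chains_on Y"
    using assms(2,3) by (intro chains_sum chains_scale) (auto simp: chains_on_def)
  finally show ?thesis .
qed

lemma push_mem: "(\<And>x. x \<in> X \<Longrightarrow> \<phi> x \<in> Y) \<Longrightarrow> c \<in> chains_on X \<Longrightarrow> push \<phi> c \<in> chains_on Y"
  by (rule lin_map_mem[OF lin_map_push]) auto

lemma push_push: "push \<phi> (push \<psi> c) = push (\<lambda>x. \<phi> (\<psi> x)) c"
  by (rule lin_map_eqI[of _ _ UNIV]) (auto simp: lin_simps chains_on_def)

lemma push_cong: "(\<And>x. x \<in> X \<Longrightarrow> \<phi> x = \<psi> x) \<Longrightarrow> c \<in> chains_on X \<Longrightarrow> push \<phi> c = push \<psi> c"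
  by (rule lin_map_eqI[of _ _ X]) auto

lemma push_id: "(\<And>x. x \<in> X \<Longrightarrow> \<phi> x = x) \<Longrightarrow> c \<in> chains_on X \<Longrightarrow> push \<phi> c = c"
  by (rule lin_map_eqI[of _ _ X]) auto

text \<open>The augmentation takes values in chains on one point rather than in \<open>rat\<close>,
  so that it is a \<open>push\<close> and shares all rules for pushed chains.\<close>

abbreviation aug :: "('x \<Rightarrow>\<^sub>0 rat) \<Rightarrow> (unit \<Rightarrow>\<^sub>0 rat)" where
  "aug \<equiv> push (\<lambda>_. ())"

section \<open>Chain homotopy equivalence\<close>

text \<open>One linear map serves all degrees at once; the degree sits in the cells, and the
  condition concerns only the cells in some \<open>X k\<close>.\<close>

definition graded_map :: "(nat \<Rightarrow> 'x set) \<Rightarrow> (nat \<Rightarrow> 'y set) \<Rightarrow> (('x \<Rightarrow>\<^sub>0 rat) \<Rightarrow> ('y \<Rightarrow>\<^sub>0 rat)) \<Rightarrow> bool" where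
  "graded_map X Y f \<longleftrightarrow> lin_map f \<and> (\<forall>k. \<forall>x\<in>X k. f (cell x) \<in> chains_on (Y k))"

abbreviation shift :: "(nat \<Rightarrow> 'x set) \<Rightarrow> nat \<Rightarrow> 'x set" where
  "shift X \<equiv> \<lambda>k. X (Suc k)"

lemma graded_map_mem: "graded_map X Y f \<Longrightarrow> c \<in> chains_on (X k) \<Longrightarrow> f c \<in> chains_on (Y k)"
  unfolding graded_map_def by (blast intro: lin_map_mem)

lemma graded_map_lin: "graded_map X Y f \<Longrightarrow> lin_map f"
  by (simp add: graded_map_def)

lemma graded_mapI: "lin_map f \<Longrightarrow> (\<And>k x. x \<in> X k \<Longrightarrow> f (cell x) \<in> chains_on (Y k)) \<Longrightarrow> graded_map X Y f"
  by (simp add: graded_map_def)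

lemma graded_map_comp:
  "graded_map Y Z g \<Longrightarrow> graded_map X Y f \<Longrightarrow> graded_map X Z (\<lambda>c. g (f c))"
  unfolding graded_map_def by (auto simp: lin_map_def) (metis graded_map_def graded_map_mem lin_map_def)

lemma graded_map_plus:
  "graded_map X Y g \<Longrightarrow> graded_map X Y f \<Longrightarrow> graded_map X Y (\<lambda>c. g c + f c)"
  unfolding graded_map_def by (auto intro: lin_map_plus chains_add)

lemma graded_map_shift: "graded_map X Y f \<Longrightarrow> graded_map (shift X) (shift Y) f"
  by (simp add: graded_map_def)

text \<open>The identities are imposed only on chains supported in one degree. With
  \<open>e = (\<lambda>_. 0)\<close> the cells in \<open>Y k\<close> index a basis of the homology
  in degree \<open>k\<close>, which is how the relation is finally used.\<close>

definition chain_equiv ::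
  "(nat \<Rightarrow> 'x set) \<Rightarrow> (('x \<Rightarrow>\<^sub>0 rat) \<Rightarrow> ('x \<Rightarrow>\<^sub>0 rat)) \<Rightarrow> (nat \<Rightarrow> 'y set) \<Rightarrow> (('y \<Rightarrow>\<^sub>0 rat) \<Rightarrow> ('y \<Rightarrow>\<^sub>0 rat)) \<Rightarrow> bool" where
  "chain_equiv X d Y e \<longleftrightarrow> (\<exists>f g h h'.
     graded_map X Y f \<and> graded_map Y X g \<and> graded_map X (shift X) h \<and> graded_map Y (shift Y) h' \<and>
     (\<forall>k. \<forall>c\<in>chains_on (X k). f (d c) = e (f c)) \<and> (\<forall>k. \<forall>c\<in>chains_on (Y k). g (e c) = d (g c)) \<and>
     (\<forall>k. \<forall>c\<in>chains_on (X k). g (f c) - c = d (h c) + h (d c)) \<and>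
     (\<forall>k. \<forall>c\<in>chains_on (Y k). f (g c) - c = e (h' c) + h' (e c)))"

text \<open>The homotopies compose as \<open>h + g r f\<close> and \<open>r' + p h' q\<close>, the
  homotopy of the middle complex being carried along the outer pair of maps.\<close>

lemma chain_equiv_trans:
  assumes d: "lin_map d" and b: "lin_map b" and XY: "chain_equiv X d Y e" and YZ: "chain_equiv Y e Z b"
  shows "chain_equiv X d Z b"
proof -
  obtain f g h h' where f: "graded_map X Y f" and g: "graded_map Y X g" and h: "graded_map X (shift X) h"
    and h': "graded_map Y (shift Y) h'"
    and fd: "\<And>k c. c \<in> chains_on (X k) \<Longrightarrow> f (d c) = e (f c)"
    and gd: "\<And>k c. c \<in> chains_on (Y k) \<Longrightarrow> g (e c) = d (g c)"
    and gf: "\<And>k c. c \<in> chains_on (X k) \<Longrightarrow> g (f c) - c = d (h c) + h (d c)"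
    and fg: "\<And>k c. c \<in> chains_on (Y k) \<Longrightarrow> f (g c) - c = e (h' c) + h' (e c)"
    using XY unfolding chain_equiv_def by blast
  obtain p q r r' where p: "graded_map Y Z p" and q: "graded_map Z Y q" and r: "graded_map Y (shift Y) r"
    and r': "graded_map Z (shift Z) r'"
    and pd: "\<And>k c. c \<in> chains_on (Y k) \<Longrightarrow> p (e c) = b (p c)"
    and qd: "\<And>k c. c \<in> chains_on (Z k) \<Longrightarrow> q (b c) = e (q c)"
    and qp: "\<And>k c. c \<in> chains_on (Y k) \<Longrightarrow> q (p c) - c = e (r c) + r (e c)"
    and pq: "\<And>k c. c \<in> chains_on (Z k) \<Longrightarrow> p (q c) - c = b (r' c) + r' (b c)"
    using YZ unfolding chain_equiv_def by blast
  have 1: "g (q (p (f c))) - c = d (h c + g (r (f c))) + (h (d c) + g (r (f (d c))))"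
    if c: "c \<in> chains_on (X k)" for k c
  proof -
    have fc: "f c \<in> chains_on (Y k)" by (rule graded_map_mem[OF f c])
    have rc: "r (f c) \<in> chains_on (Y (Suc k))" using graded_map_mem[OF r fc] by simp
    have "q (p (f c)) = f c + (e (r (f c)) + r (e (f c)))" using qp[OF fc] by (simp add: algebra_simps)
    then have "g (q (p (f c))) = g (f c) + (g (e (r (f c))) + g (r (f (d c))))"
      using graded_map_lin[OF g] by (simp add: lin_map_add fd[OF c])
    then show ?thesis
      using gf[OF c] gd[OF rc] d by (simp add: lin_map_add algebra_simps)
  qed
  have 2: "p (f (g (q c))) - c = b (r' c + p (h' (q c))) + (r' (b c) + p (h' (q (b c))))"
    if c: "c \<in> chains_on (Z k)" for k c
  proof -
    have qc: "q c \<in> chains_on (Y k)" by (rule graded_map_mem[OF q c])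
    have rc: "h' (q c) \<in> chains_on (Y (Suc k))" using graded_map_mem[OF h' qc] by simp
    have "f (g (q c)) = q c + (e (h' (q c)) + h' (e (q c)))" using fg[OF qc] by (simp add: algebra_simps)
    then have "p (f (g (q c))) = p (q c) + (p (e (h' (q c))) + p (h' (q (b c))))"
      using graded_map_lin[OF p] by (simp add: lin_map_add qd[OF c])
    then show ?thesis
      using pq[OF c] pd[OF rc] b by (simp add: lin_map_add algebra_simps)
  qed
  show ?thesis
    unfolding chain_equiv_def
  proof (intro exI conjI allI ballI)
    show "graded_map X Z (\<lambda>c. p (f c))" by (rule graded_map_comp[OF p f])
    show "graded_map Z X (\<lambda>c. g (q c))" by (rule graded_map_comp[OF g q])
    show "graded_map X (shift X) (\<lambda>c. h c + g (r (f c)))"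
      by (intro graded_map_plus h graded_map_comp[OF graded_map_shift[OF g]] graded_map_comp[OF r] f)
    show "graded_map Z (shift Z) (\<lambda>c. r' c + p (h' (q c)))"
      by (intro graded_map_plus r' graded_map_comp[OF graded_map_shift[OF p]] graded_map_comp[OF h'] q)
    fix k c assume c: "c \<in> chains_on (X k)"
    show "p (f (d c)) = b (p (f c))" using fd[OF c] pd[OF graded_map_mem[OF f c]] by simp
    show "g (q (p (f c))) - c = d (h c + g (r (f c))) + (h (d c) + g (r (f (d c))))" by (rule 1[OF c])
  next
    fix k c assume c: "c \<in> chains_on (Z k)"
    show "g (q (b c)) = d (g (q c))" using qd[OF c] gd[OF graded_map_mem[OF q c]] by simp
    show "p (f (g (q c))) - c = b (r' c + p (h' (q c))) + (r' (b c) + p (h' (q (b c))))" by (rule 2[OF c])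
  qed
qed

section \<open>Comparison of free resolutions\<close>

text \<open>A free resolution given by cells: \<open>simply_trans\<close> is freeness, with one
  chosen cell \<open>rep r\<close> per orbit. The contraction \<open>s\<close> is linear but not
  equivariant, so constructions with it are made on representatives. \<open>deg\<close> reads the
  degree off a cell, which lets maps defined by recursion on the degree be glued.\<close>

locale free_resolution = group G for G :: "('g, 'm) monoid_scheme" (structure) +
  fixes act :: "'g \<Rightarrow> 'x \<Rightarrow> 'x" and X :: "nat \<Rightarrow> 'x set" and deg :: "'x \<Rightarrow> nat"
    and orb :: "'x \<Rightarrow> 'o" and rep :: "'o \<Rightarrow> 'x"
    and d s :: "('x \<Rightarrow>\<^sub>0 rat) \<Rightarrow> ('x \<Rightarrow>\<^sub>0 rat)" and x0 :: 'x
  assumes act_closed: "\<And>g x k. g \<in> carrier G \<Longrightarrow> x \<in> X k \<Longrightarrow> act g x \<in> X k"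
    and act_mult: "\<And>g h x k. g \<in> carrier G \<Longrightarrow> h \<in> carrier G \<Longrightarrow> x \<in> X k \<Longrightarrow> act (g \<otimes> h) x = act g (act h x)"
    and orb_act: "\<And>g x k. g \<in> carrier G \<Longrightarrow> x \<in> X k \<Longrightarrow> orb (act g x) = orb x"
    and rep_orb: "\<And>x k. x \<in> X k \<Longrightarrow> rep (orb x) \<in> X k"
    and simply_trans: "\<And>x k. x \<in> X k \<Longrightarrow> \<exists>!g. g \<in> carrier G \<and> x = act g (rep (orb x))"
    and deg: "\<And>x k. x \<in> X k \<Longrightarrow> deg x = k"
    and d_lin: "lin_map d"
    and d_mem: "\<And>x k. x \<in> X (Suc k) \<Longrightarrow> d (cell x) \<in> chains_on (X k)"
    and d_0: "\<And>x. x \<in> X 0 \<Longrightarrow> d (cell x) = 0"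
    and d_act: "\<And>g x k. g \<in> carrier G \<Longrightarrow> x \<in> X k \<Longrightarrow> d (cell (act g x)) = push (act g) (d (cell x))"
    and d_d: "\<And>x k. x \<in> X k \<Longrightarrow> d (d (cell x)) = 0"
    and aug_d: "\<And>x. x \<in> X (Suc 0) \<Longrightarrow> aug (d (cell x)) = 0"
    and s: "graded_map X (shift X) s"
    and d_s: "\<And>x k. x \<in> X (Suc k) \<Longrightarrow> d (s (cell x)) + s (d (cell x)) = cell x"
    and d_s_0: "\<And>x. x \<in> X 0 \<Longrightarrow> d (s (cell x)) = cell x - cell x0"
    and x0: "x0 \<in> X 0"
begin

definition "coef x = (THE g. g \<in> carrier G \<and> x = act g (rep (orb x)))"

lemma coef: "x \<in> X k \<Longrightarrow> coef x \<in> carrier G \<and> x = act (coef x) (rep (orb x))"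
  unfolding coef_def by (rule theI') (rule simply_trans)

lemma coef_act:
  assumes "g \<in> carrier G" "x \<in> X k"
  shows "coef (act g x) = g \<otimes> coef x"
proof -
  have "\<exists>!h. h \<in> carrier G \<and> act g x = act h (rep (orb (act g x)))"
    by (rule simply_trans) (rule act_closed[OF assms])
  moreover have "act g x = act (g \<otimes> coef x) (rep (orb (act g x)))"
    using coef[OF assms(2)] assms by (simp add: act_mult[OF _ _ rep_orb] orb_act[OF assms])
  ultimately show ?thesis
    using coef[OF act_closed[OF assms]] coef[OF assms(2)] assms by blast
qed

lemma d_chain: "c \<in> chains_on (X (Suc k)) \<Longrightarrow> d c \<in> chains_on (X k)"
  by (rule lin_map_mem[OF d_lin d_mem])

lemma d_chain_0: "c \<in> chains_on (X 0) \<Longrightarrow> d c = 0"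
  by (rule lin_map_eqI[OF d_lin lin_map_zero]) (auto simp: d_0)

lemma d_d_chain: "c \<in> chains_on (X k) \<Longrightarrow> d (d c) = 0"
  by (rule lin_map_eqI[OF lin_map_comp[OF d_lin d_lin] lin_map_zero]) (auto simp: d_d)

lemma s_lin: "lin_map s"
  by (rule graded_map_lin[OF s])

lemma s_chain: "c \<in> chains_on (X k) \<Longrightarrow> s c \<in> chains_on (X (Suc k))"
  using graded_map_mem[OF s] by simp

lemma d_s_chain: "c \<in> chains_on (X (Suc k)) \<Longrightarrow> d (s c) + s (d c) = c"
  by (rule lin_map_eqI[of "\<lambda>c. d (s c) + s (d c)" "\<lambda>c. c"])
    (use d_lin s_lin in \<open>auto simp: lin_simps algebra_simps d_s\<close>)

lemma d_s_chain_0: "c \<in> chains_on (X 0) \<Longrightarrow> aug c = 0 \<Longrightarrow> d (s c) = c"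
proof -
  assume c: "c \<in> chains_on (X 0)" "aug c = 0"
  have "d (s c) = c - push (\<lambda>_. x0) (aug c)"
    by (rule lin_map_eqI[OF _ _ _ c(1)])
      (use d_lin s_lin in \<open>auto simp: lin_simps algebra_simps d_s_0\<close>)
  then show ?thesis using c(2) by (simp add: pushs)
qed

lemma d_act_chain: "g \<in> carrier G \<Longrightarrow> c \<in> chains_on (X k) \<Longrightarrow> d (push (act g) c) = push (act g) (d c)"
  by (rule lin_map_eqI[of _ _ "X k"]) (use d_lin in \<open>auto simp: lin_simps d_act\<close>)

lemma act_chain: "g \<in> carrier G \<Longrightarrow> c \<in> chains_on (X k) \<Longrightarrow> push (act g) c \<in> chains_on (X k)"
  by (rule push_mem) (rule act_closed)

lemma push_orb_act: "g \<in> carrier G \<Longrightarrow> c \<in> chains_on (X k) \<Longrightarrow> push orb (push (act g) c) = push orb c"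
  by (simp add: push_push) (rule push_cong[of "X k"], auto simp: orb_act)

lemma push_act_mult: "g \<in> carrier G \<Longrightarrow> h \<in> carrier G \<Longrightarrow> c \<in> chains_on (X k) \<Longrightarrow>
    push (act g) (push (act h) c) = push (act (g \<otimes> h)) c"
  by (simp add: push_push) (rule push_cong[of "X k"], auto simp: act_mult)

definition orbits :: "nat \<Rightarrow> 'o set" where
  "orbits k = orb ` X k"

definition d_orb :: "('o \<Rightarrow>\<^sub>0 rat) \<Rightarrow> ('o \<Rightarrow>\<^sub>0 rat)" where
  "d_orb = lin (\<lambda>r. push orb (d (cell (rep r))))"

end

locale two_resolutions = R: free_resolution G act X deg orb rep d s x0 +
    Q: free_resolution G act' Y deg' orb' rep' e t y0
  for G :: "('g, 'm) monoid_scheme" (structure)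
    and act :: "'g \<Rightarrow> 'x \<Rightarrow> 'x" and X deg and orb :: "'x \<Rightarrow> 'o" and rep d s x0
    and act' :: "'g \<Rightarrow> 'y \<Rightarrow> 'y" and Y deg' and orb' :: "'y \<Rightarrow> 'q" and rep' e t y0
begin

definition equivariant :: "(('x \<Rightarrow>\<^sub>0 rat) \<Rightarrow> ('y \<Rightarrow>\<^sub>0 rat)) \<Rightarrow> bool" where
  "equivariant f \<longleftrightarrow> (\<forall>k. \<forall>x\<in>X k. \<forall>g\<in>carrier G. f (cell (act g x)) = push (act' g) (f (cell x)))"

definition aug_chain_map :: "(('x \<Rightarrow>\<^sub>0 rat) \<Rightarrow> ('y \<Rightarrow>\<^sub>0 rat)) \<Rightarrow> bool" where
  "aug_chain_map f \<longleftrightarrow> graded_map X Y f \<and> equivariant f \<and> (\<forall>k. \<forall>x\<in>X k. f (d (cell x)) = e (f (cell x)))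
     \<and> (\<forall>x\<in>X 0. aug (f (cell x)) = cell ())"

text \<open>The comparison map: the contraction \<open>t\<close> of the target is applied to the
  already lifted boundary of the representative, and \<open>coef\<close> spreads the value over the
  orbit. Applying \<open>t\<close> at every cell would lose equivariance.\<close>

primrec lift :: "nat \<Rightarrow> 'x \<Rightarrow> ('y \<Rightarrow>\<^sub>0 rat)" where
  "lift 0 x = push (act' (R.coef x)) (cell y0)"
| "lift (Suc k) x = push (act' (R.coef x)) (t (lin (lift k) (d (cell (rep (orb x))))))"

definition "lifted = lin (\<lambda>x. lift (deg x) x)"

lemma lifted_eq: "c \<in> chains_on (X k) \<Longrightarrow> lifted c = lin (lift k) c"
  unfolding lifted_def by (rule lin_map_eqI[of _ _ "X k"]) (auto simp: R.deg)

lemma lift_mem: "x \<in> X k \<Longrightarrow> lift k x \<in> chains_on (Y k)"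
proof (induction k arbitrary: x)
  case 0
  then show ?case using R.coef[OF 0] Q.x0 Q.act_closed by simp
next
  case (Suc k)
  have "lin (lift k) (d (cell (rep (orb x)))) \<in> chains_on (Y k)"
    by (rule lin_map_mem[OF lin_map_lin _ R.d_mem[OF R.rep_orb[OF Suc.prems]]]) (simp add: Suc.IH)
  then show ?case using R.coef[OF Suc.prems] by (simp add: Q.act_chain Q.s_chain)
qed

lemma lift_act: "x \<in> X k \<Longrightarrow> g \<in> carrier G \<Longrightarrow> lift k (act g x) = push (act' g) (lift k x)"
proof (cases k)
  case 0
  assume x: "x \<in> X k" "g \<in> carrier G"
  then show ?thesis
    using 0 R.coef[of x] Q.push_act_mult[of g "R.coef x" "cell y0" 0] Q.x0 R.coef_act[of g x]
    by auto
next
  case (Suc j)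
  assume x: "x \<in> X k" "g \<in> carrier G"
  have r: "rep (orb x) \<in> X (Suc j)" using R.rep_orb[OF x(1)] Suc by simp
  have "lin (lift j) (d (cell (rep (orb x)))) \<in> chains_on (Y j)"
    by (rule lin_map_mem[OF lin_map_lin _ R.d_mem[OF r]]) (simp add: lift_mem)
  then show ?thesis
    using x Suc R.coef[of x] Q.push_act_mult[of g "R.coef x" _ "Suc j"] R.coef_act[of g x]
    by (auto simp: Q.s_chain R.orb_act)
qed

lemma lift_aug: "x \<in> X 0 \<Longrightarrow> aug (lift 0 x) = cell ()"
  by simp

lemma lifted_act_chain:
  "c \<in> chains_on (X k) \<Longrightarrow> g \<in> carrier G \<Longrightarrow> lin (lift k) (push (act g) c) = push (act' g) (lin (lift k) c)"
  by (rule lin_map_eqI[of _ _ "X k"]) (auto simp: lift_act lin_simps)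

text \<open>On a representative the lifted boundary \<open>?u\<close> is a cycle, so
  \<open>e (t ?u) = ?u\<close>. In degree one the condition is \<open>aug ?u = 0\<close> instead,
  hence the separate base case.\<close>

lemma lift_d: "x \<in> X (Suc k) \<Longrightarrow> e (lift (Suc k) x) = lin (lift k) (d (cell x))"
proof (induction k arbitrary: x)
  case 0
  let ?r = "rep (orb x)"
  let ?u = "lin (lift 0) (d (cell ?r))"
  have r: "?r \<in> X (Suc 0)" by (rule R.rep_orb[OF 0])
  note dr = R.d_mem[OF r]
  have u: "?u \<in> chains_on (Y 0)"
    by (rule lin_map_mem[OF _ _ dr]) (auto intro: lift_mem simp del: lift.simps)
  have "aug ?u = aug (d (cell ?r))"
    by (rule lin_map_eqI[OF _ _ _ dr]) (auto simp: lift_aug lin_simps simp del: lift.simps)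
  then have "aug ?u = 0" by (simp add: R.aug_d r)
  then have "e (t ?u) = ?u" by (rule Q.d_s_chain_0[OF u])
  then have "e (lift (Suc 0) x) = push (act' (R.coef x)) ?u"
    using R.coef[OF 0] Q.d_act_chain[of "R.coef x" "t ?u" "Suc 0"] u by (simp add: Q.s_chain)
  also have "\<dots> = lin (lift 0) (push (act (R.coef x)) (d (cell ?r)))"
    using R.coef[OF 0] by (simp add: lifted_act_chain[OF dr])
  also have "\<dots> = lin (lift 0) (d (cell x))"
    using R.coef[OF 0] R.d_act[OF _ r, of "R.coef x"] by simp
  finally show ?case .
next
  case (Suc k)
  let ?r = "rep (orb x)"
  let ?u = "lin (lift (Suc k)) (d (cell ?r))"
  have r: "?r \<in> X (Suc (Suc k))" by (rule R.rep_orb[OF Suc.prems])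
  note dr = R.d_mem[OF r]
  have u: "?u \<in> chains_on (Y (Suc k))"
    by (rule lin_map_mem[OF _ _ dr]) (auto intro: lift_mem simp del: lift.simps)
  have "e ?u = lin (lift k) (d (d (cell ?r)))"
    by (rule lin_map_eqI[OF _ _ _ dr])
      (use Q.d_lin R.d_lin in \<open>auto simp: Suc.IH lin_simps simp del: lift.simps\<close>)
  then have "e ?u = 0" by (simp add: R.d_d[OF r] lins)
  then have "e (t ?u) = ?u" using Q.d_s_chain[OF u] by (simp add: lin_map_0[OF Q.s_lin])
  then have "e (lift (Suc (Suc k)) x) = push (act' (R.coef x)) ?u"
    using R.coef[OF Suc.prems] Q.d_act_chain[of "R.coef x" "t ?u" "Suc (Suc k)"] u
    by (simp add: Q.s_chain del: lift.simps(2)) (simp)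
  also have "\<dots> = lin (lift (Suc k)) (push (act (R.coef x)) (d (cell ?r)))"
    using R.coef[OF Suc.prems] by (simp add: lifted_act_chain[OF dr] del: lift.simps)
  also have "\<dots> = lin (lift (Suc k)) (d (cell x))"
    using R.coef[OF Suc.prems] R.d_act[OF _ r, of "R.coef x"] by simp
  finally show ?case .
qed

lemma aug_chain_map_lifted: "aug_chain_map lifted"
  unfolding aug_chain_map_def
proof (intro conjI allI ballI)
  show "graded_map X Y lifted"
    by (rule graded_mapI) (auto simp: lifted_def R.deg lift_mem)
  show "equivariant lifted"
    unfolding equivariant_def lifted_def
    using R.deg R.act_closed lift_act by (auto simp del: lift.simps) (metis lift_act)
  fix k x assume x: "x \<in> X k"
  show "lifted (d (cell x)) = e (lifted (cell x))"
  proof (cases k)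
    case 0
    then show ?thesis
      using x lift_mem[of x 0] by (auto simp: R.d_0 lifted_def lins R.deg Q.d_chain_0 simp del: lift.simps)
  next
    case (Suc j)
    then show ?thesis
      using x lifted_eq[of "d (cell x)" j] by (auto simp: R.d_mem lifted_def R.deg lift_d simp del: lift.simps)
  qed
next
  fix x assume "x \<in> X 0"
  then show "aug (lifted (cell x)) = cell ()" by (simp add: lifted_def R.deg)
qed

context
  fixes f g
  assumes f: "aug_chain_map f" and g: "aug_chain_map g"
begin

definition "\<delta> c = f c - g c"

text \<open>The homotopy between two lifts: on a representative, the defect \<delta> minus the
  homotopy already built on the boundary is a cycle, and \<open>t\<close> fills it.\<close>

primrec htp :: "nat \<Rightarrow> 'x \<Rightarrow> ('y \<Rightarrow>\<^sub>0 rat)" where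
  "htp 0 x = push (act' (R.coef x)) (t (\<delta> (cell (rep (orb x)))))"
| "htp (Suc k) x = push (act' (R.coef x)) (t (\<delta> (cell (rep (orb x))) - lin (htp k) (d (cell (rep (orb x))))))"

lemma \<delta>_lin: "lin_map \<delta>"
  using f g unfolding \<delta>_def[abs_def] aug_chain_map_def graded_map_def by (auto intro: lin_map_minus)

lemma \<delta>_mem: "c \<in> chains_on (X k) \<Longrightarrow> \<delta> c \<in> chains_on (Y k)"
  using f g unfolding \<delta>_def aug_chain_map_def by (intro chains_diff) (auto intro: graded_map_mem)

lemma \<delta>_act: "x \<in> X k \<Longrightarrow> h \<in> carrier G \<Longrightarrow> \<delta> (cell (act h x)) = push (act' h) (\<delta> (cell x))"
  using f g unfolding \<delta>_def aug_chain_map_def equivariant_def by (auto simp: pushs)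

lemma \<delta>_d: "c \<in> chains_on (X k) \<Longrightarrow> e (\<delta> c) = \<delta> (d c)"
  by (rule lin_map_eqI[of _ _ "X k"])
    (use f g Q.d_lin R.d_lin in \<open>auto simp: \<delta>_def aug_chain_map_def graded_map_def lin_map_diff[OF Q.d_lin] lin_simps algebra_simps\<close>)

lemma \<delta>_aug: "x \<in> X 0 \<Longrightarrow> aug (\<delta> (cell x)) = 0"
  using f g unfolding \<delta>_def aug_chain_map_def by (simp add: pushs)

lemma htp_mem: "x \<in> X k \<Longrightarrow> htp k x \<in> chains_on (Y (Suc k))"
proof (induction k arbitrary: x)
  case 0
  then show ?case using R.coef[OF 0] R.rep_orb[OF 0] by (simp add: Q.act_chain Q.s_chain \<delta>_mem)
next
  case (Suc k)
  note r = R.rep_orb[OF Suc.prems]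
  have "lin (htp k) (d (cell (rep (orb x)))) \<in> chains_on (Y (Suc k))"
    by (rule lin_map_mem[OF _ _ R.d_mem[OF r]]) (auto simp: Suc.IH)
  then show ?case using R.coef[OF Suc.prems] r by (simp add: Q.act_chain Q.s_chain \<delta>_mem chains_diff)
qed

lemma htp_act: "x \<in> X k \<Longrightarrow> h \<in> carrier G \<Longrightarrow> htp k (act h x) = push (act' h) (htp k x)"
proof (cases k)
  case 0
  assume x: "x \<in> X k" "h \<in> carrier G"
  then show ?thesis
    using 0 R.coef[of x] Q.push_act_mult[of h "R.coef x" _ "Suc 0"] R.rep_orb[of x] R.coef_act[of h x]
    by (auto simp: Q.s_chain \<delta>_mem R.orb_act)
next
  case (Suc j)
  assume x: "x \<in> X k" "h \<in> carrier G"
  then have r: "rep (orb x) \<in> X (Suc j)" using R.rep_orb Suc by blast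
  have "lin (htp j) (d (cell (rep (orb x)))) \<in> chains_on (Y (Suc j))"
    by (rule lin_map_mem[OF _ _ R.d_mem[OF r]]) (auto simp: htp_mem)
  then show ?thesis
    using x Suc R.coef[of x] Q.push_act_mult[of h "R.coef x" _ "Suc (Suc j)"] r R.coef_act[of h x]
    by (auto simp: Q.s_chain \<delta>_mem R.orb_act chains_diff)
qed

lemma htp_act_chain:
  "c \<in> chains_on (X k) \<Longrightarrow> h \<in> carrier G \<Longrightarrow> lin (htp k) (push (act h) c) = push (act' h) (lin (htp k) c)"
  by (rule lin_map_eqI[of _ _ "X k"]) (auto simp: htp_act lin_simps)

lemma htp_0: "x \<in> X 0 \<Longrightarrow> e (htp 0 x) = \<delta> (cell x)"
proof -
  assume x: "x \<in> X 0"
  let ?r = "rep (orb x)"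
  have r: "?r \<in> X 0" by (rule R.rep_orb[OF x])
  have u: "\<delta> (cell ?r) \<in> chains_on (Y 0)" using r by (simp add: \<delta>_mem)
  have "e (t (\<delta> (cell ?r))) = \<delta> (cell ?r)"
    by (rule Q.d_s_chain_0[OF u \<delta>_aug[OF r]])
  then show ?thesis
    using R.coef[OF x] Q.d_act_chain[OF _ Q.s_chain[OF u], of "R.coef x"] \<delta>_act[OF r, of "R.coef x"]
    by simp
qed

lemma htp_Suc: "x \<in> X (Suc k) \<Longrightarrow> e (htp (Suc k) x) + lin (htp k) (d (cell x)) = \<delta> (cell x)"
proof -
  \<comment> \<open>All positive degrees share this argument; only the reason why the chain to be
    filled is a cycle differs between degree one and higher degrees.\<close>
  have step: "e (htp (Suc k) x) + lin (htp k) (d (cell x)) = \<delta> (cell x)"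
    if x: "x \<in> X (Suc k)" and z: "e (\<delta> (cell (rep (orb x))) - lin (htp k) (d (cell (rep (orb x))))) = 0" for k x
  proof -
    let ?r = "rep (orb x)"
    let ?u = "\<delta> (cell ?r) - lin (htp k) (d (cell ?r))"
    have r: "?r \<in> X (Suc k)" by (rule R.rep_orb[OF x])
    note dr = R.d_mem[OF r]
    have u: "?u \<in> chains_on (Y (Suc k))"
      by (intro chains_diff \<delta>_mem lin_map_mem[OF lin_map_lin _ dr]) (auto simp: htp_mem r)
    have "e (t ?u) = ?u" using Q.d_s_chain[OF u] z by (simp add: lin_map_0[OF Q.s_lin])
    then have "e (htp (Suc k) x) = push (act' (R.coef x)) ?u"
      using R.coef[OF x] Q.d_act_chain[OF _ Q.s_chain[OF u], of "R.coef x"] by simp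
    also have "\<dots> = \<delta> (cell x) - lin (htp k) (push (act (R.coef x)) (d (cell ?r)))"
      using R.coef[OF x] \<delta>_act[OF r, of "R.coef x"] by (simp add: pushs htp_act_chain[OF dr])
    also have "push (act (R.coef x)) (d (cell ?r)) = d (cell x)"
      using R.coef[OF x] R.d_act[OF _ r, of "R.coef x"] by simp
    finally show ?thesis by simp
  qed
  show "x \<in> X (Suc k) \<Longrightarrow> e (htp (Suc k) x) + lin (htp k) (d (cell x)) = \<delta> (cell x)"
  proof (induction k arbitrary: x)
    case 0
    let ?r = "rep (orb x)"
    have r: "?r \<in> X (Suc 0)" by (rule R.rep_orb[OF 0])
    note dr = R.d_mem[OF r]
    have "e (lin (htp 0) (d (cell ?r))) = \<delta> (d (cell ?r))"
      by (rule lin_map_eqI[OF _ _ _ dr]) (use Q.d_lin \<delta>_lin in \<open>auto simp: htp_0 lin_simps simp del: htp.simps\<close>)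
    then show ?case
      by (intro step 0) (simp add: lin_map_diff[OF Q.d_lin] \<delta>_d[where k="Suc 0"] r del: htp.simps)
  next
    case (Suc k)
    let ?r = "rep (orb x)"
    have r: "?r \<in> X (Suc (Suc k))" by (rule R.rep_orb[OF Suc.prems])
    note dr = R.d_mem[OF r]
    have "e (lin (htp (Suc k)) (d (cell ?r))) + lin (htp k) (d (d (cell ?r))) = \<delta> (d (cell ?r))"
      by (rule lin_map_eqI[OF _ _ _ dr])
        (use Q.d_lin R.d_lin \<delta>_lin in \<open>auto simp: Suc.IH lin_simps algebra_simps simp del: htp.simps\<close>)
    then have "e (lin (htp (Suc k)) (d (cell ?r))) = \<delta> (d (cell ?r))"
      by (simp add: R.d_d[OF r] lins)
    then show ?case
      by (intro step Suc.prems) (simp add: lin_map_diff[OF Q.d_lin] \<delta>_d[where k="Suc (Suc k)"] r del: htp.simps)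
  qed
qed

lemma homotopic:
  "\<exists>h. graded_map X (shift Y) h \<and> equivariant h \<and> (\<forall>k. \<forall>x\<in>X k. f (cell x) - g (cell x) = e (h (cell x)) + h (d (cell x)))"
proof (intro exI conjI allI ballI)
  let ?h = "lin (\<lambda>x. htp (deg x) x)"
  show "graded_map X (shift Y) ?h"
    by (rule graded_mapI) (auto simp: R.deg htp_mem simp del: htp.simps)
  show "equivariant ?h"
    unfolding equivariant_def
    using R.deg R.act_closed htp_act by (auto simp del: htp.simps) (metis htp_act)
  fix k x assume x: "x \<in> X k"
  have eq: "?h c = lin (htp k) c" if "c \<in> chains_on (X k)" for c k
    by (rule lin_map_eqI[OF _ _ _ that]) (auto simp: R.deg)
  show "f (cell x) - g (cell x) = e (?h (cell x)) + ?h (d (cell x))"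
  proof (cases k)
    case 0
    then show ?thesis using htp_0[of x] x by (simp add: R.deg R.d_0 lins \<delta>_def del: htp.simps)
  next
    case (Suc j)
    then show ?thesis using htp_Suc[of x j] x by (simp add: R.deg eq[OF R.d_mem] \<delta>_def del: htp.simps)
  qed
qed

end

definition desc :: "(('x \<Rightarrow>\<^sub>0 rat) \<Rightarrow> ('y \<Rightarrow>\<^sub>0 rat)) \<Rightarrow> ('o \<Rightarrow>\<^sub>0 rat) \<Rightarrow> ('q \<Rightarrow>\<^sub>0 rat)" where
  "desc f = lin (\<lambda>r. push orb' (f (cell (rep r))))"

lemma lin_map_desc [simp, intro]: "lin_map (desc f)"
  by (simp add: desc_def)

text \<open>Equivariance makes the value on an orbit independent of the representative. The shift
  \<open>j\<close> is the identity for chain maps and \<open>Suc\<close> for homotopies.\<close>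

lemma desc_push:
  assumes f: "graded_map X (\<lambda>k. Y (j k)) f" "equivariant f" and c: "c \<in> chains_on (X k)"
  shows "desc f (push orb c) = push orb' (f c)"
proof (rule lin_map_eqI[OF _ _ _ c])
  fix x assume x: "x \<in> X k"
  note r = R.rep_orb[OF x]
  have "f (cell x) = push (act' (R.coef x)) (f (cell (rep (orb x))))"
    using R.coef[OF x] f(2) r unfolding equivariant_def by metis
  then show "desc f (push orb (cell x)) = push orb' (f (cell x))"
    using R.coef[OF x] graded_map_mem[OF f(1), of "cell (rep (orb x))" k] r
    by (simp add: desc_def Q.push_orb_act)
qed (use graded_map_lin[OF f(1)] in \<open>auto simp: lin_simps desc_def\<close>)

lemma desc_graded:
  assumes f: "graded_map X (\<lambda>k. Y (j k)) f"
  shows "graded_map R.orbits (\<lambda>k. Q.orbits (j k)) (desc f)"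
  by (rule graded_mapI)
    (use graded_map_mem[OF f] in \<open>auto simp: R.orbits_def Q.orbits_def desc_def R.rep_orb intro!: push_mem[of "Y (j _)"]\<close>)

end

context free_resolution
begin

lemma orbit_chain:
  assumes c: "c \<in> chains_on (orbits k)"
  shows "push rep c \<in> chains_on (X k)" "push orb (push rep c) = c"
proof -
  have o: "rep r \<in> X k \<and> orb (rep r) = r" if r: "r \<in> orbits k" for r
  proof -
    obtain x where x: "x \<in> X k" "r = orb x" using r by (auto simp: orbits_def)
    have "orb (rep (orb x)) = orb (act (coef x) (rep (orb x)))"
      using coef[OF x(1)] orb_act[OF _ rep_orb[OF x(1)], of "coef x"] by (simp only:)
    also have "\<dots> = orb x" using coef[OF x(1)] by metis
    finally show ?thesis using x rep_orb[OF x(1)] by simp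
  qed
  show "push rep c \<in> chains_on (X k)" by (rule push_mem[OF _ c]) (use o in auto)
  show "push orb (push rep c) = c"
    by (subst push_push) (rule push_id[OF _ c], use o in auto)
qed

lemma d_orb_push:
  assumes c: "c \<in> chains_on (X k)"
  shows "d_orb (push orb c) = push orb (d c)"
proof (rule lin_map_eqI[OF _ _ _ c])
  fix x assume x: "x \<in> X k"
  note r = rep_orb[OF x]
  have "d (cell x) = push (act (coef x)) (d (cell (rep (orb x))))"
    using coef[OF x] d_act[OF _ r] by metis
  moreover have "push orb (push (act (coef x)) (d (cell (rep (orb x))))) = push orb (d (cell (rep (orb x))))"
  proof (cases k)
    case 0
    then show ?thesis using r by (simp add: d_0 pushs)
  next
    case (Suc j)
    then show ?thesis using r coef[OF x] by (simp add: push_orb_act[OF _ d_mem])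
  qed
  ultimately show "d_orb (push orb (cell x)) = push orb (d (cell x))"
    by (simp add: d_orb_def)
qed (use d_lin in \<open>auto simp: d_orb_def lin_simps\<close>)

end

text \<open>Lifts exist in both directions. Each composite and the identity are augmented
  equivariant self-maps of one resolution, hence homotopic, and all maps and homotopies descend to
  orbits.\<close>

lemma (in two_resolutions) orbit_complexes_equiv: "chain_equiv R.orbits R.d_orb Q.orbits Q.d_orb"
proof -
  interpret I: two_resolutions G act' Y deg' orb' rep' e t y0 act X deg orb rep d s x0
    by unfold_locales
  interpret RR: two_resolutions G act X deg orb rep d s x0 act X deg orb rep d s x0
    by unfold_locales
  interpret QQ: two_resolutions G act' Y deg' orb' rep' e t y0 act' Y deg' orb' rep' e t y0
    by unfold_locales
  define f where "f = lifted"
  define g where "g = I.lifted"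
  have f: "graded_map X Y f" "equivariant f" and f_d: "\<And>k x. x \<in> X k \<Longrightarrow> f (d (cell x)) = e (f (cell x))"
    and f_aug: "\<And>x. x \<in> X 0 \<Longrightarrow> aug (f (cell x)) = cell ()"
    using aug_chain_map_lifted unfolding aug_chain_map_def f_def by auto
  have g: "graded_map Y X g" "I.equivariant g" and g_d: "\<And>k x. x \<in> Y k \<Longrightarrow> g (e (cell x)) = d (g (cell x))"
    and g_aug: "\<And>x. x \<in> Y 0 \<Longrightarrow> aug (g (cell x)) = cell ()"
    using I.aug_chain_map_lifted unfolding I.aug_chain_map_def g_def by auto
  note fl = graded_map_lin[OF f(1)] and gl = graded_map_lin[OF g(1)]
  have f_d': "f (d c) = e (f c)" if "c \<in> chains_on (X k)" for c k
    by (rule lin_map_eqI[OF _ _ _ that]) (use fl R.d_lin Q.d_lin in \<open>auto simp: lin_simps f_d\<close>)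
  have g_d': "g (e c) = d (g c)" if "c \<in> chains_on (Y k)" for c k
    by (rule lin_map_eqI[OF _ _ _ that]) (use gl R.d_lin Q.d_lin in \<open>auto simp: lin_simps g_d\<close>)
  have f_act: "f (push (act h) c) = push (act' h) (f c)" if "c \<in> chains_on (X k)" "h \<in> carrier G" for c k h
    by (rule lin_map_eqI[OF _ _ _ that(1)]) (use f(2) that fl in \<open>auto simp: equivariant_def lin_simps\<close>)
  have g_act: "g (push (act' h) c) = push (act h) (g c)" if "c \<in> chains_on (Y k)" "h \<in> carrier G" for c k h
    by (rule lin_map_eqI[OF _ _ _ that(1)]) (use g(2) that gl in \<open>auto simp: I.equivariant_def lin_simps\<close>)
  have f_aug': "aug (f c) = aug c" if "c \<in> chains_on (X 0)" for c
    by (rule lin_map_eqI[OF _ _ _ that]) (use fl in \<open>auto simp: f_aug lin_simps\<close>)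
  have g_aug': "aug (g c) = aug c" if "c \<in> chains_on (Y 0)" for c
    by (rule lin_map_eqI[OF _ _ _ that]) (use gl in \<open>auto simp: g_aug lin_simps\<close>)
  have gf: "RR.aug_chain_map (\<lambda>c. g (f c))"
    unfolding RR.aug_chain_map_def RR.equivariant_def
  proof (intro conjI allI ballI)
    show "graded_map X X (\<lambda>c. g (f c))" by (rule graded_map_comp[OF g(1) f(1)])
    fix k x assume x: "x \<in> X k"
    have fx: "f (cell x) \<in> chains_on (Y k)" using graded_map_mem[OF f(1)] x by simp
    show "g (f (d (cell x))) = d (g (f (cell x)))" using f_d[OF x] g_d'[OF fx] by simp
    fix a assume a: "a \<in> carrier G"
    show "g (f (cell (act a x))) = push (act a) (g (f (cell x)))"
      using f(2) x a g_act[OF fx a] unfolding equivariant_def by simp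
  next
    fix x assume x: "x \<in> X 0"
    then show "aug (g (f (cell x))) = cell ()"
      using g_aug'[of "f (cell x)"] graded_map_mem[OF f(1), of "cell x" 0] f_aug by simp
  qed
  have fg: "QQ.aug_chain_map (\<lambda>c. f (g c))"
    unfolding QQ.aug_chain_map_def QQ.equivariant_def
  proof (intro conjI allI ballI)
    show "graded_map Y Y (\<lambda>c. f (g c))" by (rule graded_map_comp[OF f(1) g(1)])
    fix k x assume x: "x \<in> Y k"
    have gx: "g (cell x) \<in> chains_on (X k)" using graded_map_mem[OF g(1)] x by simp
    show "f (g (e (cell x))) = e (f (g (cell x)))" using g_d[OF x] f_d'[OF gx] by simp
    fix a assume a: "a \<in> carrier G"
    show "f (g (cell (act' a x))) = push (act' a) (f (g (cell x)))"
      using g(2) x a f_act[OF gx a] unfolding I.equivariant_def by simp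
  next
    fix x assume x: "x \<in> Y 0"
    then show "aug (f (g (cell x))) = cell ()"
      using f_aug'[of "g (cell x)"] graded_map_mem[OF g(1), of "cell x" 0] g_aug by simp
  qed
  have idR: "RR.aug_chain_map (\<lambda>c. c)"
    by (auto simp: RR.aug_chain_map_def RR.equivariant_def graded_map_def)
  have idQ: "QQ.aug_chain_map (\<lambda>c. c)"
    by (auto simp: QQ.aug_chain_map_def QQ.equivariant_def graded_map_def)
  obtain h where h: "graded_map X (shift X) h" "RR.equivariant h"
    and h_d: "\<And>k x. x \<in> X k \<Longrightarrow> g (f (cell x)) - cell x = d (h (cell x)) + h (d (cell x))"
    using RR.homotopic[OF gf idR] by blast
  obtain h' where h': "graded_map Y (shift Y) h'" "QQ.equivariant h'"
    and h'_d: "\<And>k x. x \<in> Y k \<Longrightarrow> f (g (cell x)) - cell x = e (h' (cell x)) + h' (e (cell x))"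
    using QQ.homotopic[OF fg idQ] by blast
  note hl = graded_map_lin[OF h(1)] and hl' = graded_map_lin[OF h'(1)]
  have h_d': "g (f c) - c = d (h c) + h (d c)" if "c \<in> chains_on (X k)" for c k
    by (rule lin_map_eqI[OF _ _ _ that])
      (use fl gl hl R.d_lin in \<open>auto simp: lin_simps h_d\<close>)
  have h'_d': "f (g c) - c = e (h' c) + h' (e c)" if "c \<in> chains_on (Y k)" for c k
    by (rule lin_map_eqI[OF _ _ _ that])
      (use fl gl hl' Q.d_lin in \<open>auto simp: lin_simps h'_d\<close>)
  have dX: "\<exists>j. d c \<in> chains_on (X j)" if "c \<in> chains_on (X k)" for c k
    using that R.d_chain[of c] R.d_chain_0[of c] by (cases k) (auto intro: chains_0)
  have dY: "\<exists>j. e c \<in> chains_on (Y j)" if "c \<in> chains_on (Y k)" for c k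
    using that Q.d_chain[of c] Q.d_chain_0[of c] by (cases k) (auto intro: chains_0)
  have Xo: thesis if "c \<in> chains_on (R.orbits k)" "\<And>b. b \<in> chains_on (X k) \<Longrightarrow> c = push orb b \<Longrightarrow> thesis" for c k thesis
    using R.orbit_chain[OF that(1)] that(2)[of "push rep c"] by simp
  have Yo: thesis if "c \<in> chains_on (Q.orbits k)" "\<And>b. b \<in> chains_on (Y k) \<Longrightarrow> c = push orb' b \<Longrightarrow> thesis" for c k thesis
    using Q.orbit_chain[OF that(1)] that(2)[of "push rep' c"] by simp
  note fp = desc_push[where j="\<lambda>k. k", OF f] and gp = I.desc_push[where j="\<lambda>k. k", OF g]
    and hp = RR.desc_push[where j=Suc, OF h] and hp' = QQ.desc_push[where j=Suc, OF h']
  show ?thesis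
    unfolding chain_equiv_def
  proof (intro exI conjI allI ballI)
    show "graded_map R.orbits Q.orbits (desc f)" by (rule desc_graded[where j="\<lambda>k. k", OF f(1)])
    show "graded_map Q.orbits R.orbits (I.desc g)" by (rule I.desc_graded[where j="\<lambda>k. k", OF g(1)])
    show "graded_map R.orbits (shift R.orbits) (RR.desc h)" by (rule RR.desc_graded[where j=Suc, OF h(1)])
    show "graded_map Q.orbits (shift Q.orbits) (QQ.desc h')" by (rule QQ.desc_graded[where j=Suc, OF h'(1)])
  next
    fix k c assume "c \<in> chains_on (R.orbits k)"
    then obtain b where b: "b \<in> chains_on (X k)" "c = push orb b" by (rule Xo)
    obtain j where j: "d b \<in> chains_on (X j)" using dX b(1) by blast
    have fb: "f b \<in> chains_on (Y k)" by (rule graded_map_mem[OF f(1) b(1)])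
    have hb: "h b \<in> chains_on (X (Suc k))" using graded_map_mem[OF h(1) b(1)] by simp
    show "desc f (R.d_orb c) = Q.d_orb (desc f c)"
      using b(1) j fb by (simp add: b(2) R.d_orb_push fp Q.d_orb_push f_d')
    show "I.desc g (desc f c) - c = R.d_orb (RR.desc h c) + RR.desc h (R.d_orb c)"
      using b(1) j fb hb h_d'[OF b(1)]
      by (simp add: b(2) R.d_orb_push fp gp hp) (metis lin_map_push lin_map_add lin_map_diff)
  next
    fix k c assume "c \<in> chains_on (Q.orbits k)"
    then obtain b where b: "b \<in> chains_on (Y k)" "c = push orb' b" by (rule Yo)
    obtain j where j: "e b \<in> chains_on (Y j)" using dY b(1) by blast
    have fb: "g b \<in> chains_on (X k)" by (rule graded_map_mem[OF g(1) b(1)])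
    have hb: "h' b \<in> chains_on (Y (Suc k))" using graded_map_mem[OF h'(1) b(1)] by simp
    show "I.desc g (Q.d_orb c) = R.d_orb (I.desc g c)"
      using b(1) j fb by (simp add: b(2) R.d_orb_push gp Q.d_orb_push g_d')
    show "desc f (I.desc g c) - c = Q.d_orb (QQ.desc h' c) + QQ.desc h' (Q.d_orb c)"
      using b(1) j fb hb h'_d'[OF b(1)]
      by (simp add: b(2) Q.d_orb_push fp gp hp') (metis lin_map_push lin_map_add lin_map_diff)
  qed
qed

section \<open>The bar resolution\<close>

locale bar_group = group G for G :: "'a monoid" (structure)
begin

text \<open>The cell \<open>(g, gs)\<close> is the element \<open>g [g1|...|gk]\<close> of the bar
  resolution; the group acts on the first entry only, so the tuples \<open>gs\<close> index the
  orbits.\<close>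

definition bar_cells :: "nat \<Rightarrow> ('a \<times> 'a list) set" where
  "bar_cells k = {(g, gs). g \<in> carrier G \<and> length gs = k \<and> set gs \<subseteq> carrier G}"

definition bar_d :: "('a \<times> 'a list \<Rightarrow>\<^sub>0 rat) \<Rightarrow> ('a \<times> 'a list \<Rightarrow>\<^sub>0 rat)" where
  "bar_d = lin (\<lambda>(g, gs). if gs = [] then 0 else cell (g \<otimes> hd gs, tl gs) +
     (\<Sum>i<length gs. Poly_Mapping.single (g, bar_face G (Suc i) gs) ((-1) ^ Suc i)))"

definition bar_s :: "('a \<times> 'a list \<Rightarrow>\<^sub>0 rat) \<Rightarrow> ('a \<times> 'a list \<Rightarrow>\<^sub>0 rat)" where
  "bar_s = push (\<lambda>(g, gs). (\<one>, g # gs))"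

definition bar_act :: "'a \<Rightarrow> 'a \<times> 'a list \<Rightarrow> 'a \<times> 'a list" where
  "bar_act h = (\<lambda>(g, gs). (h \<otimes> g, gs))"

lemma bar_d_cell: "gs \<noteq> [] \<Longrightarrow> bar_d (cell (g, gs)) = cell (g \<otimes> hd gs, tl gs) +
     (\<Sum>i<length gs. Poly_Mapping.single (g, bar_face G (Suc i) gs) ((-1) ^ Suc i))"
  and bar_d_Nil: "bar_d (cell (g, [])) = 0"
  and bar_s_cell: "bar_s (cell (g, gs)) = cell (\<one>, g # gs)"
  by (simp_all add: bar_d_def bar_s_def)

lemma bar_d_lin: "lin_map bar_d" and bar_s_lin: "lin_map bar_s"
  by (simp_all add: bar_d_def bar_s_def lin_map_lin lin_map_push)

lemma bar_d_mem: "x \<in> bar_cells (Suc k) \<Longrightarrow> bar_d (cell x) \<in> chains_on (bar_cells k)"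
proof -
  assume "x \<in> bar_cells (Suc k)"
  then obtain g gs where x: "x = (g, gs)" "g \<in> carrier G" "length gs = Suc k" "set gs \<subseteq> carrier G"
    by (auto simp: bar_cells_def)
  then have ne: "gs \<noteq> []" by auto
  have "bar_face G (Suc i) gs \<in> {gs. length gs = k \<and> set gs \<subseteq> carrier G}" if "i < length gs" for i
    using bar_face_closed[OF group_axioms x(4), of "Suc i"] length_bar_face[OF ne, of "Suc i"] that x by simp
  then show ?thesis
    using x ne unfolding x(1) bar_d_cell[OF ne]
    by (intro chains_add chains_sum chains_single) (auto simp: bar_cells_def neq_Nil_conv)
qed

lemma bar_d_act:
  assumes "h \<in> carrier G" "x \<in> bar_cells k"
  shows "bar_d (cell (bar_act h x)) = push (bar_act h) (bar_d (cell x))"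
proof -
  obtain g gs where x: "x = (g, gs)" "g \<in> carrier G" "set gs \<subseteq> carrier G"
    using assms by (auto simp: bar_cells_def)
  show ?thesis
  proof (cases "gs = []")
    case True
    then show ?thesis by (simp add: x bar_act_def bar_d_Nil pushs)
  next
    case False
    then have "hd gs \<in> carrier G" using x by (cases gs) auto
    then show ?thesis
      using False x assms by (simp add: x bar_act_def bar_d_cell pushs push_single m_assoc)
  qed
qed

lemma bar_face_Cons:
  assumes "gs \<noteq> []"
  shows "bar_face G (Suc 0) (g # gs) = (g \<otimes> hd gs) # tl gs"
    and "i < length gs \<Longrightarrow> bar_face G (Suc (Suc i)) (g # gs) = g # bar_face G (Suc i) gs"
  using assms by (auto simp: bar_face_def hd_conv_nth drop_Suc)

text \<open>The first face of \<open>[g|gs]\<close> returns \<open>g [gs]\<close>; every other face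
  of it is cancelled by \<open>bar_s\<close> of a face of \<open>g [gs]\<close>.\<close>

lemma bar_d_s:
  assumes "x \<in> bar_cells (Suc k)"
  shows "bar_d (bar_s (cell x)) + bar_s (bar_d (cell x)) = cell x"
proof -
  obtain g gs where x0: "x = (g, gs)" "g \<in> carrier G" "length gs = Suc k"
    using assms by (cases x) (auto simp: bar_cells_def)
  then have x: "x = (g, gs)" "g \<in> carrier G" "gs \<noteq> []" by auto
  have 1: "bar_d (bar_s (cell x)) = cell (g, gs) + (\<Sum>i<Suc (length gs).
      Poly_Mapping.single (\<one>, bar_face G (Suc i) (g # gs)) ((-1) ^ Suc i))"
    using x by (simp add: bar_s_cell bar_d_cell del: sum.lessThan_Suc)
  have 2: "(\<Sum>i<Suc (length gs). Poly_Mapping.single (\<one>, bar_face G (Suc i) (g # gs)) ((-1) ^ Suc i))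
     = - cell (\<one>, (g \<otimes> hd gs) # tl gs) - (\<Sum>i<length gs.
      Poly_Mapping.single (\<one>, g # bar_face G (Suc i) gs) ((-1) ^ Suc i :: rat))"
    using x by (subst sum.lessThan_Suc_shift)
      (simp add: bar_face_Cons single_uminus sum_negf[symmetric])
  have 3: "bar_s (bar_d (cell x)) = cell (\<one>, (g \<otimes> hd gs) # tl gs) + (\<Sum>i<length gs.
      Poly_Mapping.single (\<one>, g # bar_face G (Suc i) gs) ((-1) ^ Suc i :: rat))"
    using x by (simp add: bar_d_cell bar_s_def pushs push_single)
  show ?thesis unfolding 1 2 3 using x by simp
qed

lemma bar_d_s_0: "x \<in> bar_cells 0 \<Longrightarrow> bar_d (bar_s (cell x)) = cell x - cell (\<one>, [])"
  by (auto simp: bar_cells_def bar_s_cell bar_d_cell bar_face_def single_uminus)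

lemma bar_aug_d: "x \<in> bar_cells (Suc 0) \<Longrightarrow> aug (bar_d (cell x)) = 0"
  by (auto simp: bar_cells_def bar_d_cell bar_face_def pushs push_single length_Suc_conv single_uminus)

text \<open>Derived from the contraction instead of a double sum: every cell of positive degree is a
  translate of some \<open>bar_s (cell ?y)\<close>, and \<open>d d s y = d y - d s d y\<close>,
  where \<open>d s = 1 - s d\<close> returns \<open>d y\<close> because \<open>d d y = 0\<close> by
  induction. In the lowest degrees the augmentation takes over.\<close>

lemma bar_d_d: "x \<in> bar_cells k \<Longrightarrow> bar_d (bar_d (cell x)) = 0"
proof (induction k arbitrary: x)
  case 0
  then show ?case by (auto simp: bar_cells_def bar_d_Nil lin_map_0[OF bar_d_lin])
next
  case (Suc k)
  have dc: "bar_d c \<in> chains_on (bar_cells j)" if "c \<in> chains_on (bar_cells (Suc j))" for c j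
    by (rule lin_map_mem[OF bar_d_lin bar_d_mem that])
  have dc0: "bar_d c = 0" if "c \<in> chains_on (bar_cells 0)" for c
    by (rule lin_map_eqI[OF bar_d_lin lin_map_zero _ that]) (auto simp: bar_cells_def bar_d_Nil)
  obtain g h hs where x: "x = (g, h # hs)" "g \<in> carrier G" "h \<in> carrier G" "set hs \<subseteq> carrier G" "length hs = k"
    using Suc.prems by (auto simp: bar_cells_def length_Suc_conv)
  let ?y = "(h, hs)"
  have y: "?y \<in> bar_cells k" using x by (simp add: bar_cells_def)
  have y1: "(\<one>, h # hs) \<in> bar_cells (Suc k)" using x by (simp add: bar_cells_def)
  have "bar_d (bar_d (bar_s (cell ?y))) = 0"
  proof (cases k)
    case 0
    then show ?thesis using dc0 bar_d_mem y1 by (simp add: bar_s_cell)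
  next
    case (Suc j)
    have y': "?y \<in> bar_cells (Suc j)" using y Suc by simp
    have dy: "bar_d (cell ?y) \<in> chains_on (bar_cells j)" by (rule bar_d_mem[OF y'])
    have ddy: "bar_d (bar_d (cell ?y)) = 0" by (rule Suc.IH[OF y])
    have "bar_d (bar_s (cell ?y)) = cell ?y - bar_s (bar_d (cell ?y))"
      using bar_d_s[OF y'] by (simp add: algebra_simps)
    then have *: "bar_d (bar_d (bar_s (cell ?y))) = bar_d (cell ?y) - bar_d (bar_s (bar_d (cell ?y)))"
      by (simp add: lin_map_diff[OF bar_d_lin])
    have "bar_d (bar_s (bar_d (cell ?y))) = bar_d (cell ?y)"
    proof (cases j)
      case 0
      have "bar_d (bar_s c) = c - push (\<lambda>_. (\<one>, [])) (aug c)" if "c \<in> chains_on (bar_cells 0)" for c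
        by (rule lin_map_eqI[OF _ _ _ that])
          (use bar_d_lin bar_s_lin in \<open>auto simp: lin_simps bar_d_s_0 algebra_simps\<close>)
      then show ?thesis using dy bar_aug_d[of ?y] y' 0 by (simp add: pushs)
    next
      case (Suc i)
      have "bar_d (bar_s c) + bar_s (bar_d c) = c" if "c \<in> chains_on (bar_cells (Suc i))" for c
        by (rule lin_map_eqI[OF _ _ _ that])
          (use bar_d_lin bar_s_lin in \<open>auto simp: lin_simps bar_d_s algebra_simps\<close>)
      from this[of "bar_d (cell ?y)"] show ?thesis
        using dy ddy Suc by (simp add: lin_map_0[OF bar_s_lin])
    qed
    then show ?thesis using * by simp
  qed
  moreover have "cell x = push (bar_act g) (bar_s (cell ?y))"
    using x by (simp add: bar_s_cell bar_act_def)
  moreover have act: "bar_d (push (bar_act g) c) = push (bar_act g) (bar_d c)"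
    if "c \<in> chains_on (bar_cells j)" for c j
    by (rule lin_map_eqI[OF _ _ _ that]) (use bar_d_lin x in \<open>auto simp: lin_simps bar_d_act\<close>)
  ultimately show ?case
    using act[of "bar_s (cell ?y)" "Suc k"] act[of "bar_d (bar_s (cell ?y))" k] y1 bar_d_mem[OF y1]
    by (simp add: bar_s_cell pushs)
qed

lemma free_resolution_bar:
  "free_resolution G bar_act bar_cells (\<lambda>x. length (snd x)) snd (\<lambda>gs. (\<one>, gs)) bar_d bar_s (\<one>, [])"
proof unfold_locales
  show "graded_map bar_cells (shift bar_cells) bar_s"
    by (rule graded_mapI) (auto simp: bar_s_lin bar_s_cell bar_cells_def)
  fix x k assume "x \<in> bar_cells k"
  then show "\<exists>!g. g \<in> carrier G \<and> x = bar_act g (\<one>, snd x)"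
    by (auto simp: bar_cells_def bar_act_def)
qed (auto simp: bar_d_d bar_d_lin bar_d_mem bar_d_act bar_aug_d bar_d_s bar_d_s_0,
    auto simp: bar_cells_def bar_act_def m_assoc bar_d_Nil)

text \<open>Passing to orbits forgets the leading group element, which turns the face multiplying
  into it into deletion of the first entry: this is the complex that defines
  \<open>group_homology\<close>.\<close>

lemma bar_orbits:
  "free_resolution.orbits bar_cells snd = (\<lambda>k. {gs. length gs = k \<and> set gs \<subseteq> carrier G})"
  "free_resolution.d_orb snd (\<lambda>gs. (\<one>, gs)) bar_d = bar_boundary G"
proof -
  interpret free_resolution G bar_act bar_cells "\<lambda>x. length (snd x)" snd "\<lambda>gs. (\<one>, gs)" bar_d bar_s "(\<one>, [])"
    by (rule free_resolution_bar)
  show "orbits = (\<lambda>k. {gs. length gs = k \<and> set gs \<subseteq> carrier G})"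
    by (rule ext) (auto simp: orbits_def bar_cells_def image_iff intro!: exI[of _ \<one>])
  have "push snd (bar_d (cell (\<one>, gs))) = bar_boundary_basis G gs" for gs
  proof (cases "gs = []")
    case True
    then show ?thesis by (simp add: bar_d_Nil bar_boundary_basis_def pushs)
  next
    case False
    have "(\<Sum>i\<le>length gs. Poly_Mapping.single (bar_face G i gs) ((-1) ^ i :: rat)) =
      cell (tl gs) + (\<Sum>i<length gs. Poly_Mapping.single (bar_face G (Suc i) gs) ((-1) ^ Suc i))"
      by (subst lessThan_Suc_atMost[symmetric], subst sum.lessThan_Suc_shift) (simp add: bar_face_def)
    then show ?thesis
      using False by (simp add: bar_d_cell bar_boundary_basis_def pushs push_single)
  qed
  then show "d_orb = bar_boundary G"
    by (simp add: d_orb_def fun_eq_iff lin_def bar_boundary_def)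
qed

end

section \<open>Dimensions\<close>

lemma chain_module_simps:
  "carrier (chain_module C) = C" "\<zero>\<^bsub>chain_module C\<^esub> = 0" "a \<oplus>\<^bsub>chain_module C\<^esub> b = a + b"
  "r \<odot>\<^bsub>chain_module C\<^esub> a = chain_scale r a"
  by (simp_all add: chain_module_def)

lemma cell_inject: "(cell x = (cell y :: 'a \<Rightarrow>\<^sub>0 rat)) \<longleftrightarrow> x = y"
  by (metis lookup_single_eq lookup_single_not_eq zero_neq_one)

lemma finsum_chain_module:
  assumes "finite A" "f \<in> A \<rightarrow> chains_on E"
  shows "finsum (chain_module (chains_on E)) f A = sum f A"
proof -
  interpret Module.module "class_ring :: rat ring" "chain_module (chains_on E)"
    by (rule module_chain_module) (auto intro: chains_intros)
  show ?thesis
    using assms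
  proof (induction A)
    case (insert x A)
    then have "finsum (chain_module (chains_on E)) f (insert x A) =
        f x \<oplus>\<^bsub>chain_module (chains_on E)\<^esub> finsum (chain_module (chains_on E)) f A"
      by (intro M.finsum_insert) (auto simp: chain_module_simps)
    with insert show ?case by (auto simp: chain_module_simps)
  qed (simp add: chain_module_simps)
qed

lemma vectorspace_chains: "vectorspace (class_ring :: rat ring) (chain_module (chains_on E))"
  by (intro vectorspace.intro class_field module_chain_module) (auto intro: chains_intros)

lemma basis_chains:
  assumes E: "finite E"
  shows "vectorspace.basis (class_ring :: rat ring) (chain_module (chains_on E)) (cell ` E)"
proof -
  interpret vectorspace "class_ring :: rat ring" "chain_module (chains_on E)"
    by (rule vectorspace_chains)
  have lc: "lincomb a (cell ` E) = (\<Sum>x\<in>E. chain_scale (a (cell x)) (cell x))" for a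
  proof -
    have "lincomb a (cell ` E) = (\<Sum>v\<in>cell ` E. chain_scale (a v) v)"
      unfolding lincomb_def using E
      by (subst finsum_chain_module) (auto simp: chain_module_simps chains_scale)
    also have "\<dots> = (\<Sum>x\<in>E. chain_scale (a (cell x)) (cell x))"
      by (subst sum.reindex) (simp_all add: inj_on_def cell_inject)
    finally show ?thesis .
  qed
  have lk: "Poly_Mapping.lookup (lincomb a (cell ` E)) x = (if x \<in> E then a (cell x) else 0)" for a x
    unfolding lc by (simp add: lookup_sum lookup_single when_def E if_distrib cong: if_cong)
  have inj: "lin_indpt (cell ` E)"
  proof (rule finite_lin_indpt2)
    fix a assume z: "lincomb a (cell ` E) = \<zero>\<^bsub>chain_module (chains_on E)\<^esub>"
    have "a (cell x) = 0" if "x \<in> E" for x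
      using lk[of a x] z that by (simp add: chain_module_simps)
    then show "\<forall>v\<in>cell ` E. a v = \<zero>\<^bsub>class_ring\<^esub>" by auto
  qed (use E in \<open>auto simp: chain_module_simps\<close>)
  have gen: "v \<in> span (cell ` E)" if v: "v \<in> chains_on E" for v
  proof -
    let ?a = "\<lambda>w. Poly_Mapping.lookup v (THE x. w = cell x)"
    have the: "(THE x'. cell x = (cell x' :: 'a \<Rightarrow>\<^sub>0 rat)) = x" for x
      by (rule the_equality) (auto simp: cell_inject)
    have v0: "Poly_Mapping.lookup v x = 0" if "x \<notin> E" for x
      using v that by (auto simp: chains_on_def in_keys_iff)
    have "v = lincomb ?a (cell ` E)"
      by (rule poly_mapping_eqI) (simp add: lk the v0)
    then show ?thesis
      unfolding span_def using E by (auto intro!: exI[of _ ?a] exI[of _ "cell ` E"])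
  qed
  have sub: "cell ` E \<subseteq> carrier (chain_module (chains_on E))" by (auto simp: chain_module_simps)
  show ?thesis
    unfolding basis_def using inj gen sub span_is_subset2[OF sub]
    by (auto simp: chain_module_simps)
qed

text \<open>Both halves of \<open>has_dimension\<close>, finiteness and the value, are transported
  from the space of chains on a finite set, whose cells form a basis.\<close>

lemma has_dimension_iso:
  assumes V: "vectorspace (class_ring :: rat ring) V" and E: "finite E"
    and T: "T \<in> LinearCombinations.module_hom class_ring (chain_module (chains_on E)) V"
    and inj: "inj_on T (chains_on E)" and surj: "T ` chains_on E = carrier V"
  shows "has_dimension V (card E)"
proof -
  interpret linear_map "class_ring :: rat ring" "chain_module (chains_on E)" V T
    by (intro linear_map.intro V vectorspace_chains mod_hom.intro mod_hom_axioms.intro T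
        vectorspace.axioms(1))
  note b = basis_chains[OF E]
  have fd: "V.fin_dim" unfolding V.fin_dim_def using b E unfolding V.basis_def by blast
  have "V.dim = card (cell ` E)" using V.dim_basis[OF _ b] E by simp
  also have "\<dots> = card E" by (rule card_image) (simp_all add: inj_on_def cell_inject)
  finally have "V.dim = card E" .
  then show ?thesis
    unfolding has_dimension_def
    using surj_fin_dim[OF fd] dim_eq[OF fd] inj surj by (simp add: chain_module_simps)
qed

text \<open>The classes of \<open>g c\<close> give the isomorphism. \<open>f\<close> kills
  boundaries and \<open>f g\<close> is the identity, which gives injectivity; on a cycle
  \<open>z\<close> the difference \<open>g (f z) - z\<close> is the boundary of \<open>h z\<close>,
  which gives surjectivity.\<close>

theorem group_homology_dimension:
  assumes G: "group G" and E: "finite (E k)"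
    and eqv: "chain_equiv (\<lambda>k. {gs. length gs = k \<and> set gs \<subseteq> carrier G}) (bar_boundary G) E (\<lambda>_. 0)"
  shows "has_dimension (group_homology G k) (card (E k))"
proof -
  let ?B = "\<lambda>k. {gs. length gs = k \<and> set gs \<subseteq> carrier G}"
  let ?d = "bar_boundary G" and ?C = "bar_cycles G k" and ?N = "bar_boundaries G k"
  have chains: "bar_chains G j = chains_on (?B j)" for j by (simp add: bar_chains_def chains_on_def)
  obtain f g h h' where f: "graded_map ?B E f" and g: "graded_map E ?B g"
    and h: "graded_map ?B (shift ?B) h"
    and fd: "\<And>k c. c \<in> chains_on (?B k) \<Longrightarrow> f (?d c) = 0"
    and gd: "\<And>k c. c \<in> chains_on (E k) \<Longrightarrow> ?d (g c) = g 0"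
    and gf: "\<And>k c. c \<in> chains_on (?B k) \<Longrightarrow> g (f c) - c = ?d (h c) + h (?d c)"
    and fg: "\<And>k c. c \<in> chains_on (E k) \<Longrightarrow> f (g c) - c = 0 + h' 0" and h'0: "h' 0 = 0"
    using eqv unfolding chain_equiv_def
    by (elim exE conjE) (rule that, assumption+, simp_all, metis graded_map_lin lin_map_0)
  have dl: "lin_map ?d" by (simp add: lin_map_def bar_boundary_add bar_boundary_scale)
  note fl = graded_map_lin[OF f] and gl = graded_map_lin[OF g] and hl = graded_map_lin[OF h]
  have N0: "0 \<in> ?N" unfolding bar_boundaries_def chains by (rule image_eqI[of _ _ 0]) (auto simp: lin_map_0[OF dl])
  have Nadd: "a + b \<in> ?N" if "a \<in> ?N" "b \<in> ?N" for a b
    using that unfolding bar_boundaries_def chains by (auto simp flip: lin_map_add[OF dl] intro!: imageI chains_add)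
  have Nsc: "chain_scale r a \<in> ?N" if "a \<in> ?N" for a r
    using that unfolding bar_boundaries_def chains by (auto simp flip: lin_map_scale[OF dl] intro!: imageI chains_scale)
  have Nneg: "- a \<in> ?N" if "a \<in> ?N" for a using Nsc[OF that, of "-1"] by (simp add: chain_scale_minus_one)
  have Nsub: "a - b \<in> ?N" if "a \<in> ?N" "b \<in> ?N" for a b using Nadd[OF that(1) Nneg[OF that(2)]] by simp
  \<comment> \<open>Explicit cosets of the boundaries; carrier, addition and scaling of the quotient
    module are rewritten in terms of them once.\<close>
  define co where "co x = {n + x | n. n \<in> ?N}" for x
  have co: "?N +>\<^bsub>chain_module ?C\<^esub> x = co x" for x
    by (auto simp: co_def a_r_coset_def r_coset_def chain_module_def)
  have co_mem: "y \<in> co x \<longleftrightarrow> y - x \<in> ?N" for x y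
    unfolding co_def by (auto simp: algebra_simps) (metis add.commute diff_add_cancel)
  have co_eq: "co x = co y \<longleftrightarrow> x - y \<in> ?N" for x y
  proof
    assume "co x = co y"
    moreover have "x \<in> co x" by (simp add: co_mem N0)
    ultimately show "x - y \<in> ?N" by (simp add: co_mem)
  next
    assume xy: "x - y \<in> ?N"
    show "co x = co y"
    proof (rule Set.set_eqI)
      fix z
      have "z - y = (z - x) + (x - y)" "z - x = (z - y) - (x - y)" by simp_all
      then show "z \<in> co x \<longleftrightarrow> z \<in> co y" unfolding co_mem using Nadd Nsub xy by metis
    qed
  qed
  let ?V = "group_homology G k"
  have car: "carrier ?V = co ` ?C"
    by (auto simp: group_homology_def quotient_module_def A_RCOSETS_def' co chain_module_simps)
  have ad: "co x \<oplus>\<^bsub>?V\<^esub> co y = co (x + y)" for x y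
  proof -
    have "co x \<oplus>\<^bsub>?V\<^esub> co y = {a + b | a b. a \<in> co x \<and> b \<in> co y}"
      by (auto simp: group_homology_def quotient_module_def set_add_def set_mult_def chain_module_def)
    also have "\<dots> = co (x + y)"
    proof (intro Set.set_eqI iffI)
      fix z assume "z \<in> {a + b | a b. a \<in> co x \<and> b \<in> co y}"
      then obtain a b where "z = a + b" "a - x \<in> ?N" "b - y \<in> ?N" by (auto simp: co_mem)
      then show "z \<in> co (x + y)" using Nadd[of "a - x" "b - y"] by (simp add: co_mem algebra_simps)
    next
      fix z assume "z \<in> co (x + y)"
      then have "z - y \<in> co x" "y \<in> co y" by (simp_all add: co_mem N0 algebra_simps)
      moreover have "z = (z - y) + y" by simp
      ultimately show "z \<in> {a + b | a b. a \<in> co x \<and> b \<in> co y}" by blast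
    qed
    finally show ?thesis .
  qed
  have sm: "r \<odot>\<^bsub>?V\<^esub> co x = co (chain_scale r x)" for r x
  proof -
    have "r \<odot>\<^bsub>?V\<^esub> co x = (\<Union>y\<in>co x. co (chain_scale r y))"
      by (simp add: group_homology_def quotient_module_def co chain_module_simps)
    moreover have "co (chain_scale r y) = co (chain_scale r x)" if "y \<in> co x" for y
      using Nsc[of "y - x" r] that by (simp add: co_eq co_mem chain_scale_diff_right)
    moreover have "x \<in> co x" by (simp add: co_mem N0)
    ultimately show ?thesis by blast
  qed
  have gC: "g c \<in> ?C" if "c \<in> chains_on (E k)" for c
    using graded_map_mem[OF g that] gd[OF that] by (simp add: bar_cycles_def chains lin_map_0[OF gl])
  show ?thesis
  proof (rule has_dimension_iso[OF vectorspace_group_homology[OF G] E])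
    show "(\<lambda>c. co (g c)) \<in> LinearCombinations.module_hom class_ring (chain_module (chains_on (E k))) ?V"
      by (auto simp: LinearCombinations.module_hom_def chain_module_simps car gC ad sm lin_map_add[OF gl] lin_map_scale[OF gl])
    have f_N: "f n = 0" if "n \<in> ?N" for n using that fd unfolding bar_boundaries_def chains by auto
    show "inj_on (\<lambda>c. co (g c)) (chains_on (E k))"
    proof (rule inj_onI)
      fix a b assume ab: "a \<in> chains_on (E k)" "b \<in> chains_on (E k)" and "co (g a) = co (g b)"
      then have "f (g a - g b) = 0" by (simp add: co_eq f_N)
      then show "a = b" using fg[OF ab(1)] fg[OF ab(2)] by (simp add: lin_map_diff[OF fl] h'0)
    qed
    show "(\<lambda>c. co (g c)) ` chains_on (E k) = carrier ?V"
    proof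
      show "(\<lambda>c. co (g c)) ` chains_on (E k) \<subseteq> carrier ?V" using gC by (auto simp: car)
      show "carrier ?V \<subseteq> (\<lambda>c. co (g c)) ` chains_on (E k)"
      proof
        fix Z assume "Z \<in> carrier ?V"
        then obtain z where z: "Z = co z" "z \<in> chains_on (?B k)" "?d z = 0"
          by (auto simp: car bar_cycles_def chains)
        have "g (f z) - z \<in> ?N"
          using gf[OF z(2)] z(3) graded_map_mem[OF h z(2)] lin_map_0[OF hl]
          unfolding bar_boundaries_def chains by simp
        then have "Z = co (g (f z))" using co_eq[of "g (f z)" z] z by simp
        then show "Z \<in> (\<lambda>c. co (g c)) ` chains_on (E k)" using graded_map_mem[OF f z(2)] by blast
      qed
    qed
  qed
qed

section \<open>Free groups and the contractible complexes built from their Cayley trees\<close>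

section \<open>Free groups\<close>

abbreviation flip :: "'a \<times> bool \<Rightarrow> 'a \<times> bool" where
  "flip l \<equiv> (fst l, \<not> snd l)"

fun reduced :: "('a \<times> bool) list \<Rightarrow> bool" where
  "reduced (l # m # w) \<longleftrightarrow> m \<noteq> flip l \<and> reduced (m # w)"
| "reduced w \<longleftrightarrow> True"

fun push_letter :: "'a \<times> bool \<Rightarrow> ('a \<times> bool) list \<Rightarrow> ('a \<times> bool) list" where
  "push_letter l [] = [l]"
| "push_letter l (m # w) = (if m = flip l then w else l # m # w)"

lemma reduced_Cons: "reduced (l # w) \<Longrightarrow> reduced w"
  by (cases w) auto

lemma reduced_push_letter: "reduced w \<Longrightarrow> reduced (push_letter l w)"
  by (cases w) (auto dest: reduced_Cons)

lemma push_letter_flip: "reduced w \<Longrightarrow> push_letter (flip l) (push_letter l w) = w"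
  by (cases w rule: reduced.cases) (auto simp: prod_eq_iff)

lemma push_letter_flip': "reduced w \<Longrightarrow> push_letter l (push_letter (flip l) w) = w"
  using push_letter_flip[of w "flip l"] by simp

lemma reduced_foldr: "reduced w \<Longrightarrow> reduced (foldr push_letter u w)"
  by (induction u) (auto intro: reduced_push_letter)

lemma foldr_push_letter_id: "reduced u \<Longrightarrow> foldr push_letter u [] = u"
  by (induction u rule: reduced.induct) auto

lemma foldr_push_letter_push:
  "reduced w \<Longrightarrow> foldr push_letter (push_letter l x) w = push_letter l (foldr push_letter x w)"
  by (cases x) (auto simp: push_letter_flip' reduced_foldr)

text \<open>Van der Waerden's argument: letters act on reduced words by mutually inverse
  permutations, and a product of words acts as the composite.\<close>

lemma foldr_push_letter_assoc:
  "reduced w \<Longrightarrow> foldr push_letter (foldr push_letter u v) w = foldr push_letter u (foldr push_letter v w)"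
  by (induction u) (auto simp: foldr_push_letter_push)

lemma foldr_push_letter_inv:
  "reduced w \<Longrightarrow> foldr push_letter (rev (map flip u)) (foldr push_letter u w) = w"
  by (induction u arbitrary: w) (auto simp: push_letter_flip reduced_foldr)

lemma foldr_push_letter_inv_nil:
  "reduced u \<Longrightarrow> foldr push_letter (rev (map flip u)) u = []"
  using foldr_push_letter_inv[of "[]" u] by (simp add: foldr_push_letter_id)

text \<open>Elements are reduced words. The group is written additively: the class
  \<open>group_add\<close> does not require commutativity.\<close>

typedef 'a fg = "{w :: ('a \<times> bool) list. reduced w}"
  by (rule exI[of _ "[]"]) simp

setup_lifting type_definition_fg

instantiation fg :: (type) group_add
begin

lift_definition zero_fg :: "'a fg" is "[]" by simp

lift_definition plus_fg :: "'a fg \<Rightarrow> 'a fg \<Rightarrow> 'a fg" is "\<lambda>u v. foldr push_letter u v"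
  by (rule reduced_foldr)

lift_definition uminus_fg :: "'a fg \<Rightarrow> 'a fg" is "\<lambda>u. foldr push_letter (rev (map flip u)) []"
  by (rule reduced_foldr) simp

definition minus_fg :: "'a fg \<Rightarrow> 'a fg \<Rightarrow> 'a fg" where
  "minus_fg u v = u + - v"

instance
proof
  fix a b c :: "'a fg"
  show "a + b + c = a + (b + c)" by transfer (rule foldr_push_letter_assoc)
  show "0 + a = a" by transfer simp
  show "a + 0 = a" by transfer (rule foldr_push_letter_id)
  show "- a + a = 0"
    by transfer (simp add: foldr_push_letter_assoc foldr_push_letter_inv_nil)
  show "a + - b = a - b" by (simp add: minus_fg_def)
qed

end

lift_definition gen :: "'a \<Rightarrow> 'a fg" is "\<lambda>s. [(s, True)]" by simp

definition letter :: "'a \<times> bool \<Rightarrow> 'a fg" where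
  "letter l = (if snd l then gen (fst l) else - gen (fst l))"

definition word :: "('a \<times> bool) list \<Rightarrow> 'a fg" where
  "word w = foldr (\<lambda>l x. letter l + x) w 0"

lemma word_simps [simp]: "word [] = 0" "word (l # w) = letter l + word w"
  by (simp_all add: word_def)

lemma word_append: "word (u @ v) = word u + word v"
  by (induction u) (auto simp: add.assoc)

lemma Rep_letter: "Rep_fg (letter l) = [l]"
proof (cases l)
  case (Pair s b)
  then show ?thesis by (cases b) (simp_all add: letter_def gen.rep_eq uminus_fg.rep_eq)
qed

lemma Rep_letter_plus: "Rep_fg (letter l + w) = push_letter l (Rep_fg w)"
  by (simp add: plus_fg.rep_eq Rep_letter)

lemma word_Rep: "word (Rep_fg w) = w"
proof -
  have "reduced v \<Longrightarrow> Rep_fg (word v) = v" for v :: "('a \<times> bool) list"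
  proof (induction v)
    case (Cons l v)
    then have "Rep_fg (word v) = v" using reduced_Cons by blast
    with Cons.prems show ?case by (cases v) (auto simp: Rep_letter_plus Rep_letter zero_fg.rep_eq)
  qed (simp add: zero_fg.rep_eq)
  then show ?thesis using Rep_fg[of w] by (simp add: Rep_fg_inject[symmetric])
qed

lemma fg_letter_induct [case_names zero letter]:
  assumes "P 0" "\<And>l w. P w \<Longrightarrow> P (letter l + w)"
  shows "P w"
proof -
  have "P (word v)" for v by (induction v) (auto intro: assms)
  then show ?thesis by (metis word_Rep)
qed

lemma fg_induct [case_names zero gen inv]:
  assumes "P 0" "\<And>s w. P w \<Longrightarrow> P (gen s + w)" "\<And>s w. P w \<Longrightarrow> P (- gen s + w)"
  shows "P w"
  by (induction w rule: fg_letter_induct) (auto simp: letter_def intro: assms)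

text \<open>A letter-wise recursion that respects cancellation of adjacent inverse letters descends to
  the free group.\<close>

lemma word_respects:
  assumes "\<And>l w. F (l # flip l # w) = F w" "\<And>l u v. F u = F v \<Longrightarrow> F (l # u) = F (l # v)"
  shows "F (Rep_fg (word w)) = F w"
proof (induction w)
  case (Cons l w)
  have "F (push_letter l (Rep_fg (word w))) = F (l # Rep_fg (word w))"
    using assms(1)[of l] by (cases "Rep_fg (word w)") auto
  with Cons show ?case using assms(2)[of "Rep_fg (word w)" w l] by (simp add: Rep_letter_plus)
qed (simp add: zero_fg.rep_eq)

definition fg_act :: "('a \<Rightarrow> 'c \<Rightarrow> 'c) \<Rightarrow> ('a \<Rightarrow> 'c \<Rightarrow> 'c) \<Rightarrow> 'a fg \<Rightarrow> 'c \<Rightarrow> 'c" where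
  "fg_act p q w = foldr (\<lambda>l. if snd l then p (fst l) else q (fst l)) (Rep_fg w)"

lemma fg_act_letter:
  assumes "\<And>s c. p s (q s c) = c" "\<And>s c. q s (p s c) = c"
  shows "fg_act p q (letter l + w) c = (if snd l then p (fst l) else q (fst l)) (fg_act p q w c)"
  using assms unfolding fg_act_def Rep_letter_plus by (cases "Rep_fg w") auto

lemma fg_act_0: "fg_act p q 0 c = c"
  by (simp add: fg_act_def zero_fg.rep_eq)

lemma fg_act_gen: "fg_act p q (gen s) c = p s c"
  by (simp add: fg_act_def gen.rep_eq)

lemma fg_act_plus:
  assumes "\<And>s c. p s (q s c) = c" "\<And>s c. q s (p s c) = c"
  shows "fg_act p q (u + v) c = fg_act p q u (fg_act p q v c)"
  by (induction u rule: fg_letter_induct)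
    (simp_all add: fg_act_0 add.assoc fg_act_letter[of p q, OF assms])

text \<open>The universal property, obtained by letting the free group act on the target by left
  translations and following the point 0.\<close>

definition fg_lift :: "('a \<Rightarrow> 'b::group_add) \<Rightarrow> 'a fg \<Rightarrow> 'b" where
  "fg_lift f w = fg_act (\<lambda>s x. f s + x) (\<lambda>s x. - f s + x) w 0"

lemma group_add_simps:
  fixes a b :: "'a::group_add"
  shows "a + (- a + b) = b" "- a + (a + b) = b"
  by (simp_all add: add.assoc[symmetric])

lemma fg_lift_0 [simp]: "fg_lift f 0 = 0"
  and fg_lift_gen [simp]: "fg_lift f (gen s) = f s"
  by (simp_all add: fg_lift_def fg_act_0 fg_act_gen)

lemma fg_lift_letter: "fg_lift f (letter l + w) = (if snd l then f (fst l) else - f (fst l)) + fg_lift f w"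
  unfolding fg_lift_def by (subst fg_act_letter) (auto simp: group_add_simps)

lemma fg_lift_plus [simp]: "fg_lift f (u + v) = fg_lift f u + fg_lift f v"
  by (induction u rule: fg_letter_induct) (simp_all add: add.assoc fg_lift_letter)

lemma fg_lift_uminus [simp]: "fg_lift f (- u) = - fg_lift f u"
  using fg_lift_plus[of f "- u" u] by (simp add: eq_neg_iff_add_eq_0)

lemma fg_lift_diff [simp]: "fg_lift f (u - v) = fg_lift f u - fg_lift f v"
  using fg_lift_plus[of f u "- v"] by simp

lemma hom_uminus:
  fixes f :: "'a::group_add \<Rightarrow> 'b::group_add"
  assumes "\<And>x y. f (x + y) = f x + f y"
  shows "f 0 = 0" "f (- x) = - f x" "f (x - y) = f x - f y"
proof -
  show 0: "f 0 = 0" using assms[of 0 0] by (metis add_0 add_right_imp_eq)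
  show u: "f (- x) = - f x" for x using assms[of "- x" x] 0 by (simp add: eq_neg_iff_add_eq_0)
  show "f (x - y) = f x - f y" using assms[of x "- y"] u[of y] by simp
qed

lemma fg_hom_eqI:
  fixes f g :: "'a fg \<Rightarrow> 'b::group_add"
  assumes "\<And>x y. f (x + y) = f x + f y" "\<And>x y. g (x + y) = g x + g y" "\<And>s. f (gen s) = g (gen s)"
  shows "f w = g w"
  by (induction w rule: fg_induct) (simp_all add: assms hom_uminus[of f, OF assms(1)] hom_uminus[of g, OF assms(2)])

section \<open>Resolutions of extensions by free groups\<close>

text \<open>The part of \<open>free_resolution\<close> that does not mention the group, kept apart
  because the acting group grows with every cone.\<close>

locale acyclic_complex =
  fixes X :: "nat \<Rightarrow> 'x set" and d s :: "('x \<Rightarrow>\<^sub>0 rat) \<Rightarrow> ('x \<Rightarrow>\<^sub>0 rat)" and x0 :: 'x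
  assumes d_lin: "lin_map d"
    and d_mem: "\<And>x k. x \<in> X (Suc k) \<Longrightarrow> d (cell x) \<in> chains_on (X k)"
    and d_0: "\<And>x. x \<in> X 0 \<Longrightarrow> d (cell x) = 0"
    and d_d: "\<And>x k. x \<in> X k \<Longrightarrow> d (d (cell x)) = 0"
    and aug_d: "\<And>x. x \<in> X (Suc 0) \<Longrightarrow> aug (d (cell x)) = 0"
    and s: "graded_map X (shift X) s"
    and d_s: "\<And>x k. x \<in> X (Suc k) \<Longrightarrow> d (s (cell x)) + s (d (cell x)) = cell x"
    and d_s_0: "\<And>x. x \<in> X 0 \<Longrightarrow> d (s (cell x)) = cell x - cell x0"
    and x0: "x0 \<in> X 0"
begin

lemma s_lin: "lin_map s"
  by (rule graded_map_lin[OF s])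

lemma d_chain: "c \<in> chains_on (X k) \<Longrightarrow> \<exists>j. d c \<in> chains_on (X j)"
proof (cases k)
  case 0
  assume c: "c \<in> chains_on (X k)"
  have "d c = 0" by (rule lin_map_eqI[OF d_lin lin_map_zero _ c]) (simp add: 0 d_0)
  then show ?thesis by (auto intro: chains_0)
next
  case (Suc j)
  assume c: "c \<in> chains_on (X k)"
  have "d c \<in> chains_on (X j)" by (rule lin_map_mem[OF d_lin _ c]) (simp add: Suc d_mem)
  then show ?thesis by blast
qed

lemma d_d_chain: "c \<in> chains_on (X k) \<Longrightarrow> d (d c) = 0"
  by (rule lin_map_eqI[OF lin_map_comp[OF d_lin d_lin] lin_map_zero]) (auto simp: d_d)

lemma d_s_chain:
  assumes c: "c \<in> chains_on (X (Suc k))"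
  shows "d (s c) + s (d c) = c"
  by (rule lin_map_eqI[OF _ _ _ c]) (use d_lin s_lin in \<open>auto simp: lin_simps algebra_simps d_s\<close>)

lemma d_s_chain_0:
  assumes c: "c \<in> chains_on (X 0)"
  shows "d (s c) = c - push (\<lambda>_. x0) (aug c)"
  by (rule lin_map_eqI[OF _ _ _ c]) (use d_lin s_lin in \<open>auto simp: lin_simps algebra_simps d_s_0\<close>)

end

text \<open>The free group acts by augmentation-preserving chain maps, not by permutations of cells:
  this is all that automorphisms of a free group provide on its Cayley tree.\<close>

locale cone = acyclic_complex X d s x0 for X :: "nat \<Rightarrow> 'x set" and d s x0 +
  fixes A :: "'s fg \<Rightarrow> ('x \<Rightarrow>\<^sub>0 rat) \<Rightarrow> ('x \<Rightarrow>\<^sub>0 rat)"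
  assumes A: "\<And>w. graded_map X X (A w)"
    and A_0: "\<And>c k. c \<in> chains_on (X k) \<Longrightarrow> A 0 c = c"
    and A_plus: "\<And>c k u v. c \<in> chains_on (X k) \<Longrightarrow> A (u + v) c = A u (A v c)"
    and A_d: "\<And>c k w. c \<in> chains_on (X k) \<Longrightarrow> A w (d c) = d (A w c)"
    and A_aug: "\<And>c w. c \<in> chains_on (X 0) \<Longrightarrow> aug (A w c) = aug c"
begin

definition vtx :: "'s fg \<Rightarrow> ('x \<Rightarrow>\<^sub>0 rat) \<Rightarrow> ('s fg \<times> 's option \<times> 'x \<Rightarrow>\<^sub>0 rat)" where
  "vtx w = push (\<lambda>p. (w, None, p))"

definition edge :: "'s fg \<Rightarrow> 's \<Rightarrow> ('x \<Rightarrow>\<^sub>0 rat) \<Rightarrow> ('s fg \<times> 's option \<times> 'x \<Rightarrow>\<^sub>0 rat)" where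
  "edge w t = push (\<lambda>p. (w, Some t, p))"

definition trans :: "'s fg \<Rightarrow> ('s fg \<times> 's option \<times> 'x \<Rightarrow>\<^sub>0 rat) \<Rightarrow> ('s fg \<times> 's option \<times> 'x \<Rightarrow>\<^sub>0 rat)" where
  "trans u = push (\<lambda>(w, o', p). (u + w, o', p))"

definition cone_cells :: "nat \<Rightarrow> ('s fg \<times> 's option \<times> 'x) set" where
  "cone_cells k = {(w, o', p). case o' of None \<Rightarrow> p \<in> X k | Some _ \<Rightarrow> \<exists>j. k = Suc j \<and> p \<in> X j}"

text \<open>The fibre over each vertex of the Cayley tree is a copy of the complex in coordinates
  relative to that vertex, so an edge labelled \<open>t\<close> glues a cell at \<open>w\<close> to
  its image under \<open>- gen t\<close> at \<open>w + gen t\<close>.\<close>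

definition cone_d where
  "cone_d = lin (\<lambda>(w, o', p). case o' of None \<Rightarrow> vtx w (d (cell p))
     | Some t \<Rightarrow> vtx (w + gen t) (A (- gen t) (cell p)) - vtx w (cell p) - edge w t (d (cell p)))"

text \<open>The chain swept out by \<open>c\<close> when it is transported from \<open>w\<close> to \<open>0\<close> along the geodesic in
  the Cayley tree.\<close>

primrec sweep_word :: "('s \<times> bool) list \<Rightarrow> ('x \<Rightarrow>\<^sub>0 rat) \<Rightarrow> ('s fg \<times> 's option \<times> 'x \<Rightarrow>\<^sub>0 rat)" where
  "sweep_word [] c = 0"
| "sweep_word (l # w) c = (if snd l then edge 0 (fst l) (A (gen (fst l) + word w) c)
     else - edge (- gen (fst l)) (fst l) (A (word w) c)) + trans (letter l) (sweep_word w c)"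

definition sweep :: "'s fg \<Rightarrow> ('x \<Rightarrow>\<^sub>0 rat) \<Rightarrow> ('s fg \<times> 's option \<times> 'x \<Rightarrow>\<^sub>0 rat)" where
  "sweep w = sweep_word (Rep_fg w)"

text \<open>A cell over a vertex is swept to the fibre over 0 and contracted there by
  \<open>s\<close>. Cells over edges go to 0, since the sweeps of their two ends already differ by
  the cell itself.\<close>

definition cone_s where
  "cone_s = lin (\<lambda>(w, o', p). case o' of None \<Rightarrow> sweep w (cell p) + vtx 0 (s (A w (cell p))) | Some _ \<Rightarrow> 0)"

lemma lins' [simp]: "lin_map (vtx w)" "lin_map (edge w t)" "lin_map (trans w)" "lin_map cone_d" "lin_map cone_s"
  by (simp_all add: vtx_def edge_def trans_def cone_d_def cone_s_def lin_map_push lin_map_lin)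

lemma A_lin: "lin_map (A w)"
  by (rule graded_map_lin[OF A])

lemma A_mem: "c \<in> chains_on (X k) \<Longrightarrow> A w c \<in> chains_on (X k)"
  by (rule graded_map_mem[OF A])

lemmas lin_simps' = lins'[THEN lin_map_add] lins'[THEN lin_map_diff] lins'[THEN lin_map_0]
  lins'[THEN lin_map_uminus] lins'[THEN lin_map_scale]

lemma trans_vtx [simp]: "trans u (vtx w c) = vtx (u + w) c"
  and trans_edge [simp]: "trans u (edge w t c) = edge (u + w) t c"
  and trans_trans [simp]: "trans u (trans v b) = trans (u + v) b"
  and trans_0 [simp]: "trans 0 b = b"
  by (simp_all add: trans_def vtx_def edge_def push_push case_prod_unfold add.assoc)
    (rule push_id[of UNIV], simp_all add: chains_on_def)

lemma sweep_word_lin: "lin_map (sweep_word w)"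
proof (induction w)
  case (Cons l w)
  then show ?case using A_lin
    by (auto simp: lin_map_def lin_simps' chain_scale_add_right chain_scale_minus_right)
qed (simp add: lin_map_zero)

lemma sweep_lin: "lin_map (sweep w)"
  by (simp add: sweep_def sweep_word_lin)

lemma sweep_word_append:
  assumes c: "c \<in> chains_on (X k)"
  shows "sweep_word (u @ v) c = sweep_word u (A (word v) c) + trans (word u) (sweep_word v c)"
proof -
  have A_word: "A (a + word v) c = A a (A (word v) c)" for a
    by (rule A_plus[OF c])
  have A_word': "A (a + (b + word v)) c = A (a + b) (A (word v) c)" for a b
    by (simp add: A_word flip: add.assoc)
  show ?thesis
  by (induction u) (auto simp: lin_simps' word_append add.assoc A_word A_word')
qed

lemma sweep_word_Rep:
  assumes c: "c \<in> chains_on (X k)"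
  shows "sweep_word (Rep_fg (word w)) c = sweep_word w c"
proof -
  \<comment> \<open>The word is carried along in the pair, because the sweep of \<open>l # w\<close>
    depends on the group element \<open>word w\<close> as well.\<close>
  have "(sweep_word (Rep_fg (word w)) c, word (Rep_fg (word w))) = (sweep_word w c, word w)"
  proof (rule word_respects[of "\<lambda>w. (sweep_word w c, word w)"])
    fix l :: "'s \<times> bool" and w
    show "(sweep_word (l # flip l # w) c, word (l # flip l # w)) = (sweep_word w c, word w)"
      by (cases l; cases "snd l") (auto simp: lin_simps' letter_def group_add_simps add.assoc[symmetric])
  qed auto
  then show ?thesis by simp
qed

lemma sweep_0 [simp]: "sweep 0 c = 0"
  by (simp add: sweep_def zero_fg.rep_eq)

text \<open>A cocycle rule: the geodesic of a product differs from the concatenated path only by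
  backtracking, and the sweeps along a letter and its inverse cancel.\<close>

lemma sweep_plus:
  assumes c: "c \<in> chains_on (X k)"
  shows "sweep (u + v) c = sweep u (A v c) + trans u (sweep v c)"
proof -
  have "sweep (u + v) c = sweep_word (Rep_fg u @ Rep_fg v) c"
    using sweep_word_Rep[OF c, of "Rep_fg u @ Rep_fg v"] by (simp add: sweep_def word_append word_Rep)
  then show ?thesis by (simp add: sweep_word_append[OF c] word_Rep sweep_def)
qed

lemma sweep_gen: "sweep (gen t) c = edge 0 t (A (gen t) c)"
  by (simp add: sweep_def gen.rep_eq lin_simps')

lemma cone_d_vtx: "cone_d (vtx w c) = vtx w (d c)"
proof (rule lin_map_eqI[of "\<lambda>c. cone_d (vtx w c)" "\<lambda>c. vtx w (d c)" UNIV])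
  show "lin_map (\<lambda>c. vtx w (d c))" by (rule lin_map_comp[OF _ d_lin]) simp
qed (auto simp: lin_map_comp vtx_def cone_d_def chains_on_def)

lemma cone_d_edge: "cone_d (edge w t c) = vtx (w + gen t) (A (- gen t) c) - vtx w c - edge w t (d c)"
proof (rule lin_map_eqI[of "\<lambda>c. cone_d (edge w t c)"
      "\<lambda>c. vtx (w + gen t) (A (- gen t) c) - vtx w c - edge w t (d c)" UNIV])
  show "lin_map (\<lambda>c. vtx (w + gen t) (A (- gen t) c) - vtx w c - edge w t (d c))"
    using A_lin[of "- gen t"] d_lin by (simp add: lin_map_def lin_simps' chain_scale_diff_right)
qed (auto simp: lin_map_comp edge_def cone_d_def chains_on_def)

lemma cone_d_trans: "cone_d (trans u b) = trans u (cone_d b)"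
proof (rule lin_map_eqI[of "\<lambda>b. cone_d (trans u b)" "\<lambda>b. trans u (cone_d b)" UNIV])
  fix x :: "'s fg \<times> 's option \<times> 'x"
  obtain w o' p where x: "x = (w, o', p)" by (cases x)
  show "cone_d (trans u (cell x)) = trans u (cone_d (cell x))"
  proof (cases o')
    case None
    then have "cell x = vtx w (cell p)" by (simp add: x vtx_def)
    then show ?thesis by (simp add: cone_d_vtx)
  next
    case (Some t)
    then have "cell x = edge w t (cell p)" by (simp add: x edge_def)
    then show ?thesis by (simp add: cone_d_edge lin_simps' add.assoc)
  qed
qed (auto simp: lin_map_comp chains_on_def)

lemma cone_s_vtx: "cone_s (vtx w c) = sweep w c + vtx 0 (s (A w c))"
proof (rule lin_map_eqI[of "\<lambda>c. cone_s (vtx w c)" "\<lambda>c. sweep w c + vtx 0 (s (A w c))" UNIV])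
  show "lin_map (\<lambda>c. sweep w c + vtx 0 (s (A w c)))"
    using A_lin[of w] s_lin sweep_lin[of w] by (simp add: lin_map_def lin_simps' chain_scale_add_right)
qed (auto simp: lin_map_comp vtx_def cone_s_def chains_on_def)

lemma cone_s_edge: "cone_s (edge w t c) = 0"
proof (rule lin_map_eqI[of "\<lambda>c. cone_s (edge w t c)" "\<lambda>_. 0" UNIV])
qed (auto simp: lin_map_comp lin_map_zero edge_def cone_s_def chains_on_def)

text \<open>The prism formula: the boundary of a swept chain is the difference of its ends minus the
  sweep of the boundary; the intermediate ends telescope along the word.\<close>

lemma cone_d_sweep:
  assumes c: "c \<in> chains_on (X k)"
  shows "cone_d (sweep w c) = vtx w c - vtx 0 (A w c) - sweep w (d c)"
proof -
  obtain j where dc: "d c \<in> chains_on (X j)" using d_chain[OF c] by blast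
  have Ag: "A (- gen t) (A (gen t + v) c) = A v c" for t v
    using A_plus[OF c, of "- gen t" "gen t + v"] by (simp add: group_add_simps)
  have "cone_d (sweep_word v c) = vtx (word v) c - vtx 0 (A (word v) c) - sweep_word v (d c)" for v
  proof (induction v)
    case Nil
    then show ?case by (simp add: lin_simps' A_0[OF c])
  next
    case (Cons l v)
    obtain t b where l: "l = (t, b)" by fastforce
    show ?case
      using Cons by (cases b)
       (simp_all add: l lin_simps' letter_def cone_d_edge cone_d_trans Ag A_d[OF c] A_plus[OF c, of "- gen t" "word v"])
  qed
  from this[of "Rep_fg w"] show ?thesis by (simp add: word_Rep sweep_def)
qed

lemma vtx_mem: "c \<in> chains_on (X k) \<Longrightarrow> vtx w c \<in> chains_on (cone_cells k)"
  unfolding vtx_def by (rule push_mem[of "X k"]) (auto simp: cone_cells_def)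

lemma edge_mem: "c \<in> chains_on (X k) \<Longrightarrow> edge w t c \<in> chains_on (cone_cells (Suc k))"
  unfolding edge_def by (rule push_mem[of "X k"]) (auto simp: cone_cells_def)

lemma trans_mem: "b \<in> chains_on (cone_cells k) \<Longrightarrow> trans u b \<in> chains_on (cone_cells k)"
  unfolding trans_def by (rule push_mem[of "cone_cells k"]) (auto simp: cone_cells_def split: option.splits)

lemma sweep_mem: "c \<in> chains_on (X k) \<Longrightarrow> sweep w c \<in> chains_on (cone_cells (Suc k))"
proof -
  assume c: "c \<in> chains_on (X k)"
  have "sweep_word v c \<in> chains_on (cone_cells (Suc k))" for v
    by (induction v) (auto intro!: chains_intros edge_mem trans_mem A_mem c)
  then show ?thesis by (simp add: sweep_def)
qed

lemma cone_cell_cases: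
  assumes "x \<in> cone_cells k"
  obtains (vtx) w p where "cell x = vtx w (cell p)" "p \<in> X k" "x = (w, None, p)"
    | (edge) w t p j where "cell x = edge w t (cell p)" "k = Suc j" "p \<in> X j" "x = (w, Some t, p)"
  using assms by (cases x) (auto simp: cone_cells_def vtx_def edge_def split: option.splits)

lemma aug_vtx [simp]: "aug (vtx w c) = aug c"
  by (simp add: vtx_def push_push)

lemma A_inv: "c \<in> chains_on (X k) \<Longrightarrow> A u (A (- u) c) = c"
  using A_plus[of c k u "- u"] A_0 by simp

lemma acyclic_cone: "acyclic_complex cone_cells cone_d cone_s (0, None, x0)"
proof
  show "lin_map cone_d" by simp
  show "(0, None, x0) \<in> cone_cells 0" by (simp add: cone_cells_def x0)
  show "graded_map cone_cells (shift cone_cells) cone_s"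
  proof (rule graded_mapI)
    fix k x assume "x \<in> cone_cells k"
    then show "cone_s (cell x) \<in> chains_on (cone_cells (Suc k))"
      by (cases rule: cone_cell_cases)
        (auto simp: cone_s_vtx cone_s_edge intro!: chains_add sweep_mem vtx_mem graded_map_mem[OF s] A_mem)
  qed simp
  fix x k
  show "cone_d (cell x) \<in> chains_on (cone_cells k)" if "x \<in> cone_cells (Suc k)"
    using that
  proof (cases rule: cone_cell_cases)
    case (edge w t p j)
    have "edge w t (d (cell p)) \<in> chains_on (cone_cells k)"
    proof (cases j)
      case 0
      then show ?thesis using edge by (simp add: d_0 lin_simps')
    next
      case (Suc i)
      then show ?thesis using edge edge_mem[of "d (cell p)" i] by (simp add: d_mem)
    qed
    then show ?thesis
      using edge by (auto simp: cone_d_edge intro!: chains_diff vtx_mem A_mem)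
  qed (auto simp: cone_d_vtx intro!: vtx_mem d_mem)
  show "cone_d (cell x) = 0" if "x \<in> cone_cells 0"
    using that by (cases rule: cone_cell_cases) (auto simp: cone_d_vtx d_0 lin_simps')
  show "cone_d (cone_d (cell x)) = 0" if "x \<in> cone_cells k"
    using that
    by (cases rule: cone_cell_cases) (auto simp: cone_d_vtx cone_d_edge lin_simps' d_d A_d[of "cell _"])
  show "aug (cone_d (cell x)) = 0" if "x \<in> cone_cells (Suc 0)"
    using that
    by (cases rule: cone_cell_cases) (auto simp: cone_d_vtx cone_d_edge lin_simps' pushs aug_d d_0 A_aug)
  show "cone_d (cone_s (cell x)) = cell x - cell (0, None, x0)" if "x \<in> cone_cells 0"
    using that
  proof (cases rule: cone_cell_cases)
    case (vtx w p)
    then have "A w (cell p) \<in> chains_on (X 0)" by (simp add: A_mem)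
    then have "d (s (A w (cell p))) = A w (cell p) - cell x0"
      using vtx A_aug[of "cell p" w] by (simp add: d_s_chain_0)
    moreover have "cell (0, None, x0) = vtx 0 (cell x0)" by (simp add: vtx_def)
    ultimately show ?thesis
      using vtx by (simp add: cone_s_vtx lin_simps' cone_d_vtx cone_d_sweep[of _ 0] d_0 lin_map_0[OF sweep_lin])
  qed simp
  show "cone_d (cone_s (cell x)) + cone_s (cone_d (cell x)) = cell x" if "x \<in> cone_cells (Suc k)"
    using that
  proof (cases rule: cone_cell_cases)
    case (vtx w p)
    then have p: "cell p \<in> chains_on (X (Suc k))" by simp
    let ?a = "A w (cell p)"
    have 1: "cone_d (cone_s (cell x)) = vtx w (cell p) - vtx 0 ?a - sweep w (d (cell p)) + vtx 0 (d (s ?a))"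
      by (simp add: vtx(1) cone_s_vtx cone_d_vtx lin_simps' cone_d_sweep[OF p])
    have 2: "cone_s (cone_d (cell x)) = sweep w (d (cell p)) + vtx 0 (s (d ?a))"
      by (simp add: vtx(1) cone_s_vtx cone_d_vtx A_d[OF p])
    have 3: "vtx 0 (d (s ?a)) = vtx 0 ?a - vtx 0 (s (d ?a))"
      using d_s_chain[OF A_mem[OF p, of w]] lin_map_diff[OF lins'(1), of 0 ?a "s (d ?a)"]
      by (metis add_diff_cancel_right')
    show ?thesis unfolding 1 2 unfolding 3 vtx(1) by simp
  next
    case (edge w t p j)
    then have p: "cell p \<in> chains_on (X j)" by simp
    have "A (w + gen t) (A (- gen t) (cell p)) = A w (cell p)"
      using A_plus[OF p, of "w + gen t" "- gen t"] by simp
    \<comment> \<open>The cocycle rule makes the two sweeps differ by exactly the given edge cell;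
      the contractions in the fibre over 0 agree and cancel.\<close>
    then show ?thesis
      using sweep_plus[OF A_mem[OF p], of w "gen t" "- gen t"] A_inv[OF p]
      by (simp add: edge(1) cone_s_edge cone_d_edge lin_simps' cone_s_vtx sweep_gen)
  qed
qed

end

section \<open>The Cayley tree of a free group\<close>

definition point_cells :: "nat \<Rightarrow> unit set" where
  "point_cells k = (if k = 0 then UNIV else {})"

lemma acyclic_point: "acyclic_complex point_cells (\<lambda>_. 0) (\<lambda>_. 0) ()"
  by unfold_locales (auto simp: point_cells_def graded_map_def)

text \<open>The cone over a point is the Cayley tree: vertices are group elements, and an edge
  labelled \<open>t\<close> runs from \<open>w\<close> to \<open>w + gen t\<close>.\<close>

interpretation tree: cone point_cells "\<lambda>_. 0" "\<lambda>_. 0" "()" "\<lambda>_ c. c"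
  by (intro cone.intro acyclic_point) (unfold_locales, auto simp: graded_map_def)

section \<open>Braid groups: combing and the level 4 condition\<close>

section \<open>Braid groups as types\<close>

text \<open>Only the cardinality of the parameter matters.\<close>

typedef 'n braid = "carrier (braid_group CARD('n))"
  using group.is_monoid[OF group_braid_group] monoid.one_closed by blast

setup_lifting type_definition_braid

instantiation braid :: (type) group_add
begin

lift_definition zero_braid :: "'a braid" is "\<one>\<^bsub>braid_group CARD('a)\<^esub>"
  by (simp add: group.is_monoid[OF group_braid_group] monoid.one_closed)

lift_definition plus_braid :: "'a braid \<Rightarrow> 'a braid \<Rightarrow> 'a braid" is "\<lambda>x y. x \<otimes>\<^bsub>braid_group CARD('a)\<^esub> y"
  by (simp add: group.is_monoid[OF group_braid_group] monoid.m_closed)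

lift_definition uminus_braid :: "'a braid \<Rightarrow> 'a braid" is "\<lambda>x. inv\<^bsub>braid_group CARD('a)\<^esub> x"
  by (simp add: group.inv_closed[OF group_braid_group])

definition minus_braid :: "'a braid \<Rightarrow> 'a braid \<Rightarrow> 'a braid" where
  "minus_braid x y = x + - y"

instance
proof
  fix a b c :: "'a braid"
  interpret group "braid_group CARD('a)" by (rule group_braid_group)
  show "a + b + c = a + (b + c)" by transfer (rule m_assoc)
  show "0 + a = a" by transfer simp
  show "a + 0 = a" by transfer simp
  show "- a + a = 0" by transfer simp
  show "a + - b = a - b" by (simp add: minus_braid_def)
qed

end

definition braid_of :: "braid_word \<Rightarrow> 'n braid" where
  "braid_of u = Abs_braid (braid_rel CARD('n) `` {u})"

lemma Rep_braid_of:
  "u \<in> braid_words CARD('n) \<Longrightarrow> Rep_braid (braid_of u :: 'n braid) = braid_rel CARD('n) `` {u}"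
  by (simp add: braid_of_def Abs_braid_inverse braid_group_carrierI)

lemma braid_of_append:
  assumes "u \<in> braid_words CARD('n)" "v \<in> braid_words CARD('n)"
  shows "(braid_of (u @ v) :: 'n braid) = braid_of u + braid_of v"
  using assms by (simp add: Rep_braid_inject[symmetric] plus_braid.rep_eq Rep_braid_of braid_words_app
      braid_group_mult)

lemma Nil_braid_words [simp]: "[] \<in> braid_words n"
  by (simp add: braid_words_def)

lemma Cons_braid_words [simp]: "l # w \<in> braid_words n \<longleftrightarrow> 1 \<le> fst l \<and> fst l < n \<and> w \<in> braid_words n"
  by (cases l) (auto simp: braid_words_def)

lemma append_braid_words [simp]: "u @ v \<in> braid_words n \<longleftrightarrow> u \<in> braid_words n \<and> v \<in> braid_words n"
  by (auto simp: braid_words_def)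

lemma braid_of_Nil [simp]: "(braid_of [] :: 'n braid) = 0"
  by (simp add: Rep_braid_inject[symmetric] zero_braid.rep_eq Rep_braid_of) (simp add: braid_group_def)

lemma braid_of_eq_iff:
  assumes "u \<in> braid_words CARD('n)" "v \<in> braid_words CARD('n)"
  shows "(braid_of u :: 'n braid) = braid_of v \<longleftrightarrow> braid_equiv CARD('n) u v"
proof -
  have "(braid_of u :: 'n braid) = braid_of v \<longleftrightarrow> braid_rel CARD('n) `` {u} = braid_rel CARD('n) `` {v}"
    using assms by (simp add: Rep_braid_inject[symmetric] Rep_braid_of)
  also have "\<dots> \<longleftrightarrow> (u, v) \<in> braid_rel CARD('n)"
    by (rule eq_equiv_class_iff[OF equiv_braid_rel assms])
  finally show ?thesis by (simp add: braid_rel_def)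
qed

definition sig :: "nat \<Rightarrow> 'n braid" where
  "sig i = braid_of [(i, True)]"

lemma braid_of_inv: "1 \<le> i \<Longrightarrow> i < CARD('n) \<Longrightarrow> (braid_of [(i, False)] :: 'n braid) = - sig i"
proof -
  assume i: "1 \<le> i" "i < CARD('n)"
  have "(braid_of [(i, True), (i, \<not> True)] :: 'n braid) = braid_of []"
    using i by (subst braid_of_eq_iff) (auto intro: braid_equiv.cancel simp del: not_True_eq_False)
  then have "sig i + (braid_of [(i, False)] :: 'n braid) = 0"
    using i by (simp add: sig_def flip: braid_of_append)
  then show ?thesis by (metis minus_unique)
qed

section \<open>Artin combing\<close>

definition gen_word :: "(nat \<Rightarrow> 'g::group_add) \<Rightarrow> braid_word \<Rightarrow> 'g" where
  "gen_word s w = foldr (\<lambda>l x. (if snd l then s (fst l) else - s (fst l)) + x) w 0"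

lemma gen_word_simps [simp]: "gen_word s [] = 0"
  "gen_word s (l # w) = (if snd l then s (fst l) else - s (fst l)) + gen_word s w"
  by (simp_all add: gen_word_def)

lemma gen_word_append: "gen_word s (u @ v) = gen_word s u + gen_word s v"
  by (induction u) (auto simp: add.assoc)

lemma braid_of_gen_word: "u \<in> braid_words CARD('n) \<Longrightarrow> (braid_of u :: 'n braid) = gen_word sig u"
proof (induction u)
  case (Cons l u)
  obtain i b where l: "l = (i, b)" by fastforce
  have "(braid_of (l # u) :: 'n braid) = braid_of [l] + braid_of u"
    using Cons.prems braid_of_append[of "[l]" u, where 'n='n] by (simp add: l)
  then show ?case using Cons by (cases b) (auto simp: l sig_def braid_of_inv[unfolded sig_def])
qed simp

locale braid_gens =
  fixes s :: "nat \<Rightarrow> 'g::group_add" and n :: nat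
  assumes far: "\<And>i j. 1 \<le> i \<Longrightarrow> i + 2 \<le> j \<Longrightarrow> j \<le> n \<Longrightarrow> s i + s j = s j + s i"
    and braid: "\<And>i. 1 \<le> i \<Longrightarrow> i < n \<Longrightarrow> s i + (s (Suc i) + s i) = s (Suc i) + (s i + s (Suc i))"
begin

primrec tau' :: "nat \<Rightarrow> 'g" where
  "tau' 0 = 0"
| "tau' (Suc d) = tau' d + s (n - d)"

text \<open>\<open>tau p\<close> is \<open>s n + ... + s p\<close>, the transversal element that
  joins the last position to position \<open>p\<close>; \<open>tau (Suc n)\<close> is the empty
  sum.\<close>

definition "tau p = tau' (Suc n - p)"

lemma tau_top [simp]: "tau (Suc n) = 0"
  by (simp add: tau_def)

lemma tau_step: "p \<le> n \<Longrightarrow> tau p = tau (Suc p) + s p"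
  by (simp add: tau_def Suc_diff_le)

lemma commute': "a + b = b + a \<Longrightarrow> a + (b + c) = b + (a + (c::'g))"
  by (simp add: add.assoc[symmetric])

lemma tau_below: "1 \<le> i \<Longrightarrow> Suc i < p \<Longrightarrow> p \<le> Suc n \<Longrightarrow> tau p + s i = s i + tau p"
proof (induction "Suc n - p" arbitrary: p)
  case (Suc d)
  then have p: "p \<le> n" and IH: "tau (Suc p) + s i = s i + tau (Suc p)" by auto
  have "tau p + s i = tau (Suc p) + (s i + s p)"
    using far[of i p] Suc.prems p by (simp add: tau_step add.assoc)
  also have "\<dots> = s i + tau p" using commute'[OF IH] p by (simp add: tau_step)
  finally show ?case .
qed simp

text \<open>A letter pushed through the descending sum loses one index: it commutes with the low
  terms, and one braid relation is spent where the letter meets its neighbour.\<close>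

lemma tau_above: "1 \<le> p \<Longrightarrow> p < i \<Longrightarrow> i \<le> n \<Longrightarrow> tau p + s i = s (i - 1) + tau p"
proof (induction "i - p" arbitrary: p)
  case (Suc d)
  show ?case
  proof (cases "i = Suc p")
    case True
    have "tau p + s i = tau (Suc (Suc p)) + (s (Suc p) + (s p + s (Suc p)))"
      using True Suc.prems by (simp add: tau_step add.assoc)
    also have "\<dots> = tau (Suc (Suc p)) + (s p + (s (Suc p) + s p))"
      using braid[of p] Suc.prems True by simp
    also have "\<dots> = s p + tau p"
      using True Suc.prems commute'[OF tau_below[of p "Suc (Suc p)"]] by (simp add: tau_step add.assoc)
    finally show ?thesis using True by simp
  next
    case False
    then have IH: "tau (Suc p) + s i = s (i - 1) + tau (Suc p)"
      using Suc by auto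
    have "tau p + s i = tau (Suc p) + (s i + s p)"
      using far[of p i] Suc.prems False by (simp add: tau_step add.assoc)
    also have "\<dots> = s (i - 1) + tau p"
      using IH Suc.prems by (simp add: tau_step add.assoc[symmetric])
    finally show ?thesis .
  qed
qed simp

text \<open>The standard pure braid in which the last strand encircles strand \<open>j\<close>:
  \<open>s j\<close> taken twice, conjugated by the transversal.\<close>

definition "A j = tau (Suc j) + s j + s j - tau (Suc j)"

lemma A_tau: "j \<le> n \<Longrightarrow> A j + tau (Suc j) = tau j + s j"
  by (simp add: A_def tau_step)

lemma right_cancel: "a + c = b + (c::'g) \<Longrightarrow> a = b"
  by simp

lemma A_far_below: "1 \<le> i \<Longrightarrow> Suc i < j \<Longrightarrow> j \<le> n \<Longrightarrow> s i + A j = A j + s i"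
proof (rule right_cancel[of _ "tau (Suc j)"])
  assume i: "1 \<le> i" "Suc i < j" "j \<le> n"
  have "s i + A j + tau (Suc j) = s i + tau j + s j" using A_tau i by (simp add: add.assoc)
  also have "\<dots> = tau j + (s i + s j)" using tau_below[of i j] i by (simp add: add.assoc[symmetric])
  also have "\<dots> = A j + tau (Suc j) + s i" using far[of i j] i A_tau[of j] by (simp add: add.assoc[symmetric])
  also have "\<dots> = A j + s i + tau (Suc j)" using tau_below[of i "Suc j"] i by (simp add: add.assoc)
  finally show "s i + A j + tau (Suc j) = A j + s i + tau (Suc j)" .
qed

lemma A_far_above: "1 \<le> j \<Longrightarrow> j < i \<Longrightarrow> i < n \<Longrightarrow> s i + A j = A j + s i"
proof (rule right_cancel[of _ "tau (Suc j)"])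
  assume i: "1 \<le> j" "j < i" "i < n"
  have "s i + A j + tau (Suc j) = s i + tau j + s j" using A_tau[of j] i by (simp add: add.assoc)
  also have "\<dots> = tau j + (s (Suc i) + s j)" using tau_above[of j "Suc i"] i by (simp add: add.assoc[symmetric])
  also have "\<dots> = tau j + (s j + s (Suc i))" using far[of j "Suc i"] i by simp
  also have "\<dots> = A j + (tau (Suc j) + s (Suc i))" using i A_tau[of j] by (simp add: add.assoc[symmetric])
  also have "\<dots> = A j + s i + tau (Suc j)" using tau_above[of "Suc j" "Suc i"] i by (simp add: add.assoc)
  finally show "s i + A j + tau (Suc j) = A j + s i + tau (Suc j)" .
qed

lemma A_same: "1 \<le> i \<Longrightarrow> i < n \<Longrightarrow> s i + A i = A (Suc i) + s i"
proof (rule right_cancel[of _ "tau (Suc i)"])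
  assume i: "1 \<le> i" "i < n"
  have "s i + A i + tau (Suc i) = s i + tau i + s i" using A_tau[of i] i by (simp add: add.assoc)
  also have "\<dots> = tau i + (s (Suc i) + s i)" using tau_above[of i "Suc i"] i by (simp add: add.assoc[symmetric])
  also have "\<dots> = tau (Suc i) + (s i + (s (Suc i) + s i))" using i by (simp add: tau_step add.assoc)
  also have "\<dots> = tau (Suc i) + (s (Suc i) + (s i + s (Suc i)))" using braid[of i] i by simp
  also have "\<dots> = A (Suc i) + (tau (Suc (Suc i)) + s i) + s (Suc i)"
    using i A_tau[of "Suc i"] by (simp add: add.assoc[symmetric])
  also have "\<dots> = A (Suc i) + s i + tau (Suc i)"
    using i tau_below[of i "Suc (Suc i)"] by (simp add: tau_step[of "Suc i"] add.assoc)
  finally show "s i + A i + tau (Suc i) = A (Suc i) + s i + tau (Suc i)" .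
qed

text \<open>\<open>s i\<close> commutes with \<open>A i + A (Suc i)\<close>, in which the last
  strand encircles both strands exchanged by \<open>s i\<close>; the rule then follows from
  \<open>A_same\<close>.\<close>

lemma A_next: "1 \<le> i \<Longrightarrow> i < n \<Longrightarrow> s i + A (Suc i) = - A (Suc i) + A i + A (Suc i) + s i"
proof -
  assume i: "1 \<le> i" "i < n"
  let ?t = "tau (Suc (Suc i))"
  have AA: "A i + A (Suc i) + ?t = tau i + (s i + s (Suc i))"
    using i A_tau[of i] A_tau[of "Suc i"] by (simp add: add.assoc) (simp add: add.assoc[symmetric])
  have "s i + (A i + A (Suc i)) + ?t = s i + tau i + (s i + s (Suc i))"
    using AA by (simp add: add.assoc)
  also have "\<dots> = tau i + (s (Suc i) + (s i + s (Suc i)))"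
    using i tau_above[of i "Suc i"] by (simp add: add.assoc[symmetric])
  also have "\<dots> = tau i + (s i + s (Suc i)) + s i" using braid[of i] i by (simp add: add.assoc)
  also have "\<dots> = A i + A (Suc i) + (?t + s i)" unfolding AA[symmetric] by (simp add: add.assoc)
  also have "\<dots> = A i + A (Suc i) + s i + ?t"
    using i tau_below[of i "Suc (Suc i)"] by (simp add: add.assoc)
  finally have "s i + (A i + A (Suc i)) = A i + A (Suc i) + s i" by simp
  then have "A (Suc i) + (s i + A (Suc i)) = A i + A (Suc i) + s i"
    using A_same[OF i] by (simp add: add.assoc[symmetric])
  then have "- A (Suc i) + (A (Suc i) + (s i + A (Suc i))) = - A (Suc i) + (A i + A (Suc i) + s i)" by simp
  then show ?thesis by (simp add: group_add_simps add.assoc)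
qed

end

text \<open>\<open>F\<^sub>n\<close> has the letters \<open>xl 1, \<dots>, xl n\<close>; the letter \<open>xl j\<close> stands for the pure braid \<open>A\<^sub>j\<^sub>,\<^sub>n\<^sub>+\<^sub>1\<close>.
  A braid on \<open>n + 1\<close> strands is combed by following one strand from position \<open>p\<close>:
  the letters that do not involve it form a braid on \<open>n\<close> strands.\<close>

locale artin =
  fixes n :: nat and xl :: "nat \<Rightarrow> 'f" and xi :: "'f \<Rightarrow> nat"
  assumes xi_xl: "\<And>j. 1 \<le> j \<Longrightarrow> j \<le> n \<Longrightarrow> xi (xl j) = j"
    and xl_xi: "\<And>x. xl (xi x) = x"
    and xi_range: "\<And>x. 1 \<le> xi x \<and> xi x \<le> n"
begin

abbreviation x where "x j \<equiv> gen (xl j)"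

text \<open>Artin's representation, read off from the conjugation rules for \<open>A j\<close>:
  \<open>x j\<close> is the formal counterpart of \<open>A j\<close>, and a letter acts as
  conjugation.\<close>

definition act_letter :: "nat \<times> bool \<Rightarrow> 'f fg \<Rightarrow> 'f fg" where
  "act_letter = (\<lambda>(i, b). fg_lift (\<lambda>y. let j = xi y in
     if b then (if j = i then x (Suc i) else if j = Suc i then - x (Suc i) + (x i + x (Suc i)) else x j)
     else (if j = i then x i + (x (Suc i) + - x i) else if j = Suc i then x i else x j)))"

definition act :: "braid_word \<Rightarrow> 'f fg \<Rightarrow> 'f fg" where
  "act w k = foldr act_letter w k"

lemma act_Nil [simp]: "act [] k = k" and act_append: "act (u @ v) k = act u (act v k)"
  and act_Cons: "act (l # u) k = act_letter l (act u k)"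
  by (simp_all add: act_def)

lemma act_letter_plus: "act_letter l (a + b) = act_letter l a + act_letter l b"
  by (cases l) (simp add: act_letter_def)

lemma act_letter_0 [simp]: "act_letter l 0 = 0" and act_letter_uminus: "act_letter l (- a) = - act_letter l a"
  by (rule hom_uminus act_letter_plus)+

lemma act_letter_diff: "act_letter l (a - b) = act_letter l a - act_letter l b"
  by (rule hom_uminus act_letter_plus)+

lemma act_plus: "act u (a + b) = act u a + act u b"
  by (induction u) (auto simp: act_Cons act_letter_plus)

lemma act_0 [simp]: "act u 0 = 0" and act_uminus: "act u (- a) = - act u a"
  by (rule hom_uminus act_plus)+

lemma act_letter_gen:
  assumes "1 \<le> i" "i < n" "1 \<le> j" "j \<le> n"
  shows "act_letter (i, True) (x j) = (if j = i then x (Suc i) else if j = Suc i then - x (Suc i) + (x i + x (Suc i)) else x j)"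
    "act_letter (i, False) (x j) = (if j = i then x i + (x (Suc i) + - x i) else if j = Suc i then x i else x j)"
  using assms by (simp_all add: act_letter_def xi_xl)

lemma hom_eqI:
  fixes f g :: "'f fg \<Rightarrow> 'h::group_add"
  assumes "\<And>a b. f (a + b) = f a + f b" "\<And>a b. g (a + b) = g a + g b"
    and "\<And>j. 1 \<le> j \<Longrightarrow> j \<le> n \<Longrightarrow> f (x j) = g (x j)"
  shows "f a = g a"
  by (rule fg_hom_eqI[of f g]) (use assms xl_xi xi_range in metis)+

lemmas act_simps = act_Cons act_letter_plus act_letter_uminus act_letter_gen add.assoc

lemma act_equiv: "braid_equiv n u v \<Longrightarrow> act u k = act v k"
proof (induction arbitrary: k rule: braid_equiv.induct)
  case (cancel i b)
  show ?case
  proof (rule hom_eqI[of "act [(i, b), (i, \<not> b)]" "act []"])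
    fix j assume "1 \<le> j" "j \<le> n"
    then show "act [(i, b), (i, \<not> b)] (x j) = act [] (x j)"
      using cancel by (cases b) (auto simp: act_simps act_letter_diff group_add_simps add_diff_eq)
  qed (simp_all add: act_plus)
next
  case (far i j)
  show ?case
  proof (rule hom_eqI[of "act [(i, True), (j, True)]" "act [(j, True), (i, True)]"])
    fix p assume "1 \<le> p" "p \<le> n"
    then show "act [(i, True), (j, True)] (x p) = act [(j, True), (i, True)] (x p)"
      using far by (auto simp: act_simps)
  qed (simp_all add: act_plus)
next
  case (braid i)
  show ?case
  proof (rule hom_eqI[of "act [(i, True), (Suc i, True), (i, True)]" "act [(Suc i, True), (i, True), (Suc i, True)]"])
    fix p assume "1 \<le> p" "p \<le> n"
    then show "act [(i, True), (Suc i, True), (i, True)] (x p) = act [(Suc i, True), (i, True), (Suc i, True)] (x p)"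
      using braid by (auto simp: act_simps minus_add group_add_simps)
        (simp add: diff_conv_add_uminus add.assoc del: add_uminus_conv_diff)
  qed (simp_all add: act_plus)
qed (auto simp: act_append)

text \<open>\<open>lp\<close>, \<open>lb\<close> and \<open>lk\<close> form a Reidemeister-Schreier
  rewriting for the transversal \<open>tau\<close>: \<open>tau p\<close> followed by a letter equals
  a free part \<open>lk\<close>, a braid \<open>lb\<close> on the other strands and
  \<open>tau\<close> at the new position \<open>lp\<close>.\<close>

definition lp :: "nat \<times> bool \<Rightarrow> nat \<Rightarrow> nat" where
  "lp l p = (if fst l = p then Suc p else if Suc (fst l) = p then fst l else p)"

definition lb :: "nat \<times> bool \<Rightarrow> nat \<Rightarrow> braid_word" where
  "lb l p = (if Suc (fst l) < p then [l] else if p < fst l then [(fst l - 1, snd l)] else [])"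

definition lk :: "nat \<times> bool \<Rightarrow> nat \<Rightarrow> 'f fg" where
  "lk l p = (if fst l = p \<and> snd l then x p else if Suc (fst l) = p \<and> \<not> snd l then - x (fst l) else 0)"

primrec comb_pos :: "braid_word \<Rightarrow> nat \<Rightarrow> nat" where
  "comb_pos [] p = p"
| "comb_pos (l # u) p = comb_pos u (lp l p)"

primrec comb_braid :: "braid_word \<Rightarrow> nat \<Rightarrow> braid_word" where
  "comb_braid [] p = []"
| "comb_braid (l # u) p = lb l p @ comb_braid u (lp l p)"

primrec comb_free :: "braid_word \<Rightarrow> nat \<Rightarrow> 'f fg" where
  "comb_free [] p = 0"
| "comb_free (l # u) p = lk l p + act (lb l p) (comb_free u (lp l p))"

lemma comb_append:
  "comb_pos (u @ v) p = comb_pos v (comb_pos u p)"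
  "comb_braid (u @ v) p = comb_braid u p @ comb_braid v (comb_pos u p)"
  "comb_free (u @ v) p = comb_free u p + act (comb_braid u p) (comb_free v (comb_pos u p))"
  by (induction u arbitrary: p) (auto simp: act_append act_plus add.assoc)

definition positions where "positions = {1..Suc n}"

lemma lp_mem: "1 \<le> fst l \<Longrightarrow> fst l \<le> n \<Longrightarrow> p \<in> positions \<Longrightarrow> lp l p \<in> positions"
  by (auto simp: lp_def positions_def)

lemma comb_pos_mem: "u \<in> braid_words (Suc n) \<Longrightarrow> p \<in> positions \<Longrightarrow> comb_pos u p \<in> positions"
  by (induction u arbitrary: p) (auto simp: lp_mem)

lemma comb_braid_mem: "u \<in> braid_words (Suc n) \<Longrightarrow> p \<in> positions \<Longrightarrow> comb_braid u p \<in> braid_words n"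
proof (induction u arbitrary: p)
  case (Cons l u)
  then have "lb l p \<in> braid_words n" by (auto simp: lb_def positions_def)
  with Cons show ?case by (auto simp: lp_mem)
qed simp

text \<open>The position of the followed strand relative to the letters decides each case. Away from
  the strand the same relation, shifted by at most one index, remains on \<open>n\<close> strands;
  when the strand takes part, both sides leave the same braid word and the same free part.\<close>

lemma comb_equiv:
  "braid_equiv (Suc n) u v \<Longrightarrow> \<forall>p\<in>positions. comb_pos u p = comb_pos v p \<and>
     comb_free u p = comb_free v p \<and> braid_equiv n (comb_braid u p) (comb_braid v p)"
proof (induction rule: braid_equiv.induct)
  case (refl w)
  then show ?case by (auto intro: braid_equiv.refl comb_braid_mem)
next
  case (sym u v)
  then show ?case by (auto intro: braid_equiv.sym)
next
  case (trans u v w)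
  then show ?case by (auto intro: braid_equiv.trans)
next
  case (app u u' v v')
  show ?case
  proof (intro ballI conjI)
    fix p assume p: "p \<in> positions"
    then have q: "comb_pos u p \<in> positions"
      using comb_pos_mem braid_equiv_words[OF app.hyps(1)] by blast
    note u = app.IH(1)[rule_format, OF p] and v = app.IH(2)[rule_format, OF q]
    show "comb_pos (u @ v) p = comb_pos (u' @ v') p" using u v by (simp add: comb_append)
    show "comb_free (u @ v) p = comb_free (u' @ v') p"
      using u v act_equiv[of "comb_braid u p" "comb_braid u' p"] by (simp add: comb_append)
    show "braid_equiv n (comb_braid (u @ v) p) (comb_braid (u' @ v') p)"
      using u v by (simp add: comb_append braid_equiv.app)
  qed
next
  case (cancel i b)
  show ?case
  proof
    fix p assume p: "p \<in> positions"
    have 1: "braid_equiv n [(j, c), (j, \<not> c)] []" if "1 \<le> j" "j < n" for j c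
      using that by (rule braid_equiv.cancel)
    consider "p < i" | "p = i" | "p = Suc i" | "Suc i < p" by linarith
    then show "comb_pos [(i, b), (i, \<not> b)] p = comb_pos [] p \<and>
       comb_free [(i, b), (i, \<not> b)] p = comb_free [] p \<and>
       braid_equiv n (comb_braid [(i, b), (i, \<not> b)] p) (comb_braid [] p)"
      using p cancel 1[of i b] 1[of "i - 1" b] braid_equiv.refl[of "[]" n]
      by cases (auto simp: lp_def lk_def lb_def positions_def)
  qed
next
  case (far i j)
  obtain q where j: "j = Suc q" using far by (cases j) auto
  show ?case
  proof
    fix p assume p: "p \<in> positions"
    have 1: "braid_equiv n [(i, True), (j, True)] [(j, True), (i, True)]" if "1 \<le> i" "i + 2 \<le> j" "j < n" for i j
      using that by (rule braid_equiv.far)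
    consider "p < i" | "p = i" | "p = Suc i" | "Suc i < p" "p < j" | "p = j" | "p = Suc j" | "Suc j < p"
      by linarith
    then show "comb_pos [(i, True), (j, True)] p = comb_pos [(j, True), (i, True)] p \<and>
       comb_free [(i, True), (j, True)] p = comb_free [(j, True), (i, True)] p \<and>
       braid_equiv n (comb_braid [(i, True), (j, True)] p) (comb_braid [(j, True), (i, True)] p)"
      using p far 1[of i j] 1[of "i - 1" q] 1[of i q] braid_equiv.refl[of "[(q, True)]" n] unfolding j

      by cases (auto simp: lp_def lk_def lb_def positions_def act_Cons act_letter_gen braid_equiv.refl)
  qed
next
  case (braid i)
  show ?case
  proof
    fix p assume p: "p \<in> positions"
    have 1: "braid_equiv n [(i, True), (Suc i, True), (i, True)] [(Suc i, True), (i, True), (Suc i, True)]"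
      if "1 \<le> i" "Suc i < n" for i
      using that by (rule braid_equiv.braid)
    consider "p < i" | "p = i" | "p = Suc i" | "p = Suc (Suc i)" | "Suc (Suc i) < p"
      by linarith
    then show "comb_pos [(i, True), (Suc i, True), (i, True)] p = comb_pos [(Suc i, True), (i, True), (Suc i, True)] p \<and>
       comb_free [(i, True), (Suc i, True), (i, True)] p = comb_free [(Suc i, True), (i, True), (Suc i, True)] p \<and>
       braid_equiv n (comb_braid [(i, True), (Suc i, True), (i, True)] p)
         (comb_braid [(Suc i, True), (i, True), (Suc i, True)] p)"
      using p braid 1[of i] 1[of "i - 1"] braid_equiv.refl[of "[(i, True)]" n]
      by cases (auto simp: lp_def lk_def lb_def positions_def act_simps group_add_simps)
  qed
qed

end

locale artin_braid = artin n xl xi + braid_gens s n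
  for n and xl :: "nat \<Rightarrow> 'f" and xi and s :: "nat \<Rightarrow> 'g::group_add"
begin

definition pure :: "'f fg \<Rightarrow> 'g" where
  "pure = fg_lift (\<lambda>y. A (xi y))"

lemma pure_gen: "1 \<le> j \<Longrightarrow> j \<le> n \<Longrightarrow> pure (x j) = A j"
  by (simp add: pure_def xi_xl)

lemma pure_simps [simp]: "pure (a + b) = pure a + pure b" "pure 0 = 0" "pure (- a) = - pure a"
  by (simp_all add: pure_def)

text \<open>The abstract action on the free group is conjugation by the braid. Positive letters are
  checked on generators, and negative ones follow by inverting.\<close>

lemma pure_act: "w \<in> braid_words n \<Longrightarrow> gen_word s w + pure k = pure (act w k) + gen_word s w"
proof (induction w arbitrary: k)
  case (Cons l w)
  obtain i b where l: "l = (i, b)" by fastforce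
  have i: "1 \<le> i" "i < n" using Cons.prems by (auto simp: l)
  have pos: "s i + pure k - s i = pure (act_letter (i, True) k)" for k
  proof (rule hom_eqI[of "\<lambda>k. s i + pure k - s i" "\<lambda>k. pure (act_letter (i, True) k)"])
    fix j assume j: "1 \<le> j" "j \<le> n"
    consider "j = i" | "j = Suc i" | "Suc i < j" | "j < i" by linarith
    then show "s i + pure (x j) - s i = pure (act_letter (i, True) (x j))"
    proof cases
      case 1
      then show ?thesis using A_same[OF i] i by (simp add: act_letter_gen pure_gen)
    next
      case 2
      then show ?thesis using A_next[OF i, THEN arg_cong, of "\<lambda>a. a - s i"] i by (simp add: act_letter_gen pure_gen) (simp add: add.assoc)
    next
      case 3
      then show ?thesis using A_far_below[of i j] i j by (simp add: act_letter_gen pure_gen)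
    next
      case 4
      then show ?thesis using A_far_above[of j i] i j by (simp add: act_letter_gen pure_gen)
    qed
  qed (simp_all add: act_letter_plus add.assoc group_add_simps diff_conv_add_uminus del: add_uminus_conv_diff)
  have inv: "act_letter (i, True) (act_letter (i, False) k) = k" for k
    using act_equiv[OF braid_equiv.cancel[OF i, of True], of k] by (simp add: act_Cons)
  have neg: "- s i + pure k + s i = pure (act_letter (i, False) k)" for k
  proof -
    have "pure k = s i + pure (act_letter (i, False) k) - s i"
      using pos[of "act_letter (i, False) k"] by (simp add: inv)
    then show ?thesis by (simp add: add_diff_eq)
  qed
  have eq: "gen_word s [l] + pure k = pure (act_letter l k) + gen_word s [l]" for k
    using pos[of k] neg[of k] by (cases b) (simp_all add: l diff_eq_eq eq_diff_eq)
  have "gen_word s (l # w) + pure k = gen_word s [l] + pure (act w k) + gen_word s w"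
    using Cons by (simp add: add.assoc)
  also have "\<dots> = pure (act (l # w) k) + gen_word s (l # w)"
    unfolding eq by (simp add: act_Cons add.assoc)
  finally show ?case .
qed simp

lemma letter_normal_form:
  assumes i: "1 \<le> i" "i \<le> n" and p: "p \<in> positions"
  shows "tau p + gen_word s [(i, b)] = pure (lk (i, b) p) + gen_word s (lb (i, b) p) + tau (lp (i, b) p)"
proof -
  have neg: "b + - a = - c + d" if "c + b = d + a" for a b c d :: 'g
    using that by (metis add.assoc add.right_inverse add.right_neutral left_minus add_0)
  consider "p < i" | "p = i" | "p = Suc i" | "Suc i < p" by linarith
  then show ?thesis
  proof cases
    case 1
    then have "tau p + s i = s (i - 1) + tau p" using tau_above[of p i] i p by (simp add: positions_def)
    then show ?thesis using 1 i neg[of "s (i - 1)" "tau p" "tau p" "s i"] by (cases b) (simp_all add: lp_def lk_def lb_def)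
  next
    case 2
    then have "tau p + s i = A p + tau (Suc p)" using A_tau[of p] i by simp
    moreover have "tau p + - s i = tau (Suc p)" using 2 i by (simp add: tau_step)
    ultimately show ?thesis using 2 i by (cases b) (simp_all add: lp_def lk_def lb_def pure_gen)
  next
    case 3
    have 1: "tau p + s i = tau i" using 3 i by (simp add: tau_step)
    have "A i + tau p = tau i + s i" using A_tau[of i] i 3 by simp
    then have "tau p + - s i = - A i + tau i" by (rule neg)
    then show ?thesis using 1 3 i by (cases b) (simp_all add: lp_def lk_def lb_def pure_gen)
  next
    case 4
    then have "tau p + s i = s i + tau p" using tau_below[of i p] i p by (simp add: positions_def)
    then show ?thesis using 4 i neg[of "s i" "tau p" "tau p" "s i"] by (cases b) (simp_all add: lp_def lk_def lb_def)
  qed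
qed

text \<open>The rewriting is applied letter by letter; \<open>pure_act\<close> moves the braid part
  already produced past the next free part.\<close>

theorem normal_form:
  "u \<in> braid_words (Suc n) \<Longrightarrow> p \<in> positions \<Longrightarrow>
    tau p + gen_word s u = pure (comb_free u p) + gen_word s (comb_braid u p) + tau (comb_pos u p)"
proof (induction u arbitrary: p)
  case (Cons l u)
  have lb: "lb l p \<in> braid_words n" using Cons.prems by (auto simp: lb_def positions_def)
  have q: "lp l p \<in> positions" using Cons.prems by (auto simp: lp_mem)
  have "tau p + gen_word s (l # u) = tau p + gen_word s [l] + gen_word s u" by (simp add: add.assoc)
  also have "\<dots> = pure (lk l p) + gen_word s (lb l p) + (tau (lp l p) + gen_word s u)"
    using letter_normal_form[of "fst l" p "snd l"] Cons.prems by (simp add: add.assoc)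
  also have "\<dots> = pure (lk l p) + (gen_word s (lb l p) + pure (comb_free u (lp l p))) +
      gen_word s (comb_braid u (lp l p)) + tau (comb_pos u (lp l p))"
    using Cons.IH[OF _ q] Cons.prems by (simp add: add.assoc)
  also have "\<dots> = pure (comb_free (l # u) p) + gen_word s (comb_braid (l # u) p) + tau (comb_pos (l # u) p)"
    unfolding pure_act[OF lb] by (simp add: add.assoc gen_word_append)
  finally show ?case .
qed simp

end

lemma braid_gens_sig: "CARD('m) = Suc n \<Longrightarrow> braid_gens (sig :: nat \<Rightarrow> 'm braid) n"
proof
  assume c: "CARD('m) = Suc n"
  fix i j assume "1 \<le> i" "i + 2 \<le> j" "j \<le> n"
  then have "(braid_of [(i, True), (j, True)] :: 'm braid) = braid_of [(j, True), (i, True)]"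
    using c by (subst braid_of_eq_iff) (auto intro: braid_equiv.far)
  then show "(sig i :: 'm braid) + sig j = sig j + sig i"
    using c \<open>1 \<le> i\<close> \<open>i + 2 \<le> j\<close> \<open>j \<le> n\<close> by (simp add: braid_of_gen_word)
next
  assume c: "CARD('m) = Suc n"
  fix i assume "1 \<le> i" "i < n"
  then have "(braid_of [(i, True), (Suc i, True), (i, True)] :: 'm braid) = braid_of [(Suc i, True), (i, True), (Suc i, True)]"
    using c by (subst braid_of_eq_iff) (auto intro: braid_equiv.braid)
  then show "(sig i :: 'm braid) + (sig (Suc i) + sig i) = sig (Suc i) + (sig i + sig (Suc i))"
    using c \<open>1 \<le> i\<close> \<open>i < n\<close> by (simp add: braid_of_gen_word)
qed

lemma braid_equiv_Suc: "braid_equiv n u v \<Longrightarrow> braid_equiv (Suc n) u v"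
proof (induction rule: braid_equiv.induct)
  case (refl w)
  have "w \<in> braid_words (Suc n)" using refl by (induction w) auto
  then show ?case by (rule braid_equiv.refl)
qed (auto intro: braid_equiv.intros)

lemma braid_words_Suc: "w \<in> braid_words n \<Longrightarrow> w \<in> braid_words (Suc n)"
  by (induction w) auto

lemma braid_words_1: "w \<in> braid_words (Suc 0) \<Longrightarrow> w = []"
  by (cases w) auto

context artin
begin

text \<open>The normal form is taken in the braid group itself, starting at the last position, where
  \<open>tau\<close> vanishes; hence position, free part and braid part determine the braid. The
  type \<open>'m\<close> supplies the strand number \<open>n + 1\<close>.\<close>

lemma comb_inject:
  fixes T :: "'m itself"
  assumes T: "CARD('m) = Suc n" and u: "u \<in> braid_words (Suc n)" and v: "v \<in> braid_words (Suc n)"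
    and eq: "comb_pos u (Suc n) = comb_pos v (Suc n)" "comb_free u (Suc n) = comb_free v (Suc n)"
      "braid_equiv n (comb_braid u (Suc n)) (comb_braid v (Suc n))"
  shows "braid_equiv (Suc n) u v"
proof -
  interpret artin_braid n xl xi "sig :: nat \<Rightarrow> 'm braid"
    by (intro artin_braid.intro artin_axioms braid_gens_sig T)
  have p: "Suc n \<in> positions" by (simp add: positions_def)
  have b: "comb_braid u (Suc n) \<in> braid_words (Suc n)" "comb_braid v (Suc n) \<in> braid_words (Suc n)"
    using comb_braid_mem[OF u p] comb_braid_mem[OF v p] by (auto intro: braid_words_Suc)
  have "(gen_word sig (comb_braid u (Suc n)) :: 'm braid) = gen_word sig (comb_braid v (Suc n))"
    using b T braid_equiv_Suc[OF eq(3)] braid_of_eq_iff[where 'n='m] by (simp flip: braid_of_gen_word)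
  then have "(gen_word sig u :: 'm braid) = gen_word sig v"
    using normal_form[OF u p] normal_form[OF v p] eq by simp
  then show ?thesis
    using u v T braid_of_eq_iff[of u v, where 'n='m] by (simp add: braid_of_gen_word)
qed

text \<open>\<open>pure_letter\<close> is a word for \<open>A\<^sub>j\<^sub>,\<^sub>n\<^sub>+\<^sub>1\<close> or its inverse.\<close>

definition down :: "nat \<Rightarrow> braid_word" where
  "down p = map (\<lambda>i. (i, True)) (rev [p..<Suc n])"

definition up :: "nat \<Rightarrow> braid_word" where
  "up p = map (\<lambda>i. (i, False)) [p..<Suc n]"

definition pure_letter :: "nat \<times> bool \<Rightarrow> braid_word" where
  "pure_letter = (\<lambda>(j, b). if b then down j @ (j, True) # up (Suc j) else down (Suc j) @ (j, False) # up j)"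

definition pure_word :: "'f fg \<Rightarrow> braid_word" where
  "pure_word k = concat (map (\<lambda>l. pure_letter (xi (fst l), snd l)) (Rep_fg k))"

lemma down_step: "p \<le> n \<Longrightarrow> down p = down (Suc p) @ [(p, True)]" and down_top [simp]: "down (Suc n) = []"
  and up_step: "p \<le> n \<Longrightarrow> up p = (p, False) # up (Suc p)" and up_top [simp]: "up (Suc n) = []"
  by (simp_all add: down_def up_def upt_conv_Cons del: upt_Suc)

lemma down_up_words: "1 \<le> p \<Longrightarrow> down p \<in> braid_words (Suc n)" "1 \<le> p \<Longrightarrow> up p \<in> braid_words (Suc n)"
  by (auto simp: down_def up_def braid_words_def)

lemma comb_down: "1 \<le> p \<Longrightarrow> p \<le> Suc n \<Longrightarrow>
    comb_pos (down p) (Suc n) = p \<and> comb_braid (down p) (Suc n) = [] \<and> comb_free (down p) (Suc n) = 0"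
proof (induction "Suc n - p" arbitrary: p)
  case (Suc d)
  then have "p \<le> n" by simp
  then show ?case using Suc by (simp add: down_step comb_append lp_def lb_def lk_def)
qed simp

lemma comb_up: "1 \<le> p \<Longrightarrow> p \<le> Suc n \<Longrightarrow>
    comb_pos (up p) p = Suc n \<and> comb_braid (up p) p = [] \<and> comb_free (up p) p = 0"
proof (induction "Suc n - p" arbitrary: p)
  case (Suc d)
  then have "p \<le> n" by simp
  then show ?case using Suc by (simp add: up_step lp_def lb_def lk_def)
qed simp

lemma comb_pure_letter:
  assumes "1 \<le> j" "j \<le> n"
  shows "comb_pos (pure_letter (j, b)) (Suc n) = Suc n" "comb_braid (pure_letter (j, b)) (Suc n) = []"
    "comb_free (pure_letter (j, b)) (Suc n) = (if b then x j else - x j)"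
    "pure_letter (j, b) \<in> braid_words (Suc n)"
  using assms comb_down[of j] comb_down[of "Suc j"] comb_up[of j] comb_up[of "Suc j"]
    down_up_words[of j] down_up_words[of "Suc j"]
  by (auto simp: pure_letter_def comb_append lp_def lb_def lk_def)

text \<open>Every element of the free group is realised with empty braid part. With
  \<open>comb_inject\<close> this splits the braids fixing the last position into a free part and a
  braid on \<open>n\<close> strands.\<close>

lemma comb_pure_word:
  "comb_pos (pure_word k) (Suc n) = Suc n \<and> comb_braid (pure_word k) (Suc n) = [] \<and>
   comb_free (pure_word k) (Suc n) = k \<and> pure_word k \<in> braid_words (Suc n)"
proof -
  let ?P = "\<lambda>w. concat (map (\<lambda>l. pure_letter (xi (fst l), snd l)) w)"
  have "comb_pos (?P w) (Suc n) = Suc n \<and> comb_braid (?P w) (Suc n) = [] \<and>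
      comb_free (?P w) (Suc n) = word w \<and> ?P w \<in> braid_words (Suc n)" for w
    using xi_range by (induction w) (auto simp: comb_append comb_pure_letter letter_def xl_xi)
  from this[of "Rep_fg k"] show ?thesis by (simp add: pure_word_def word_Rep)
qed

lemma comb_lower: "\<beta> \<in> braid_words n \<Longrightarrow>
    comb_pos \<beta> (Suc n) = Suc n \<and> comb_braid \<beta> (Suc n) = \<beta> \<and> comb_free \<beta> (Suc n) = 0"
  by (induction \<beta>) (auto simp: lp_def lb_def lk_def)

lemma combing:
  fixes T :: "'m itself"
  assumes T: "CARD('m) = Suc n" and u: "u \<in> braid_words (Suc n)" and p: "comb_pos u (Suc n) = Suc n"
  shows "braid_equiv (Suc n) u (pure_word (comb_free u (Suc n)) @ comb_braid u (Suc n))"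
proof -
  have b: "comb_braid u (Suc n) \<in> braid_words n"
    by (rule comb_braid_mem[OF u]) (simp add: positions_def)
  show ?thesis
    by (rule comb_inject[OF T u])
      (use b p comb_pure_word comb_lower[OF b] in
        \<open>auto simp: comb_append braid_words_Suc intro: braid_equiv.refl\<close>)
qed

lemma act_pure_word:
  "artin.act yl yi (pure_word k) = fg_act (\<lambda>z. artin.act yl yi (pure_letter (xi z, True)))
     (\<lambda>z. artin.act yl yi (pure_letter (xi z, False))) k"
  if "artin m yl yi" for yl :: "nat \<Rightarrow> 'h"
proof -
  interpret Y: artin m yl yi by fact
  have "Y.act (concat (map (\<lambda>l. pure_letter (xi (fst l), snd l)) w)) =
    foldr (\<lambda>l. if snd l then Y.act (pure_letter (xi (fst l), True)) else Y.act (pure_letter (xi (fst l), False))) w" for w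
    by (induction w) (auto simp: Y.act_append fun_eq_iff)
  then show ?thesis by (simp add: pure_word_def fg_act_def fun_eq_iff)
qed

end

section \<open>The Burau representation at \<open>t = -1\<close> modulo 4\<close>

lemma four_eq_0: "(4 :: 4) = 0"
  by simp

lemma four_mult [simp]: "4 * x = (0 :: 4)" "x * 4 = (0 :: 4)"
  by (simp_all only: four_eq_0 mult_zero_left mult_zero_right)

lemma two_two_eq_0 [simp]: "2 * (2 * x) = (0 :: 4)"
  by (simp add: mult.assoc[symmetric])

lemma minus_two: "- (2 * a) = (2 * a :: 4)"
  using two_two_eq_0[of a] by (simp add: neg_eq_iff_add_eq_0)

lemma two_neq_0: "(2 :: 4) \<noteq> 0"
  by simp

text \<open>Left multiplication of a column by the Burau block at t = -1 modulo 4, with rows (2,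
  -1), (1, 0), or by its inverse, with rows (0, 1), (-1, 2). Columns are functions on all of
  \<open>nat\<close>, so braids on different numbers of strands act on the same vectors.\<close>

fun row_op :: "nat \<times> bool \<Rightarrow> (nat \<Rightarrow> 4) \<Rightarrow> (nat \<Rightarrow> 4)" where
  "row_op (i, True) v = v(i - 1 := 2 * v (i - 1) - v i, i := v (i - 1))"
| "row_op (i, False) v = v(i - 1 := v i, i := 2 * v i - v (i - 1))"

definition row_ops :: "braid_word \<Rightarrow> (nat \<Rightarrow> 4) \<Rightarrow> (nat \<Rightarrow> 4)" where
  "row_ops w v = foldr row_op w v"

lemma row_ops_simps [simp]: "row_ops [] v = v" "row_ops (l # w) v = row_op l (row_ops w v)"
  and row_ops_append: "row_ops (u @ w) v = row_ops u (row_ops w v)"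
  by (simp_all add: row_ops_def)

abbreviation unit_at :: "nat \<Rightarrow> nat \<Rightarrow> 4" where
  "unit_at s \<equiv> (\<lambda>r. if r = s then 1 else 0)"

lemma row_ops_equiv: "braid_equiv n u v \<Longrightarrow> row_ops u = row_ops v"
proof (induction rule: braid_equiv.induct)
  case (cancel i b)
  then show ?case by (cases b) (auto simp: fun_eq_iff)
next
  case (far i j)
  then show ?case by (auto simp: fun_eq_iff)
next
  case (braid i)
  then show ?case by (auto simp: fun_eq_iff algebra_simps)
next
  case (app u u' v v')
  then show ?case by (intro ext) (simp add: row_ops_append)
qed simp_all

lemma row_op_outside: "1 \<le> fst l \<Longrightarrow> fst l < n \<Longrightarrow> n \<le> r \<Longrightarrow> row_op l v r = v r"
  by (cases l rule: row_op.cases[of "(l, v)" for l v, simplified]) auto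

lemma row_ops_outside: "w \<in> braid_words n \<Longrightarrow> n \<le> r \<Longrightarrow> row_ops w v r = v r"
  by (induction w) (auto simp: row_op_outside)

definition reduce4 :: "laurent mat \<Rightarrow> 4 mat" where
  "reduce4 M = map_mat of_int (map_mat eval_minus_one M)"

lemma dim_reduce4: "dim_row (reduce4 M) = dim_row M" "dim_col (reduce4 M) = dim_col M"
  by (simp_all add: reduce4_def)

lemma reduce4_mult:
  assumes "A \<in> carrier_mat n n" "B \<in> carrier_mat n n"
  shows "reduce4 (A * B) = reduce4 A * reduce4 B"
proof -
  interpret e: comm_ring_hom eval_minus_one by (rule eval_minus_one_hom)
  interpret f: comm_ring_hom "of_int :: int \<Rightarrow> 4" by (rule of_int_mod4_hom)
  show ?thesis
    using assms by (simp add: reduce4_def e.mat_hom_mult[OF assms] of_int_hom.mat_hom_mult[of _ n n _ n])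
qed

lemma reduce4_letter:
  assumes i: "1 \<le> i" "i < n"
  shows "reduce4 (burau_letter n (i, b)) = (if b then block_mat n i 2 (-1) 1 0 else block_mat n i 0 1 (-1) 2)"
proof -
  interpret e: comm_ring_hom eval_minus_one by (rule eval_minus_one_hom)
  have [simp]: "eval_minus_one laurent_t = -1" "eval_minus_one laurent_t_inv = -1"
    by (simp_all add: eval_minus_one_single)
  have "eval_minus_one (1 - laurent_t) = 2" "eval_minus_one (1 - laurent_t_inv) = 2"
    by (simp_all add: e.hom_minus)
  then show ?thesis
    by (cases b; intro eq_matI) (auto simp: reduce4_def block_mat_def)
qed

lemma reduce4_burau_word:
  "w \<in> braid_words n \<Longrightarrow> r < n \<Longrightarrow> s < n \<Longrightarrow> reduce4 (burau_word n w) $$ (r, s) = row_ops w (unit_at s) r"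
proof (induction w arbitrary: r)
  case Nil
  then show ?case by (simp add: reduce4_def eval_minus_one_0 eval_minus_one_1)
next
  case (Cons l w)
  obtain i b where l: "l = (i, b)" by fastforce
  have i: "1 \<le> i" "i < n" and w: "w \<in> braid_words n" using Cons.prems by (auto simp: l)
  have M: "reduce4 (burau_word n w) \<in> carrier_mat n n" by (simp add: reduce4_def)
  have "reduce4 (burau_word n (l # w)) = reduce4 (burau_letter n l) * reduce4 (burau_word n w)"
    by (simp only: burau_word_Cons) (rule reduce4_mult[of _ n], simp_all)
  then show ?case
    using i Cons.IH[OF w] Cons.prems
    by (cases b) (simp_all add: l reduce4_letter index_block_mat_mult[OF i M] del: index_mult_mat(1) burau_letter.simps)
qed

lemma level4_iff:
  assumes u: "u \<in> braid_words n"
  shows "braid_rel n `` {u} \<in> carrier (level4_braid_group n) \<longleftrightarrow> (\<forall>s<n. row_ops u (unit_at s) = unit_at s)"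
proof -
  have "braid_rel n `` {u} \<in> carrier (level4_braid_group n) \<longleftrightarrow> reduce4 (burau_word n u) = 1\<^sub>m n"
    using braid_group_carrierI[OF u]
    by (simp add: level4_braid_group_def kernel_def burau_mod4_def burau_class[OF u] GL_simps reduce4_def)
  also have "\<dots> \<longleftrightarrow> (\<forall>s<n. \<forall>r<n. row_ops u (unit_at s) r = unit_at s r)"
  proof
    assume "reduce4 (burau_word n u) = 1\<^sub>m n"
    then show "\<forall>s<n. \<forall>r<n. row_ops u (unit_at s) r = unit_at s r"
      using reduce4_burau_word[OF u] by fastforce
  next
    assume "\<forall>s<n. \<forall>r<n. row_ops u (unit_at s) r = unit_at s r"
    then show "reduce4 (burau_word n u) = 1\<^sub>m n"
      by (intro eq_matI) (auto simp: reduce4_burau_word[OF u] dim_reduce4 carrier_matD[OF burau_word_carrier])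
  qed
  also have "\<dots> \<longleftrightarrow> (\<forall>s<n. row_ops u (unit_at s) = unit_at s)"
    using row_ops_outside[OF u, of _ "unit_at _"] by (auto simp: fun_eq_iff) (metis not_le)
  finally show ?thesis .
qed

definition expo :: "'a \<Rightarrow> 'a fg \<Rightarrow> int" where
  "expo y = fg_lift (\<lambda>z. if z = y then 1 else 0)"

lemma expo_simps [simp]: "expo y (a + b) = expo y a + expo y b" "expo y 0 = 0" "expo y (- a) = - expo y a"
  "expo y (a - b) = expo y a - expo y b" "expo y (gen z) = (if z = y then 1 else 0)"
  by (simp_all add: expo_def)

definition even_fg :: "'a fg \<Rightarrow> bool" where
  "even_fg a \<longleftrightarrow> (\<forall>y. even (expo y a))"

text \<open>This turns reduction modulo 4 into a parity condition: exponent sums enter the matrices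
  with a factor 2.\<close>

lemma two_expo_eq_0_iff: "2 * (of_int e :: 4) = 0 \<longleftrightarrow> even e"
proof
  assume "even e"
  then show "2 * (of_int e :: 4) = 0" by (auto elim!: evenE)
next
  assume *: "2 * (of_int e :: 4) = 0"
  show "even e"
  proof (rule ccontr)
    assume "odd e"
    then obtain f where "e = 2 * f + 1" by (elim oddE)
    then show False using * two_neq_0 by (simp add: distrib_left)
  qed
qed

context artin
begin

text \<open>The effect of a squared letter modulo 4. The map is its own inverse, so a pure letter
  and its inverse have the same matrix.\<close>

definition transvect :: "nat \<Rightarrow> nat \<Rightarrow> (nat \<Rightarrow> 4) \<Rightarrow> (nat \<Rightarrow> 4)" where
  "transvect a b v = v(a := v a + 2 * (v a + v b), b := v b + 2 * (v a + v b))"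

lemma row_ops_down_up:
  "1 \<le> j \<Longrightarrow> j < p \<Longrightarrow> p \<le> Suc n \<Longrightarrow>
    row_ops (down p) (transvect (j - 1) (p - 1) (row_ops (up p) v)) = transvect (j - 1) n v"
proof (induction "Suc n - p" arbitrary: p v)
  case 0
  then have "p = Suc n" by simp
  then show ?case by simp
next
  case (Suc d)
  then have p: "p \<le> n" by simp
  have *: "row_op (p, True) (transvect (j - 1) (p - 1) (row_op (p, False) v)) = transvect (j - 1) p v" for v
    using Suc.prems by (auto simp: transvect_def fun_eq_iff algebra_simps)
  have "row_ops (down p) (transvect (j - 1) (p - 1) (row_ops (up p) v)) =
      row_ops (down (Suc p)) (transvect (j - 1) p (row_ops (up (Suc p)) v))"
    by (simp only: down_step[OF p] up_step[OF p] row_ops_append row_ops_simps *)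
  then show ?case using Suc.hyps(1)[of "Suc p" v] Suc.hyps(2) Suc.prems p by simp
qed

lemma row_ops_pure_letter:
  assumes j: "1 \<le> j" "j \<le> n"
  shows "row_ops (pure_letter (j, b)) v = transvect (j - 1) n v"
proof -
  have 1: "row_op (j, True) (row_op (j, True) v) = transvect (j - 1) j v" for v
    using j by (auto simp: transvect_def fun_eq_iff algebra_simps)
  have 2: "row_op (j, False) (row_op (j, False) v) = transvect (j - 1) j v" for v
    using j by (auto simp: transvect_def fun_eq_iff algebra_simps)
  have "row_ops (pure_letter (j, b)) v = row_ops (down (Suc j)) (transvect (j - 1) j (row_ops (up (Suc j)) v))"
    by (cases b) (simp_all only: pure_letter_def prod.case if_True if_False down_step[OF j(2)] up_step[OF j(2)]
        row_ops_append row_ops_simps 1 2)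
  then show ?thesis
    using row_ops_down_up[of j "Suc j" v] j by simp
qed

text \<open>The product of the transvections along a word: since 2 * 2 = 0, none of them sees the
  change made by the others, and only exponent sums remain.\<close>

definition shear :: "'f fg \<Rightarrow> (nat \<Rightarrow> 4) \<Rightarrow> (nat \<Rightarrow> 4)" where
  "shear k v = (\<lambda>r. if r = n then v n + (\<Sum>j<n. 2 * (of_int (expo (xl (Suc j)) k) * (v j + v n)))
     else if r < n then v r + 2 * (of_int (expo (xl (Suc r)) k) * (v r + v n)) else v r)"

lemma two_shear: "2 * shear k v r = 2 * v r"
  by (auto simp: shear_def distrib_left sum_distrib_left)

lemma xl_inject: "1 \<le> i \<Longrightarrow> i \<le> n \<Longrightarrow> 1 \<le> j \<Longrightarrow> j \<le> n \<Longrightarrow> xl i = xl j \<longleftrightarrow> i = j"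
  by (metis xi_xl)

lemma transvect_shear:
  assumes j: "1 \<le> j" "j \<le> n"
  shows "transvect (j - 1) n (shear k v) = shear ((if b then x j else - x j) + k) v"
proof
  fix r
  obtain i where i: "j = Suc i" "i < n" using j by (cases j) auto
  have two: "2 * (shear k v i + shear k v n) = 2 * (v i + v n)"
    by (simp add: distrib_left two_shear)
  have ex: "2 * (of_int (expo (xl (Suc q)) ((if b then x j else - x j) + k)) * c) =
      2 * (of_int (expo (xl (Suc q)) k) * c) + (if q = i then 2 * c else (0 :: 4))" if "q < n" for q c
    using that i minus_two[of c] xl_inject[of j "Suc q"] by (auto simp: algebra_simps)
  let ?k = "(if b then x j else - x j) + k"
  have other: "shear ?k v q = shear k v q + (if q = i then 2 * (v q + v n) else 0)" if "q < n" for q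
    using that ex[OF that, of "v q + v n"] by (simp add: shear_def del: expo_simps)
  have "(\<Sum>q<n. 2 * (of_int (expo (xl (Suc q)) ?k) * (v q + v n))) =
      (\<Sum>q<n. 2 * (of_int (expo (xl (Suc q)) k) * (v q + v n))) + (\<Sum>q<n. if q = i then 2 * (v q + v n) else 0)"
    unfolding sum.distrib[symmetric] by (rule sum.cong) (simp_all add: ex del: expo_simps)
  then have top: "shear ?k v n = shear k v n + 2 * (v i + v n)"
    using i by (simp add: shear_def add.assoc del: expo_simps)
  consider "r = i" | "r = n" | "r \<noteq> i" "r < n" | "n < r" by linarith
  then show "transvect (j - 1) n (shear k v) r = shear ?k v r"
  proof cases
    case 4
    then show ?thesis using i by (simp add: shear_def transvect_def del: expo_simps)
  qed (use i two other[of r] top in \<open>simp_all add: transvect_def del: expo_simps\<close>)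
qed

lemma row_ops_pure_word: "row_ops (pure_word k) v = shear k v"
proof -
  have "row_ops (concat (map (\<lambda>l. pure_letter (xi (fst l), snd l)) w)) v = shear (word w) v" for w
  proof (induction w)
    case Nil
    then show ?case by (auto simp: shear_def fun_eq_iff)
  next
    case (Cons l w)
    then show ?case
      using xi_range[of "fst l"] transvect_shear[of "xi (fst l)" "word w" v "snd l"]
      by (simp add: row_ops_append row_ops_pure_letter letter_def xl_xi)
  qed
  then show ?thesis by (simp add: pure_word_def word_Rep)
qed

lemma shear_even: "even_fg k \<Longrightarrow> shear k v = v"
proof -
  assume "even_fg k"
  then have "2 * (of_int (expo y k) * c) = (0 :: 4)" for y c
    using two_expo_eq_0_iff[of "expo y k"] by (metis mult.assoc mult_zero_left even_fg_def)
  then show ?thesis by (auto simp: shear_def fun_eq_iff)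
qed

text \<open>The column of the last strand has twice an exponent sum in each row
  \<open>r < n\<close>, so it alone detects the parity of all of them.\<close>

lemma shear_unit: "shear k (unit_at n) = unit_at n \<Longrightarrow> even_fg k"
proof -
  assume *: "shear k (unit_at n) = unit_at n"
  have "even (expo y k)" for y
  proof -
    obtain r where r: "y = xl (Suc r)" "r < n"
      using xl_xi[of y] xi_range[of y] by (cases "xi y") auto
    then show ?thesis using fun_cong[OF *, of r] by (simp add: shear_def two_expo_eq_0_iff)
  qed
  then show ?thesis by (simp add: even_fg_def)
qed

lemma shear_unit_above: "n < s \<Longrightarrow> shear k (unit_at s) = unit_at s"
  by (auto simp: shear_def fun_eq_iff)

text \<open>Modulo 2, the Burau matrix is the permutation matrix of the braid.\<close>

lemma two_row_ops:
  "u \<in> braid_words (Suc n) \<Longrightarrow> p \<in> positions \<Longrightarrow> 2 * row_ops u v (p - 1) = 2 * v (comb_pos u p - 1)"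
proof (induction u arbitrary: p)
  case (Cons l u)
  obtain i b where l: "l = (i, b)" by fastforce
  have i: "1 \<le> i" "i \<le> n" using Cons.prems by (auto simp: l)
  have "2 * row_op l v (p - 1) = 2 * v (lp l p - 1)" for v
    using i Cons.prems(2) minus_two
    by (cases b) (auto simp: l lp_def positions_def right_diff_distrib)
  then show ?case using Cons i by (simp add: l lp_mem)
qed simp

lemma comb_pos_top:
  assumes "u \<in> braid_words (Suc n)" "2 * row_ops u (unit_at n) n = 2"
  shows "comb_pos u (Suc n) = Suc n"
proof -
  have p: "Suc n \<in> positions" by (simp add: positions_def)
  have "2 * unit_at n (comb_pos u (Suc n) - 1) = 2"
    using two_row_ops[OF assms(1) p, of "unit_at n"] assms(2) by simp
  then have "comb_pos u (Suc n) - 1 = n" using two_neq_0 by (auto split: if_splits)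
  then show ?thesis using comb_pos_mem[OF assms(1) p] by (auto simp: positions_def)
qed

end

section \<open>Pure braids on three and four strands\<close>

datatype two_letters = Y1 | Y2
datatype three_letters = X1 | X2 | X3

definition "yl (j :: nat) = (if j = 1 then Y1 else Y2)"
definition "yi y = (case y of Y1 \<Rightarrow> 1 | Y2 \<Rightarrow> (2 :: nat))"
definition "xl (j :: nat) = (if j = 1 then X1 else if j = 2 then X2 else X3)"
definition "xi x = (case x of X1 \<Rightarrow> 1 | X2 \<Rightarrow> 2 | X3 \<Rightarrow> (3 :: nat))"

text \<open>The three stages of combing: \<open>X\<close> takes a strand off four, \<open>Y\<close>
  off three and \<open>Z\<close> off two.\<close>

interpretation Z: artin "Suc 0" "\<lambda>_. ()" "\<lambda>_. Suc 0"
  by unfold_locales auto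

interpretation Y: artin 2 yl yi
  by unfold_locales (auto simp: yl_def yi_def split: two_letters.splits)

interpretation X: artin 3 xl xi
  by unfold_locales (auto simp: xl_def xi_def split: three_letters.splits)

abbreviation "zg \<equiv> gen ()"
abbreviation "y1 \<equiv> gen Y1"
abbreviation "y2 \<equiv> gen Y2"
abbreviation "x1 \<equiv> gen X1"
abbreviation "x2 \<equiv> gen X2"
abbreviation "x3 \<equiv> gen X3"

text \<open>The images of the full twists on three and four strands in \<open>F\<^sub>2\<close> and \<open>F\<^sub>3\<close>.\<close>

definition c2 :: "unit fg \<Rightarrow> two_letters fg" where "c2 = fg_lift (\<lambda>_. y1 + y2)"
definition c3 :: "unit fg \<Rightarrow> three_letters fg" where "c3 = fg_lift (\<lambda>_. x1 + (x2 + x3))"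

lemma c_simps [simp]: "c2 0 = 0" "c2 (a + b) = c2 a + c2 b" "c2 (- a) = - c2 a" "c2 zg = y1 + y2"
  "c3 0 = 0" "c3 (a + b) = c3 a + c3 b" "c3 (- a) = - c3 a" "c3 zg = x1 + (x2 + x3)"
  by (simp_all add: c2_def c3_def)

lemma unit_fg_commute: "a + b = b + (a :: unit fg)"
proof -
  have g: "zg + b = b + zg" for b
  proof (induction b rule: fg_induct)
    case (inv s w)
    have "- zg + (w + zg) = - zg + (zg + w)" using inv by simp
    then show ?case by (simp add: add.assoc)
  next
    case (gen s w)
    then show ?case by (simp add: add.assoc[symmetric])
  qed simp
  have g': "- zg + b = b + - zg" for b
    using g[of b] by (metis add.assoc add.right_inverse add.right_neutral group_add_simps(2))
  show ?thesis
  proof (induction a rule: fg_induct)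
    case (gen s w)
    then show ?case using g[of b] by (metis add.assoc unit.exhaust)
  next
    case (inv s w)
    then show ?case using g'[of b] by (metis add.assoc unit.exhaust)
  qed simp
qed

lemma unit_fg_expo_inject: "expo () a = expo () b \<longleftrightarrow> a = b"
  and unit_fg_expo_surj: "\<exists>a. expo () a = n"
proof -
  \<comment> \<open>\<open>Z n\<close> is the \<open>n\<close>-th multiple of the generator,
    negative multiples iterating its inverse; it turns out to invert \<open>expo ()\<close>.\<close>
  define Z where "Z n = (if n \<ge> 0 then ((+) zg ^^ nat n) 0 else ((+) (- zg) ^^ nat (- n)) 0)" for n :: int
  have up: "Z (n + 1) = zg + Z n" for n
  proof (cases "n \<ge> 0")
    case True
    then have "nat (n + 1) = Suc (nat n)" by simp
    then show ?thesis using True by (simp add: Z_def)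
  next
    case False
    then have "nat (- n) = Suc (nat (- (n + 1)))" by simp
    then show ?thesis using False by (cases "n + 1 = 0") (simp_all add: Z_def group_add_simps)
  qed
  have down: "Z (n - 1) = - zg + Z n" for n
    using up[of "n - 1"] by (simp add: group_add_simps)
  have Z: "a = Z (expo () a)" for a
  proof (induction a rule: fg_induct)
    case zero
    then show ?case by (simp add: Z_def)
  next
    case (gen s w)
    then show ?case using up[of "expo () w"] by (simp add: add.commute)
  next
    case (inv s w)
    then show ?case using down[of "expo () w"] by simp
  qed
  show "expo () a = expo () b \<longleftrightarrow> a = b" using Z[of a] Z[of b] by auto
  have "expo () (Z n) = n" for n
    by (induction n rule: int_induct[where k=0]) (simp_all add: up down, simp add: Z_def)
  then show "\<exists>a. expo () a = n" by blast
qed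

text \<open>At level 4 only even powers of the full twist occur; halving identifies them with the
  whole free group on one letter.\<close>

definition half :: "unit fg \<Rightarrow> unit fg" where
  "half a = (SOME b. expo () b = expo () a div 2)"

lemma half: "even_fg a \<Longrightarrow> half a + half a = a"
proof -
  assume a: "even_fg a"
  have "expo () (half a) = expo () a div 2"
    unfolding half_def by (rule someI_ex) (rule unit_fg_expo_surj)
  then show ?thesis using a by (subst unit_fg_expo_inject[symmetric]) (simp add: even_fg_def)
qed

lemma half_unique: "b + b = c + c \<Longrightarrow> b = (c :: unit fg)"
  by (subst (asm) unit_fg_expo_inject[symmetric], subst unit_fg_expo_inject[symmetric]) simp

lemma c_commute: "c2 a + c2 b = c2 b + c2 a" "c3 a + c3 b = c3 b + c3 a"
  using unit_fg_commute[of a b] by (metis c_simps(2), metis c_simps(6))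

text \<open>The action of \<open>F\<^sub>2\<close>, the pure braids in which only the third strand moves, on \<open>F\<^sub>3\<close>.\<close>

definition \<alpha> :: "two_letters fg \<Rightarrow> three_letters fg \<Rightarrow> three_letters fg" where
  "\<alpha> w = X.act (Y.pure_word w)"

definition "\<alpha>p y = X.act (Y.pure_letter (yi y, True))"
definition "\<alpha>m y = X.act (Y.pure_letter (yi y, False))"

lemma X_act_letter:
  "X.act_letter (Suc 0, True) x1 = x2" "X.act_letter (Suc 0, True) x2 = - x2 + (x1 + x2)" "X.act_letter (Suc 0, True) x3 = x3"
  "X.act_letter (Suc 0, False) x1 = x1 + (x2 + - x1)" "X.act_letter (Suc 0, False) x2 = x1" "X.act_letter (Suc 0, False) x3 = x3"
  "X.act_letter (2, True) x1 = x1" "X.act_letter (2, True) x2 = x3" "X.act_letter (2, True) x3 = - x3 + (x2 + x3)"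
  "X.act_letter (2, False) x1 = x1" "X.act_letter (2, False) x2 = x2 + (x3 + - x2)" "X.act_letter (2, False) x3 = x2"
  by (simp_all add: X.act_letter_def xi_def xl_def)

lemma Y_act_letter:
  "Y.act_letter (Suc 0, True) y1 = y2" "Y.act_letter (Suc 0, True) y2 = - y2 + (y1 + y2)"
  "Y.act_letter (Suc 0, False) y1 = y1 + (y2 + - y1)" "Y.act_letter (Suc 0, False) y2 = y1"
  by (simp_all add: Y.act_letter_def yi_def yl_def)

lemma Y_pure_letter:
  "Y.pure_letter (yi Y1, True) = [(2, True), (1, True), (1, True), (2, False)]"
  "Y.pure_letter (yi Y1, False) = [(2, True), (1, False), (1, False), (2, False)]"
  "Y.pure_letter (yi Y2, True) = [(2, True), (2, True)]"
  "Y.pure_letter (yi Y2, False) = [(2, False), (2, False)]"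
  by (simp_all add: Y.pure_letter_def Y.down_def Y.up_def yi_def upt_rec)

lemma Z_pure_letter: "Z.pure_letter (Suc 0, True) = [(Suc 0, True), (Suc 0, True)]"
    "Z.pure_letter (Suc 0, False) = [(Suc 0, False), (Suc 0, False)]"
  by (simp_all add: Z.pure_letter_def Z.down_def Z.up_def upt_rec)

lemmas word_simps' = X_act_letter Y_act_letter X.act_letter_plus X.act_letter_uminus Y.act_letter_plus Y.act_letter_uminus
  X.act_Cons Y.act_Cons add.assoc minus_add group_add_simps diff_conv_add_uminus

lemma \<alpha>_gen:
  "\<alpha>p Y1 x1 = - x3 + (x1 + x3)" "\<alpha>p Y1 x2 = - x3 + (- x1 + (x3 + (x1 + (x2 + (- x1 + (- x3 + (x1 + x3)))))))"
  "\<alpha>p Y1 x3 = - x3 + (- x1 + (x3 + (x1 + x3)))"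
  "\<alpha>p Y2 x1 = x1" "\<alpha>p Y2 x2 = - x3 + (x2 + x3)" "\<alpha>p Y2 x3 = - x3 + (- x2 + (x3 + (x2 + x3)))"
  "\<alpha>m Y1 x1 = x1 + (x3 + (x1 + (- x3 + - x1)))"
  "\<alpha>m Y1 x2 = x1 + (x3 + (- x1 + (- x3 + (x2 + (x3 + (x1 + (- x3 + - x1)))))))"
  "\<alpha>m Y1 x3 = x1 + (x3 + - x1)"
  "\<alpha>m Y2 x1 = x1" "\<alpha>m Y2 x2 = x2 + (x3 + (x2 + (- x3 + - x2)))" "\<alpha>m Y2 x3 = x2 + (x3 + - x2)"
  by (simp_all add: \<alpha>p_def \<alpha>m_def Y_pure_letter word_simps' del: add_uminus_conv_diff)

lemma \<alpha>_hom: "\<alpha>p y (a + b) = \<alpha>p y a + \<alpha>p y b" "\<alpha>m y (a + b) = \<alpha>m y a + \<alpha>m y b"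
  by (simp_all add: \<alpha>p_def \<alpha>m_def X.act_plus)

lemma three_hom_eqI:
  fixes f g :: "three_letters fg \<Rightarrow> 'h::group_add"
  assumes "\<And>a b. f (a + b) = f a + f b" "\<And>a b. g (a + b) = g a + g b"
    and "f x1 = g x1" "f x2 = g x2" "f x3 = g x3"
  shows "f a = g a"
proof (rule fg_hom_eqI[OF assms(1,2)])
  fix s show "f (gen s) = g (gen s)" by (cases s) (simp_all add: assms)
qed

lemma two_hom_eqI:
  fixes f g :: "two_letters fg \<Rightarrow> 'h::group_add"
  assumes "\<And>a b. f (a + b) = f a + f b" "\<And>a b. g (a + b) = g a + g b" and "f y1 = g y1" "f y2 = g y2"
  shows "f a = g a"
proof (rule fg_hom_eqI[OF assms(1,2)])
  fix s show "f (gen s) = g (gen s)" by (cases s) (simp_all add: assms)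
qed

lemma \<alpha>_uminus: "\<alpha>p y (- a) = - \<alpha>p y a" "\<alpha>m y (- a) = - \<alpha>m y a"
  by (rule hom_uminus \<alpha>_hom)+

lemma \<alpha>_inverse: "\<alpha>p y (\<alpha>m y a) = a" "\<alpha>m y (\<alpha>p y a) = a"
proof -
  show "\<alpha>p y (\<alpha>m y a) = a"
    by (rule three_hom_eqI[of "\<lambda>a. \<alpha>p y (\<alpha>m y a)" "\<lambda>a. a"])
      (cases y; simp add: \<alpha>_hom \<alpha>_uminus \<alpha>_gen add.assoc minus_add group_add_simps diff_conv_add_uminus del: add_uminus_conv_diff)+
  show "\<alpha>m y (\<alpha>p y a) = a"
    by (rule three_hom_eqI[of "\<lambda>a. \<alpha>m y (\<alpha>p y a)" "\<lambda>a. a"])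
      (cases y; simp add: \<alpha>_hom \<alpha>_uminus \<alpha>_gen add.assoc minus_add group_add_simps diff_conv_add_uminus del: add_uminus_conv_diff)+
qed

text \<open>\<open>Y.pure_word\<close> does not send sums to concatenations of words. Recast as a
  letter-wise action with mutually inverse letters, \<alpha> becomes insensitive to cancellation and
  hence multiplicative.\<close>

lemma \<alpha>_fg_act: "\<alpha> = fg_act \<alpha>p \<alpha>m"
  using Y.act_pure_word[OF X.artin_axioms] by (simp add: fun_eq_iff \<alpha>_def \<alpha>p_def[abs_def] \<alpha>m_def[abs_def])

lemma \<alpha>_plus: "\<alpha> (u + v) a = \<alpha> u (\<alpha> v a)"
  unfolding \<alpha>_fg_act by (rule fg_act_plus[OF \<alpha>_inverse])

lemma \<alpha>_0 [simp]: "\<alpha> 0 a = a"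
  by (simp add: \<alpha>_fg_act fg_act_0)

lemma \<alpha>_y: "\<alpha> (gen y) a = \<alpha>p y a"
  by (simp add: \<alpha>_fg_act fg_act_gen)

lemma \<alpha>_y_inv: "\<alpha> (- gen y) a = \<alpha>m y a"
  using \<alpha>_plus[of "- gen y" "gen y" "\<alpha>m y a"] by (simp add: \<alpha>_y \<alpha>_inverse)

lemma \<alpha>_add: "\<alpha> w (a + b) = \<alpha> w a + \<alpha> w b"
  by (simp add: \<alpha>_def X.act_plus)

lemma \<alpha>_minus: "\<alpha> w 0 = 0" "\<alpha> w (- a) = - \<alpha> w a" "\<alpha> w (a - b) = \<alpha> w a - \<alpha> w b"
  by (rule hom_uminus \<alpha>_add)+

text \<open>\<open>x1 + (x2 + x3)\<close> is the loop around all punctures, which braids fix; the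
  check on the generators of F_2 and their inverses suffices.\<close>

lemma \<alpha>_c3: "\<alpha> w (c3 a) = c3 a"
proof (rule fg_hom_eqI[of "\<lambda>a. \<alpha> w (c3 a)" c3])
  fix s :: unit
  have p: "\<alpha>p y (c3 zg) = c3 zg" for y
    by (cases y) (simp_all add: \<alpha>_hom \<alpha>_gen add.assoc group_add_simps)
  then have m: "\<alpha>m y (c3 zg) = c3 zg" for y
    using \<alpha>_inverse(2)[of y "c3 zg"] by simp
  show "\<alpha> w (c3 (gen s)) = c3 (gen s)"
    using p m by (induction w rule: fg_induct) (simp_all add: \<alpha>_plus \<alpha>_y \<alpha>_y_inv del: c_simps(4,8))
qed (simp_all add: \<alpha>_add)

text \<open>Pure braids send each generator to a conjugate of itself, so exponent sums are preserved
  and the even subgroup is stable.\<close>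

lemma expo_\<alpha>: "expo x (\<alpha> w a) = expo x a"
proof -
  have p: "expo x (\<alpha>p y a) = expo x a" for y a
    by (rule three_hom_eqI[of "\<lambda>a. expo x (\<alpha>p y a)" "\<lambda>a. expo x a"])
      (cases y; simp add: \<alpha>_hom \<alpha>_gen)+
  then have m: "expo x (\<alpha>m y a) = expo x a" for y a
    using \<alpha>_inverse(1)[of y a] by metis
  show ?thesis
    using p m by (induction w arbitrary: a rule: fg_induct) (simp_all add: \<alpha>_plus \<alpha>_y \<alpha>_y_inv)
qed

text \<open>The square of \<open>\<sigma>\<^sub>1\<close> acts through the full twist, which acts by an inner automorphism.\<close>

definition "\<tau> m = X.act (Z.pure_word m)"

lemma \<tau>_plus: "\<tau> (a + b) k = \<tau> a (\<tau> b k)" and \<tau>_0 [simp]: "\<tau> 0 k = k"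
  and \<tau>_gen: "\<tau> zg k = X.act [(Suc 0, True), (Suc 0, True)] k"
proof -
  let ?p = "\<lambda>z :: unit. X.act (Z.pure_letter (Suc 0, True))" and ?q = "\<lambda>z :: unit. X.act (Z.pure_letter (Suc 0, False))"
  have \<tau>: "\<tau> = fg_act ?p ?q"
    using Z.act_pure_word[OF X.artin_axioms] by (simp add: fun_eq_iff \<tau>_def)
  have e: "braid_equiv 3 [(1, b), (1, b), (1, \<not> b), (1, \<not> b)] []" for b
  proof -
    have c: "braid_equiv 3 [(1, b), (1, \<not> b)] []" by (rule braid_equiv.cancel) auto
    have "braid_equiv 3 ([(1, b)] @ [(1, b), (1, \<not> b)] @ [(1, \<not> b)]) ([(1, b)] @ [] @ [(1, \<not> b)])"
      by (intro braid_equiv.app c) (auto intro: braid_equiv.refl)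
    then show ?thesis using c by (auto intro: braid_equiv.trans)
  qed
  have inv: "?p z (?q z c) = c" "?q z (?p z c) = c" for z c
    using X.act_equiv[OF e[of True], of c] X.act_equiv[OF e[of False], of c]
    by (simp_all add: Z_pure_letter X.act_Cons)
  show "\<tau> (a + b) k = \<tau> a (\<tau> b k)" unfolding \<tau> by (rule fg_act_plus[OF inv])
  show "\<tau> 0 k = k" by (simp add: \<tau> fg_act_0)
  show "\<tau> zg k = X.act [(Suc 0, True), (Suc 0, True)] k" unfolding \<tau> fg_act_gen Z_pure_letter ..
qed

lemma \<tau>_add: "\<tau> m (a + b) = \<tau> m a + \<tau> m b"
  by (simp add: \<tau>_def X.act_plus)

text \<open>The full twist on three strands is the product of \<open>y1 + y2\<close> and the square
  of the first letter, and it acts as conjugation by \<open>c3\<close>. Powers collect because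
  \<alpha> fixes \<open>c3\<close> and the free group on one letter is commutative.\<close>

lemma \<tau>_eq: "\<tau> m k = - c3 m + (\<alpha> (- c2 m) k + c3 m)"
proof -
  have twist: "\<alpha> (c2 zg) (\<tau> zg k) = - c3 zg + (k + c3 zg)" for k
    by (rule three_hom_eqI[of "\<lambda>k. \<alpha> (c2 zg) (\<tau> zg k)" "\<lambda>k. - c3 zg + (k + c3 zg)"])
      (simp_all add: \<tau>_add \<alpha>_add add.assoc group_add_simps,
       simp_all add: \<tau>_gen \<alpha>_plus \<alpha>_y \<alpha>_hom \<alpha>_uminus \<alpha>_gen word_simps' del: add_uminus_conv_diff)
  have pos: "\<tau> zg k = - c3 zg + (\<alpha> (- c2 zg) k + c3 zg)" for k
  proof -
    have "\<tau> zg k = \<alpha> (- c2 zg) (\<alpha> (c2 zg) (\<tau> zg k))" by (simp flip: \<alpha>_plus del: c_simps(4,8))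
    then show ?thesis unfolding twist by (simp add: \<alpha>_add \<alpha>_minus \<alpha>_c3 del: c_simps(4,8))
  qed
  have neg: "\<tau> (- zg) k = c3 zg + (\<alpha> (c2 zg) k + - c3 zg)" for k
  proof -
    have "\<tau> (- zg) (\<tau> zg j) = j" for j using \<tau>_plus[of "- zg" zg j] by simp
    moreover have "\<tau> zg (c3 zg + (\<alpha> (c2 zg) k + - c3 zg)) = k"
      unfolding pos \<alpha>_add \<alpha>_minus \<alpha>_c3 by (simp add: group_add_simps add.assoc flip: \<alpha>_plus del: c_simps(4,8))
    ultimately show ?thesis by metis
  qed
  show ?thesis
  proof (induction m arbitrary: k rule: fg_induct)
    case (gen s w)
    have "\<tau> (gen s + w) k = - c3 zg + (\<alpha> (- c2 zg) (- c3 w + (\<alpha> (- c2 w) k + c3 w)) + c3 zg)"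
      using gen by (simp add: \<tau>_plus pos del: c_simps(4,8))
    also have "\<dots> = - c3 (w + zg) + (\<alpha> (- c2 (w + zg)) k + c3 (w + zg))"
      by (simp add: \<alpha>_add \<alpha>_minus \<alpha>_c3 \<alpha>_plus minus_add add.assoc diff_conv_add_uminus 
 del: c_simps(4,8) add_uminus_conv_diff)
    finally show ?case using unit_fg_commute[of w zg] by simp
  next
    case (inv s w)
    have "\<tau> (- gen s + w) k = c3 zg + (\<alpha> (c2 zg) (- c3 w + (\<alpha> (- c2 w) k + c3 w)) + - c3 zg)"
      using inv by (simp add: \<tau>_plus neg del: c_simps(4,8))
    also have "\<dots> = - c3 (w + - zg) + (\<alpha> (- c2 (w + - zg)) k + c3 (w + - zg))"
      by (simp add: \<alpha>_add \<alpha>_minus \<alpha>_c3 \<alpha>_plus minus_add add.assoc diff_conv_add_uminus 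
 del: c_simps(4,8) add_uminus_conv_diff)
    finally show ?case using unit_fg_commute[of w "- zg"] by simp
  qed simp
qed

text \<open>The product of \<open>y1 + y2\<close> and the square of the first letter is central, so
  on F_2 the square acts as conjugation by the inverse of \<open>y1 + y2\<close>; the formula is
  verified on the two generators.\<close>

lemma Y_act_square: "Y.act (Z.pure_word m) w = - c2 m + (w + c2 m)"
proof -
  have e: "braid_equiv 2 [(1, b), (1, b), (1, \<not> b), (1, \<not> b)] []" for b
  proof -
    have c: "braid_equiv 2 [(1, b), (1, \<not> b)] []" by (rule braid_equiv.cancel) auto
    have "braid_equiv 2 ([(1, b)] @ [(1, b), (1, \<not> b)] @ [(1, \<not> b)]) ([(1, b)] @ [] @ [(1, \<not> b)])"
      by (intro braid_equiv.app c) (auto intro: braid_equiv.refl)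
    then show ?thesis using c by (auto intro: braid_equiv.trans)
  qed
  let ?p = "\<lambda>z :: unit. Y.act (Z.pure_letter (Suc 0, True))" and ?q = "\<lambda>z :: unit. Y.act (Z.pure_letter (Suc 0, False))"
  have act: "Y.act (Z.pure_word m) = fg_act ?p ?q m" for m
    using Z.act_pure_word[OF Y.artin_axioms] by simp
  have pq: "?p z (?q z c) = c" "?q z (?p z c) = c" for z :: unit and c
    using Y.act_equiv[OF e[of True], of c] Y.act_equiv[OF e[of False], of c]
    by (simp_all add: Z_pure_letter Y.act_Cons)
  have pos: "?p z w = - c2 zg + (w + c2 zg)" for z :: unit and w
    by (rule two_hom_eqI[of "?p z" "\<lambda>w. - c2 zg + (w + c2 zg)"])
      (simp_all add: Y.act_plus add.assoc group_add_simps Z_pure_letter word_simps' del: add_uminus_conv_diff)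
  have neg: "?q z w = c2 zg + (w + - c2 zg)" for z :: unit and w
  proof -
    have "?q z (?p z (c2 zg + (w + - c2 zg))) = c2 zg + (w + - c2 zg)" by (rule pq)
    then show ?thesis unfolding pos by (simp add: add.assoc group_add_simps del: c_simps(4,8))
  qed
  have inv': "fg_act ?p ?q (- zg) w = ?q () w" for w
    using fg_act_plus[of ?p ?q, OF pq, of "- zg" zg "?q () w"] by (simp add: fg_act_gen fg_act_0 pq)
  show ?thesis
    unfolding act
  proof (induction m arbitrary: w rule: fg_induct)
    case (gen s m)
    have "fg_act ?p ?q (gen s + m) w = ?p s (fg_act ?p ?q m w)"
      by (simp only: fg_act_plus[of ?p ?q, OF pq] fg_act_gen)
    also have "\<dots> = - c2 zg + (fg_act ?p ?q m w + c2 zg)" by (rule pos)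
    also have "\<dots> = - c2 zg + ((- c2 m + (w + c2 m)) + c2 zg)" by (simp only: gen)
    also have "\<dots> = - c2 (m + zg) + (w + c2 (m + zg))"
      by (simp add: minus_add add.assoc diff_conv_add_uminus del: c_simps(4,8) add_uminus_conv_diff)
    finally show ?case using unit_fg_commute[of m zg] by simp
  next
    case (inv s m)
    have "fg_act ?p ?q (- gen s + m) w = ?q s (fg_act ?p ?q m w)"
      using inv'[of "fg_act ?p ?q m w"] by (simp only: fg_act_plus[of ?p ?q, OF pq]) simp
    also have "\<dots> = c2 zg + (fg_act ?p ?q m w + - c2 zg)" by (rule neg)
    also have "\<dots> = c2 zg + ((- c2 m + (w + c2 m)) + - c2 zg)" by (simp only: inv)
    also have "\<dots> = - c2 (m + - zg) + (w + c2 (m + - zg))"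
      by (simp add: minus_add add.assoc diff_conv_add_uminus del: c_simps(4,8) add_uminus_conv_diff)
    finally show ?case using unit_fg_commute[of m "- zg"] by simp
  qed (simp add: fg_act_0)
qed

section \<open>The level 4 subgroups\<close>

abbreviation "K u \<equiv> X.comb_free u 4"
abbreviation "top3 u \<equiv> X.comb_braid u 4"
abbreviation "W \<beta> \<equiv> Y.comb_free \<beta> 3"
abbreviation "top2 \<beta> \<equiv> Y.comb_braid \<beta> 3"
abbreviation "M \<gamma> \<equiv> Z.comb_free \<gamma> 2"

definition "pure2 \<gamma> \<longleftrightarrow> Z.comb_pos \<gamma> 2 = 2"
definition "pure3 \<beta> \<longleftrightarrow> Y.comb_pos \<beta> 3 = 3 \<and> pure2 (top2 \<beta>)"
definition "pure4 u \<longleftrightarrow> X.comb_pos u 4 = 4 \<and> pure3 (top3 u)"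

lemma Suc_nums: "Suc (Suc 0) = 2" "Suc 2 = 3" "Suc 3 = 4"
  by simp_all

lemma positions_top: "2 \<in> Z.positions" "3 \<in> Y.positions" "4 \<in> X.positions"
  by (simp_all add: Z.positions_def Y.positions_def X.positions_def)

lemma top_words:
  "\<beta> \<in> braid_words 3 \<Longrightarrow> top2 \<beta> \<in> braid_words 2" "u \<in> braid_words 4 \<Longrightarrow> top3 u \<in> braid_words 3"
  using Y.comb_braid_mem[of \<beta> 3] X.comb_braid_mem[of u 4] positions_top by (simp_all add: Suc_nums)

lemma top1: "\<gamma> \<in> braid_words 2 \<Longrightarrow> Z.comb_braid \<gamma> 2 = []"
  using Z.comb_braid_mem[of \<gamma> 2] positions_top by (auto simp: Suc_nums intro: braid_words_1)

lemmas Z_comb = Z.comb_pure_word[unfolded Suc_nums] and Y_comb = Y.comb_pure_word[unfolded Suc_nums]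
  and X_comb = X.comb_pure_word[unfolded Suc_nums]

lemmas Z_equiv = Z.comb_equiv[unfolded Suc_nums, rule_format, OF _ positions_top(1)]
  and Y_equiv = Y.comb_equiv[unfolded Suc_nums, rule_format, OF _ positions_top(2)]
  and X_equiv = X.comb_equiv[unfolded Suc_nums, rule_format, OF _ positions_top(3)]

lemma equiv_append:
  "braid_equiv n u u' \<Longrightarrow> v \<in> braid_words n \<Longrightarrow> braid_equiv n (v @ u) (v @ u')"
  by (rule braid_equiv.app[OF braid_equiv.refl])

lemma combing2: "\<gamma> \<in> braid_words 2 \<Longrightarrow> pure2 \<gamma> \<Longrightarrow> braid_equiv 2 \<gamma> (Z.pure_word (M \<gamma>))"
  using Z.combing[where 'm=2, of \<gamma>] top1[of \<gamma>] by (simp add: Suc_nums pure2_def)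

lemma combing3':
  "\<beta> \<in> braid_words 3 \<Longrightarrow> Y.comb_pos \<beta> 3 = 3 \<Longrightarrow> braid_equiv 3 \<beta> (Y.pure_word (W \<beta>) @ top2 \<beta>)"
  using Y.combing[where 'm=3, of \<beta>] by (simp add: Suc_nums)

lemma combing4':
  "u \<in> braid_words 4 \<Longrightarrow> X.comb_pos u 4 = 4 \<Longrightarrow> braid_equiv 4 u (X.pure_word (K u) @ top3 u)"
  using X.combing[where 'm=4, of u] by (simp add: Suc_nums)

lemma combing3:
  assumes "\<beta> \<in> braid_words 3" "pure3 \<beta>"
  shows "braid_equiv 3 \<beta> (Y.pure_word (W \<beta>) @ Z.pure_word (M (top2 \<beta>)))"
proof -
  have "braid_equiv 3 (top2 \<beta>) (Z.pure_word (M (top2 \<beta>)))"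
    using combing2[of "top2 \<beta>", THEN braid_equiv_Suc] assms top_words(1) by (simp add: pure3_def Suc_nums)
  then show ?thesis
    using combing3'[of \<beta>] assms Y_comb
    by (meson braid_equiv.trans equiv_append pure3_def)
qed

lemmas Y_lower = Y.comb_lower[unfolded Suc_nums] and X_lower = X.comb_lower[unfolded Suc_nums]

lemma row_ops_level2: "\<gamma> \<in> braid_words 2 \<Longrightarrow> pure2 \<gamma> \<Longrightarrow> row_ops \<gamma> v = Z.shear (M \<gamma>) v"
  using row_ops_equiv[OF combing2] Z.row_ops_pure_word by metis

lemma row_ops_level3':
  "\<beta> \<in> braid_words 3 \<Longrightarrow> Y.comb_pos \<beta> 3 = 3 \<Longrightarrow> row_ops \<beta> v = Y.shear (W \<beta>) (row_ops (top2 \<beta>) v)"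
  using row_ops_equiv[OF combing3'] Y.row_ops_pure_word by (metis row_ops_append)

lemma row_ops_level4':
  "u \<in> braid_words 4 \<Longrightarrow> X.comb_pos u 4 = 4 \<Longrightarrow> row_ops u v = X.shear (K u) (row_ops (top3 u) v)"
  using row_ops_equiv[OF combing4'] X.row_ops_pure_word by (metis row_ops_append)

lemma pure2I:
  assumes "\<gamma> \<in> braid_words 2" "2 * row_ops \<gamma> (unit_at 1) 1 = 2"
  shows "pure2 \<gamma>"
  using Z.comb_pos_top[of \<gamma>] assms by (simp add: pure2_def Suc_nums)

text \<open>Doubling sees the matrix modulo 2, where shears are invisible, so the test on the
  diagonal passes down to the braid on the remaining strands.\<close>

lemma pure3I:
  assumes \<beta>: "\<beta> \<in> braid_words 3" and r: "\<And>s. s < 3 \<Longrightarrow> 2 * row_ops \<beta> (unit_at s) s = 2"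
  shows "pure3 \<beta>"
proof -
  have p: "Y.comb_pos \<beta> 3 = 3" using Y.comb_pos_top[of \<beta>] assms r[of 2] by (simp add: Suc_nums)
  have "2 * row_ops (top2 \<beta>) (unit_at 1) 1 = 2"
    using r[of 1] by (simp add: row_ops_level3'[OF \<beta> p] Y.two_shear)
  then show ?thesis using pure2I[OF top_words(1)[OF \<beta>]] p by (simp add: pure3_def)
qed

lemma pure4I:
  assumes u: "u \<in> braid_words 4" and r: "\<And>s. s < 4 \<Longrightarrow> 2 * row_ops u (unit_at s) s = 2"
  shows "pure4 u"
proof -
  have p: "X.comb_pos u 4 = 4" using X.comb_pos_top[of u] assms r[of 3] by (simp add: Suc_nums)
  have "2 * row_ops (top3 u) (unit_at s) s = 2" if "s < 3" for s
    using r[of s] that by (simp add: row_ops_level4'[OF u p] X.two_shear)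
  then show ?thesis using pure3I[OF top_words(2)[OF u]] p by (simp add: pure4_def)
qed

lemma row_ops_level3:
  "\<beta> \<in> braid_words 3 \<Longrightarrow> pure3 \<beta> \<Longrightarrow> row_ops \<beta> v = Y.shear (W \<beta>) (Z.shear (M (top2 \<beta>)) v)"
  by (simp add: pure3_def row_ops_level3' row_ops_level2 top_words)

text \<open>Columns are used from the last one downwards: the inner shear fixes
  \<open>unit_at 2\<close>, so this column tests \<open>W\<close> alone; once that shear is trivial,
  \<open>unit_at 1\<close> tests \<open>M\<close>.\<close>

lemma level4_three_iff:
  assumes \<beta>: "\<beta> \<in> braid_words 3"
  shows "(\<forall>s<3. row_ops \<beta> (unit_at s) = unit_at s) \<longleftrightarrow> pure3 \<beta> \<and> even_fg (W \<beta>) \<and> even_fg (M (top2 \<beta>))"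
proof
  assume r: "\<forall>s<3. row_ops \<beta> (unit_at s) = unit_at s"
  then have p: "pure3 \<beta>" by (intro pure3I[OF \<beta>]) simp
  note eq = row_ops_level3[OF \<beta> p]
  have "Y.shear (W \<beta>) (unit_at 2) = unit_at 2"
    using r[rule_format, of 2] by (simp add: eq Z.shear_unit_above)
  then have w: "even_fg (W \<beta>)" by (rule Y.shear_unit)
  have "Z.shear (M (top2 \<beta>)) (unit_at 1) = unit_at 1"
    using r[rule_format, of 1] by (simp add: eq Y.shear_even[OF w])
  then have "even_fg (M (top2 \<beta>))" using Z.shear_unit by simp
  then show "pure3 \<beta> \<and> even_fg (W \<beta>) \<and> even_fg (M (top2 \<beta>))" using p w by simp
qed (simp add: row_ops_level3[OF \<beta>] Y.shear_even Z.shear_even)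

lemma level4_four_iff:
  assumes u: "u \<in> braid_words 4"
  shows "(\<forall>s<4. row_ops u (unit_at s) = unit_at s) \<longleftrightarrow>
    pure4 u \<and> even_fg (K u) \<and> even_fg (W (top3 u)) \<and> even_fg (M (top2 (top3 u)))"
proof
  assume r: "\<forall>s<4. row_ops u (unit_at s) = unit_at s"
  then have p: "pure4 u" by (intro pure4I[OF u]) simp
  note eq = row_ops_level4'[OF u] and \<beta> = top_words(2)[OF u]
  have "X.shear (K u) (unit_at 3) = unit_at 3"
    using r[rule_format, of 3] p
    by (simp add: pure4_def eq row_ops_level3[OF \<beta>] Z.shear_unit_above Y.shear_unit_above)
  then have k: "even_fg (K u)" by (rule X.shear_unit)
  have "\<forall>s<3. row_ops (top3 u) (unit_at s) = unit_at s"
    using r p by (simp add: pure4_def eq X.shear_even[OF k])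
  then show "pure4 u \<and> even_fg (K u) \<and> even_fg (W (top3 u)) \<and> even_fg (M (top2 (top3 u)))"
    using p k by (simp add: level4_three_iff[OF \<beta>])
next
  assume *: "pure4 u \<and> even_fg (K u) \<and> even_fg (W (top3 u)) \<and> even_fg (M (top2 (top3 u)))"
  then show "\<forall>s<4. row_ops u (unit_at s) = unit_at s"
    by (simp add: pure4_def row_ops_level4'[OF u] row_ops_level3[OF top_words(2)[OF u]] X.shear_even Y.shear_even Z.shear_even)
qed

text \<open>Dividing by the power of the full twist with the same first component makes the factor \<open>\<int>\<close> central.\<close>

definition split3 :: "braid_word \<Rightarrow> unit fg \<times> two_letters fg" where
  "split3 \<beta> = (M (top2 \<beta>), W \<beta> - c2 (M (top2 \<beta>)))"

definition split4 :: "braid_word \<Rightarrow> unit fg \<times> two_letters fg \<times> three_letters fg" where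
  "split4 u = (M (top2 (top3 u)), W (top3 u) - c2 (M (top2 (top3 u))), K u - c3 (M (top2 (top3 u))))"

lemma split3_equiv: "braid_equiv 3 \<beta> \<beta>' \<Longrightarrow> split3 \<beta> = split3 \<beta>'"
  using Y_equiv[of \<beta> \<beta>'] Z_equiv[of "top2 \<beta>" "top2 \<beta>'"] by (simp add: split3_def)

lemma split4_equiv: "braid_equiv 4 u u' \<Longrightarrow> split4 u = split4 u'"
  using X_equiv[of u u'] Y_equiv[of "top3 u" "top3 u'"] Z_equiv[of "top2 (top3 u)" "top2 (top3 u')"]
  by (simp add: split4_def)

lemma M_append: "\<gamma> \<in> braid_words 2 \<Longrightarrow> pure2 \<gamma> \<Longrightarrow> M (\<gamma> @ \<gamma>') = M \<gamma> + M \<gamma>'"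
  by (simp add: Z.comb_append top1 pure2_def)

lemma W_append:
  assumes "\<beta> \<in> braid_words 3" "pure3 \<beta>"
  shows "W (\<beta> @ \<beta>') = W \<beta> + (- c2 (M (top2 \<beta>)) + (W \<beta>' + c2 (M (top2 \<beta>))))"
proof -
  have "Y.act (top2 \<beta>) w = Y.act (Z.pure_word (M (top2 \<beta>))) w" for w
    using Y.act_equiv[OF combing2[of "top2 \<beta>"]] assms top_words(1) by (simp add: pure3_def)
  then show ?thesis using assms by (simp add: Y.comb_append pure3_def Y_act_square)
qed

lemma top2_append: "pure3 \<beta> \<Longrightarrow> top2 (\<beta> @ \<beta>') = top2 \<beta> @ top2 \<beta>'"
  by (simp add: Y.comb_append pure3_def)

lemma commute_cancel: "a + b = b + a \<Longrightarrow> a + - (a + b) = - (b :: 'a::group_add)"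
  by (simp only: minus_add group_add_simps)

text \<open>The conjugation by \<open>c2\<close> in \<open>W_append\<close> is absorbed by the
  subtracted \<open>c2\<close>, which leaves a direct product.\<close>

lemma split3_append:
  assumes "\<beta> \<in> braid_words 3" "pure3 \<beta>"
  shows "split3 (\<beta> @ \<beta>') = split3 \<beta> + split3 \<beta>'"
proof -
  let ?m = "M (top2 \<beta>)" and ?m' = "M (top2 \<beta>')"
  have m: "M (top2 (\<beta> @ \<beta>')) = ?m + ?m'"
    using assms by (simp add: top2_append M_append top_words pure3_def)
  have "c2 ?m + - c2 (?m + ?m') = - c2 ?m'"
    using commute_cancel[OF c_commute(1)] by simp
  then show ?thesis
    unfolding split3_def m W_append[OF assms] by (simp add: add.assoc diff_conv_add_uminus del: add_uminus_conv_diff)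
qed

lemma act_top3:
  assumes "\<beta> \<in> braid_words 3" "pure3 \<beta>"
  shows "X.act \<beta> k = - c3 (M (top2 \<beta>)) + (\<alpha> (W \<beta> - c2 (M (top2 \<beta>))) k + c3 (M (top2 \<beta>)))"
proof -
  have "X.act \<beta> k = \<alpha> (W \<beta>) (\<tau> (M (top2 \<beta>)) k)"
    using X.act_equiv[OF combing3[OF assms]] by (simp add: X.act_append \<alpha>_def \<tau>_def)
  also have "\<dots> = - c3 (M (top2 \<beta>)) + (\<alpha> (W \<beta> + - c2 (M (top2 \<beta>))) k + c3 (M (top2 \<beta>)))"
    by (simp only: \<tau>_eq \<alpha>_add \<alpha>_minus \<alpha>_c3 \<alpha>_plus)
  finally show ?thesis by simp
qed

lemma top3_append: "pure4 u \<Longrightarrow> top3 (u @ u') = top3 u @ top3 u'"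
  by (simp add: X.comb_append pure4_def)

lemma split4_split3: "split4 u = (fst (split3 (top3 u)), snd (split3 (top3 u)), K u - c3 (fst (split3 (top3 u))))"
  by (simp add: split4_def split3_def)

text \<open>The inner automorphism by \<open>c3\<close> in \<open>act_top3\<close> is absorbed by
  the subtracted \<open>c3\<close>, so only the component \<open>w\<close> still acts on the last
  one.\<close>

lemma split4_append:
  assumes u: "u \<in> braid_words 4" "pure4 u"
  shows "split4 (u @ u') = (case (split4 u, split4 u') of ((m, w, k), (m', w', k')) \<Rightarrow> (m + m', w + w', k + \<alpha> w k'))"
proof -
  note \<beta> = top_words(2)[OF u(1)]
  have p: "pure3 (top3 u)" using u by (simp add: pure4_def)
  let ?m = "M (top2 (top3 u))" and ?m' = "M (top2 (top3 u'))" and ?w = "W (top3 u) - c2 (M (top2 (top3 u)))"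
  have s: "split3 (top3 (u @ u')) = split3 (top3 u) + split3 (top3 u')"
    using split3_append[OF \<beta> p] by (simp add: top3_append[OF u(2)])
  have K: "K (u @ u') = K u + (- c3 ?m + (\<alpha> ?w (K u') + c3 ?m))"
    using u act_top3[OF \<beta> p] by (simp add: X.comb_append pure4_def)
  have "c3 ?m + - c3 (?m + ?m') = - c3 ?m'"
    using commute_cancel[OF c_commute(2)] by simp
  then have "K (u @ u') - c3 (?m + ?m') = (K u - c3 ?m) + \<alpha> ?w (K u' - c3 ?m')"
    unfolding K \<alpha>_minus \<alpha>_c3 by (simp add: add.assoc diff_conv_add_uminus del: add_uminus_conv_diff)
  then show ?thesis
    unfolding split4_split3 s by (simp add: split3_def)
qed

lemma split3_inject:
  assumes "\<beta> \<in> braid_words 3" "pure3 \<beta>" "\<beta>' \<in> braid_words 3" "pure3 \<beta>'" "split3 \<beta> = split3 \<beta>'"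
  shows "braid_equiv 3 \<beta> \<beta>'"
proof -
  have "M (top2 \<beta>) = M (top2 \<beta>')" using assms(5) by (simp add: split3_def)
  moreover from this have "W \<beta> = W \<beta>'" using assms(5) by (simp add: split3_def) (metis diff_add_cancel)
  ultimately show ?thesis
    using combing3[OF assms(1,2)] combing3[OF assms(3,4)] by (metis braid_equiv.sym braid_equiv.trans)
qed

lemma split4_inject:
  assumes "u \<in> braid_words 4" "pure4 u" "u' \<in> braid_words 4" "pure4 u'" "split4 u = split4 u'"
  shows "braid_equiv 4 u u'"
proof -
  have p: "pure3 (top3 u)" "pure3 (top3 u')" "X.comb_pos u 4 = 4" "X.comb_pos u' 4 = 4"
    using assms by (simp_all add: pure4_def)
  have s: "split3 (top3 u) = split3 (top3 u')"
    using assms(5) by (auto simp: split4_split3 prod_eq_iff)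
  have k: "K u = K u'"
    using assms(5) unfolding split4_split3 s by simp (metis diff_add_cancel)
  have "braid_equiv 3 (top3 u) (top3 u')"
    by (rule split3_inject[OF top_words(2)[OF assms(1)] p(1) top_words(2)[OF assms(3)] p(2) s])
  then have e: "braid_equiv 4 (top3 u) (top3 u')" using braid_equiv_Suc[of 3] by (simp add: Suc_nums)
  have "X.pure_word (K u) \<in> braid_words 4" using X_comb by blast
  from equiv_append[OF e this] show ?thesis
    using combing4'[OF assms(1) p(3)] combing4'[OF assms(3) p(4)] unfolding k
    by (metis braid_equiv.sym braid_equiv.trans)
qed

lemma split3_surj:
  "\<exists>\<beta>\<in>braid_words 3. pure3 \<beta> \<and> split3 \<beta> = (m, w) \<and> W \<beta> = w + c2 m \<and> M (top2 \<beta>) = m"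
proof
  let ?\<beta> = "Y.pure_word (w + c2 m) @ Z.pure_word m"
  have z: "Z.pure_word m \<in> braid_words 2" using Z_comb by blast
  note l = Y_lower[OF z]
  show "?\<beta> \<in> braid_words 3"
    using Y_comb braid_words_Suc[OF z] by (simp add: Suc_nums)
  show "pure3 ?\<beta> \<and> split3 ?\<beta> = (m, w) \<and> W ?\<beta> = w + c2 m \<and> M (top2 ?\<beta>) = m"
    using Y_comb Z_comb l by (simp add: pure3_def pure2_def split3_def Y.comb_append)
qed

lemma split4_surj:
  "\<exists>u\<in>braid_words 4. pure4 u \<and> split4 u = (m, w, k) \<and> K u = k + c3 m \<and> W (top3 u) = w + c2 m \<and> M (top2 (top3 u)) = m"
proof -
  obtain \<beta> where \<beta>: "\<beta> \<in> braid_words 3" "pure3 \<beta>" "split3 \<beta> = (m, w)" "W \<beta> = w + c2 m" "M (top2 \<beta>) = m"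
    using split3_surj by blast
  let ?u = "X.pure_word (k + c3 m) @ \<beta>"
  note l = X_lower[OF \<beta>(1)]
  have "?u \<in> braid_words 4"
    using X_comb braid_words_Suc[OF \<beta>(1)] by (simp add: Suc_nums)
  moreover have "pure4 ?u \<and> split4 ?u = (m, w, k) \<and> K ?u = k + c3 m \<and> W (top3 ?u) = w + c2 m \<and> M (top2 (top3 ?u)) = m"
    using X_comb l \<beta> by (simp add: pure4_def split4_split3 X.comb_append)
  ultimately show ?thesis by blast
qed

lemma expo_c: "expo y (c2 m) = expo () m" "expo x (c3 m) = expo () m"
proof -
  show "expo y (c2 m) = expo () m"
    by (rule fg_hom_eqI[of "\<lambda>m. expo y (c2 m)" "expo ()"]) (cases y; simp)+
  show "expo x (c3 m) = expo () m"
    by (rule fg_hom_eqI[of "\<lambda>m. expo x (c3 m)" "expo ()"]) (cases x; simp)+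
qed

text \<open>The full twist has exponent one in every letter, so an even power of it changes no
  parity.\<close>

lemma even_c: "even_fg m \<Longrightarrow> even_fg (w - c2 m) \<longleftrightarrow> even_fg w" "even_fg m \<Longrightarrow> even_fg (k - c3 m) \<longleftrightarrow> even_fg k"
    "even_fg m \<Longrightarrow> even_fg (w + c2 m) \<longleftrightarrow> even_fg w" "even_fg m \<Longrightarrow> even_fg (k + c3 m) \<longleftrightarrow> even_fg k"
  by (auto simp: even_fg_def expo_c)

text \<open>On an even element, the first component of \<open>split\<close> is twice a unique element.\<close>

definition coord3 :: "braid_word set \<Rightarrow> unit fg \<times> two_letters fg" where
  "coord3 C = (let u = (SOME u. u \<in> braid_words 3 \<and> C = braid_rel 3 `` {u}) in (half (fst (split3 u)), snd (split3 u)))"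

definition coord4 :: "braid_word set \<Rightarrow> unit fg \<times> two_letters fg \<times> three_letters fg" where
  "coord4 C = (let u = (SOME u. u \<in> braid_words 4 \<and> C = braid_rel 4 `` {u}) in (half (fst (split4 u)), snd (split4 u)))"

lemma class_eq_iff:
  "u \<in> braid_words n \<Longrightarrow> v \<in> braid_words n \<Longrightarrow> braid_rel n `` {u} = braid_rel n `` {v} \<longleftrightarrow> braid_equiv n u v"
  using eq_equiv_class_iff[OF equiv_braid_rel, of u n v] by (simp add: braid_rel_def)

lemma some_class:
  assumes "u \<in> braid_words n"
  shows "braid_equiv n u (SOME v. v \<in> braid_words n \<and> braid_rel n `` {u} = braid_rel n `` {v})"
proof -
  have "\<exists>v. v \<in> braid_words n \<and> braid_rel n `` {u} = braid_rel n `` {v}" using assms by blast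
  from someI_ex[OF this] show ?thesis using assms class_eq_iff by blast
qed

lemma coord_class:
  "u \<in> braid_words 3 \<Longrightarrow> coord3 (braid_rel 3 `` {u}) = (half (fst (split3 u)), snd (split3 u))"
  "v \<in> braid_words 4 \<Longrightarrow> coord4 (braid_rel 4 `` {v}) = (half (fst (split4 v)), snd (split4 v))"
  using split3_equiv[OF some_class, of u] split4_equiv[OF some_class, of v]
  by (simp_all add: coord3_def coord4_def Let_def)

lemma half_plus: "even_fg a \<Longrightarrow> even_fg b \<Longrightarrow> half (a + b) = half a + half b"
proof (rule half_unique)
  assume ab: "even_fg a" "even_fg b"
  then have "even_fg (a + b)" by (simp add: even_fg_def)
  then have "half (a + b) + half (a + b) = half a + half a + (half b + half b)" using ab by (simp add: half)
  then show "half (a + b) + half (a + b) = half a + half b + (half a + half b)"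
    using unit_fg_commute[of "half a" "half b"] by (simp add: add.assoc) (metis add.assoc unit_fg_commute)
qed

lemma half_double: "half (a + a) = a"
  by (rule half_unique) (simp add: half even_fg_def)

lemma level4_carrierE:
  assumes "C \<in> carrier (level4_braid_group n)"
  obtains u where "u \<in> braid_words n" "C = braid_rel n `` {u}" "\<forall>s<n. row_ops u (unit_at s) = unit_at s"
proof -
  have "C \<in> carrier (braid_group n)" using assms by (simp add: level4_braid_group_def kernel_def)
  then obtain u where u: "u \<in> braid_words n" "C = braid_rel n `` {u}" by (rule braid_group_carrierE)
  then show thesis using that level4_iff[OF u(1)] assms by simp
qed

lemma level4_mult: "mult (level4_braid_group n) = mult (braid_group n)"
  by (simp add: level4_braid_group_def)

theorem coord3_bij: "bij_betw coord3 (carrier (level4_braid_group 3)) {(m, w). even_fg w}"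
proof (rule bij_betw_imageI)
  have "\<exists>u. u \<in> braid_words 3 \<and> C = braid_rel 3 `` {u} \<and> pure3 u \<and> even_fg (W u) \<and> even_fg (M (top2 u))"
    if "C \<in> carrier (level4_braid_group 3)" for C
    using that by (rule level4_carrierE) (use level4_three_iff in blast)
  note * = this
  show "inj_on coord3 (carrier (level4_braid_group 3))"
  proof (rule inj_onI)
    fix C D assume C: "C \<in> carrier (level4_braid_group 3)" and D: "D \<in> carrier (level4_braid_group 3)"
      and eq: "coord3 C = coord3 D"
    obtain u where u: "u \<in> braid_words 3" "C = braid_rel 3 `` {u}" "pure3 u" "even_fg (M (top2 u))"
      using *[OF C] by blast
    obtain v where v: "v \<in> braid_words 3" "D = braid_rel 3 `` {v}" "pure3 v" "even_fg (M (top2 v))"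
      using *[OF D] by blast
    have "half (M (top2 u)) = half (M (top2 v))" and s: "snd (split3 u) = snd (split3 v)"
      using eq u v by (simp_all add: coord_class split3_def)
    then have "M (top2 u) = M (top2 v)" using half[OF u(4)] half[OF v(4)] by metis
    with s have "split3 u = split3 v" by (simp add: split3_def)
    then show "C = D" using split3_inject[OF u(1,3) v(1,3)] u v class_eq_iff by blast
  qed
  show "coord3 ` carrier (level4_braid_group 3) = {(m, w). even_fg w}"
  proof (intro equalityI subsetI)
    fix q assume "q \<in> coord3 ` carrier (level4_braid_group 3)"
    then obtain u where u: "u \<in> braid_words 3" "q = coord3 (braid_rel 3 `` {u})" "even_fg (W u)" "even_fg (M (top2 u))"
      using * by blast
    then show "q \<in> {(m, w). even_fg w}" by (simp add: coord_class split3_def even_c)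
  next
    fix q :: "unit fg \<times> two_letters fg" assume "q \<in> {(m, w). even_fg w}"
    then obtain m w where q: "q = (m, w)" "even_fg w" by auto
    \<comment> \<open>The preimage is built with first component \<open>m + m\<close>, since the
      coordinate stores its half.\<close>
    have m: "even_fg (m + m)" by (simp add: even_fg_def)
    obtain u where u: "u \<in> braid_words 3" "pure3 u" "split3 u = (m + m, w)" "W u = w + c2 (m + m)" "M (top2 u) = m + m"
      using split3_surj by blast
    have "braid_rel 3 `` {u} \<in> carrier (level4_braid_group 3)"
      using u q m by (simp add: level4_iff level4_three_iff even_c(3)[OF m] del: c_simps)
    moreover have "coord3 (braid_rel 3 `` {u}) = q" using u q by (simp add: coord_class half_double)
    ultimately show "q \<in> coord3 ` carrier (level4_braid_group 3)" by blast
  qed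
qed

theorem coord4_bij: "bij_betw coord4 (carrier (level4_braid_group 4)) {(m, w, k). even_fg w \<and> even_fg k}"
proof (rule bij_betw_imageI)
  have "\<exists>u. u \<in> braid_words 4 \<and> C = braid_rel 4 `` {u} \<and> pure4 u \<and> even_fg (K u) \<and> even_fg (W (top3 u)) \<and>
      even_fg (M (top2 (top3 u)))"
    if "C \<in> carrier (level4_braid_group 4)" for C
    using that by (rule level4_carrierE) (use level4_four_iff in blast)
  note * = this
  show "inj_on coord4 (carrier (level4_braid_group 4))"
  proof (rule inj_onI)
    fix C D assume C: "C \<in> carrier (level4_braid_group 4)" and D: "D \<in> carrier (level4_braid_group 4)"
      and eq: "coord4 C = coord4 D"
    obtain u where u: "u \<in> braid_words 4" "C = braid_rel 4 `` {u}" "pure4 u" "even_fg (M (top2 (top3 u)))"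
      using *[OF C] by blast
    obtain v where v: "v \<in> braid_words 4" "D = braid_rel 4 `` {v}" "pure4 v" "even_fg (M (top2 (top3 v)))"
      using *[OF D] by blast
    have h: "half (M (top2 (top3 u))) = half (M (top2 (top3 v)))" and s: "snd (split4 u) = snd (split4 v)"
      using eq u v by (simp_all add: coord_class) (simp_all add: split4_def)
    have "M (top2 (top3 u)) = M (top2 (top3 v))" using half[OF u(4)] half[OF v(4)] h by metis
    then have "fst (split4 u) = fst (split4 v)" by (simp add: split4_def)
    with s have "split4 u = split4 v" by (simp add: prod_eq_iff)
    then show "C = D" using split4_inject[OF u(1,3) v(1,3)] u v class_eq_iff by blast
  qed
  show "coord4 ` carrier (level4_braid_group 4) = {(m, w, k). even_fg w \<and> even_fg k}"
  proof (intro equalityI subsetI)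
    fix q assume "q \<in> coord4 ` carrier (level4_braid_group 4)"
    then obtain u where u: "u \<in> braid_words 4" "q = coord4 (braid_rel 4 `` {u})" "even_fg (K u)"
      "even_fg (W (top3 u))" "even_fg (M (top2 (top3 u)))"
      using * by blast
    then show "q \<in> {(m, w, k). even_fg w \<and> even_fg k}" by (simp add: coord_class split4_def even_c)
  next
    fix q :: "unit fg \<times> two_letters fg \<times> three_letters fg" assume "q \<in> {(m, w, k). even_fg w \<and> even_fg k}"
    then obtain m w k where q: "q = (m, w, k)" "even_fg w" "even_fg k" by auto
    have m: "even_fg (m + m)" by (simp add: even_fg_def)
    obtain u where u: "u \<in> braid_words 4" "pure4 u" "split4 u = (m + m, w, k)" "K u = k + c3 (m + m)"
      "W (top3 u) = w + c2 (m + m)" "M (top2 (top3 u)) = m + m"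
      using split4_surj by blast
    have "braid_rel 4 `` {u} \<in> carrier (level4_braid_group 4)"
      using u q m by (simp add: level4_iff level4_four_iff even_c(3,4)[OF m] del: c_simps)
    moreover have "coord4 (braid_rel 4 `` {u}) = q" using u q by (simp add: coord_class half_double)
    ultimately show "q \<in> coord4 ` carrier (level4_braid_group 4)" by blast
  qed
qed

theorem coord3_mult:
  assumes "C \<in> carrier (level4_braid_group 3)" "D \<in> carrier (level4_braid_group 3)"
  shows "coord3 (C \<otimes>\<^bsub>level4_braid_group 3\<^esub> D) = coord3 C + coord3 D"
proof -
  obtain u where u: "u \<in> braid_words 3" "C = braid_rel 3 `` {u}" "pure3 u" "even_fg (M (top2 u))"
    using assms(1) by (rule level4_carrierE) (use level4_three_iff in blast)
  obtain v where v: "v \<in> braid_words 3" "D = braid_rel 3 `` {v}" "pure3 v" "even_fg (M (top2 v))"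
    using assms(2) by (rule level4_carrierE) (use level4_three_iff in blast)
  have "coord3 (braid_rel 3 `` {u @ v}) = coord3 C + coord3 D"
    using u v by (simp add: coord_class split3_append) (simp add: split3_def half_plus)
  then show ?thesis using u v by (simp add: level4_mult braid_group_mult)
qed

theorem coord4_mult:
  assumes "C \<in> carrier (level4_braid_group 4)" "D \<in> carrier (level4_braid_group 4)"
  shows "coord4 (C \<otimes>\<^bsub>level4_braid_group 4\<^esub> D) =
    (case (coord4 C, coord4 D) of ((m, w, k), (m', w', k')) \<Rightarrow> (m + m', w + w', k + \<alpha> w k'))"
proof -
  obtain u where u: "u \<in> braid_words 4" "C = braid_rel 4 `` {u}" "pure4 u" "even_fg (M (top2 (top3 u)))"
    using assms(1) by (rule level4_carrierE) (use level4_four_iff in blast)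
  obtain v where v: "v \<in> braid_words 4" "D = braid_rel 4 `` {v}" "pure4 v" "even_fg (M (top2 (top3 v)))"
    using assms(2) by (rule level4_carrierE) (use level4_four_iff in blast)
  have "coord4 (braid_rel 4 `` {u @ v}) =
      (case (coord4 C, coord4 D) of ((m, w, k), (m', w', k')) \<Rightarrow> (m + m', w + w', k + \<alpha> w k'))"
    using u v by (simp add: coord_class split4_append) (simp add: split4_def half_plus)
  then show ?thesis using u v by (simp add: level4_mult braid_group_mult)
qed

section \<open>Linear algebra: critical cells and decomposition along characters\<close>

section \<open>Homology of matrix complexes\<close>

text \<open>A family of matrices indexed by \<open>i\<close>, with row \<open>x\<close> and column
  \<open>y\<close>. In the application \<open>i\<close> is a character and \<open>x\<close>,
  \<open>y\<close> are cells, so this is a block diagonal differential.\<close>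

definition mat_map :: "('i \<Rightarrow> 'b::finite \<Rightarrow> 'b \<Rightarrow> rat) \<Rightarrow> ('i \<times> 'b \<Rightarrow>\<^sub>0 rat) \<Rightarrow> ('i \<times> 'b \<Rightarrow>\<^sub>0 rat)" where
  "mat_map A = lin (\<lambda>(i, y). \<Sum>x\<in>UNIV. Poly_Mapping.single (i, x) (A i x y))"

lemma mat_map_cell: "mat_map A (cell (i, y)) = (\<Sum>x\<in>UNIV. Poly_Mapping.single (i, x) (A i x y))"
  by (simp add: mat_map_def)

lemma mat_map_single:
  "mat_map A (Poly_Mapping.single (i, y) a) = (\<Sum>x\<in>UNIV. Poly_Mapping.single (i, x) (a * A i x y))"
  by (simp add: mat_map_def lin_single chain_scale_sum chain_scale_single)

lemma lin_map_mat_map [simp, intro]: "lin_map (mat_map A)"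
  by (simp add: mat_map_def lin_map_lin)

lemma lookup_mat_map_cell: "Poly_Mapping.lookup (mat_map A (cell (i, y))) (j, x) = (if i = j then A i x y else 0)"
proof -
  have "Poly_Mapping.lookup (mat_map A (cell (i, y))) (j, x) = (\<Sum>z\<in>UNIV. if z = x then (if i = j then A i z y else 0) else 0)"
    unfolding mat_map_cell lookup_sum by (rule sum.cong) (auto simp: lookup_single when_def)
  then show ?thesis by simp
qed

lemma single_sum: "Poly_Mapping.single x (sum f A) = (\<Sum>a\<in>A. Poly_Mapping.single x (f a))"
  by (induction A rule: infinite_finite_induct) (auto simp: single_add)

lemma mat_map_eqI: "(\<And>i x y. A i x y = B i x y) \<Longrightarrow> mat_map A c = mat_map B c"
  by (simp add: mat_map_def)

lemma mat_map_mat_map: "mat_map A (mat_map B c) = mat_map (\<lambda>i x y. \<Sum>z\<in>UNIV. A i x z * B i z y) c"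
proof (rule lin_map_eqI[of "\<lambda>c. mat_map A (mat_map B c)" "mat_map (\<lambda>i x y. \<Sum>z\<in>UNIV. A i x z * B i z y)" UNIV])
  fix p :: "'a \<times> 'b"
  obtain i y where p: "p = (i, y)" by fastforce
  have "mat_map A (mat_map B (cell p)) = (\<Sum>z\<in>UNIV. \<Sum>x\<in>UNIV. Poly_Mapping.single (i, x) (A i x z * B i z y))"
    by (simp add: p mat_map_cell[of B] lin_map_sum[OF lin_map_mat_map] mat_map_single mult.commute)
  also have "\<dots> = mat_map (\<lambda>i x y. \<Sum>z\<in>UNIV. A i x z * B i z y) (cell p)"
    unfolding p mat_map_cell by (subst sum.swap) (simp add: single_sum)
  finally show "mat_map A (mat_map B (cell p)) = mat_map (\<lambda>i x y. \<Sum>z\<in>UNIV. A i x z * B i z y) (cell p)" .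
qed (auto simp: chains_on_def intro: lin_map_comp)

lemma mat_map_diff: "mat_map A c - mat_map B c = mat_map (\<lambda>i x y. A i x y - B i x y) c"
proof (rule lin_map_eqI[of "\<lambda>c. mat_map A c - mat_map B c" "mat_map (\<lambda>i x y. A i x y - B i x y)" UNIV])
  fix p :: "'a \<times> 'b"
  show "mat_map A (cell p) - mat_map B (cell p) = mat_map (\<lambda>i x y. A i x y - B i x y) (cell p)"
    by (cases p) (simp add: mat_map_cell sum_subtractf[symmetric] single_diff)
qed (auto simp: chains_on_def intro: lin_map_minus)

lemma mat_map_id: "mat_map (\<lambda>i x y. of_bool (x = y)) c = c"
proof (rule lin_map_eqI[of "mat_map (\<lambda>i x y. of_bool (x = y))" "\<lambda>c. c" UNIV])
  fix p :: "'a \<times> 'b"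
  show "mat_map (\<lambda>i x y. of_bool (x = y)) (cell p) = cell p"
    by (cases p, rule poly_mapping_eqI) (auto simp: lookup_mat_map_cell lookup_single when_def split: prod.splits if_splits)
qed (auto simp: chains_on_def)

lemma mat_map_zero: "mat_map (\<lambda>i x y. 0) c = 0"
  by (rule lin_map_eqI[of "mat_map (\<lambda>i x y. 0)" "\<lambda>_. 0" UNIV]) (auto simp: chains_on_def mat_map_def)

lemma mat_map_graded:
  assumes "\<And>i x y. A i x y \<noteq> 0 \<Longrightarrow> dg i y = k \<Longrightarrow> dg i x = j" "c \<in> chains_on {(i, b). dg i b = k}"
  shows "mat_map A c \<in> chains_on {(i, b). dg i b = j}"
proof (rule lin_map_mem[OF lin_map_mat_map _ assms(2)])
  fix p assume "p \<in> {(i, b). dg i b = k}"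
  then obtain i y where p: "p = (i, y)" "dg i y = k" by auto
  have "Poly_Mapping.single (i, x) (A i x y) \<in> chains_on {(i, b). dg i b = j}" for x
    using assms(1)[of i x y] p by (cases "A i x y = 0") (auto intro!: chains_single)
  then show "mat_map A (cell p) \<in> chains_on {(i, b). dg i b = j}"
    unfolding p mat_map_cell by (intro chains_sum)
qed

text \<open>A splitting homotopy \<open>H\<close> whose defect \<open>\<Theta> = 1 - DH - HD\<close> is supported on critical cells
  in the sense below identifies the homology with the space spanned by the critical cells.\<close>

theorem chain_equiv_critical:
  fixes D H \<Theta> :: "'i \<Rightarrow> 'b::finite \<Rightarrow> 'b \<Rightarrow> rat" and crit :: "'i \<Rightarrow> 'b \<Rightarrow> bool" and dg :: "'i \<Rightarrow> 'b \<Rightarrow> nat"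
  assumes D: "\<And>i x y. D i x y \<noteq> 0 \<Longrightarrow> dg i y = Suc (dg i x)"
    and H: "\<And>i x y. H i x y \<noteq> 0 \<Longrightarrow> dg i x = Suc (dg i y)"
    and \<Theta>: "\<And>i x y. \<Theta> i x y = of_bool (x = y) - (\<Sum>z\<in>UNIV. D i x z * H i z y) - (\<Sum>z\<in>UNIV. H i x z * D i z y)"
    and \<Theta>D: "\<And>i x y. (\<Sum>z\<in>UNIV. \<Theta> i x z * D i z y) = 0"
    and D\<Theta>: "\<And>i x y. (\<Sum>z\<in>UNIV. D i x z * \<Theta> i z y) = 0"
    and \<Theta>\<Theta>: "\<And>i x y. (\<Sum>z\<in>UNIV. \<Theta> i x z * (of_bool (crit i z) * \<Theta> i z y)) = \<Theta> i x y"
    and crit: "\<And>i x y. crit i x \<Longrightarrow> crit i y \<Longrightarrow> (\<Sum>z\<in>UNIV. \<Theta> i x z * \<Theta> i z y) = of_bool (x = y)"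
  shows "chain_equiv (\<lambda>k. {(i, b). dg i b = k}) (mat_map D) (\<lambda>k. {(i, b). dg i b = k \<and> crit i b}) (\<lambda>_. 0)"
proof -
  let ?X = "\<lambda>k. {(i, b). dg i b = k}" and ?E = "\<lambda>k. {(i, b). dg i b = k \<and> crit i b}"
  let ?P = "\<lambda>i x y. of_bool (x = y \<and> crit i x) :: rat"
  have P_entry: "(\<Sum>z\<in>UNIV. of_bool (x = z \<and> crit i x) * F z) = of_bool (crit i x) * F x"
    "(\<Sum>z\<in>UNIV. F z * of_bool (z = x \<and> crit i z)) = F x * of_bool (crit i x)" for i x and F :: "'b \<Rightarrow> rat"
  proof -
    have "(\<Sum>z\<in>UNIV. of_bool (x = z \<and> crit i x) * F z) = (\<Sum>z\<in>UNIV. if z = x then of_bool (crit i x) * F z else 0)"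
      by (rule sum.cong) auto
    then show "(\<Sum>z\<in>UNIV. of_bool (x = z \<and> crit i x) * F z) = of_bool (crit i x) * F x" by simp
    have "(\<Sum>z\<in>UNIV. F z * of_bool (z = x \<and> crit i z)) = (\<Sum>z\<in>UNIV. if z = x then F z * of_bool (crit i x) else 0)"
      by (rule sum.cong) auto
    then show "(\<Sum>z\<in>UNIV. F z * of_bool (z = x \<and> crit i z)) = F x * of_bool (crit i x)" by simp
  qed
  have \<Theta>_map: "mat_map \<Theta> c = c - mat_map D (mat_map H c) - mat_map H (mat_map D c)" for c
  proof -
    have "mat_map \<Theta> c = mat_map (\<lambda>i x y. of_bool (x = y) - (\<Sum>z\<in>UNIV. D i x z * H i z y) - (\<Sum>z\<in>UNIV. H i x z * D i z y)) c"
      by (rule mat_map_eqI) (rule \<Theta>)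
    then show ?thesis by (simp add: mat_map_mat_map mat_map_diff[symmetric] mat_map_id)
  qed
  have P_mem: "mat_map ?P c \<in> chains_on (?E k)" if "c \<in> chains_on (?X k)" for c k
  proof (rule lin_map_mem[OF lin_map_mat_map _ that])
    fix p assume "p \<in> ?X k"
    then obtain i y where p: "p = (i, y)" "dg i y = k" by auto
    show "mat_map ?P (cell p) \<in> chains_on (?E k)"
      unfolding p mat_map_cell
      by (intro chains_sum) (use p in \<open>auto intro!: chains_single simp: of_bool_def\<close>)
  qed
  have P_E: "mat_map ?P c = c" if "c \<in> chains_on (?E k)" for c k
  proof (rule lin_map_eqI[OF _ lin_map_id _ that])
    fix p assume "p \<in> ?E k"
    then obtain i y where p: "p = (i, y)" "crit i y" by auto
    show "mat_map ?P (cell p) = cell p"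
      unfolding p by (rule poly_mapping_eqI) (use p in \<open>auto simp: lookup_mat_map_cell lookup_single when_def split: prod.splits if_splits\<close>)
  qed simp
  have gD: "mat_map D c \<in> chains_on (?X k)" if "c \<in> chains_on (?X (Suc k))" for c k
    by (rule mat_map_graded[OF _ that]) (use D in auto)
  have gH: "mat_map H c \<in> chains_on (?X (Suc k))" if "c \<in> chains_on (?X k)" for c k
    by (rule mat_map_graded[OF _ that]) (use H in auto)
  have D0: "mat_map D c = 0" if "c \<in> chains_on (?X 0)" for c
  proof (rule lin_map_eqI[OF lin_map_mat_map lin_map_zero _ that])
    fix p assume "p \<in> ?X 0"
    then obtain i y where p: "p = (i, y)" "dg i y = 0" by auto
    have "D i x y = 0" for x using D[of i x y] p by auto
    then show "mat_map D (cell p) = 0" by (simp add: p mat_map_cell)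
  qed
  have g\<Theta>: "mat_map \<Theta> c \<in> chains_on (?X k)" if c: "c \<in> chains_on (?X k)" for c k
  proof (cases k)
    case 0
    then show ?thesis using c gH[OF c] gD[of "mat_map H c" k] D0[of c]
      by (simp add: \<Theta>_map lin_map_0[OF lin_map_mat_map] chains_diff)
  next
    case (Suc j)
    then show ?thesis using c gH[OF c] gD[of "mat_map H c" k] gD[of c j] gH[of "mat_map D c" j]
      by (simp add: \<Theta>_map chains_diff)
  qed
  have \<Theta>D': "mat_map \<Theta> (mat_map D c) = 0" and D\<Theta>': "mat_map D (mat_map \<Theta> c) = 0" for c
    by (simp_all add: mat_map_mat_map \<Theta>D D\<Theta> mat_map_zero)
  have \<Theta>P\<Theta>: "mat_map \<Theta> (mat_map ?P (mat_map \<Theta> c)) = mat_map \<Theta> c" for c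
    unfolding mat_map_mat_map P_entry \<Theta>\<Theta> ..
  have P\<Theta>\<Theta>P: "mat_map ?P (mat_map \<Theta> (mat_map \<Theta> (mat_map ?P c))) = mat_map ?P c" for c
    unfolding mat_map_mat_map P_entry sum_distrib_right[symmetric]
  proof (rule mat_map_eqI)
    fix i x y
    have "(\<Sum>z\<in>UNIV. \<Theta> i x z * (\<Theta> i z y * of_bool (crit i y))) = (\<Sum>z\<in>UNIV. \<Theta> i x z * \<Theta> i z y) * of_bool (crit i y)"
      by (simp add: sum_distrib_right mult.assoc)
    then show "of_bool (crit i x) * (\<Sum>z\<in>UNIV. \<Theta> i x z * (\<Theta> i z y * of_bool (crit i y))) = of_bool (x = y \<and> crit i x)"
      using crit[of i x y] by (auto simp: of_bool_def)
  qed
  show ?thesis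
    unfolding chain_equiv_def
  proof (intro exI conjI allI ballI)
    \<comment> \<open>With \<open>?P\<close> the projection to critical cells,
      \<open>f g = P \<Theta> \<Theta> P = P\<close> by \<open>crit\<close>, and
      \<open>g f = \<Theta> P \<Theta> = \<Theta> = 1 - D H - H D\<close>, so that
      \<open>- H\<close> is the homotopy.\<close>
    let ?f = "\<lambda>c. mat_map ?P (mat_map \<Theta> c)" and ?g = "\<lambda>c. mat_map \<Theta> (mat_map ?P c)"
    let ?h = "\<lambda>c. - mat_map H c" and ?z = "\<lambda>c. 0"
    have EX: "c \<in> chains_on (?X k)" if "c \<in> chains_on (?E k)" for c k
      by (rule chains_mono[OF _ that]) auto
    show "graded_map ?X ?E ?f"
      by (rule graded_mapI[OF lin_map_comp[OF lin_map_mat_map lin_map_mat_map]]) (auto intro!: P_mem g\<Theta>)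
    show "graded_map ?E ?X ?g"
    proof (rule graded_mapI[OF lin_map_comp[OF lin_map_mat_map lin_map_mat_map]])
      fix k p assume "p \<in> ?E k"
      then have p: "cell p \<in> chains_on (?E k)" by simp
      show "?g (cell p) \<in> chains_on (?X k)" using g\<Theta>[OF EX[OF p]] unfolding P_E[OF p] .
    qed
    show "graded_map ?X (shift ?X) ?h"
    proof (rule graded_mapI)
      show "lin_map ?h" by (auto simp: lin_map_def lin_map_add[OF lin_map_mat_map] lin_map_scale[OF lin_map_mat_map] chain_scale_minus_right)
      fix k p assume "p \<in> ?X k"
      then show "?h (cell p) \<in> chains_on (?X (Suc k))" using gH[of "cell p" k] by (auto intro: chains_uminus)
    qed
    show "graded_map ?E (shift ?E) ?z" by (rule graded_mapI) auto
    fix k c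
    show "?f (mat_map D c) = 0" by (simp add: \<Theta>D' lin_map_0[OF lin_map_mat_map])
    show "?g 0 = mat_map D (?g c)" by (simp add: D\<Theta>' lin_map_0[OF lin_map_mat_map])
    show "?g (?f c) - c = mat_map D (?h c) + ?h (mat_map D c)"
    proof -
      have "mat_map ?P (mat_map ?P b) = mat_map ?P b" for b
        unfolding mat_map_mat_map P_entry by (rule mat_map_eqI) (auto simp: of_bool_def)
      then have "?g (?f c) = mat_map \<Theta> c" by (simp only: \<Theta>P\<Theta>)
      then show ?thesis by (simp add: \<Theta>_map lin_map_uminus[OF lin_map_mat_map])
    qed
    assume c: "c \<in> chains_on (?E k)"
    show "?f (?g c) - c = 0 + 0"
      using P\<Theta>\<Theta>P[of c] P_E[OF c] by simp
  qed
qed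

section \<open>Characters of elementary abelian 2-groups\<close>

text \<open>Models a finite elementary abelian 2-group whose rational characters are indexed by the
  group itself. Orthogonality in both variables makes the Fourier transform invertible.\<close>

locale duality =
  fixes xor :: "'v::finite \<Rightarrow> 'v \<Rightarrow> 'v" and pair :: "'v \<Rightarrow> 'v \<Rightarrow> rat" and N :: rat
  assumes pair_xor: "\<And>\<chi> u v. pair \<chi> (xor u v) = pair \<chi> u * pair \<chi> v"
    and orth: "\<And>u v. (\<Sum>\<chi>\<in>UNIV. pair \<chi> u * pair \<chi> v) = (if u = v then N else 0)"
    and orth': "\<And>\<chi> \<psi>. (\<Sum>v\<in>UNIV. pair \<chi> v * pair \<psi> v) = (if \<chi> = \<psi> then N else 0)"
    and N: "N \<noteq> 0"

definition sgn_bool :: "bool \<Rightarrow> bool \<Rightarrow> rat" where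
  "sgn_bool a b = (if a \<and> b then -1 else 1)"

lemma duality_bool: "duality (\<lambda>a b. a \<noteq> b) sgn_bool 2"
  by unfold_locales (auto simp: sgn_bool_def UNIV_bool)

lemma duality_prod:
  fixes xor :: "'a::finite \<Rightarrow> 'a \<Rightarrow> 'a" and xor' :: "'b::finite \<Rightarrow> 'b \<Rightarrow> 'b"
  assumes "duality xor pair N" "duality xor' pair' N'"
  shows "duality (\<lambda>(a, a') (b, b'). (xor a b, xor' a' b')) (\<lambda>(a, a') (b, b'). pair a b * pair' a' b') (N * N')"
proof -
  interpret A: duality xor pair N by fact
  interpret B: duality xor' pair' N' by fact
  have s: "(\<Sum>p\<in>UNIV. (case p of (a, b) \<Rightarrow> f a * g b)) = (\<Sum>a\<in>UNIV. f a) * (\<Sum>b\<in>UNIV. g b)"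
    for f :: "'a \<Rightarrow> rat" and g :: "'b \<Rightarrow> rat"
    unfolding UNIV_Times_UNIV[symmetric] sum.cartesian_product[symmetric] by (simp add: sum_product)
  show ?thesis
  proof
    fix u v :: "'a \<times> 'b"
    obtain u1 u2 v1 v2 where uv: "u = (u1, u2)" "v = (v1, v2)" by fastforce
    have "(\<Sum>p\<in>UNIV. (case p of (a, b) \<Rightarrow> (pair a u1 * pair a v1) * (pair' b u2 * pair' b v2))) =
        (if u = v then N * N' else 0)"
      unfolding s A.orth B.orth by (simp add: uv)
    then show "(\<Sum>\<chi>\<in>UNIV. (case \<chi> of (a, a') \<Rightarrow> \<lambda>(b, b'). pair a b * pair' a' b') u *
        (case \<chi> of (a, a') \<Rightarrow> \<lambda>(b, b'). pair a b * pair' a' b') v) = (if u = v then N * N' else 0)"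
      by (simp add: uv case_prod_unfold mult_ac)
    have "(\<Sum>p\<in>UNIV. (case p of (a, b) \<Rightarrow> (pair u1 a * pair v1 a) * (pair' u2 b * pair' v2 b))) =
        (if u = v then N * N' else 0)"
      unfolding s A.orth' B.orth' by (simp add: uv)
    then show "(\<Sum>w\<in>UNIV. (case u of (a, a') \<Rightarrow> \<lambda>(b, b'). pair a b * pair' a' b') w *
        (case v of (a, a') \<Rightarrow> \<lambda>(b, b'). pair a b * pair' a' b') w) = (if u = v then N * N' else 0)"
      by (simp add: uv case_prod_unfold mult_ac)
  qed (auto simp: A.pair_xor B.pair_xor A.N B.N)
qed

context duality
begin

text \<open>The differential of a complex of free modules over the group ring, determined by its
  values \<open>bd b\<close> on a basis; the cell \<open>(v, b)\<close> is the translate of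
  \<open>b\<close> by \<open>v\<close>.\<close>

definition group_ring_d :: "('b \<Rightarrow> ('v \<times> 'b \<Rightarrow>\<^sub>0 rat)) \<Rightarrow> ('v \<times> 'b \<Rightarrow>\<^sub>0 rat) \<Rightarrow> ('v \<times> 'b \<Rightarrow>\<^sub>0 rat)" where
  "group_ring_d bd = lin (\<lambda>(v, b). push (\<lambda>(u, b'). (xor v u, b')) (bd b))"

definition ev :: "'v \<Rightarrow> ('v \<times> 'b \<Rightarrow>\<^sub>0 rat) \<Rightarrow> ('b \<Rightarrow>\<^sub>0 rat)" where
  "ev \<chi> = lin (\<lambda>(u, b). Poly_Mapping.single b (pair \<chi> u))"

definition fourier :: "('v \<times> 'b \<Rightarrow>\<^sub>0 rat) \<Rightarrow> ('v \<times> 'b \<Rightarrow>\<^sub>0 rat)" where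
  "fourier = lin (\<lambda>(v, b). \<Sum>\<chi>\<in>UNIV. Poly_Mapping.single (\<chi>, b) (pair \<chi> v))"

definition inv_fourier :: "('v \<times> 'b \<Rightarrow>\<^sub>0 rat) \<Rightarrow> ('v \<times> 'b \<Rightarrow>\<^sub>0 rat)" where
  "inv_fourier = lin (\<lambda>(\<chi>, b). \<Sum>v\<in>UNIV. Poly_Mapping.single (v, b) (pair \<chi> v / N))"

lemma single_lin_eqI:
  assumes "lin_map f" "lin_map g" "\<And>v b. f (cell (v, b)) = g (cell (v, b))"
  shows "f c = g c"
  by (rule lin_map_eqI[OF assms(1,2), of UNIV]) (use assms(3) in \<open>auto simp: chains_on_def\<close>)

lemma inv_fourier_fourier: "inv_fourier (fourier c) = c"
proof (rule single_lin_eqI[of "\<lambda>c. inv_fourier (fourier c)" "\<lambda>c. c"])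
  fix v :: 'v and b :: 'b
  have "inv_fourier (fourier (cell (v, b))) = (\<Sum>\<chi>\<in>UNIV. \<Sum>u\<in>UNIV. Poly_Mapping.single (u, b) (pair \<chi> v * pair \<chi> u / N))"
    by (simp add: fourier_def inv_fourier_def lins lin_single chain_scale_sum chain_scale_single)
  also have "\<dots> = (\<Sum>u\<in>UNIV. Poly_Mapping.single (u, b) ((\<Sum>\<chi>\<in>UNIV. pair \<chi> v * pair \<chi> u) / N))"
    by (subst sum.swap) (simp add: single_sum[symmetric] sum_divide_distrib)
  also have "\<dots> = (\<Sum>u\<in>UNIV. if u = v then cell (v, b) else 0)"
    by (rule sum.cong) (auto simp: orth N)
  finally show "inv_fourier (fourier (cell (v, b))) = cell (v, b)" by simp
qed (auto simp: fourier_def inv_fourier_def lin_simps)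

lemma fourier_inv_fourier: "fourier (inv_fourier c) = c"
proof (rule single_lin_eqI[of "\<lambda>c. fourier (inv_fourier c)" "\<lambda>c. c"])
  fix \<psi> :: 'v and b :: 'b
  have "fourier (inv_fourier (cell (\<psi>, b))) = (\<Sum>u\<in>UNIV. \<Sum>\<chi>\<in>UNIV. Poly_Mapping.single (\<chi>, b) (pair \<psi> u * pair \<chi> u / N))"
    by (simp add: fourier_def inv_fourier_def lins lin_single chain_scale_sum chain_scale_single)
  also have "\<dots> = (\<Sum>\<chi>\<in>UNIV. Poly_Mapping.single (\<chi>, b) ((\<Sum>u\<in>UNIV. pair \<psi> u * pair \<chi> u) / N))"
    by (subst sum.swap) (simp add: single_sum[symmetric] sum_divide_distrib)
  also have "\<dots> = (\<Sum>\<chi>\<in>UNIV. if \<chi> = \<psi> then cell (\<psi>, b) else 0)"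
    by (rule sum.cong) (auto simp: orth' N)
  finally show "fourier (inv_fourier (cell (\<psi>, b))) = cell (\<psi>, b)" by simp
qed (auto simp: fourier_def inv_fourier_def lin_simps)

lemma fourier_translate:
  fixes c :: "'v \<times> 'b::finite \<Rightarrow>\<^sub>0 rat"
  shows "fourier (push (\<lambda>(u, b'). (xor v u, b')) c) =
    (\<Sum>\<chi>\<in>UNIV. \<Sum>x\<in>UNIV. Poly_Mapping.single (\<chi>, x) (pair \<chi> v * Poly_Mapping.lookup (ev \<chi> c) x))" (is "?f c = ?g c")
proof (rule single_lin_eqI[of ?f ?g])
  fix u :: 'v and b' :: 'b
  have "(\<Sum>x\<in>UNIV. Poly_Mapping.single (\<chi>, x) (pair \<chi> v * Poly_Mapping.lookup (ev \<chi> (cell (u, b'))) x))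
      = Poly_Mapping.single (\<chi>, b') (pair \<chi> v * pair \<chi> u)" for \<chi>
  proof -
    have "(\<Sum>x\<in>UNIV. Poly_Mapping.single (\<chi>, x) (pair \<chi> v * Poly_Mapping.lookup (ev \<chi> (cell (u, b'))) x))
      = (\<Sum>x\<in>UNIV. if x = b' then Poly_Mapping.single (\<chi>, x) (pair \<chi> v * pair \<chi> u) else 0)"
      by (rule sum.cong) (auto simp: ev_def lookup_single when_def)
    then show ?thesis by simp
  qed
  then show "?f (cell (u, b')) = ?g (cell (u, b'))"
    by (simp add: fourier_def pair_xor)
next
  show "lin_map ?g"
    by (auto simp: lin_map_def ev_def lins lookup_add distrib_left single_add sum.distrib chain_scale_sum
        chain_scale_single mult_ac)
  show "lin_map ?f" by (rule lin_map_comp) (auto simp: fourier_def)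
qed

text \<open>Characters are multiplicative, so translation by \<open>v\<close> multiplies each
  character component by a scalar. The differential becomes block diagonal, its group ring
  coefficients being evaluated at the character.\<close>

lemma fourier_d:
  fixes bd :: "'b::finite \<Rightarrow> ('v \<times> 'b \<Rightarrow>\<^sub>0 rat)"
  shows "fourier (group_ring_d bd c) = mat_map (\<lambda>\<chi> x y. Poly_Mapping.lookup (ev \<chi> (bd y)) x) (fourier c)"
    (is "?f c = ?g c")
proof (rule single_lin_eqI[of ?f ?g])
  fix v :: 'v and b :: 'b
  show "?f (cell (v, b)) = ?g (cell (v, b))"
    by (simp add: group_ring_d_def fourier_translate)
      (simp add: fourier_def lin_map_sum[OF lin_map_mat_map] mat_map_single)
next
  show "lin_map ?f" by (rule lin_map_comp) (auto simp: fourier_def group_ring_d_def)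
  show "lin_map ?g" by (rule lin_map_comp) (auto simp: fourier_def)
qed

theorem chain_equiv_fourier:
  fixes bd :: "'b::finite \<Rightarrow> ('v \<times> 'b \<Rightarrow>\<^sub>0 rat)"
  shows "chain_equiv (\<lambda>k. {(v, b). dg b = k}) (group_ring_d bd) (\<lambda>k. {(\<chi>, b). dg b = k})
    (mat_map (\<lambda>\<chi> x y. Poly_Mapping.lookup (ev \<chi> (bd y)) x))"
  unfolding chain_equiv_def
proof (intro exI conjI allI ballI)
  let ?X = "\<lambda>k. {(v, b). dg b = k}"
  show "graded_map ?X ?X fourier" "graded_map ?X ?X inv_fourier"
    by (auto intro!: graded_mapI chains_sum chains_single simp: fourier_def inv_fourier_def)
  show "graded_map ?X (shift ?X) (\<lambda>_. 0)" "graded_map ?X (shift ?X) (\<lambda>_. 0)"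
    by (auto intro!: graded_mapI)
  fix c :: "'v \<times> 'b \<Rightarrow>\<^sub>0 rat"
  let ?m = "mat_map (\<lambda>\<chi> x y. Poly_Mapping.lookup (ev \<chi> (bd y)) x)"
  show "fourier (group_ring_d bd c) = ?m (fourier c)" by (rule fourier_d)
  show "inv_fourier (?m c) = group_ring_d bd (inv_fourier c)"
    by (metis fourier_d inv_fourier_fourier fourier_inv_fourier)
qed (simp_all add: inv_fourier_fourier fourier_inv_fourier group_ring_d_def lins lin_map_0[OF lin_map_mat_map])

end

section \<open>Equivariant structure of the iterated cones\<close>

section \<open>Equivariance of the cone\<close>

context cone
begin

text \<open>The map \<open>L w\<close> on the fibre may depend on the vertex, because fibre
  coordinates are relative to it; \<open>L_A\<close> makes these maps compatible with the gluing
  along edges.\<close>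

lemma cone_d_equivariant:
  assumes x: "x \<in> cone_cells k"
    and L_d: "\<And>w p j. p \<in> X j \<Longrightarrow> d (cell (L w p)) = push (L w) (d (cell p))"
    and L_A: "\<And>w t p j. p \<in> X j \<Longrightarrow> A (- gen t) (cell (L w p)) = push (L (w + gen t)) (A (- gen t) (cell p))"
  shows "cone_d (cell (case x of (w, o', p) \<Rightarrow> (u + w, o', L w p))) =
    push (\<lambda>(w, o', p). (u + w, o', L w p)) (cone_d (cell x))"
proof -
  let ?F = "\<lambda>(w, o', p). (u + w, o', L w p)"
  have v: "push ?F (vtx w c) = vtx (u + w) (push (L w) c)" and e: "push ?F (edge w t c) = edge (u + w) t (push (L w) c)" for w t c
    by (simp_all add: vtx_def edge_def push_push)
  show ?thesis
    using x
  proof (cases rule: cone_cell_cases)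
    case (vtx w p)
    have "cell (u + w, None, L w p) = vtx (u + w) (cell (L w p))" by (simp add: vtx_def)
    then show ?thesis using vtx by (simp add: cone_d_vtx v L_d[OF vtx(2)] del: push_cell)
  next
    case (edge w t p j)
    have "cell (u + w, Some t, L w p) = edge (u + w) t (cell (L w p))" by (simp add: edge_def)
    moreover have "cone_d (edge (u + w) t (cell (L w p))) = push ?F (cone_d (edge w t (cell p)))"
      unfolding cone_d_edge pushs v e L_d[OF edge(3)] L_A[OF edge(3)] by (simp add: add.assoc)
    ultimately show ?thesis using edge by simp
  qed
qed

end

section \<open>The action of an automorphism on the Cayley tree\<close>

text \<open>The 1-chain of the geodesic from 0 to \<open>f\<close>. Its cocycle rule is the product
  rule of Fox calculus, so its coefficients are the Fox derivatives of \<open>f\<close>.\<close>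

definition geod :: "'a fg \<Rightarrow> ('a fg \<times> 'a option \<times> unit \<Rightarrow>\<^sub>0 rat)" where
  "geod f = tree.sweep f (cell ())"

lemma point_chain: "c \<in> chains_on (point_cells 0)"
  by (simp add: chains_on_def point_cells_def)

lemma geod_plus: "geod (a + b) = geod a + tree.trans a (geod b)"
  unfolding geod_def by (rule tree.sweep_plus[OF point_chain])

lemma geod_0 [simp]: "geod 0 = 0"
  by (simp add: geod_def)

lemma geod_gen: "geod (gen x) = cell (0, Some x, ())"
  by (simp add: geod_def tree.sweep_gen tree.edge_def)

lemma geod_uminus: "geod (- a) = - tree.trans (- a) (geod a)"
  using geod_plus[of "- a" a] by (simp add: eq_neg_iff_add_eq_0)

lemma geod_mem: "geod f \<in> chains_on (tree.cone_cells (Suc 0))"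
  unfolding geod_def by (rule tree.sweep_mem[OF point_chain])

lemma tree_d_geod: "tree.cone_d (geod f) = cell (f, None, ()) - cell (0, None, ())"
  unfolding geod_def by (simp add: tree.cone_d_sweep[OF point_chain] tree.vtx_def lin_map_0[OF tree.sweep_lin])

lemma trans_cell: "tree.trans a (cell (k, o', ())) = cell (a + k, o', ())"
  by (simp add: tree.trans_def)

lemma tree_d_cell: "tree.cone_d (cell (k, None, ())) = 0"
  "tree.cone_d (cell (k, Some x, ())) = cell (k + gen x, None, ()) - cell (k, None, ())"
  using tree.cone_d_vtx[of k "cell ()"] tree.cone_d_edge[of k x "cell ()"]
  by (simp_all add: tree.vtx_def tree.edge_def pushs)

text \<open>A homomorphism carries vertices to vertices but stretches an edge to the geodesic
  between the images of its ends.\<close>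

definition tree_map :: "('a fg \<Rightarrow> 'a fg) \<Rightarrow> ('a fg \<times> 'a option \<times> unit \<Rightarrow>\<^sub>0 rat) \<Rightarrow> ('a fg \<times> 'a option \<times> unit \<Rightarrow>\<^sub>0 rat)" where
  "tree_map \<phi> = lin (\<lambda>(k, o', _). case o' of None \<Rightarrow> cell (\<phi> k, None, ()) | Some x \<Rightarrow> tree.trans (\<phi> k) (geod (\<phi> (gen x))))"

lemma tree_map_lin [simp]: "lin_map (tree_map \<phi>)"
  by (simp add: tree_map_def lin_map_lin)

lemma tree_map_cell: "tree_map \<phi> (cell (k, None, ())) = cell (\<phi> k, None, ())"
  "tree_map \<phi> (cell (k, Some x, ())) = tree.trans (\<phi> k) (geod (\<phi> (gen x)))"
  by (simp_all add: tree_map_def)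

lemma tree_cell_cases:
  obtains (vtx) k where "p = (k, None, ())" | (edge) k x where "p = (k, Some x, ())"
  by (cases p) (metis option.exhaust unit.exhaust)

lemma tree_lin_eqI:
  assumes "lin_map f" "lin_map g" "\<And>k. f (cell (k, None, ())) = g (cell (k, None, ()))"
    "\<And>k x. f (cell (k, Some x, ())) = g (cell (k, Some x, ()))"
  shows "f c = g c"
proof (rule lin_map_eqI[OF assms(1,2), of UNIV])
  fix p show "f (cell p) = g (cell p)" by (cases p rule: tree_cell_cases) (simp_all add: assms)
qed (auto simp: chains_on_def)

lemma tree_map_trans:
  assumes "\<And>a b. \<phi> (a + b) = \<phi> a + \<phi> b"
  shows "tree_map \<phi> (tree.trans a c) = tree.trans (\<phi> a) (tree_map \<phi> c)"
  by (rule tree_lin_eqI[of "\<lambda>c. tree_map \<phi> (tree.trans a c)" "\<lambda>c. tree.trans (\<phi> a) (tree_map \<phi> c)"]) (auto intro: lin_map_comp simp: trans_cell tree_map_cell assms)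

text \<open>The image of a geodesic may backtrack, but backtracking cancels in the chain. This is
  what makes \<open>tree_map\<close> respect composition.\<close>

lemma tree_map_geod:
  assumes "\<And>a b. \<phi> (a + b) = \<phi> a + \<phi> b"
  shows "tree_map \<phi> (geod f) = geod (\<phi> f)"
proof (induction f rule: fg_induct)
  case zero
  then show ?case using hom_uminus(1)[of \<phi>, OF assms] by (simp add: lin_map_0[OF tree_map_lin])
next
  case (gen s w)
  have "tree_map \<phi> (geod (gen s)) = geod (\<phi> (gen s))"
    using hom_uminus(1)[of \<phi>, OF assms] by (simp add: geod_gen tree_map_cell)
  then show ?case using gen
    by (simp add: geod_plus lin_map_add[OF tree_map_lin] tree_map_trans[of \<phi>, OF assms] assms)
next
  case (inv s w)
  have "tree_map \<phi> (geod (gen s)) = geod (\<phi> (gen s))"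
    using hom_uminus(1)[of \<phi>, OF assms] by (simp add: geod_gen tree_map_cell)
  then have "tree_map \<phi> (geod (- gen s)) = geod (\<phi> (- gen s))"
    using hom_uminus(2)[of \<phi>, OF assms]
    by (simp add: geod_uminus lin_map_uminus[OF tree_map_lin] tree_map_trans[of \<phi>, OF assms])
  then show ?case using inv
    by (simp add: geod_plus lin_map_add[OF tree_map_lin] tree_map_trans[of \<phi>, OF assms] assms)
qed

lemma tree_cells: "tree.cone_cells k = {(w, o', p). k = (if o' = None then 0 else Suc 0)}"
  by (auto simp: tree.cone_cells_def point_cells_def split: option.splits if_splits)

lemma tree_map_d:
  assumes "\<And>a b. \<phi> (a + b) = \<phi> a + \<phi> b"
  shows "tree_map \<phi> (tree.cone_d c) = tree.cone_d (tree_map \<phi> c)"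
proof (rule tree_lin_eqI[of "\<lambda>c. tree_map \<phi> (tree.cone_d c)" "\<lambda>c. tree.cone_d (tree_map \<phi> c)"])
  fix k x
  have "tree.cone_d (tree.trans (\<phi> k) (geod (\<phi> (gen x)))) = tree.trans (\<phi> k) (tree.cone_d (geod (\<phi> (gen x))))"
    by (rule tree.cone_d_trans)
  then show "tree_map \<phi> (tree.cone_d (cell (k, Some x, ()))) = tree.cone_d (tree_map \<phi> (cell (k, Some x, ())))"
    by (simp add: tree_d_cell tree_map_cell lin_map_diff[OF tree_map_lin] assms tree_d_geod tree.lin_simps' trans_cell)
qed (auto intro: lin_map_comp simp: tree_d_cell tree_map_cell lin_map_0[OF tree_map_lin])

lemma cone_tree:
  fixes \<phi> :: "'s fg \<Rightarrow> 'a fg \<Rightarrow> 'a fg"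
  assumes hom: "\<And>w a b. \<phi> w (a + b) = \<phi> w a + \<phi> w b"
    and act: "\<And>u v a. \<phi> (u + v) a = \<phi> u (\<phi> v a)" and id: "\<And>a. \<phi> 0 a = a"
  shows "cone tree.cone_cells tree.cone_d tree.cone_s (0, None, ()) (\<lambda>w. tree_map (\<phi> w))"
proof (intro cone.intro tree.acyclic_cone cone_axioms.intro)
  fix w u v :: "'s fg"
  show "graded_map tree.cone_cells tree.cone_cells (tree_map (\<phi> w))"
  proof (rule graded_mapI)
    fix k and p :: "'a fg \<times> 'a option \<times> unit" assume p: "p \<in> tree.cone_cells k"
    then show "tree_map (\<phi> w) (cell p) \<in> chains_on (tree.cone_cells k)"
      using tree.trans_mem[OF geod_mem]
      by (cases p rule: tree_cell_cases) (auto simp: tree_map_cell tree_cells)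
  qed simp
  fix c :: "'a fg \<times> 'a option \<times> unit \<Rightarrow>\<^sub>0 rat"
  show "tree_map (\<phi> 0) c = c"
    by (rule tree_lin_eqI[of "tree_map (\<phi> 0)" "\<lambda>c. c"]) (auto simp: tree_map_cell id geod_gen trans_cell)
  show "tree_map (\<phi> (u + v)) c = tree_map (\<phi> u) (tree_map (\<phi> v) c)"
    by (rule tree_lin_eqI[of "tree_map (\<phi> (u + v))" "\<lambda>c. tree_map (\<phi> u) (tree_map (\<phi> v) c)"])
      (auto intro: lin_map_comp simp: tree_map_cell act tree_map_trans[of "\<phi> u", OF hom] tree_map_geod[of "\<phi> u", OF hom])
  show "tree_map (\<phi> w) (tree.cone_d c) = tree.cone_d (tree_map (\<phi> w) c)"
    by (rule tree_map_d[of "\<phi> w", OF hom])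
  assume "c \<in> chains_on (tree.cone_cells 0)"
  then show "aug (tree_map (\<phi> w) c) = aug c"
  proof (rule lin_map_eqI[of "\<lambda>c. aug (tree_map (\<phi> w) c)" aug, rotated 3])
    show "lin_map (\<lambda>c. aug (tree_map (\<phi> w) c))" by (rule lin_map_comp[OF lin_map_push tree_map_lin])
    fix p :: "'a fg \<times> 'a option \<times> unit" assume "p \<in> tree.cone_cells 0"
    then show "aug (tree_map (\<phi> w) (cell p)) = aug (cell p)"
      by (cases p rule: tree_cell_cases) (auto simp: tree_map_cell tree_cells)
  qed simp
qed

section \<open>Certified computation of the complexes for the 32 characters\<close>

section \<open>Splittings of the character complexes\<close>

text \<open>The nonzero rows of a splitting homotopy for each of the 32 characters, found by Gaussian
  elimination; the last six columns vanish.\<close>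

fun splitting :: "bool \<Rightarrow> bool \<Rightarrow> bool \<Rightarrow> bool \<Rightarrow> bool \<Rightarrow> (nat \<times> int list) list" where
  "splitting False False False False False = []"
| "splitting False False False False True = [(5, [- 1, 0, 0, 0, 0, 0]), (9, [0, - 1, 0, 0, 0, 0]), (10, [0, 0, - 1, 0, 0, 0]), (11, [0, 0, 0, - 1, 0, 0])]"
| "splitting False False False True False = [(4, [- 1, 0, 0, 0, 0, 0]), (6, [0, - 1, 0, 0, 0, 0]), (7, [0, 0, - 1, 0, 0, 0]), (8, [0, 0, 0, - 1, 0, 0])]"
| "splitting False False False True True = [(4, [- 1, 0, 0, 0, 0, 0]), (6, [0, - 1, 0, 0, 0, 0]), (7, [0, 0, - 1, 0, 0, 0]), (8, [0, 0, 0, - 1, 0, 0])]"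
| "splitting False False True False False = [(3, [- 1, 0, 0, 0, 0, 0]), (6, [0, - 1, 0, 0, 1, 0]), (8, [0, 0, 0, 0, 1, 0]), (10, [0, 0, - 1, 0, 0, 1]), (11, [0, 0, 0, 0, 0, 1])]"
| "splitting False False True False True = [(3, [- 1, 0, 0, 0, 0, 0]), (6, [0, - 1, 0, 0, 1, 0]), (8, [0, 0, 0, 0, 1, 0]), (11, [0, 0, - 1, 0, 0, 0])]"
| "splitting False False True True False = [(3, [- 1, 0, 0, 0, 0, 0]), (7, [0, 0, - 1, 0, 0, 1]), (8, [0, - 1, 0, 0, 0, 0]), (11, [0, 0, 0, 0, 0, 1])]"
| "splitting False False True True True = [(3, [- 1, 0, 0, 0, 0, 0]), (7, [0, 0, - 1, 0, 0, - 1]), (8, [0, 0, 0, 0, 1, 0]), (9, [0, - 1, 0, 0, - 1, 0]), (11, [0, 0, 0, 0, 0, 1])]"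
| "splitting False True False False False = [(2, [- 1, 0, 0, 0, 0, 0]), (7, [0, 0, 0, 0, 1, 0]), (10, [0, 0, 0, 0, 0, 1]), (11, [0, 0, 0, - 1, 0, - 1])]"
| "splitting False True False False True = [(2, [- 1, 0, 0, 0, 0, 0]), (7, [0, 0, 0, 0, 1, 0]), (9, [0, - 1, 0, 0, 0, 0]), (10, [0, 0, 0, 1, 0, 0])]"
| "splitting False True False True False = [(2, [- 1, 0, 0, 0, 0, 0]), (6, [0, - 1, 0, 0, 0, 0]), (7, [0, 0, 0, 0, 1, 0]), (8, [0, 0, 0, - 1, 0, - 1]), (10, [0, 0, 0, 0, 0, 1])]"
| "splitting False True False True True = [(2, [- 1, 0, 0, 0, 0, 0]), (6, [0, - 1, 0, 0, 0, 0]), (7, [0, 0, 0, 0, 1, 0]), (8, [0, 0, 0, - 1, 0, 1]), (10, [0, 0, 0, 0, 0, 1])]"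
| "splitting False True True False False = [(2, [- 1, 0, 0, 0, 0, 0]), (6, [0, - 1, 0, 0, 1, 0]), (8, [0, 0, 0, 0, 1, 0]), (10, [0, 0, 0, - 1, 0, 0])]"
| "splitting False True True False True = [(2, [- 1, 0, 0, 0, 0, 0]), (6, [0, - 1, 0, 0, 1, 0]), (8, [0, 0, 0, 0, 1, 0]), (10, [0, 0, 0, 1, 0, 0]), (11, [0, 0, 0, - 1, 0, 1])]"
| "splitting False True True True False = [(4, [- 1, 0, 0, 0, 0, 0]), (7, [0, 0, - 1, 0, 0, 1]), (8, [0, 0, 0, - 1, 0, - 1]), (10, [0, 0, 0, 0, 0, 1])]"
| "splitting False True True True True = [(2, [- 1, 0, 0, 0, 0, 0]), (7, [0, 0, 0, 0, 1, 0]), (9, [0, - 1, 0, 0, - 2, 0]), (10, [0, 0, 0, 1, 0, 0]), (11, [0, 0, 0, - 1, 0, 1])]"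
| "splitting True False False False False = [(1, [- 1, 0, 0, 0, 0, 0]), (6, [0, 0, 0, 0, 1, 0]), (8, [0, 0, 0, - 1, - 1, 0]), (9, [0, 0, 0, 0, 0, 1])]"
| "splitting True False False False True = [(1, [- 1, 0, 0, 0, 0, 0]), (6, [0, 0, 0, 0, 1, 0]), (8, [0, 0, 0, - 1, - 1, 0]), (9, [0, 0, 0, 0, 0, 1]), (10, [0, 0, - 1, 0, 0, 0])]"
| "splitting True False False True False = [(1, [- 1, 0, 0, 0, 0, 0]), (6, [0, 0, 0, 1, 0, 0]), (7, [0, 0, - 1, 0, 0, 0]), (9, [0, 0, 0, 0, 0, 1])]"
| "splitting True False False True True = [(1, [- 1, 0, 0, 0, 0, 0]), (6, [0, 0, 0, 0, 1, 0]), (7, [0, 0, - 1, 0, 0, 0]), (9, [0, 0, 0, 0, 0, 1]), (11, [0, 0, 0, - 1, 1, 0])]"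
| "splitting True False True False False = [(1, [- 1, 0, 0, 0, 0, 0]), (6, [0, 0, 0, - 1, 0, 0]), (9, [0, 0, 0, 0, 0, 1]), (10, [0, 0, - 1, 0, 0, 0])]"
| "splitting True False True False True = [(1, [- 1, 0, 0, 0, 0, 0]), (6, [0, 0, 0, 0, 1, 0]), (9, [0, 0, 1, 0, 0, 1]), (11, [0, 0, - 1, 0, 0, 0])]"
| "splitting True False True True False = [(1, [- 1, 0, 0, 0, 0, 0]), (6, [0, 0, 0, 1, 0, 0]), (7, [0, 0, - 1, 0, 0, 0]), (8, [0, 0, 0, - 1, 1, 0]), (9, [0, 0, 0, 0, 0, 1])]"
| "splitting True False True True True = [(1, [- 1, 0, 0, 0, 0, 0]), (6, [0, 0, 0, 1, 0, 0]), (7, [0, 0, - 1, 0, 0, 0]), (8, [0, 0, 0, - 1, 1, 0]), (9, [0, 0, 0, 0, 0, 1])]"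
| "splitting True True False False False = [(1, [- 1, 0, 0, 0, 0, 0]), (6, [0, 0, 0, 0, 1, 0]), (8, [0, 0, 0, - 1, - 1, 0]), (9, [0, 0, 0, 0, 0, 1])]"
| "splitting True True False False True = [(5, [- 1, 0, 0, 0, 0, 0]), (6, [0, 0, 0, 0, 1, 0]), (8, [0, 0, - 1, - 1, - 1, 0]), (9, [0, - 1, 0, 0, 0, 0]), (10, [0, 0, - 1, 0, 0, 0])]"
| "splitting True True False True False = [(1, [- 1, 0, 0, 0, 0, 0]), (6, [0, 0, 1, 0, 1, 0]), (7, [0, 0, - 1, 0, 0, 0]), (9, [0, 0, 0, 0, 0, 1]), (11, [0, 0, - 1, - 1, 1, 0])]"
| "splitting True True False True True = [(1, [- 1, 0, 0, 0, 0, 0]), (6, [0, 0, 1, 0, 1, 0]), (7, [0, 0, - 1, 0, 0, 0]), (9, [0, 0, 0, 0, 0, 1])]"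
| "splitting True True True False False = [(3, [- 1, 0, 0, 0, 0, 0]), (6, [0, - 1, 0, 0, 2, 0]), (7, [0, 1, 0, 0, - 1, 0]), (9, [0, 0, - 1, 0, 0, 1]), (10, [0, 0, 1, 0, 0, 0])]"
| "splitting True True True False True = [(1, [- 1, 0, 0, 0, 0, 0]), (6, [0, 0, 0, 1, 2, 0]), (7, [0, 0, 0, - 1, - 1, 0]), (9, [0, 0, 1, 0, 0, 1]), (11, [0, 0, - 1, 0, 0, 0])]"
| "splitting True True True True False = [(1, [- 1, 0, 0, 0, 0, 0]), (6, [0, 0, 2, 1, 0, 0]), (7, [0, 0, - 1, 0, 0, 0]), (8, [0, 0, - 1, - 1, 1, 0]), (9, [0, 0, 0, 0, 0, 1])]"
| "splitting True True True True True = [(1, [- 1, 0, 0, 0, 0, 0]), (6, [0, 0, 0, 1, 0, 0]), (8, [0, 0, 0, - 1, 1, 0]), (9, [0, 0, 1, 0, 0, 1]), (11, [0, 0, - 1, 0, 0, 0])]"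

definition sg :: "bool \<Rightarrow> int" where
  "sg b = (if b then -1 else 1)"

definition zero_row :: "int list" where "zero_row = [0, 0, 0, 0, 0, 0, 0, 0, 0, 0, 0, 0]"

text \<open>Expands the sparse table to a 12 by 12 matrix: missing rows become zero, and six zeros
  are appended to each listed row for the columns of the 2-cells.\<close>

primrec h_rows :: "nat list \<Rightarrow> (nat \<times> int list) list \<Rightarrow> int list list" where
  "h_rows [] es = []"
| "h_rows (i # is) es = (case es of [] \<Rightarrow> zero_row # h_rows is es
     | e # es' \<Rightarrow> if fst e = i then (snd e @ [0, 0, 0, 0, 0, 0]) # h_rows is es' else zero_row # h_rows is es)"

definition h_matrix :: "bool \<Rightarrow> bool \<Rightarrow> bool \<Rightarrow> bool \<Rightarrow> bool \<Rightarrow> int list list" where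
  "h_matrix a1 a2 a3 b1 b2 = h_rows [0, 1, 2, 3, 4, 5, 6, 7, 8, 9, 10, 11] (splitting a1 a2 a3 b1 b2)"

text \<open>The boundary matrix at a character with values \<open>e\<^sub>i\<close> on the \<open>x\<^sub>i\<close> and \<open>f\<^sub>i\<close> on the \<open>y\<^sub>i\<close>; the columns
  of the 2-cells are Fox derivatives. All entries are even, and only half of the matrix is checked.\<close>

definition d_rows :: "int \<Rightarrow> int \<Rightarrow> int \<Rightarrow> int \<Rightarrow> int \<Rightarrow> int list list" where
  "d_rows e1 e2 e3 f1 f2 =
    [[0, e1 - 1, e2 - 1, e3 - 1, f1 - 1, f2 - 1, 0, 0, 0, 0, 0, 0],
     [0, 0, 0, 0, 0, 0, f1 * (1 + e1 * e3 - e1) - 1, f1 * (1 - e3 + e2 * (e3 - 1)), f1 * (1 - e3), f2 - 1, 0, 0],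
     [0, 0, 0, 0, 0, 0, 0, f1 - 1, 0, 0, f2 * (1 + e2 * e3 - e2) - 1, f2 * (1 - e3)],
     [0, 0, 0, 0, 0, 0, f1 * (e1 - 1), f1 * (e1 - 1 + e2 * (1 - e1)), f1 * e1 - 1, 0, f2 * (e2 - 1), f2 * e2 - 1],
     [0, 0, 0, 0, 0, 0, 1 - e1, 1 - e2, 1 - e3, 0, 0, 0],
     [0, 0, 0, 0, 0, 0, 0, 0, 0, 1 - e1, 1 - e2, 1 - e3],
     zero_row, zero_row, zero_row, zero_row, zero_row, zero_row]"

text \<open>Halving the differential while doubling the homotopy leaves their products unchanged,
  which keeps the whole check in the integers.\<close>

definition halve :: "int list list \<Rightarrow> int list list" where
  "halve = map (map (\<lambda>x. x div 2))"

definition d_matrix :: "bool \<Rightarrow> bool \<Rightarrow> bool \<Rightarrow> bool \<Rightarrow> bool \<Rightarrow> int list list" where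
  "d_matrix a1 a2 a3 b1 b2 = halve (d_rows (sg a1) (sg a2) (sg a3) (sg b1) (sg b2))"

fun row_comb :: "int list \<Rightarrow> int list list \<Rightarrow> int list" where
  "row_comb (a # r) (b # B) = (if a = 0 then row_comb r B else map2 (\<lambda>x y. a * x + y) b (row_comb r B))"
| "row_comb _ _ = zero_row"

definition mmul :: "int list list \<Rightarrow> int list list \<Rightarrow> int list list" where
  "mmul A B = map (\<lambda>r. row_comb r B) A"

definition msub :: "int list list \<Rightarrow> int list list \<Rightarrow> int list list" where
  "msub = map2 (map2 (-))"

definition id_matrix :: "int list list" where
  "id_matrix = map (\<lambda>i. map (\<lambda>j. if i = j then 1 else 0) [0, 1, 2, 3, 4, 5, 6, 7, 8, 9, 10, 11]) [0, 1, 2, 3, 4, 5, 6, 7, 8, 9, 10, 11 :: int]"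

text \<open>A cell is critical if it occurs in no pivot of the splitting.\<close>

definition crit_row :: "int list \<Rightarrow> int list list \<Rightarrow> bool list" where
  "crit_row c H = map2 (\<lambda>r s. s = 0 \<and> list_all (\<lambda>x. x = 0) r) H c"

text \<open>The fold marks each column of \<open>H\<close> with a nonzero entry; a critical cell is
  one whose row vanishes and whose column is unmarked.\<close>

definition crit_list :: "int list list \<Rightarrow> bool list" where
  "crit_list H = crit_row (foldr (map2 (\<lambda>x y. if x = 0 then y else 1)) H zero_row) H"

definition mask :: "bool list \<Rightarrow> int list list \<Rightarrow> int list list" where
  "mask = map2 (\<lambda>c r. if c then r else zero_row)"

definition mask_both :: "bool list \<Rightarrow> int list list \<Rightarrow> int list list" where
  "mask_both c A = mask c (map (map2 (\<lambda>b x. if b then x else 0) c) A)"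

definition theta :: "int list list \<Rightarrow> int list list \<Rightarrow> int list list" where
  "theta D H = msub (msub id_matrix (mmul D H)) (mmul H D)"

text \<open>The four conditions on the defect in \<open>chain_equiv_critical\<close>; the equation
  that defines the defect holds by construction of \<open>theta\<close>.\<close>

definition check_theta :: "bool list \<Rightarrow> int list list \<Rightarrow> int list list \<Rightarrow> bool" where
  "check_theta c D T \<longleftrightarrow> list_all (list_all (\<lambda>x. x = 0)) (mmul T D) \<and> list_all (list_all (\<lambda>x. x = 0)) (mmul D T)
     \<and> mmul T (mask c T) = T \<and> mask_both c (mmul T T) = mask_both c id_matrix"

definition check :: "int list list \<Rightarrow> int list list \<Rightarrow> bool" where
  "check D H \<longleftrightarrow> check_theta (crit_list H) D (theta D H)"


definition degree_list :: "nat list" where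
  "degree_list = [0, 1, 1, 1, 1, 1, 2, 2, 2, 2, 2, 2]"

definition check_degrees :: "int list list \<Rightarrow> int list list \<Rightarrow> bool" where
  "check_degrees D H \<longleftrightarrow> list_all2 (\<lambda>r a. list_all2 (\<lambda>x b. x = 0 \<or> b = Suc a) r degree_list) D degree_list
    \<and> list_all2 (\<lambda>r a. list_all2 (\<lambda>x b. x = 0 \<or> a = Suc b) r degree_list) H degree_list"

lemma check_all: "\<forall>a1 a2 a3 b1 b2. check (d_matrix a1 a2 a3 b1 b2) (h_matrix a1 a2 a3 b1 b2)"
  by code_simp

lemma check_degrees_all: "\<forall>a1 a2 a3 b1 b2. check_degrees (d_matrix a1 a2 a3 b1 b2) (h_matrix a1 a2 a3 b1 b2)"
  by code_simp

lemma d_rows_even: "\<forall>a1 a2 a3 b1 b2. d_rows (sg a1) (sg a2) (sg a3) (sg b1) (sg b2) = map (map (\<lambda>x. 2 * x)) (d_matrix a1 a2 a3 b1 b2)"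
  by code_simp

definition critical_number :: "nat \<Rightarrow> bool list \<Rightarrow> nat" where
  "critical_number k c = sum_list (map2 (\<lambda>a b. if b \<and> a = k then 1 else 0) degree_list c)"

text \<open>These are the Betti numbers of the extension of E_2 by E_3. The alternating sum 1 - 20 +
  83 = 64 is 32 times 1 - 5 + 6, the Euler characteristic of one character complex.\<close>

lemma critical_totals:
  "(\<Sum>b1\<leftarrow>[False, True]. \<Sum>b2\<leftarrow>[False, True]. \<Sum>a1\<leftarrow>[False, True]. \<Sum>a2\<leftarrow>[False, True]. \<Sum>a3\<leftarrow>[False, True].
     critical_number 0 (crit_list (h_matrix a1 a2 a3 b1 b2))) = 1"
  "(\<Sum>b1\<leftarrow>[False, True]. \<Sum>b2\<leftarrow>[False, True]. \<Sum>a1\<leftarrow>[False, True]. \<Sum>a2\<leftarrow>[False, True]. \<Sum>a3\<leftarrow>[False, True].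
     critical_number 1 (crit_list (h_matrix a1 a2 a3 b1 b2))) = 20"
  "(\<Sum>b1\<leftarrow>[False, True]. \<Sum>b2\<leftarrow>[False, True]. \<Sum>a1\<leftarrow>[False, True]. \<Sum>a2\<leftarrow>[False, True]. \<Sum>a3\<leftarrow>[False, True].
     critical_number 2 (crit_list (h_matrix a1 a2 a3 b1 b2))) = 83"
  by code_simp+

lemma row_comb_nth:
  "length r = length B \<Longrightarrow> \<forall>s\<in>set B. length s = 12 \<Longrightarrow> j < 12 \<Longrightarrow>
    length (row_comb r B) = 12 \<and> row_comb r B ! j = (\<Sum>m<length B. r ! m * B ! m ! j)"
proof (induction r B rule: row_comb.induct)
  case (1 a r b B)
  then show ?case by (simp add: sum.lessThan_Suc_shift del: sum.lessThan_Suc)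
next
  case ("2_1" B)
  then show ?case by (cases j) (auto simp: zero_row_def nth_Cons split: nat.splits)
next
  case ("2_2" r)
  then show ?case by (auto simp: zero_row_def nth_Cons split: nat.splits)
qed

definition square :: "'a list list \<Rightarrow> bool" where
  "square A \<longleftrightarrow> length A = 12 \<and> (\<forall>s\<in>set A. length s = 12)"

lemma square_nth: "square A \<Longrightarrow> i < 12 \<Longrightarrow> length (A ! i) = 12"
  by (simp add: square_def)

lemma mmul_nth:
  assumes "square A" "square B"
  shows "square (mmul A B)" and "i < 12 \<Longrightarrow> j < 12 \<Longrightarrow> mmul A B ! i ! j = (\<Sum>m<12. A ! i ! m * B ! m ! j)"
  using assms row_comb_nth[of _ B 0] row_comb_nth[of "A ! i" B j] by (auto simp: square_def mmul_def)

lemma msub_nth: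
  assumes "square A" "square B"
  shows "square (msub A B)" and "i < 12 \<Longrightarrow> j < 12 \<Longrightarrow> msub A B ! i ! j = A ! i ! j - B ! i ! j"
  using assms by (auto simp: square_def msub_def set_zip)

lemma id_matrix_nth: "square id_matrix" "i < 12 \<Longrightarrow> j < 12 \<Longrightarrow> id_matrix ! i ! j = of_bool (i = j)"
proof -
  have *: "[0, 1, 2, 3, 4, 5, 6, 7, 8, 9, 10, 11 :: int] = map int [0..<12]" by code_simp
  show "square id_matrix" by (simp add: square_def id_matrix_def)
  show "i < 12 \<Longrightarrow> j < 12 \<Longrightarrow> id_matrix ! i ! j = of_bool (i = j)"
    unfolding id_matrix_def * by (simp del: upt_rec_numeral)
qed

lemma theta_nth:
  assumes "square D" "square H"
  shows "square (theta D H)"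
    and "i < 12 \<Longrightarrow> j < 12 \<Longrightarrow> theta D H ! i ! j =
      of_bool (i = j) - (\<Sum>m<12. D ! i ! m * H ! m ! j) - (\<Sum>m<12. H ! i ! m * D ! m ! j)"
  using assms by (simp_all add: theta_def msub_nth mmul_nth id_matrix_nth)

lemma mask_nth:
  assumes "length c = 12" "square A"
  shows "square (mask c A)" and "i < 12 \<Longrightarrow> j < 12 \<Longrightarrow> mask c A ! i ! j = of_bool (c ! i) * A ! i ! j"
proof -
  have "zero_row ! j = 0" if "j < 12"
    using row_comb_nth[of "[]" "[]" j] that by simp
  then show "square (mask c A)" and "i < 12 \<Longrightarrow> j < 12 \<Longrightarrow> mask c A ! i ! j = of_bool (c ! i) * A ! i ! j"
    using assms by (auto simp: square_def mask_def set_zip) (simp_all add: zero_row_def)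
qed

lemma mask_both_nth:
  assumes "length c = 12" "square A" "i < 12" "j < 12"
  shows "mask_both c A ! i ! j = of_bool (c ! i) * of_bool (c ! j) * A ! i ! j"
proof -
  have "square (map (map2 (\<lambda>b x. if b then x else 0) c) A)" using assms by (auto simp: square_def)
  then show ?thesis using assms by (simp add: mask_both_def mask_nth square_def)
qed

lemma check_square:
  assumes "check_degrees D H"
  shows "square D" "square H"
proof -
  have "length degree_list = 12" by (simp add: degree_list_def)
  then show "square D" "square H"
    using assms by (auto simp: check_degrees_def square_def list_all2_conv_all_nth in_set_conv_nth)
qed

text \<open>Translates the boolean checks on lists into the entrywise identities that the rational
  matrices have to satisfy.\<close>

lemma check_nth:
  assumes "check D H" "check_degrees D H"
  defines "c \<equiv> crit_list H" and "T \<equiv> theta D H"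
  assumes ij: "i < 12" "j < 12"
  shows "T ! i ! j = of_bool (i = j) - (\<Sum>m<12. D ! i ! m * H ! m ! j) - (\<Sum>m<12. H ! i ! m * D ! m ! j)"
    and "(\<Sum>m<12. T ! i ! m * D ! m ! j) = 0" and "(\<Sum>m<12. D ! i ! m * T ! m ! j) = 0"
    and "(\<Sum>m<12. T ! i ! m * (of_bool (c ! m) * T ! m ! j)) = T ! i ! j"
    and "c ! i \<Longrightarrow> c ! j \<Longrightarrow> (\<Sum>m<12. T ! i ! m * T ! m ! j) = of_bool (i = j)"
    and "D ! i ! j \<noteq> 0 \<Longrightarrow> degree_list ! j = Suc (degree_list ! i)"
    and "H ! i ! j \<noteq> 0 \<Longrightarrow> degree_list ! i = Suc (degree_list ! j)"
    and "length c = 12"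
proof -
  note sq = check_square[OF assms(2)]
  show c: "length c = 12"
  proof -
    have "length (foldr (map2 (\<lambda>x y. if x = 0 then y else 1)) B zero_row) = 12" if "\<forall>s\<in>set B. length s = 12" for B
      using that by (induction B) (auto simp: zero_row_def)
    from this[of H] show ?thesis using sq by (simp add: c_def crit_list_def crit_row_def square_def)
  qed
  have sT: "square T" unfolding T_def by (rule theta_nth(1)[OF sq])
  have zero: "A ! i ! j = 0" if "list_all (list_all (\<lambda>x. x = 0)) A" "square A" for A :: "int list list"
    using that ij by (auto simp: list_all_length square_def)
  have ck: "list_all (list_all (\<lambda>x. x = 0)) (mmul T D)" "list_all (list_all (\<lambda>x. x = 0)) (mmul D T)"
    "mmul T (mask c T) = T" "mask_both c (mmul T T) = mask_both c id_matrix"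
    using assms(1) by (simp_all add: check_def check_theta_def c_def T_def)
  show "T ! i ! j = of_bool (i = j) - (\<Sum>m<12. D ! i ! m * H ! m ! j) - (\<Sum>m<12. H ! i ! m * D ! m ! j)"
    unfolding T_def by (rule theta_nth(2)[OF sq ij])
  show "(\<Sum>m<12. T ! i ! m * D ! m ! j) = 0" "(\<Sum>m<12. D ! i ! m * T ! m ! j) = 0"
    using zero[OF ck(1)] zero[OF ck(2)] by (simp_all add: mmul_nth sT sq ij)
  have "(\<Sum>m<12. T ! i ! m * (of_bool (c ! m) * T ! m ! j)) = mmul T (mask c T) ! i ! j"
    using ij by (simp add: mmul_nth sT mask_nth c)
  then show "(\<Sum>m<12. T ! i ! m * (of_bool (c ! m) * T ! m ! j)) = T ! i ! j" by (simp add: ck(3))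
  have "mask_both c (mmul T T) ! i ! j = mask_both c id_matrix ! i ! j" by (simp add: ck(4))
  then show "c ! i \<Longrightarrow> c ! j \<Longrightarrow> (\<Sum>m<12. T ! i ! m * T ! m ! j) = of_bool (i = j)"
    by (simp add: mask_both_nth c mmul_nth sT id_matrix_nth ij)
  have "list_all2 (\<lambda>x b. x = 0 \<or> b = Suc (degree_list ! i)) (D ! i) degree_list"
    "list_all2 (\<lambda>x b. x = 0 \<or> degree_list ! i = Suc b) (H ! i) degree_list"
    using assms(2) ij sq by (auto simp: check_degrees_def square_def dest: list_all2_nthD[of _ _ _ i])
  then show "D ! i ! j \<noteq> 0 \<Longrightarrow> degree_list ! j = Suc (degree_list ! i)"
    "H ! i ! j \<noteq> 0 \<Longrightarrow> degree_list ! i = Suc (degree_list ! j)"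
    using ij sq by (auto simp: square_def dest: list_all2_nthD[of _ _ _ j])
qed

section \<open>From simply transitive actions to homology\<close>

section \<open>Homology from a simply transitive action\<close>

text \<open>The full group \<open>K\<close> acts simply transitively on the cells of each kind.
  \<pi> maps it onto the finite group of parities and \<open>par\<close> is its counterpart on
  cells, so the orbits of the kernel of \<pi> are the pairs of a parity and a kind.\<close>

locale translation_action = K: group K + acyclic_complex X d s x0
  for K :: "'h monoid" and X :: "nat \<Rightarrow> 'x set" and d s :: "('x \<Rightarrow>\<^sub>0 rat) \<Rightarrow> ('x \<Rightarrow>\<^sub>0 rat)" and x0 :: 'x +
  fixes L :: "'h \<Rightarrow> 'x \<Rightarrow> 'x" and xor :: "'v \<Rightarrow> 'v \<Rightarrow> 'v" and zero :: 'v
    and deg :: "'b \<Rightarrow> nat" and par :: "'x \<Rightarrow> 'v" and kind :: "'x \<Rightarrow> 'b" and base :: "'b \<Rightarrow> 'x" and \<pi> :: "'h \<Rightarrow> 'v"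
  assumes carrier: "carrier K = UNIV"
    and X_eq: "X k = {x. deg (kind x) = k}"
    and L_mult: "L (g \<otimes>\<^bsub>K\<^esub> h) x = L g (L h x)"
    and L_d: "d (cell (L h x)) = push (L h) (d (cell x))"
    and kind_L: "kind (L h x) = kind x" and kind_base: "kind (base b) = b"
    and simply_trans: "\<exists>!h. x = L h (base (kind x))"
    and par_L: "par (L h x) = xor (\<pi> h) (par x)" and par_base: "par (base b) = zero"
    and \<pi>_mult: "\<pi> (g \<otimes>\<^bsub>K\<^esub> h) = xor (\<pi> g) (\<pi> h)" and \<pi>_surj: "surj \<pi>"
    and xor_zero: "xor v zero = v" and xor_cancel: "xor (xor u v) v = u"
begin

definition "lift v = (SOME h. \<pi> h = v)"

lemma \<pi>_lift: "\<pi> (lift v) = v"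
  unfolding lift_def by (rule someI_ex) (metis \<pi>_surj surj_def)

lemma par_lift: "par (L (lift v) (base b)) = v"
  by (simp add: par_L par_base xor_zero \<pi>_lift)

lemma K_simps: "g \<otimes>\<^bsub>K\<^esub> inv\<^bsub>K\<^esub> h \<otimes>\<^bsub>K\<^esub> h = g" "g \<otimes>\<^bsub>K\<^esub> h \<otimes>\<^bsub>K\<^esub> inv\<^bsub>K\<^esub> h = g"
  by (simp_all add: K.m_assoc carrier)

lemma zero_xor: "xor zero v = v"
proof -
  have "xor (\<pi> \<one>\<^bsub>K\<^esub>) v = v" for v
    using \<pi>_mult[of "\<one>\<^bsub>K\<^esub>" "lift v"] by (simp add: carrier \<pi>_lift)
  then show ?thesis using xor_zero by metis
qed

definition orb :: "'x \<Rightarrow> 'v \<times> 'b" where "orb x = (par x, kind x)"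
definition rep :: "'v \<times> 'b \<Rightarrow> 'x" where "rep = (\<lambda>(v, b). L (lift v) (base b))"
definition basic_d :: "'b \<Rightarrow> ('v \<times> 'b \<Rightarrow>\<^sub>0 rat)" where "basic_d b = push orb (d (cell (base b)))"

lemma orb_L: "orb (L h x) = (case orb x of (u, b) \<Rightarrow> (xor (\<pi> h) u, b))"
  by (simp add: orb_def par_L kind_L)

lemma orb_rep: "orb (rep r) = r"
  by (cases r) (simp add: orb_def rep_def par_lift kind_L kind_base)

text \<open>The representative is the base cell translated by a lift of the parity of
  \<open>x\<close>. If \<open>g\<close> takes the base cell to \<open>x\<close>, then
  \<open>g\<close> times the inverse of that lift takes the representative to \<open>x\<close>, and
  its parity cancels.\<close>

lemma simply_trans_kernel: "\<exists>!h. \<pi> h = zero \<and> x = L h (rep (orb x))"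
proof -
  obtain g where g: "x = L g (base (kind x))" "\<And>h. x = L h (base (kind x)) \<Longrightarrow> h = g"
    using simply_trans[of x] by blast
  let ?t = "lift (par x)"
  have g_par: "\<pi> g = par x"
    using arg_cong[OF g(1), of par] by (simp add: par_L par_base xor_zero)
  have rep: "L h (rep (orb x)) = L (h \<otimes>\<^bsub>K\<^esub> ?t) (base (kind x))" for h
    by (simp add: rep_def orb_def L_mult)
  show ?thesis
  proof (rule ex1I[of _ "g \<otimes>\<^bsub>K\<^esub> inv\<^bsub>K\<^esub> ?t"])
    have "xor (\<pi> (g \<otimes>\<^bsub>K\<^esub> inv\<^bsub>K\<^esub> ?t)) (par x) = par x"
      using \<pi>_mult[of "g \<otimes>\<^bsub>K\<^esub> inv\<^bsub>K\<^esub> ?t" ?t] by (simp add: K_simps \<pi>_lift g_par)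
    then have "\<pi> (g \<otimes>\<^bsub>K\<^esub> inv\<^bsub>K\<^esub> ?t) = zero"
      using xor_cancel[of _ "par x"] zero_xor by metis
    then show "\<pi> (g \<otimes>\<^bsub>K\<^esub> inv\<^bsub>K\<^esub> ?t) = zero \<and> x = L (g \<otimes>\<^bsub>K\<^esub> inv\<^bsub>K\<^esub> ?t) (rep (orb x))"
      using g(1) by (simp add: rep K_simps)
    show "h = g \<otimes>\<^bsub>K\<^esub> inv\<^bsub>K\<^esub> ?t" if "\<pi> h = zero \<and> x = L h (rep (orb x))" for h
    proof -
      have "h \<otimes>\<^bsub>K\<^esub> ?t = g" using that g(2) by (simp add: rep)
      then show ?thesis using K_simps(2)[of h ?t] by simp
    qed
  qed
qed

text \<open>\<open>coord\<close> identifies \<open>G\<close> with the kernel of \<pi>, over which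
  the complex is a free resolution; comparison with the bar resolution then applies.\<close>

theorem bar_equiv:
  assumes G: "group G" and bij: "bij_betw coord (carrier G) {h. \<pi> h = zero}"
    and mult: "\<And>C D. C \<in> carrier G \<Longrightarrow> D \<in> carrier G \<Longrightarrow> coord (C \<otimes>\<^bsub>G\<^esub> D) = coord C \<otimes>\<^bsub>K\<^esub> coord D"
  shows "chain_equiv (\<lambda>k. {gs. length gs = k \<and> set gs \<subseteq> carrier (G :: 'g monoid)}) (bar_boundary G)
    (\<lambda>k. {(v, b). deg b = k}) (lin (\<lambda>(v, b). push (\<lambda>(u, b'). (xor v u, b')) (basic_d b)))"
proof -
  interpret G: group G by (rule G)
  interpret B: bar_group G by (rule bar_group.intro) (rule G)
  have zero: "\<pi> (coord C) = zero" if "C \<in> carrier G" for C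
    using bij_betw_apply[OF bij that] by simp
  interpret R: free_resolution G "\<lambda>C. L (coord C)" X "\<lambda>x. deg (kind x)" orb rep d s x0
  proof unfold_locales
    fix x k assume "x \<in> X k"
    obtain h where h: "\<pi> h = zero" "x = L h (rep (orb x))" "\<And>h'. \<pi> h' = zero \<Longrightarrow> x = L h' (rep (orb x)) \<Longrightarrow> h' = h"
      using simply_trans_kernel[of x] by blast
    then obtain C where C: "C \<in> carrier G" "coord C = h"
      using bij by (metis (mono_tags, lifting) bij_betw_iff_bijections mem_Collect_eq)
    show "\<exists>!C. C \<in> carrier G \<and> x = L (coord C) (rep (orb x))"
    proof (rule ex1I[of _ C])
      show "C \<in> carrier G \<and> x = L (coord C) (rep (orb x))" using C h(2) by simp
      fix D assume D: "D \<in> carrier G \<and> x = L (coord D) (rep (orb x))"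
      then have "coord D = coord C" using h(3)[OF zero] C(2) by blast
      then show "D = C" using bij_betw_imp_inj_on[OF bij] D C(1) by (blast dest: inj_onD)
    qed
  next
    fix x k assume "x \<in> X k"
    then show "rep (orb x) \<in> X k" by (simp add: X_eq orb_def rep_def kind_L kind_base)
  next
    fix C x k assume "C \<in> carrier G" "x \<in> X k"
    then show "L (coord C) x \<in> X k" "orb (L (coord C) x) = orb x" "d (cell (L (coord C) x)) = push (L (coord C)) (d (cell x))"
      by (simp_all add: X_eq kind_L orb_L L_d zero zero_xor split: prod.splits)
    fix D assume "D \<in> carrier G"
    then show "L (coord (C \<otimes>\<^bsub>G\<^esub> D)) x = L (coord C) (L (coord D) x)"
      using \<open>C \<in> carrier G\<close> by (simp add: mult L_mult)
  qed (fact d_lin d_mem d_0 d_d aug_d s d_s d_s_0 x0 | simp add: X_eq)+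
  interpret T: two_resolutions G B.bar_act B.bar_cells "\<lambda>x. length (snd x)" snd "\<lambda>gs. (\<one>\<^bsub>G\<^esub>, gs)" B.bar_d B.bar_s "(\<one>\<^bsub>G\<^esub>, [])"
      "\<lambda>C. L (coord C)" X "\<lambda>x. deg (kind x)" orb rep d s x0
    by (intro two_resolutions.intro B.free_resolution_bar R.free_resolution_axioms)
  have 1: "R.orbits = (\<lambda>k. {(v, b). deg b = k})"
  proof (intro ext Set.set_eqI)
    fix k and r :: "'v \<times> 'b"
    obtain v b where r: "r = (v, b)" by fastforce
    have "deg b = k \<Longrightarrow> rep r \<in> X k" by (simp add: r rep_def X_eq kind_L kind_base)
    then have "deg b = k \<Longrightarrow> r \<in> orb ` X k" using orb_rep[of r] by (metis image_eqI)
    then show "r \<in> R.orbits k \<longleftrightarrow> r \<in> {(v, b). deg b = k}"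
      by (auto simp: R.orbits_def r X_eq orb_def)
  qed
  have 2: "R.d_orb = lin (\<lambda>(v, b). push (\<lambda>(u, b'). (xor v u, b')) (basic_d b))"
    unfolding R.d_orb_def
    by (rule arg_cong[of _ _ lin]) (auto simp: fun_eq_iff rep_def L_d basic_d_def push_push orb_L \<pi>_lift)
  show ?thesis
    using T.orbit_complexes_equiv by (simp only: 1 2 B.bar_orbits)
qed

end


text \<open>Evaluates a chain at a character of the parities before passing to orbits, so matrix
  entries can be computed in the contractible complex.\<close>

definition value_at :: "('x \<Rightarrow> 'v) \<Rightarrow> ('x \<Rightarrow> 'b) \<Rightarrow> ('v \<Rightarrow> rat) \<Rightarrow> ('x \<Rightarrow>\<^sub>0 rat) \<Rightarrow> ('b \<Rightarrow>\<^sub>0 rat)" where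
  "value_at par kind \<chi> = lin (\<lambda>x. Poly_Mapping.single (kind x) (\<chi> (par x)))"

lemma value_at_lin [simp]: "lin_map (value_at par kind \<chi>)"
  by (simp add: value_at_def lin_map_lin)

lemma value_at_cell: "value_at par kind \<chi> (cell x) = Poly_Mapping.single (kind x) (\<chi> (par x))"
  by (simp add: value_at_def)

lemma value_at_push:
  assumes "\<And>x. \<chi>' (par' (f x)) = r * \<chi> (par x)" and "\<And>x. kind' (f x) = g (kind x)"
  shows "value_at par' kind' \<chi>' (push f c) = chain_scale r (push g (value_at par kind \<chi> c))"
proof (rule lin_map_eqI[of "\<lambda>c. value_at par' kind' \<chi>' (push f c)" "\<lambda>c. chain_scale r (push g (value_at par kind \<chi> c))" UNIV])
  show "lin_map (\<lambda>c. value_at par' kind' \<chi>' (push f c))"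
    by (rule lin_map_comp[OF value_at_lin lin_map_push])
  have "lin_map (\<lambda>c. push g (value_at par kind \<chi> c))"
    by (rule lin_map_comp[OF lin_map_push value_at_lin])
  then show "lin_map (\<lambda>c. chain_scale r (push g (value_at par kind \<chi> c)))"
    by (simp add: lin_map_def chain_scale_add_right) (metis chain_scale_minus_one mult.commute chain_scale_scale)
  fix x show "value_at par' kind' \<chi>' (push f (cell x)) = chain_scale r (push g (value_at par kind \<chi> (cell x)))"
    by (simp add: value_at_cell assms push_single chain_scale_single)
qed (simp add: chains_on_def)

text \<open>Wrapping the coefficients as chains on one point makes both sides linear maps of chains,
  to which \<open>lin_map_eqI\<close> applies.\<close>

lemma lookup_push_Pair: "Poly_Mapping.lookup (push (Pair z) c) x = of_bool (fst x = z) * Poly_Mapping.lookup c (snd x)"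
proof (rule lin_map_eqI[of "\<lambda>c. Poly_Mapping.single () (Poly_Mapping.lookup (push (Pair z) c) x)"
    "\<lambda>c. Poly_Mapping.single () (of_bool (fst x = z) * Poly_Mapping.lookup c (snd x))" UNIV c,
    THEN arg_cong[of _ _ "\<lambda>c. Poly_Mapping.lookup c ()"], simplified])
qed (cases x; auto simp: lin_simps lookup_add lookup_single when_def single_add chain_scale_single distrib_left mult_ac chains_on_def lin_map_scale[OF lin_map_push])+

lemma (in duality) ev_push: "ev \<chi> (push (\<lambda>x. (par x, kind x)) c) = value_at par kind (pair \<chi>) c"
  by (rule lin_map_eqI[of "\<lambda>c. ev \<chi> (push (\<lambda>x. (par x, kind x)) c)" "value_at par kind (pair \<chi>)" UNIV])
    (auto simp: ev_def chains_on_def value_at_cell intro: lin_map_comp[OF lin_map_lin lin_map_push])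

section \<open>A central infinite cyclic factor\<close>

definition fg_group :: "'a fg monoid" where
  "fg_group = \<lparr>carrier = UNIV, mult = (+), one = 0\<rparr>"

lemma fg_group_simps [simp]: "carrier fg_group = UNIV" "mult fg_group = (+)" "one fg_group = 0"
  by (simp_all add: fg_group_def)

lemma group_fg_group: "group fg_group"
proof (rule groupI)
  fix x :: "'a fg" assume "x \<in> carrier fg_group"
  show "\<exists>y\<in>carrier fg_group. y \<otimes>\<^bsub>fg_group\<^esub> x = \<one>\<^bsub>fg_group\<^esub>"
    by (rule bexI[of _ "- x"]) simp_all
qed (simp_all add: add.assoc)

definition suspend :: "('b \<Rightarrow> nat) \<Rightarrow> unit option \<times> 'b \<Rightarrow> nat" where
  "suspend dg = (\<lambda>(o', b). case o' of None \<Rightarrow> dg b | Some _ \<Rightarrow> Suc (dg b))"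

text \<open>Two copies of a matrix, one over the vertex and one over the edge of a circle; the cone
  differential puts the sign \<open>r = -1\<close> on the latter.\<close>

definition double :: "rat \<Rightarrow> ('i \<Rightarrow> 'b \<Rightarrow> 'b \<Rightarrow> rat) \<Rightarrow> 'i \<Rightarrow> unit option \<times> 'b \<Rightarrow> unit option \<times> 'b \<Rightarrow> rat" where
  "double r A i x y = of_bool (fst x = fst y) * (case fst x of None \<Rightarrow> 1 | Some _ \<Rightarrow> r) * A i (snd x) (snd y)"

context translation_action
begin

interpretation U: cone X d s x0 "\<lambda>(_ :: unit fg) c. c"
  by (intro cone.intro acyclic_complex_axioms cone_axioms.intro) (auto simp: graded_map_def)

text \<open>The product with a line, on which the infinite cyclic group translates. This factor lies
  in the kernel entirely, so neither \<open>par\<close> nor \<pi> involves its coordinate.\<close>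

lemma unit_cone:
  "translation_action (fg_group \<times>\<times> K) U.cone_cells U.cone_d U.cone_s (0, None, x0)
    (\<lambda>(m, h) (n, o', x). (m + n, o', L h x)) xor zero (suspend deg) (\<lambda>(n, o', x). par x)
    (\<lambda>(n, o', x). (o', kind x)) (\<lambda>(o', b). (0, o', base b)) (\<lambda>(m, h). \<pi> h)"
proof (intro translation_action.intro translation_action_axioms.intro U.acyclic_cone DirProd_group group_fg_group K.group_axioms)
  have X: "U.cone_cells k = {x. suspend deg (case x of (n, o', x) \<Rightarrow> (o', kind x)) = k}" for k
    by (auto simp: U.cone_cells_def suspend_def X_eq split: option.splits)
  then show "U.cone_cells k = {x. suspend deg (case x of (n, o', x) \<Rightarrow> (o', kind x)) = k}" for k .
  fix h :: "unit fg \<times> 'h" and x :: "unit fg \<times> unit option \<times> 'x"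
  obtain m g where h: "h = (m, g)" by fastforce
  obtain n o' p where x: "x = (n, o', p)" by (metis prod_cases3)
  have "x \<in> U.cone_cells (suspend deg (o', kind p))" by (simp add: X x)
  then have "U.cone_d (cell (case x of (n, o', x) \<Rightarrow> (m + n, o', L g x))) =
      push (\<lambda>(n, o', x). (m + n, o', L g x)) (U.cone_d (cell x))"
    by (rule U.cone_d_equivariant) (simp_all add: L_d)
  then show "U.cone_d (cell ((case h of (m, h) \<Rightarrow> \<lambda>(n, o', x). (m + n, o', L h x)) x)) =
      push ((case h of (m, h) \<Rightarrow> \<lambda>(n, o', x). (m + n, o', L h x))) (U.cone_d (cell x))"
    by (simp only: h prod.case)
  obtain t where t: "p = L t (base (kind p))" "\<And>t'. p = L t' (base (kind p)) \<Longrightarrow> t' = t"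
    using simply_trans[of p] by blast
  show "\<exists>!h. x = (case h of (m, h) \<Rightarrow> \<lambda>(n, o', x). (m + n, o', L h x))
      ((case (case x of (n, o', x) \<Rightarrow> (o', kind x)) of (o', b) \<Rightarrow> (0, o', base b)))"
    unfolding x prod.case
  proof (rule ex1I[of _ "(n, t)"])
    show "(n, o', p) = (case (n, t) of (m, h) \<Rightarrow> \<lambda>(n, o', x). (m + n, o', L h x)) (0, o', base (kind p))"
      using t(1) by simp
    fix h assume "(n, o', p) = (case h of (m, h) \<Rightarrow> \<lambda>(n, o', x). (m + n, o', L h x)) (0, o', base (kind p))"
    then show "h = (n, t)" using t(2)[of "snd h"] by (cases h) simp
  qed
  show "surj (\<lambda>(m :: unit fg, h). \<pi> h)"
    using \<pi>_surj by (auto simp: surj_def)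
next
  show "carrier (fg_group \<times>\<times> K) = UNIV" by (simp add: carrier)
  fix g h :: "unit fg \<times> 'h" and x :: "unit fg \<times> unit option \<times> 'x" and b :: "unit option \<times> 'b" and u v
  obtain m a n c where gh: "g = (m, a)" "h = (n, c)" by fastforce
  obtain l o' p where x: "x = (l, o', p)" by (metis prod_cases3)
  let ?L = "\<lambda>(m, h) (n, o', x). (m + n, o', L h x)"
  show "?L (g \<otimes>\<^bsub>fg_group \<times>\<times> K\<^esub> h) x = ?L g (?L h x)"
    unfolding gh x mult_DirProd by (simp add: L_mult add.assoc)
  show "(case ?L g x of (n, o', x) \<Rightarrow> (o', kind x)) = (case x of (n, o', x) \<Rightarrow> (o', kind x))"
    "(case ?L g x of (n, o', x) \<Rightarrow> par x) = xor (case g of (m, h) \<Rightarrow> \<pi> h) (case x of (n, o', x) \<Rightarrow> par x)"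
    unfolding gh x by (simp_all add: kind_L par_L)
  show "(case case b of (o', b) \<Rightarrow> (0, o', base b) of (n, o', x) \<Rightarrow> (o', kind x)) = b"
    "(case case b of (o', b) \<Rightarrow> (0 :: unit fg, o', base b) of (n, o', x) \<Rightarrow> par x) = zero"
    by (cases b; simp add: kind_base par_base)+
  show "(case g \<otimes>\<^bsub>fg_group \<times>\<times> K\<^esub> h of (m, h) \<Rightarrow> \<pi> h) = xor (case g of (m, h) \<Rightarrow> \<pi> h) (case h of (m, h) \<Rightarrow> \<pi> h)"
    unfolding gh mult_DirProd by (simp add: \<pi>_mult)
  show "xor v zero = v" "xor (xor u v) v = u" by (rule xor_zero xor_cancel)+
qed

text \<open>The two ends of an edge of the line have equal parity and the action on the fibre is
  trivial, so their contributions cancel and only the differential of the fibre remains.\<close>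

lemma unit_cone_d:
  "Poly_Mapping.lookup (value_at (\<lambda>(n, o', x). par x) (\<lambda>(n, o', x). (o', kind x)) \<chi>
     (U.cone_d (cell (case y of (o', b) \<Rightarrow> (0, o', base b))))) x =
   double (-1) (\<lambda>\<chi> x y. Poly_Mapping.lookup (value_at par kind \<chi> (d (cell (base y)))) x) \<chi> x y"
proof -
  obtain o' b where y: "y = (o', b)" by fastforce
  let ?v = "value_at (\<lambda>(n, o', x). par x) (\<lambda>(n, o', x). (o', kind x)) \<chi>"
  have v: "?v (U.vtx m c) = push (Pair None) (value_at par kind \<chi> c)"
    and e: "?v (U.edge m t c) = push (Pair (Some t)) (value_at par kind \<chi> c)" for m t c
    unfolding U.vtx_def U.edge_def by (subst value_at_push[where r = 1 and par = par and kind = kind and \<chi> = \<chi>]; simp)+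
  note l = lookup_push_Pair
  show ?thesis
  proof (cases o')
    case None
    then have "cell (case y of (o', b) \<Rightarrow> (0, o', base b)) = U.vtx 0 (cell (base b))" by (simp add: U.vtx_def y)
    then show ?thesis by (auto simp: U.cone_d_vtx v l double_def y None split: option.splits)
  next
    case (Some t)
    then have "cell (case y of (o', b) \<Rightarrow> (0, o', base b)) = U.edge 0 t (cell (base b))" by (simp add: U.edge_def y)
    then show ?thesis
      by (simp add: U.cone_d_edge v e l lin_map_diff[OF value_at_lin] lookup_minus double_def y Some)
  qed
qed

end

lemma sum_unit_option:
  "(\<Sum>z\<in>UNIV. f z) = (\<Sum>b\<in>UNIV. f (None, b)) + (\<Sum>b\<in>UNIV. f (Some (), b))" for f :: "unit option \<times> 'b::finite \<Rightarrow> rat"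
proof -
  have "(\<Sum>z\<in>UNIV. f z) = (\<Sum>o'\<in>UNIV. \<Sum>b\<in>UNIV. f (o', b))"
    unfolding UNIV_Times_UNIV[symmetric] sum.cartesian_product by simp
  also have "(UNIV :: unit option set) = {None, Some ()}" by (auto simp: UNIV_option_conv)
  finally show ?thesis by simp
qed

text \<open>Over the edge both the differential and the homotopy change sign, so their products, and
  with them the defect, are the same in both copies.\<close>

lemma chain_equiv_critical_double:
  fixes D H \<Theta> :: "'i \<Rightarrow> 'b::finite \<Rightarrow> 'b \<Rightarrow> rat" and crit :: "'i \<Rightarrow> 'b \<Rightarrow> bool" and dg :: "'b \<Rightarrow> nat"
  assumes D: "\<And>i x y. D i x y \<noteq> 0 \<Longrightarrow> dg y = Suc (dg x)"
    and H: "\<And>i x y. H i x y \<noteq> 0 \<Longrightarrow> dg x = Suc (dg y)"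
    and \<Theta>: "\<And>i x y. \<Theta> i x y = of_bool (x = y) - (\<Sum>z\<in>UNIV. D i x z * H i z y) - (\<Sum>z\<in>UNIV. H i x z * D i z y)"
    and \<Theta>D: "\<And>i x y. (\<Sum>z\<in>UNIV. \<Theta> i x z * D i z y) = 0"
    and D\<Theta>: "\<And>i x y. (\<Sum>z\<in>UNIV. D i x z * \<Theta> i z y) = 0"
    and \<Theta>\<Theta>: "\<And>i x y. (\<Sum>z\<in>UNIV. \<Theta> i x z * (of_bool (crit i z) * \<Theta> i z y)) = \<Theta> i x y"
    and crit: "\<And>i x y. crit i x \<Longrightarrow> crit i y \<Longrightarrow> (\<Sum>z\<in>UNIV. \<Theta> i x z * \<Theta> i z y) = of_bool (x = y)"
  shows "chain_equiv (\<lambda>k. {(i, b). suspend dg b = k}) (mat_map (double (-1) D))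
    (\<lambda>k. {(i, b). suspend dg b = k \<and> crit i (snd b)}) (\<lambda>_. 0)"
proof (rule chain_equiv_critical[of _ "\<lambda>_. suspend dg" "double (-1) H" "double 1 \<Theta>" "\<lambda>i b. crit i (snd b)"])
  fix i and x y :: "unit option \<times> 'b"
  obtain o1 a o2 b where xy: "x = (o1, a)" "y = (o2, b)" by fastforce
  note o = xy double_def suspend_def sum_unit_option sum_negf
  have o12: "o1 = None \<or> o1 = Some ()" "o2 = None \<or> o2 = Some ()" by (metis option.exhaust unit.exhaust)+
  show "double (-1) D i x y \<noteq> 0 \<Longrightarrow> suspend dg y = Suc (suspend dg x)"
    "double (-1) H i x y \<noteq> 0 \<Longrightarrow> suspend dg x = Suc (suspend dg y)"
    using D[of i a b] H[of i a b] by (auto simp: o split: option.splits)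
  show "double 1 \<Theta> i x y = of_bool (x = y) - (\<Sum>z\<in>UNIV. double (-1) D i x z * double (-1) H i z y)
      - (\<Sum>z\<in>UNIV. double (-1) H i x z * double (-1) D i z y)"
    using o12 by (elim disjE) (simp_all add: o \<Theta>)
  show "(\<Sum>z\<in>UNIV. double 1 \<Theta> i x z * double (-1) D i z y) = 0" "(\<Sum>z\<in>UNIV. double (-1) D i x z * double 1 \<Theta> i z y) = 0"
    using o12 by (elim disjE; simp add: o \<Theta>D D\<Theta>)+
  show "(\<Sum>z\<in>UNIV. double 1 \<Theta> i x z * (of_bool (crit i (snd z)) * double 1 \<Theta> i z y)) = double 1 \<Theta> i x y"
    using o12 by (elim disjE) (simp_all add: o \<Theta>\<Theta>)
  show "(\<Sum>z\<in>UNIV. double 1 \<Theta> i x z * double 1 \<Theta> i z y) = of_bool (x = y)" if "crit i (snd x)" "crit i (snd y)"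
    using o12 that by (elim disjE) (simp_all add: o crit)
qed

text \<open>The central factor behaves like a circle: every critical cell counts once in its own
  degree and once in the next.\<close>

theorem homology_of_translation_action:
  fixes xor :: "'v::finite \<Rightarrow> 'v \<Rightarrow> 'v" and zero :: 'v and kind :: "'x \<Rightarrow> 'b::finite"
  assumes T: "translation_action Q X d s x0 L xor zero dg par kind base \<pi>"
    and V: "duality xor pair N"
    and G: "group (G :: 'g monoid)" and bij: "bij_betw coord (carrier G) {(m :: unit fg, h). \<pi> h = zero}"
    and mult: "\<And>C D. C \<in> carrier G \<Longrightarrow> D \<in> carrier G \<Longrightarrow> coord (C \<otimes>\<^bsub>G\<^esub> D) = coord C \<otimes>\<^bsub>fg_group \<times>\<times> Q\<^esub> coord D"
    and entries: "\<And>\<chi> x y. Poly_Mapping.lookup (value_at par kind (pair \<chi>) (d (cell (base y)))) x = D \<chi> x y"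
    and D: "\<And>i x y. D i x y \<noteq> 0 \<Longrightarrow> dg y = Suc (dg x)"
    and H: "\<And>i x y. H i x y \<noteq> 0 \<Longrightarrow> dg x = Suc (dg y)"
    and \<Theta>: "\<And>i x y. \<Theta> i x y = of_bool (x = y) - (\<Sum>z\<in>UNIV. D i x z * H i z y) - (\<Sum>z\<in>UNIV. H i x z * D i z y)"
    and \<Theta>D: "\<And>i x y. (\<Sum>z\<in>UNIV. \<Theta> i x z * D i z y) = 0"
    and D\<Theta>: "\<And>i x y. (\<Sum>z\<in>UNIV. D i x z * \<Theta> i z y) = 0"
    and \<Theta>\<Theta>: "\<And>i x y. (\<Sum>z\<in>UNIV. \<Theta> i x z * (of_bool (crit i z) * \<Theta> i z y)) = \<Theta> i x y"
    and crit: "\<And>i x y. crit i x \<Longrightarrow> crit i y \<Longrightarrow> (\<Sum>z\<in>UNIV. \<Theta> i x z * \<Theta> i z y) = of_bool (x = y)"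
  shows "has_dimension (group_homology G k)
    (card {(\<chi>, b). dg b = k \<and> crit \<chi> b} + card {(\<chi>, b). Suc (dg b) = k \<and> crit \<chi> b})"
proof -
  interpret T: translation_action Q X d s x0 L xor zero dg par kind base \<pi> by (rule T)
  interpret V: duality xor pair N by (rule V)
  interpret U: translation_action "fg_group \<times>\<times> Q" "cone.cone_cells X" "cone.cone_d d (\<lambda>_ c. c)"
    "cone.cone_s s (\<lambda>_ c. c)" "(0, None, x0)" "\<lambda>(m :: unit fg, h) (n, o' :: unit option, x). (m + n, o', L h x)"
    xor zero "suspend dg" "\<lambda>(n, o', x). par x" "\<lambda>(n, o', x). (o', kind x)" "\<lambda>(o', b). (0, o', base b)" "\<lambda>(m, h). \<pi> h"
    by (rule T.unit_cone)
  have kernel: "{(m :: unit fg, h). \<pi> h = zero} = {h. (case h of (m, h) \<Rightarrow> \<pi> h) = zero}" by auto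
  have "lin (\<lambda>(v, b). push (\<lambda>(u, b'). (xor v u, b')) (U.basic_d b)) = V.group_ring_d U.basic_d"
    by (simp add: V.group_ring_d_def)
  then have 1: "chain_equiv (\<lambda>k. {gs. length gs = k \<and> set gs \<subseteq> carrier G}) (bar_boundary G)
      (\<lambda>k. {(v, b). suspend dg b = k}) (V.group_ring_d U.basic_d)"
    using U.bar_equiv[OF G bij[unfolded kernel] mult] by simp
  have "Poly_Mapping.lookup (V.ev \<chi> (U.basic_d y)) x = double (-1) D \<chi> x y" for \<chi> x y
    using T.unit_cone_d[of "pair \<chi>" y x]
    unfolding U.basic_d_def U.orb_def[abs_def] V.ev_push double_def entries by simp
  then have 2: "chain_equiv (\<lambda>k. {(v, b). suspend dg b = k}) (V.group_ring_d U.basic_d)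
      (\<lambda>k. {(\<chi>, b). suspend dg b = k}) (mat_map (double (-1) D))"
    using V.chain_equiv_fourier[of "suspend dg" U.basic_d] by simp
  let ?E = "\<lambda>k. {(\<chi>, b). suspend dg b = k \<and> crit \<chi> (snd b)}"
  have 3: "chain_equiv (\<lambda>k. {(\<chi>, b). suspend dg b = k}) (mat_map (double (-1) D)) ?E (\<lambda>_. 0)"
    by (rule chain_equiv_critical_double[of D dg H \<Theta> crit]) (fact assms)+
  have "chain_equiv (\<lambda>k. {(v, b). suspend dg b = k}) (V.group_ring_d U.basic_d) ?E (\<lambda>_. 0)"
    by (rule chain_equiv_trans[OF _ _ 2 3]) (simp_all add: V.group_ring_d_def lin_map_zero)
  note 4 = this
  have eqv: "chain_equiv (\<lambda>k. {gs. length gs = k \<and> set gs \<subseteq> carrier G}) (bar_boundary G) ?E (\<lambda>_. 0)"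
    by (rule chain_equiv_trans[OF _ _ 1 4]) (simp_all add: bar_boundary_def[abs_def] lin_def[symmetric] lin_map_zero)
  let ?A = "{(\<chi>, b). dg b = k \<and> crit \<chi> b}" and ?B = "{(\<chi>, b). Suc (dg b) = k \<and> crit \<chi> b}"
  have E: "?E k = (\<lambda>(\<chi>, b). (\<chi>, None, b)) ` ?A \<union> (\<lambda>(\<chi>, b). (\<chi>, Some (), b)) ` ?B"
  proof (rule Set.set_eqI)
    fix p :: "'v \<times> unit option \<times> 'b"
    obtain \<chi> o' b where p: "p = (\<chi>, o', b)" by (metis prod_cases3)
    show "p \<in> ?E k \<longleftrightarrow> p \<in> (\<lambda>(\<chi>, b). (\<chi>, None, b)) ` ?A \<union> (\<lambda>(\<chi>, b). (\<chi>, Some (), b)) ` ?B"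
      unfolding p by (cases o') (simp_all add: suspend_def image_iff)
  qed
  have "card (?E k) = card ((\<lambda>(\<chi>, b). (\<chi>, None :: unit option, b)) ` ?A) + card ((\<lambda>(\<chi>, b). (\<chi>, Some (), b)) ` ?B)"
    unfolding E by (rule card_Un_disjoint) auto
  also have "\<dots> = card ?A + card ?B"
    by (simp add: card_image inj_on_def split_def prod_eq_iff)
  finally show ?thesis
    using group_homology_dimension[OF G _ eqv, of k] by simp
qed

section \<open>The level 4 braid group on three strands\<close>

instance two_letters :: finite
proof
  have "(UNIV :: two_letters set) = {Y1, Y2}" using two_letters.exhaust by auto
  then show "finite (UNIV :: two_letters set)" by (metis finite.simps)
qed

instance three_letters :: finite
proof
  have "(UNIV :: three_letters set) = {X1, X2, X3}" using three_letters.exhaust by auto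
  then show "finite (UNIV :: three_letters set)" by (metis finite.simps)
qed

definition xor2 :: "bool \<times> bool \<Rightarrow> bool \<times> bool \<Rightarrow> bool \<times> bool" where
  "xor2 = (\<lambda>(a, a') (b, b'). (a \<noteq> b, a' \<noteq> b'))"

definition pair2 :: "bool \<times> bool \<Rightarrow> bool \<times> bool \<Rightarrow> rat" where
  "pair2 = (\<lambda>(a, a') (b, b'). sgn_bool a b * sgn_bool a' b')"

lemma duality2: "duality xor2 pair2 (2 * 2)"
  unfolding xor2_def pair2_def by (rule duality_prod[OF duality_bool duality_bool])

definition parity2 :: "two_letters fg \<Rightarrow> bool \<times> bool" where
  "parity2 w = (odd (expo Y1 w), odd (expo Y2 w))"

lemma parity2_simps [simp]: "parity2 0 = (False, False)" "parity2 (a + b) = xor2 (parity2 a) (parity2 b)"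
  "parity2 (- a) = parity2 a" "parity2 y1 = (True, False)" "parity2 y2 = (False, True)"
  by (auto simp: parity2_def xor2_def)

lemma parity2_even: "parity2 w = (False, False) \<longleftrightarrow> even_fg w"
  unfolding parity2_def even_fg_def by (auto intro: two_letters.exhaust) (metis two_letters.exhaust)

lemma parity2_surj: "\<exists>w. parity2 w = v"
proof -
  obtain a b where v: "v = (a, b)" by fastforce
  have "parity2 ((if a then y1 else 0) + (if b then y2 else 0)) = v"
    by (simp add: v xor2_def)
  then show ?thesis by blast
qed

lemma xor2_simps: "xor2 v (False, False) = v" "xor2 (xor2 u v) v = u"
  by (auto simp: xor2_def split: prod.splits)

lemma tree_d_translate: "tree.cone_d (cell (case x of (w, o', u) \<Rightarrow> (a + w, o', u))) =
    push (\<lambda>(w, o', u). (a + w, o', u)) (tree.cone_d (cell x))"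
  using tree.cone_d_trans[of a "cell x"] by (simp add: tree.trans_def)

lemma translation_action_three:
  "translation_action fg_group tree.cone_cells tree.cone_d tree.cone_s (0, None, ())
    (\<lambda>a (w, o', u). (a + w, o', u)) xor2 (False, False) (\<lambda>b. case b of None \<Rightarrow> 0 | Some _ \<Rightarrow> Suc 0)
    (\<lambda>(w, o', u). parity2 w) (\<lambda>(w, o', u). o') (\<lambda>b. (0, b, ())) parity2"
proof (intro translation_action.intro translation_action_axioms.intro tree.acyclic_cone group_fg_group)
  show "tree.cone_cells k = {x. (case case x of (w :: two_letters fg, o', u :: unit) \<Rightarrow> o' of None \<Rightarrow> 0 | Some _ \<Rightarrow> Suc 0) = k}" for k
    by (auto simp: tree_cells split: option.splits if_splits)
  fix x :: "two_letters fg \<times> two_letters option \<times> unit"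
  show "\<exists>!h. x = (case (0, case x of (w, o', u) \<Rightarrow> o', ()) of (w, o', u) \<Rightarrow> (h + w, o', u))"
    by (cases x) auto
  show "surj parity2" by (metis parity2_surj surj_def)
  show "tree.cone_d (cell (case x of (w, o', u) \<Rightarrow> (h + w, o', u))) =
      push (\<lambda>(w, o', u). (h + w, o', u)) (tree.cone_d (cell x))" for h
    by (rule tree_d_translate)
qed (auto simp: add.assoc xor2_simps)

lemma sum_option: "(\<Sum>z\<in>UNIV. f z) = f None + (\<Sum>x\<in>UNIV. f (Some x))"
  for f :: "'a::finite option \<Rightarrow> 'b::comm_monoid_add"
  by (simp add: UNIV_option_conv sum.reindex)

lemma sum_two_letters: "(\<Sum>y\<in>UNIV. f y) = f Y1 + f Y2" for f :: "two_letters \<Rightarrow> 'b::comm_monoid_add"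
proof -
  have U: "(UNIV :: two_letters set) = {Y1, Y2}" using two_letters.exhaust by auto
  show ?thesis unfolding U by simp
qed

lemma card_pairs: "card {(i, b). P i b} = (\<Sum>i\<in>UNIV. \<Sum>b\<in>UNIV. of_bool (P i b))"
  for P :: "'i::finite \<Rightarrow> 'b::finite \<Rightarrow> bool"
proof -
  have "{(i, b). P i b} = (SIGMA i:UNIV. {b. P i b})" by auto
  then show ?thesis by (simp add: sum_of_bool_eq)
qed

lemma sum_UNIV_prod: "(\<Sum>p\<in>UNIV. f p) = (\<Sum>a\<in>UNIV. \<Sum>b\<in>UNIV. f (a, b))"
  for f :: "'a::finite \<times> 'b::finite \<Rightarrow> 'c::comm_monoid_add"
  unfolding UNIV_Times_UNIV[symmetric] sum.cartesian_product by simp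

text \<open>The nontrivial entries are values of a character on the generators minus one, hence 0 or
  -2.\<close>

definition d3 :: "bool \<times> bool \<Rightarrow> two_letters option \<Rightarrow> two_letters option \<Rightarrow> rat" where
  "d3 \<chi> x y = (if x \<noteq> None then 0 else
     case y of None \<Rightarrow> 0 | Some Y1 \<Rightarrow> if fst \<chi> then -2 else 0 | Some Y2 \<Rightarrow> if snd \<chi> then -2 else 0)"

text \<open>The pivot is the first edge on which the character is nontrivial; -1/2 inverts its entry
  -2.\<close>

definition h3 :: "bool \<times> bool \<Rightarrow> two_letters option \<Rightarrow> two_letters option \<Rightarrow> rat" where
  "h3 \<chi> x y = (if y = None \<and> (x = Some Y1 \<and> fst \<chi> \<or> x = Some Y2 \<and> \<not> fst \<chi> \<and> snd \<chi>) then -1/2 else 0)"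

text \<open>For the trivial character the differential vanishes and all three cells survive.
  Otherwise the vertex cancels against the pivot edge and the other edge remains, which gives 1
  vertex and 2 + 3 = 5 edges.\<close>

definition crit3 :: "bool \<times> bool \<Rightarrow> two_letters option \<Rightarrow> bool" where
  "crit3 \<chi> x \<longleftrightarrow> \<chi> = (False, False) \<or> x = Some (if fst \<chi> then Y2 else Y1)"

lemma card_crit3: "card {(\<chi>, b). (case b of None \<Rightarrow> 0 | Some _ \<Rightarrow> Suc 0) = k \<and> crit3 \<chi> b} =
    (if k = 0 then 1 else if k = Suc 0 then 5 else 0)"
  by (simp add: card_pairs sum_option sum_two_letters sum_UNIV_prod UNIV_bool crit3_def)

lemma card_crit3_Suc: "card {(\<chi>, b). Suc (case b of None \<Rightarrow> 0 | Some _ \<Rightarrow> Suc 0) = k \<and> crit3 \<chi> b} =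
    (if k = Suc 0 then 1 else if k = 2 then 5 else 0)"
  by (simp add: card_pairs sum_option sum_two_letters sum_UNIV_prod UNIV_bool crit3_def)

theorem homology_three:
  "has_dimension (group_homology (level4_braid_group 3) k)
    ((if k = 0 then 1 else if k = Suc 0 then 5 else 0) + (if k = Suc 0 then 1 else if k = 2 then 5 else 0))"
  unfolding card_crit3[symmetric] card_crit3_Suc[symmetric]
proof (rule homology_of_translation_action[OF translation_action_three duality2, of _ coord3 d3 h3
    "\<lambda>i x y. of_bool (x = y) - (\<Sum>z\<in>UNIV. d3 i x z * h3 i z y) - (\<Sum>z\<in>UNIV. h3 i x z * d3 i z y)" crit3])
  show "group (level4_braid_group 3)" by (rule group_level4_braid_group)
  show "bij_betw coord3 (carrier (level4_braid_group 3)) {(m, h). parity2 h = (False, False)}"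
    using coord3_bij by (simp add: parity2_even)
  fix C D assume CD: "C \<in> carrier (level4_braid_group 3)" "D \<in> carrier (level4_braid_group 3)"
  show "coord3 (C \<otimes>\<^bsub>level4_braid_group 3\<^esub> D) = coord3 C \<otimes>\<^bsub>fg_group \<times>\<times> fg_group\<^esub> coord3 D"
    unfolding coord3_mult[OF CD] by (cases "coord3 C"; cases "coord3 D") (simp add: mult_DirProd)
next
  fix \<chi> :: "bool \<times> bool" and x y :: "two_letters option"
  show "Poly_Mapping.lookup (value_at (\<lambda>(w, o', u). parity2 w) (\<lambda>(w, o', u). o') (pair2 \<chi>) (tree.cone_d (cell (0, y, ())))) x = d3 \<chi> x y"
    by (cases y; cases \<chi>)
      (auto simp: tree_d_cell lin_map_0[OF value_at_lin] lin_map_diff[OF value_at_lin] value_at_cell d3_def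
        lookup_minus lookup_single when_def pair2_def sgn_bool_def split: two_letters.splits)
next
  fix i :: "bool \<times> bool" and x y :: "two_letters option"
  let ?T = "\<lambda>i x y. of_bool (x = y) - (\<Sum>z\<in>UNIV. d3 i x z * h3 i z y) - (\<Sum>z\<in>UNIV. h3 i x z * d3 i z y)"
  obtain b1 b2 where i: "i = (b1, b2)" by fastforce
  have o: "z = None \<or> z = Some Y1 \<or> z = Some Y2" for z :: "two_letters option"
    by (metis option.exhaust two_letters.exhaust)
  note s = sum_option sum_two_letters d3_def h3_def crit3_def i
  show "d3 i x y \<noteq> 0 \<Longrightarrow> (case y of None \<Rightarrow> 0 | Some _ \<Rightarrow> Suc 0) = Suc (case x of None \<Rightarrow> 0 | Some _ \<Rightarrow> Suc 0)"
    "h3 i x y \<noteq> 0 \<Longrightarrow> (case x of None \<Rightarrow> 0 | Some _ \<Rightarrow> Suc 0) = Suc (case y of None \<Rightarrow> 0 | Some _ \<Rightarrow> Suc 0)"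
    by (auto simp: d3_def h3_def split: option.splits if_splits)
  show "(\<Sum>z\<in>UNIV. ?T i x z * d3 i z y) = 0" "(\<Sum>z\<in>UNIV. d3 i x z * ?T i z y) = 0"
    "(\<Sum>z\<in>UNIV. ?T i x z * (of_bool (crit3 i z) * ?T i z y)) = ?T i x y"
    using o[of x] o[of y] by (elim disjE; cases b1; cases b2; simp add: s)+
  show "(\<Sum>z\<in>UNIV. ?T i x z * ?T i z y) = of_bool (x = y)" if "crit3 i x" "crit3 i y"
    using o[of x] o[of y] that by (elim disjE; cases b1; cases b2; simp add: s)
qed simp

section \<open>The level 4 braid group on four strands\<close>

interpretation two: cone tree.cone_cells tree.cone_d tree.cone_s "(0, None, ())" "\<lambda>w. tree_map (\<alpha> w)"
  by (rule cone_tree) (simp_all add: \<alpha>_add \<alpha>_plus)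

definition semidirect :: "(two_letters fg \<times> three_letters fg) monoid" where
  "semidirect = \<lparr>carrier = UNIV, mult = \<lambda>(w, k) (w', k'). (w + w', k + \<alpha> w k'), one = (0, 0)\<rparr>"

lemma semidirect_simps [simp]: "carrier semidirect = UNIV" "(w, k) \<otimes>\<^bsub>semidirect\<^esub> (w', k') = (w + w', k + \<alpha> w k')"
  "\<one>\<^bsub>semidirect\<^esub> = (0, 0)"
  by (simp_all add: semidirect_def)

lemma group_semidirect: "group semidirect"
proof (rule groupI)
  fix g assume "g \<in> carrier semidirect"
  obtain w k where g: "g = (w, k)" by fastforce
  show "\<exists>h\<in>carrier semidirect. h \<otimes>\<^bsub>semidirect\<^esub> g = \<one>\<^bsub>semidirect\<^esub>"
    by (rule bexI[of _ "(- w, \<alpha> (- w) (- k))"]) (simp_all add: g \<alpha>_add[symmetric] \<alpha>_minus)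
next
  fix f g h :: "two_letters fg \<times> three_letters fg"
  obtain f1 f2 g1 g2 h1 h2 where "f = (f1, f2)" "g = (g1, g2)" "h = (h1, h2)" by fastforce
  then show "f \<otimes>\<^bsub>semidirect\<^esub> g \<otimes>\<^bsub>semidirect\<^esub> h = f \<otimes>\<^bsub>semidirect\<^esub> (g \<otimes>\<^bsub>semidirect\<^esub> h)"
    by (simp add: \<alpha>_add \<alpha>_plus add.assoc)
qed (auto simp: \<alpha>_minus)

definition xor3 :: "bool \<times> bool \<times> bool \<Rightarrow> bool \<times> bool \<times> bool \<Rightarrow> bool \<times> bool \<times> bool" where
  "xor3 = (\<lambda>(a, a') (b, b'). (a \<noteq> b, xor2 a' b'))"

definition pair3 :: "bool \<times> bool \<times> bool \<Rightarrow> bool \<times> bool \<times> bool \<Rightarrow> rat" where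
  "pair3 = (\<lambda>(a, a') (b, b'). sgn_bool a b * pair2 a' b')"

definition xor5 :: "(bool \<times> bool) \<times> bool \<times> bool \<times> bool \<Rightarrow> (bool \<times> bool) \<times> bool \<times> bool \<times> bool \<Rightarrow> (bool \<times> bool) \<times> bool \<times> bool \<times> bool" where
  "xor5 = (\<lambda>(a, a') (b, b'). (xor2 a b, xor3 a' b'))"

definition pair5 :: "(bool \<times> bool) \<times> bool \<times> bool \<times> bool \<Rightarrow> (bool \<times> bool) \<times> bool \<times> bool \<times> bool \<Rightarrow> rat" where
  "pair5 = (\<lambda>(a, a') (b, b'). pair2 a b * pair3 a' b')"

lemma duality3: "duality xor3 pair3 (2 * (2 * 2))"
  unfolding xor3_def pair3_def by (rule duality_prod[OF duality_bool duality2])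

lemma duality5: "duality xor5 pair5 ((2 * 2) * (2 * (2 * 2)))"
  unfolding xor5_def pair5_def by (rule duality_prod[OF duality2 duality3])

definition parity3 :: "three_letters fg \<Rightarrow> bool \<times> bool \<times> bool" where
  "parity3 k = (odd (expo X1 k), odd (expo X2 k), odd (expo X3 k))"

lemma parity3_simps [simp]: "parity3 0 = (False, False, False)" "parity3 (a + b) = xor3 (parity3 a) (parity3 b)"
  "parity3 (- a) = parity3 a" "parity3 (\<alpha> w a) = parity3 a"
  "parity3 x1 = (True, False, False)" "parity3 x2 = (False, True, False)" "parity3 x3 = (False, False, True)"
  by (auto simp: parity3_def xor3_def xor2_def expo_\<alpha>)

lemma parity3_even: "parity3 k = (False, False, False) \<longleftrightarrow> even_fg k"
  unfolding parity3_def even_fg_def by auto (metis three_letters.exhaust)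

lemma parity3_surj: "\<exists>k. parity3 k = v"
proof -
  obtain a b c where v: "v = (a, b, c)" by (metis prod_cases3)
  have "parity3 ((if a then x1 else 0) + ((if b then x2 else 0) + (if c then x3 else 0))) = v"
    by (simp add: v xor3_def xor2_def)
  then show ?thesis by blast
qed

lemma xor3_simps: "xor3 v (False, False, False) = v" "xor3 (xor3 u v) v = u"
  by (auto simp: xor3_def xor2_def split: prod.splits)

fun degree4 :: "two_letters option \<times> three_letters option \<Rightarrow> nat" where
  "degree4 (None, None) = 0"
| "degree4 (None, Some _) = Suc 0"
| "degree4 (Some _, None) = Suc 0"
| "degree4 (Some _, Some _) = 2"

abbreviation parity4 :: "two_letters fg \<times> two_letters option \<times> three_letters fg \<times> three_letters option \<times> unit \<Rightarrow> (bool \<times> bool) \<times> bool \<times> bool \<times> bool" where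
  "parity4 \<equiv> \<lambda>(w, p, k, q, u). (parity2 w, parity3 k)"

abbreviation kind4 :: "two_letters fg \<times> two_letters option \<times> three_letters fg \<times> three_letters option \<times> unit \<Rightarrow> two_letters option \<times> three_letters option" where
  "kind4 \<equiv> \<lambda>(w, p, k, q, u). (p, q)"

abbreviation "base4 \<equiv> \<lambda>(p, q). (0, p, 0, q, ())"

text \<open>A cell over the vertex \<open>v\<close> with relative coordinate \<open>l\<close>
  corresponds to the group element \<open>(v, \<alpha> v l)\<close>; left multiplication by
  \<open>(w, k)\<close>, rewritten in these coordinates, twists \<open>k\<close> by the inverse of
  \<open>w + v\<close>.\<close>

abbreviation "translate4 \<equiv> \<lambda>(w, k) (v, p, l, q, u). (w + v, p, \<alpha> (- (w + v)) k + l, q, u)"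

lemma two_cells: "two.cone_cells j = {x. degree4 (kind4 x) = j}"
proof (rule Set.set_eqI)
  fix x :: "two_letters fg \<times> two_letters option \<times> three_letters fg \<times> three_letters option \<times> unit"
  obtain w p k q u where x: "x = (w, p, k, q, u)" by (metis prod.exhaust)
  show "x \<in> two.cone_cells j \<longleftrightarrow> x \<in> {x. degree4 (kind4 x) = j}"
    by (cases p; cases q) (auto simp: x two.cone_cells_def tree_cells)
qed

lemma translate4_d: "two.cone_d (cell (translate4 h x)) = push (translate4 h) (two.cone_d (cell x))"
proof -
  obtain w k where h: "h = (w, k)" by fastforce
  obtain v p l q u where x: "x = (v, p, l, q, u)" by (metis prod.exhaust)
  have T: "(\<lambda>(v, p, l, q, u). (w + v, p, \<alpha> (- (w + v)) k + l, q, u :: unit)) =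
      (\<lambda>(v, o', y). (w + v, o', case y of (l, q, u) \<Rightarrow> (\<alpha> (- (w + v)) k + l, q, u)))"
    by (auto simp: fun_eq_iff)
  have t: "push (\<lambda>(l, q, u). (a + l, q, u)) = tree.trans a" for a :: "three_letters fg"
    by (simp add: tree.trans_def)
  have c: "cell (case y of (l, q, u) \<Rightarrow> (a + l, q, u)) = tree.trans a (cell y)" for a :: "three_letters fg" and y
    by (simp add: tree.trans_def)
  have "x \<in> two.cone_cells (degree4 (p, q))" by (simp add: two_cells x)
  then have "two.cone_d (cell (case x of (v, o', y) \<Rightarrow> (w + v, o', case y of (l, q, u) \<Rightarrow> (\<alpha> (- (w + v)) k + l, q, u)))) =
      push (\<lambda>(v, o', y). (w + v, o', case y of (l, q, u) \<Rightarrow> (\<alpha> (- (w + v)) k + l, q, u))) (two.cone_d (cell x))"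
  proof (rule two.cone_d_equivariant)
    fix v t y
    show "tree.cone_d (cell (case y of (l, q, u) \<Rightarrow> (\<alpha> (- (w + v)) k + l, q, u))) =
        push (\<lambda>(l, q, u). (\<alpha> (- (w + v)) k + l, q, u)) (tree.cone_d (cell y))"
      unfolding t c by (rule tree.cone_d_trans)
    have e: "\<alpha> (- (w + (v + gen t))) k = \<alpha> (- gen t) (\<alpha> (- (w + v)) k)"
      by (simp add: \<alpha>_plus[symmetric] minus_add add.assoc[symmetric] del: add_uminus_conv_diff)
    show "tree_map (\<alpha> (- gen t)) (cell (case y of (l, q, u) \<Rightarrow> (\<alpha> (- (w + v)) k + l, q, u))) =
        push (\<lambda>(l, q, u). (\<alpha> (- (w + (v + gen t))) k + l, q, u)) (tree_map (\<alpha> (- gen t)) (cell y))"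
      unfolding t c e by (rule tree_map_trans) (rule \<alpha>_add)
  qed
  then show ?thesis unfolding h prod.case T .
qed

lemma translation_action_four:
  "translation_action semidirect two.cone_cells two.cone_d two.cone_s (0, None, 0, None, ())
    translate4 xor5 ((False, False), False, False, False) degree4 parity4 kind4 base4 (\<lambda>(w, k). (parity2 w, parity3 k))"
proof (intro translation_action.intro translation_action_axioms.intro two.acyclic_cone group_semidirect two_cells translate4_d)
  fix g h :: "two_letters fg \<times> three_letters fg" and a :: "two_letters option \<times> three_letters option"
    and x :: "two_letters fg \<times> two_letters option \<times> three_letters fg \<times> three_letters option \<times> unit"
  obtain w k w' k' where gh: "g = (w, k)" "h = (w', k')" by fastforce
  obtain v p l q u where x: "x = (v, p, l, q, u)" by (metis prod.exhaust)
  have "\<alpha> (- (w + w' + v)) (\<alpha> w k') = \<alpha> (- (w' + v)) k'"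
    by (simp add: \<alpha>_plus[symmetric] minus_add add.assoc)
  then show "translate4 (g \<otimes>\<^bsub>semidirect\<^esub> h) x = translate4 g (translate4 h x)"
    by (simp add: gh x \<alpha>_add add.assoc)
  show "kind4 (translate4 h x) = kind4 x" "kind4 (base4 a) = a" "parity4 (base4 a) = ((False, False), False, False, False)"
    by (cases a; simp add: gh x)+
  show "parity4 (translate4 h x) = xor5 (case h of (w, k) \<Rightarrow> (parity2 w, parity3 k)) (parity4 x)"
    by (simp add: gh x xor5_def)
  show "(case g \<otimes>\<^bsub>semidirect\<^esub> h of (w, k) \<Rightarrow> (parity2 w, parity3 k)) =
      xor5 (case g of (w, k) \<Rightarrow> (parity2 w, parity3 k)) (case h of (w, k) \<Rightarrow> (parity2 w, parity3 k))"
    by (simp add: gh xor5_def)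
  show "\<exists>!h. x = translate4 h (base4 (kind4 x))"
    unfolding x prod.case
  proof (rule ex1I[of _ "(v, \<alpha> v l)"])
    show "(v, p, l, q, u) = translate4 (v, \<alpha> v l) (0, p, 0, q, ())"
      by (simp add: \<alpha>_plus[symmetric])
    fix h assume "(v, p, l, q, u) = translate4 h (0, p, 0, q, ())"
    then have "fst h = v" "\<alpha> (- v) (snd h) = l" by (cases h; auto)+
    then show "h = (v, \<alpha> v l)" by (cases h) (auto simp: \<alpha>_plus[symmetric])
  qed
  show "surj (\<lambda>(w, k). (parity2 w, parity3 k))"
    unfolding surj_def
  proof
    fix y :: "(bool \<times> bool) \<times> bool \<times> bool \<times> bool"
    obtain w k where "parity2 w = fst y" "parity3 k = snd y" using parity2_surj parity3_surj by meson
    then show "\<exists>x. y = (case x of (w, k) \<Rightarrow> (parity2 w, parity3 k))" by (intro exI[of _ "(w, k)"]) simp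
  qed
qed (auto simp: xor5_def xor2_simps xor3_simps)


abbreviation "sign3 a k \<equiv> pair3 a (parity3 k)"

abbreviation "value3 a \<equiv> value_at (\<lambda>(k :: three_letters fg, q :: three_letters option, u :: unit). parity3 k) (\<lambda>(k, q, u). q) (pair3 a)"

lemma pair_mult: "pair2 b (xor2 u v) = pair2 b u * pair2 b v" "pair3 a (xor3 u' v') = pair3 a u' * pair3 a v'"
  "pair2 b (False, False) = 1" "pair3 a (False, False, False) = 1"
  by (simp_all add: duality.pair_xor[OF duality2] duality.pair_xor[OF duality3])
    (simp_all add: pair2_def pair3_def sgn_bool_def split: prod.splits)

lemma value3_trans: "value3 a (tree.trans u c) = chain_scale (sign3 a u) (value3 a c)"
proof -
  have "push (\<lambda>q. q) b = b" for b :: "three_letters option \<Rightarrow>\<^sub>0 rat"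
    by (rule push_id[of UNIV]) (auto simp: chains_on_def)
  then show ?thesis
    unfolding tree.trans_def
    by (subst value_at_push[where \<chi> = "pair3 a" and r = "sign3 a u" and g = "\<lambda>q. q" and par = "\<lambda>(k, q :: three_letters option, u :: unit). parity3 k" and kind = "\<lambda>(k :: three_letters fg, q, u :: unit). q"])
      (auto simp: pair_mult)
qed

lemma value4_vtx: "value_at parity4 kind4 (pair5 (b, a)) (two.vtx w c) = chain_scale (pair2 b (parity2 w)) (push (Pair None) (value3 a c))"
  unfolding two.vtx_def
  by (subst value_at_push[where \<chi> = "pair3 a" and r = "pair2 b (parity2 w)" and g = "Pair None" and par = "\<lambda>(k, q :: three_letters option, u :: unit). parity3 k" and kind = "\<lambda>(k :: three_letters fg, q, u :: unit). q"])
    (auto simp: pair5_def)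

lemma value4_edge: "value_at parity4 kind4 (pair5 (b, a)) (two.edge w t c) = chain_scale (pair2 b (parity2 w)) (push (Pair (Some t)) (value3 a c))"
  unfolding two.edge_def
  by (subst value_at_push[where \<chi> = "pair3 a" and r = "pair2 b (parity2 w)" and g = "Pair (Some t)" and par = "\<lambda>(k, q :: three_letters option, u :: unit). parity3 k" and kind = "\<lambda>(k :: three_letters fg, q, u :: unit). q"])
    (auto simp: pair5_def)

text \<open>Fox derivatives, evaluated at a character.\<close>

definition fox :: "bool \<times> bool \<times> bool \<Rightarrow> three_letters option \<Rightarrow> three_letters fg \<Rightarrow> rat" where
  "fox a q f = Poly_Mapping.lookup (value3 a (geod f)) q"

lemma fox_simps [simp]:
  "fox a q (f + g) = fox a q f + sign3 a f * fox a q g" "fox a q (- f) = - sign3 a f * fox a q f"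
  "fox a q (gen x) = of_bool (q = Some x)"
  by (simp_all add: fox_def geod_plus geod_uminus geod_gen value3_trans value_at_cell pair_mult lookup_add lookup_chain_scale
      lookup_single when_def lin_map_add[OF value_at_lin] lin_map_uminus[OF value_at_lin])

lemma \<alpha>_hom_0: "\<alpha>m y 0 = 0"
  using \<alpha>_minus(1)[of "- gen y"] by (simp add: \<alpha>_y_inv)

lemma two_d_cell: "two.cone_d (cell (0, None, y)) = two.vtx 0 (tree.cone_d (cell y))"
  "two.cone_d (cell (0, Some t, y)) = two.vtx (gen t) (tree_map (\<alpha>m t) (cell y)) - two.vtx 0 (cell y) - two.edge 0 t (tree.cone_d (cell y))"
proof -
  have "cell (0, None, y) = two.vtx 0 (cell y)" "cell (0, Some t, y) = two.edge 0 t (cell y)"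
    by (simp_all add: two.vtx_def two.edge_def)
  then show "two.cone_d (cell (0, None, y)) = two.vtx 0 (tree.cone_d (cell y))"
    "two.cone_d (cell (0, Some t, y)) = two.vtx (gen t) (tree_map (\<alpha>m t) (cell y)) - two.vtx 0 (cell y) - two.edge 0 t (tree.cone_d (cell y))"
    using two.cone_d_edge[of 0 t "cell y"] by (simp_all add: two.cone_d_vtx \<alpha>_y_inv[abs_def])
qed

text \<open>In the last case, a 2-cell, the faces over the vertices are the edge \<open>x\<close>
  transported along \<open>y\<close>, which contributes Fox derivatives, and \<open>x\<close>
  itself; the faces over the edge \<open>y\<close> are the two ends of \<open>x\<close>.\<close>

lemma value4_d:
  fixes a b p' q'
  defines "v \<equiv> \<lambda>p q. Poly_Mapping.lookup (value_at parity4 kind4 (pair5 (b, a)) (two.cone_d (cell (0, p, 0, q, ())))) (p', q')"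
  shows "v None None = 0"
    "v None (Some x) = of_bool (p' = None \<and> q' = None) * (sign3 a (gen x) - 1)"
    "v (Some y) None = of_bool (p' = None \<and> q' = None) * (pair2 b (parity2 (gen y)) - 1)"
    "v (Some y) (Some x) = of_bool (p' = None) * (pair2 b (parity2 (gen y)) * fox a q' (\<alpha>m y (gen x)) - of_bool (q' = Some x))
      - of_bool (p' = Some y \<and> q' = None) * (sign3 a (gen x) - 1)"
  by (auto simp: v_def two_d_cell tree_d_cell value4_vtx value4_edge lin_map_diff[OF value_at_lin] lin_map_0[OF value_at_lin]
      pushs value_at_cell push_single lookup_minus lookup_chain_scale lookup_push_Pair lookup_single when_def pair_mult tree_map_cell
      fox_def \<alpha>_hom_0 lin_map_0[OF two.lins'(1)])


text \<open>Fixes the order of rows and columns in the tables, by increasing degree as in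
  \<open>degree_list\<close>.\<close>

fun cell_index :: "two_letters option \<times> three_letters option \<Rightarrow> nat" where
  "cell_index (None, None) = 0"
| "cell_index (None, Some X1) = 1"
| "cell_index (None, Some X2) = 2"
| "cell_index (None, Some X3) = 3"
| "cell_index (Some Y1, None) = 4"
| "cell_index (Some Y2, None) = 5"
| "cell_index (Some Y1, Some X1) = 6"
| "cell_index (Some Y1, Some X2) = 7"
| "cell_index (Some Y1, Some X3) = 8"
| "cell_index (Some Y2, Some X1) = 9"
| "cell_index (Some Y2, Some X2) = 10"
| "cell_index (Some Y2, Some X3) = 11"

lemma cell_index_bij: "bij_betw cell_index UNIV {..<12}"
proof -
  let ?C = "[(None, None), (None, Some X1), (None, Some X2), (None, Some X3), (Some Y1, None), (Some Y2, None),
    (Some Y1, Some X1), (Some Y1, Some X2), (Some Y1, Some X3), (Some Y2, Some X1), (Some Y2, Some X2), (Some Y2, Some X3)]"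
  have "z \<in> set ?C" for z
    by (cases z rule: cell_index.cases) simp_all
  then have U: "UNIV = set ?C" by blast
  have "map cell_index ?C = [0..<12]" by (simp add: upt_rec)
  then have "cell_index ` set ?C = {..<12}" "distinct (map cell_index ?C)"
    by (metis set_map atLeast_upt, metis distinct_upt)
  then show ?thesis unfolding U bij_betw_def distinct_map by blast
qed

lemma cell_index_less: "cell_index z < 12"
  using bij_betw_apply[OF cell_index_bij, of z] by simp

lemma cell_index_eq: "cell_index x = cell_index y \<longleftrightarrow> x = y"
  using inj_eq[OF bij_betw_imp_inj_on[OF cell_index_bij]] .

lemma sum_cells: "(\<Sum>z\<in>UNIV. f (cell_index z)) = (\<Sum>m<12. f m)"
  by (rule sum.reindex_bij_betw[OF cell_index_bij])

lemma degree4_index: "degree4 z = degree_list ! cell_index z"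
  by (cases z rule: cell_index.cases) (simp_all add: degree_list_def)

abbreviation sgr :: "bool \<Rightarrow> rat" where "sgr b \<equiv> of_int (sg b)"

lemma sgr_square: "sgr b * sgr b = 1" "sgr b * (sgr b * c) = c"
  by (simp_all add: sg_def)

lemma sign_gens:
  "pair3 (a1, a2, a3) (True, False, False) = sgr a1" "pair3 (a1, a2, a3) (False, True, False) = sgr a2"
  "pair3 (a1, a2, a3) (False, False, True) = sgr a3"
  "pair2 (b1, b2) (True, False) = sgr b1" "pair2 (b1, b2) (False, True) = sgr b2"
  by (simp_all add: pair3_def pair2_def sgn_bool_def sg_def)

text \<open>Inverse automorphisms appear because the cone transports along an edge by
  \<open>- gen t\<close>. The derivatives of the explicit words are shortened by
  \<open>sgr b * sgr b = 1\<close>.\<close>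

lemma fox_\<alpha>:
  "fox (a1, a2, a3) None (\<alpha>m y (gen x)) = 0"
  "fox (a1, a2, a3) (Some X1) (\<alpha>m Y1 x1) = 1 + sgr a1 * sgr a3 - sgr a1"
  "fox (a1, a2, a3) (Some X1) (\<alpha>m Y1 x2) = 1 - sgr a3 + sgr a2 * (sgr a3 - 1)"
  "fox (a1, a2, a3) (Some X1) (\<alpha>m Y1 x3) = 1 - sgr a3"
  "fox (a1, a2, a3) (Some X1) (\<alpha>m Y2 (gen x)) = of_bool (x = X1)"
  "fox (a1, a2, a3) (Some X2) (\<alpha>m Y1 (gen x)) = of_bool (x = X2)"
  "fox (a1, a2, a3) (Some X2) (\<alpha>m Y2 x1) = 0"
  "fox (a1, a2, a3) (Some X2) (\<alpha>m Y2 x2) = 1 + sgr a2 * sgr a3 - sgr a2"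
  "fox (a1, a2, a3) (Some X2) (\<alpha>m Y2 x3) = 1 - sgr a3"
  "fox (a1, a2, a3) (Some X3) (\<alpha>m Y1 x1) = sgr a1 - 1"
  "fox (a1, a2, a3) (Some X3) (\<alpha>m Y1 x2) = sgr a1 - 1 + sgr a2 * (1 - sgr a1)"
  "fox (a1, a2, a3) (Some X3) (\<alpha>m Y1 x3) = sgr a1"
  "fox (a1, a2, a3) (Some X3) (\<alpha>m Y2 x1) = 0"
  "fox (a1, a2, a3) (Some X3) (\<alpha>m Y2 x2) = sgr a2 - 1"
  "fox (a1, a2, a3) (Some X3) (\<alpha>m Y2 x3) = sgr a2"
  by ((cases y; cases x)?, simp_all add: \<alpha>_gen pair_mult sign_gens algebra_simps sgr_square del: add_uminus_conv_diff)+

lemma d4_entries: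
  "Poly_Mapping.lookup (value_at parity4 kind4 (pair5 ((b1, b2), a1, a2, a3)) (two.cone_d (cell (base4 y)))) x =
    of_int (d_rows (sg a1) (sg a2) (sg a3) (sg b1) (sg b2) ! cell_index x ! cell_index y)"
proof -
  obtain p q p' q' where xy: "y = (p, q)" "x = (p', q')" by fastforce
  show ?thesis
    unfolding xy prod.case
    by (cases "(p, q)" rule: cell_index.cases; cases "(p', q')" rule: cell_index.cases;
      simp add: value4_d d_rows_def zero_row_def fox_\<alpha> sign_gens algebra_simps)
qed

abbreviation "d_int \<equiv> \<lambda>((b1, b2), a1, a2, a3). d_matrix a1 a2 a3 b1 b2"
abbreviation "h_int \<equiv> \<lambda>((b1, b2), a1, a2, a3). h_matrix a1 a2 a3 b1 b2"

lemma check_int: "check (d_int \<chi>) (h_int \<chi>)" "check_degrees (d_int \<chi>) (h_int \<chi>)"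
  using check_all check_degrees_all by (auto split: prod.splits)

text \<open>The factor 2 here and the division by 2 in \<open>h4\<close> undo the rescaling of the
  integer tables; the products of both matrices, and so \<open>theta4\<close>, are
  unaffected.\<close>

definition d4 :: "(bool \<times> bool) \<times> bool \<times> bool \<times> bool \<Rightarrow> two_letters option \<times> three_letters option \<Rightarrow> two_letters option \<times> three_letters option \<Rightarrow> rat" where
  "d4 \<chi> x y = 2 * of_int (d_int \<chi> ! cell_index x ! cell_index y)"

definition h4 :: "(bool \<times> bool) \<times> bool \<times> bool \<times> bool \<Rightarrow> two_letters option \<times> three_letters option \<Rightarrow> two_letters option \<times> three_letters option \<Rightarrow> rat" where
  "h4 \<chi> x y = of_int (h_int \<chi> ! cell_index x ! cell_index y) / 2"

definition theta4 :: "(bool \<times> bool) \<times> bool \<times> bool \<times> bool \<Rightarrow> two_letters option \<times> three_letters option \<Rightarrow> two_letters option \<times> three_letters option \<Rightarrow> rat" where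
  "theta4 \<chi> x y = of_int (theta (d_int \<chi>) (h_int \<chi>) ! cell_index x ! cell_index y)"

definition crit4 :: "(bool \<times> bool) \<times> bool \<times> bool \<times> bool \<Rightarrow> two_letters option \<times> three_letters option \<Rightarrow> bool" where
  "crit4 \<chi> x \<longleftrightarrow> crit_list (h_int \<chi>) ! cell_index x"

text \<open>Counting pairs amounts to summing over the 32 characters; the evaluated totals settle
  degrees up to two, and no cell has a larger degree.\<close>

lemma card_crit4: "card {(\<chi>, b). degree4 b = k \<and> crit4 \<chi> b} = (if k = 0 then 1 else if k = 1 then 20 else if k = 2 then 83 else 0)"
proof -
  have count: "(\<Sum>b\<in>UNIV. of_bool (degree4 b = k \<and> crit4 \<chi> b)) = critical_number k (crit_list (h_int \<chi>))" for \<chi>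
  proof -
    have len: "length (crit_list (h_int \<chi>)) = 12" "length degree_list = 12"
      by (simp_all add: check_nth(8)[OF check_int, where i = 0 and j = 0] degree_list_def)
    show ?thesis
      unfolding degree4_index crit4_def sum_cells[of "\<lambda>m. of_bool (degree_list ! m = k \<and> crit_list (h_int \<chi>) ! m)"]
        critical_number_def sum_list_sum_nth
      by (rule sum.cong) (auto simp: len)
  qed
  have "card {(\<chi>, b). degree4 b = k \<and> crit4 \<chi> b} =
    (\<Sum>b1\<in>UNIV. \<Sum>b2\<in>UNIV. \<Sum>a1\<in>UNIV. \<Sum>a2\<in>UNIV. \<Sum>a3\<in>UNIV. critical_number k (crit_list (h_matrix a1 a2 a3 b1 b2)))"
    unfolding card_pairs count by (simp only: sum_UNIV_prod prod.case)
  also have "\<dots> = (\<Sum>b1\<leftarrow>[False, True]. \<Sum>b2\<leftarrow>[False, True]. \<Sum>a1\<leftarrow>[False, True]. \<Sum>a2\<leftarrow>[False, True]. \<Sum>a3\<leftarrow>[False, True].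
     critical_number k (crit_list (h_matrix a1 a2 a3 b1 b2)))"
    by (simp add: UNIV_bool del: One_nat_def)
  finally have *: "card {(\<chi>, b). degree4 b = k \<and> crit4 \<chi> b} = \<dots>" .
  have "degree4 b \<le> 2" for b by (cases b rule: degree4.cases) auto
  then have large: "k > 2 \<Longrightarrow> {(\<chi>, b). degree4 b = k \<and> crit4 \<chi> b} = {}" by auto (metis not_le)
  consider "k = 0" | "k = 1" | "k = 2" | "k > 2" by linarith
  then show ?thesis
  proof cases
    case 1
    show ?thesis unfolding * unfolding 1 critical_totals by simp
  next
    case 2
    show ?thesis unfolding * unfolding 2 critical_totals by simp
  next
    case 3
    show ?thesis unfolding * unfolding 3 critical_totals by simp
  next
    case 4
    show ?thesis unfolding large[OF 4] using 4 by simp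
  qed
qed

theorem homology_four:
  "has_dimension (group_homology (level4_braid_group 4) k)
    (card {(\<chi>, b). degree4 b = k \<and> crit4 \<chi> b} + card {(\<chi>, b). Suc (degree4 b) = k \<and> crit4 \<chi> b})"
proof (rule homology_of_translation_action[OF translation_action_four duality5, of _ coord4 d4 h4 theta4 crit4])
  show "group (level4_braid_group 4)" by (rule group_level4_braid_group)
  have "{(m :: unit fg, w, k). even_fg w \<and> even_fg k} =
      {(m, h). (case h of (w, k) \<Rightarrow> (parity2 w, parity3 k)) = ((False, False), False, False, False)}"
    by (auto simp: parity2_even parity3_even)
  then show "bij_betw coord4 (carrier (level4_braid_group 4))
      {(m, h). (case h of (w, k) \<Rightarrow> (parity2 w, parity3 k)) = ((False, False), False, False, False)}"
    using coord4_bij by simp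
  fix C D assume CD: "C \<in> carrier (level4_braid_group 4)" "D \<in> carrier (level4_braid_group 4)"
  show "coord4 (C \<otimes>\<^bsub>level4_braid_group 4\<^esub> D) = coord4 C \<otimes>\<^bsub>fg_group \<times>\<times> semidirect\<^esub> coord4 D"
    unfolding coord4_mult[OF CD] by (cases "coord4 C"; cases "coord4 D") (simp add: mult_DirProd split: prod.splits)
next
  fix \<chi> :: "(bool \<times> bool) \<times> bool \<times> bool \<times> bool" and x y
  obtain b1 b2 a1 a2 a3 where \<chi>: "\<chi> = ((b1, b2), a1, a2, a3)" by (metis prod.exhaust)
  note sq = square_nth[OF check_square(1)[OF check_int(2)[of \<chi>]] cell_index_less[of x]] check_square(1)[OF check_int(2)[of \<chi>]]
  have "d_rows (sg a1) (sg a2) (sg a3) (sg b1) (sg b2) ! cell_index x ! cell_index y = 2 * (d_int \<chi> ! cell_index x ! cell_index y)"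
    using sq cell_index_less by (simp add: d_rows_even \<chi> square_def)
  then show "Poly_Mapping.lookup (value_at parity4 kind4 (pair5 \<chi>) (two.cone_d (cell (base4 y)))) x = d4 \<chi> x y"
    unfolding \<chi> d4_entries by (simp add: d4_def)
next
  fix \<chi> :: "(bool \<times> bool) \<times> bool \<times> bool \<times> bool" and x y
  note less = cell_index_less[of x] cell_index_less[of y]
  note ck = check_nth[OF check_int[of \<chi>] less]
  show "d4 \<chi> x y \<noteq> 0 \<Longrightarrow> degree4 y = Suc (degree4 x)" "h4 \<chi> x y \<noteq> 0 \<Longrightarrow> degree4 x = Suc (degree4 y)"
    using ck(6,7) by (simp_all add: d4_def h4_def degree4_index)
  show "theta4 \<chi> x y = of_bool (x = y) - (\<Sum>z\<in>UNIV. d4 \<chi> x z * h4 \<chi> z y) - (\<Sum>z\<in>UNIV. h4 \<chi> x z * d4 \<chi> z y)"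
    using arg_cong[OF ck(1), of "of_int :: int \<Rightarrow> rat"]
    by (simp add: theta4_def d4_def h4_def cell_index_eq sum_cells[symmetric])
  show "(\<Sum>z\<in>UNIV. theta4 \<chi> x z * d4 \<chi> z y) = 0" "(\<Sum>z\<in>UNIV. d4 \<chi> x z * theta4 \<chi> z y) = 0"
    using arg_cong[OF ck(2), of "\<lambda>n. 2 * of_int n :: rat"] arg_cong[OF ck(3), of "\<lambda>n. 2 * of_int n :: rat"]
    by (simp_all add: theta4_def d4_def sum_cells[symmetric] sum_distrib_left mult_ac)
  show "(\<Sum>z\<in>UNIV. theta4 \<chi> x z * (of_bool (crit4 \<chi> z) * theta4 \<chi> z y)) = theta4 \<chi> x y"
    using arg_cong[OF ck(4), of "of_int :: int \<Rightarrow> rat"]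
    by (simp add: theta4_def crit4_def sum_cells[symmetric])
  show "(\<Sum>z\<in>UNIV. theta4 \<chi> x z * theta4 \<chi> z y) = of_bool (x = y)" if "crit4 \<chi> x" "crit4 \<chi> y"
    using arg_cong[OF ck(5), of "of_int :: int \<Rightarrow> rat"] that
    by (simp add: theta4_def crit4_def cell_index_eq sum_cells[symmetric])
qed

text \<open>The counts 1, 5 and 1, 20, 83 are added to their shifts by one degree: 6 = 5 + 1 on
  three strands, 21 = 20 + 1 and 103 = 83 + 20 on four, with top values 5 and 83.\<close>

theorem theorem1p2:
  shows "has_dimension (group_homology (level4_braid_group 3) 0) 1
      \<and> has_dimension (group_homology (level4_braid_group 3) 1) 6
      \<and> has_dimension (group_homology (level4_braid_group 3) 2) 5
      \<and> (\<forall>k\<ge>3. has_dimension (group_homology (level4_braid_group 3) k) 0)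
      \<and> has_dimension (group_homology (level4_braid_group 4) 0) 1
      \<and> has_dimension (group_homology (level4_braid_group 4) 1) 21
      \<and> has_dimension (group_homology (level4_braid_group 4) 2) 103
      \<and> has_dimension (group_homology (level4_braid_group 4) 3) 83
      \<and> (\<forall>k\<ge>4. has_dimension (group_homology (level4_braid_group 4) k) 0)"
proof -
  have four: "has_dimension (group_homology (level4_braid_group 4) k)
    ((if k = 0 then 1 else if k = 1 then 20 else if k = 2 then 83 else 0) +
     (if k = 0 then 0 else if k = 1 then 1 else if k = 2 then 20 else if k = 3 then 83 else 0))" for k
  proof (cases k)
    case 0
    then show ?thesis using homology_four[of 0] by (simp add: card_crit4)
  next
    case (Suc j)
    have "card {(\<chi>, b). Suc (degree4 b) = k \<and> crit4 \<chi> b} = (if j = 0 then 1 else if j = 1 then 20 else if j = 2 then 83 else 0)"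
      unfolding card_crit4[symmetric] Suc by simp
    then show ?thesis using homology_four[of k] unfolding card_crit4 by (simp add: Suc numeral_eq_Suc split: if_splits)
  qed
  have five: "k \<ge> 4 \<Longrightarrow> has_dimension (group_homology (level4_braid_group 4) k) 0" for k
    using four[of k] by simp
  have six: "k \<ge> 3 \<Longrightarrow> has_dimension (group_homology (level4_braid_group 3) k) 0" for k
    using homology_three[of k] by simp
  show ?thesis
    using four[of 0] four[of 1] four[of 2] four[of 3] homology_three[of 0] homology_three[of 1] homology_three[of 2] five six
    by simp
qed

end
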